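(* Let $(\Omega,\mathcal{F},\mathbb{P})$ be a complete probability space, let $T>0$, and let $\xi=\{\xi_{i,m} : m\ge 1,\ 1\le i\le [mT]\}$ be a family of real random variables on $(\Omega,\mathcal{F},\mathbb{P})$. For $m\ge 1$ put $t_i=\frac{i}{m}$ and $$g_m(t):=\sum_{i=1}^{[mt]}\xi_{i,m},\qquad t\in[0,T].$$ Assume: (i) the finite dimensional distributions of $(g_m(t))_{t\in[0,T]}$ converge $\mathcal{F}$-stably in law, as $m\to\infty$, to those of $(w(t))_{t\in[0,T]}$, where $w$ is a standard Brownian motion independent of $\mathcal{F}$ (defined on an extension of $(\Omega,\mathcal{F},\mathbb{P})$); that is, for all $k\ge 1$ and $s_1,\dots,s_k\in[0,T]$, the vectors $(g_m(s_1),\dots,g_m(s_k))$ converge $\mathcal{F}$-stably in law to $(w(s_1),\dots,w(s_k))$; (ii) there is a constant $C>0$, not depending on $j,k,m$, such that for all $m\ge1$ and all $1\le j<k\le [mT]$, $$\mathbb{E}\left(\left|\sum_{i=j+1}^{k}\xi_{i,m}\right|^4\right)\le C\left(\frac{k-j}{m}\right)^2 .$$ Let $(f(t))_{t\in[0,T]}$ be a real-valued stochastic process on $(\Omega,\mathcal{F},\mathbb{P})$ which is $\alpha$-Hölder continuous with index $\alpha>1/2$, and set $$X_m(t):=\sum_{i=1}^{[mt]}f(t_i)\,\xi_{i,m},\qquad t\in[0,T].$$ Then, as $m\to\infty$, the processes $(X_m(t))_{t\in[0,T]}$ converge $\mathcal{F}$-stably in law in $D[0,T]$ to the process $$\left(\int_0^t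 f(s)\,\mathrm{d}w(s)\right)_{t\in[0,T]},$$ where $w$ is a standard Brownian motion independent of $\mathcal{F}$.
   Context: $[x]$ denotes the integer part of $x$. Stable convergence: a sequence of random vectors or processes $Y_n$ on $(\Omega,\mathcal{F},\mathbb{P})$ converges $\mathcal{F}$-stably in law to a random vector or process $Y$, defined on an extension $(\Omega',\mathcal{F}',\mathbb{P}')$ of $(\Omega,\mathcal{F},\mathbb{P})$, if $(Y_n,Z)\to(Y,Z)$ in law for every $\mathcal{F}$-measurable random variable $Z$. $D[0,T]$ is the Skorohod space of càdlàg real functions on $[0,T]$, equipped with the uniform topology. The process $f$ being $\alpha$-Hölder continuous (with $\alpha$ deterministic) means that its trajectories satisfy $\|f\|_\alpha:=\sup_{u\ne v,\ u,v\in[0,T]}\frac{|f(u)-f(v)|}{|u-v|^\alpha}<\infty$, where $\|f\|_\alpha$ is a (random) finite quantity; no adaptedness of $f$ and no independence between $f$ and $\xi$ is assumed. Since $w$ is independent of $\mathcal{F}$ and $f$ is $\mathcal{F}$-measurable with continuous paths, $\int_0^t f(s)\,\mathrm{d}w(s)$ is the Itô integral with respect to the filtration $\mathcal{F}\vee\sigma(w(s):s\le t)$ (equivalently, conditionally on $\mathcal{F}$, a Wiener integral). It is the limit, uniformly on $[0,T]$ in probability as $n\to\infty$, of $\sum_{j=1}^{[nt]+1}f(u_{j-1})(w(u_j)-w(u_{j-1}))$ with $u_j=j/n$ (for the last term, $w$ is taken to be defined slightly beyond $T$). *)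

theory Defs
  imports "HOL-Probability.Probability"
begin

subsection \<open>Stable convergence in law\<close>

definition borel_of :: "'e topology \<Rightarrow> 'e measure" where
  "borel_of E = sigma (topspace E) {U. openin E U}"

text \<open>The laws are compared through integrals of bounded continuous functionals. The maps are
  required to be Borel measurable, so that no integral below takes a default value.\<close>

definition converges_in_law ::
  "'e topology \<Rightarrow> 'a measure \<Rightarrow> (nat \<Rightarrow> 'a \<Rightarrow> 'e) \<Rightarrow> 'b measure \<Rightarrow> ('b \<Rightarrow> 'e) \<Rightarrow> bool"
where
  "converges_in_law E M Y M' Y' \<longleftrightarrow>
     (\<forall>n. Y n \<in> M \<rightarrow>\<^sub>M borel_of E) \<and> Y' \<in> M' \<rightarrow>\<^sub>M borel_of E \<and>
     (\<forall>\<phi>. continuous_map E euclideanreal \<phi> \<and> bounded (\<phi> ` topspace E) \<longrightarrow>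
        (\<lambda>n. \<integral>\<omega>. \<phi> (Y n \<omega>) \<partial>M) \<longlonglongrightarrow> (\<integral>\<omega>'. \<phi> (Y' \<omega>') \<partial>M'))"

text \<open>An extension \<open>M'\<close> of \<open>M\<close> comes with a measure preserving projection \<open>\<pi>\<close>, along which random
  variables \<open>Z\<close> on \<open>M\<close> are regarded as random variables \<open>Z \<circ> \<pi>\<close> on \<open>M'\<close>.\<close>

definition prob_extension :: "'a measure \<Rightarrow> 'b measure \<Rightarrow> ('b \<Rightarrow> 'a) \<Rightarrow> bool" where
  "prob_extension M M' \<pi> \<longleftrightarrow>
     prob_space M \<and> prob_space M' \<and> \<pi> \<in> M' \<rightarrow>\<^sub>M M \<and> distr M' M \<pi> = M"

definition converges_stably ::
  "'e topology \<Rightarrow> 'a measure \<Rightarrow> (nat \<Rightarrow> 'a \<Rightarrow> 'e) \<Rightarrow>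
     'b measure \<Rightarrow> ('b \<Rightarrow> 'a) \<Rightarrow> ('b \<Rightarrow> 'e) \<Rightarrow> bool"
where
  "converges_stably E M Y M' \<pi> Y' \<longleftrightarrow>
     prob_extension M M' \<pi> \<and>
     (\<forall>Z :: 'a \<Rightarrow> real. Z \<in> borel_measurable M \<longrightarrow>
        converges_in_law (prod_topology E euclideanreal)
          M (\<lambda>n \<omega>. (Y n \<omega>, Z \<omega>)) M' (\<lambda>\<omega>'. (Y' \<omega>', Z (\<pi> \<omega>'))))"

text \<open>A random vector \<open>(Y 0, \<dots>, Y (k - 1))\<close> is an extensional function on \<open>{..<k}\<close>.\<close>

definition fdd_converge_stably ::
  "real \<Rightarrow> 'a measure \<Rightarrow> (nat \<Rightarrow> real \<Rightarrow> 'a \<Rightarrow> real) \<Rightarrow>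
     'b measure \<Rightarrow> ('b \<Rightarrow> 'a) \<Rightarrow> (real \<Rightarrow> 'b \<Rightarrow> real) \<Rightarrow> bool"
where
  "fdd_converge_stably T M Y M' \<pi> Y' \<longleftrightarrow>
     (\<forall>(k::nat) (s :: nat \<Rightarrow> real). k \<ge> 1 \<and> (\<forall>l<k. s l \<in> {0..T}) \<longrightarrow>
        converges_stably (product_topology (\<lambda>_. euclideanreal) {..<k})
          M (\<lambda>m \<omega>. \<lambda>l\<in>{..<k}. Y m (s l) \<omega>) M' \<pi> (\<lambda>\<omega>'. \<lambda>l\<in>{..<k}. Y' (s l) \<omega>'))"

subsection \<open>The space \<open>D[0,T]\<close> with the uniform topology\<close>

definition cadlag_on :: "real \<Rightarrow> (real \<Rightarrow> real) \<Rightarrow> bool" where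
  "cadlag_on T x \<longleftrightarrow>
     (\<forall>t\<in>{0..<T}. (x \<longlongrightarrow> x t) (at_right t)) \<and>
     (\<forall>t\<in>{0<..T}. \<exists>l. (x \<longlongrightarrow> l) (at_left t))"

text \<open>The points of \<open>funspace {0..T} euclidean_metric\<close> are the bounded extensional functions on
  \<open>{0..T}\<close>, and its metric is the supremum distance. Boundedness is no restriction, as cadlag
  functions on a compact interval are bounded.\<close>

definition D_space :: "real \<Rightarrow> (real \<Rightarrow> real) topology" where
  "D_space T = mtopology_of (submetric (funspace {0..T} euclidean_metric) {x. cadlag_on T x})"

definition path_of :: "real \<Rightarrow> (real \<Rightarrow> 'a \<Rightarrow> real) \<Rightarrow> 'a \<Rightarrow> real \<Rightarrow> real" where
  "path_of T X \<omega> = (\<lambda>t\<in>{0..T}. X t \<omega>)"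

subsection \<open>Hoelder continuity and Brownian motion\<close>

definition hoelder_seminorm :: "real \<Rightarrow> real \<Rightarrow> (real \<Rightarrow> real) \<Rightarrow> ennreal" where
  "hoelder_seminorm T \<alpha> h =
     (SUP (u, v) \<in> {(u, v). u \<in> {0..T} \<and> v \<in> {0..T} \<and> u \<noteq> v}.
        ennreal (\<bar>h u - h v\<bar> / \<bar>u - v\<bar> powr \<alpha>))"

definition standard_brownian_motion ::
  "real \<Rightarrow> 'b measure \<Rightarrow> (real \<Rightarrow> 'b \<Rightarrow> real) \<Rightarrow> bool"
where
  "standard_brownian_motion T M w \<longleftrightarrow>
     prob_space M \<and>
     (\<forall>t\<in>{0..T}. w t \<in> borel_measurable M) \<and>
     (AE \<omega> in M. w 0 \<omega> = 0) \<and>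
     (\<forall>\<omega>\<in>space M. continuous_on {0..T} (\<lambda>t. w t \<omega>)) \<and>
     (\<forall>s t. 0 \<le> s \<and> s < t \<and> t \<le> T \<longrightarrow>
        distributed M lborel (\<lambda>\<omega>. w t \<omega> - w s \<omega>) (normal_density 0 (sqrt (t - s)))) \<and>
     (\<forall>(n::nat) (t :: nat \<Rightarrow> real).
        0 \<le> t 0 \<and> (\<forall>i<n. t i < t (Suc i)) \<and> t n \<le> T \<longrightarrow>
        prob_space.indep_vars M (\<lambda>_. borel) (\<lambda>i \<omega>. w (t (Suc i)) \<omega> - w (t i) \<omega>) {..<n})"

text \<open>Independence of \<open>\<sigma>(\<pi>)\<close>, which is the \<open>\<sigma>\<close>-algebra of \<open>M\<close> lifted to \<open>M'\<close>, and
  \<open>\<sigma>(w(t) : t \<in> [0,T])\<close>.\<close>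

definition indep_of_base ::
  "real \<Rightarrow> 'a measure \<Rightarrow> 'b measure \<Rightarrow> ('b \<Rightarrow> 'a) \<Rightarrow> (real \<Rightarrow> 'b \<Rightarrow> real) \<Rightarrow> bool"
where
  "indep_of_base T M M' \<pi> w \<longleftrightarrow>
     prob_space.indep_set M'
       {\<pi> -` A \<inter> space M' | A. A \<in> sets M}
       {path_of T w -` B \<inter> space M' | B. B \<in> sets (Pi\<^sub>M {0..T} (\<lambda>_. borel))}"

subsection \<open>The Ito integral\<close>

text \<open>The filtration \<open>\<F> \<or> \<sigma>(w(s) : s \<le> t)\<close> on the extension.\<close>

definition enlarged_filtration ::
  "'a measure \<Rightarrow> 'b measure \<Rightarrow> ('b \<Rightarrow> 'a) \<Rightarrow> (real \<Rightarrow> 'b \<Rightarrow> real) \<Rightarrow> real \<Rightarrow> 'b measure"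
where
  "enlarged_filtration M M' \<pi> w t =
     sigma (space M')
       ({\<pi> -` A \<inter> space M' | A. A \<in> sets M} \<union>
        (\<Union>s\<in>{0..t}. {w s -` B \<inter> space M' | B. B \<in> sets borel}))"

text \<open>A triple \<open>(k, \<tau>, \<eta>)\<close> encodes the simple process
  \<open>H(s) = (\<Sum>j<k. \<eta> j * indicator {\<tau> j<..\<tau> (Suc j)} s)\<close>.\<close>

definition simple_integrand ::
  "real \<Rightarrow> (real \<Rightarrow> 'b measure) \<Rightarrow> nat \<Rightarrow> (nat \<Rightarrow> real) \<Rightarrow> (nat \<Rightarrow> 'b \<Rightarrow> real) \<Rightarrow> bool"
where
  "simple_integrand T G k \<tau> \<eta> \<longleftrightarrow>
     0 \<le> \<tau> 0 \<and> (\<forall>j<k. \<tau> j \<le> \<tau> (Suc j)) \<and> \<tau> k \<le> T \<and>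
     (\<forall>j<k. \<eta> j \<in> borel_measurable (G (\<tau> j))) \<and>
     (\<exists>B. \<forall>j<k. \<forall>\<omega>\<in>space (G (\<tau> j)). \<bar>\<eta> j \<omega>\<bar> \<le> B)"

definition simple_process ::
  "nat \<Rightarrow> (nat \<Rightarrow> real) \<Rightarrow> (nat \<Rightarrow> 'b \<Rightarrow> real) \<Rightarrow> real \<Rightarrow> 'b \<Rightarrow> real"
where
  "simple_process k \<tau> \<eta> s \<omega> = (\<Sum>j<k. \<eta> j \<omega> * indicator {\<tau> j<..\<tau> (Suc j)} s)"

definition simple_integral ::
  "(real \<Rightarrow> 'b \<Rightarrow> real) \<Rightarrow> nat \<Rightarrow> (nat \<Rightarrow> real) \<Rightarrow> (nat \<Rightarrow> 'b \<Rightarrow> real) \<Rightarrow> real \<Rightarrow> 'b \<Rightarrow> real"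
where
  "simple_integral w k \<tau> \<eta> t \<omega> =
     (\<Sum>j<k. \<eta> j \<omega> * (w (min (\<tau> (Suc j)) t) \<omega> - w (min (\<tau> j) t) \<omega>))"

definition null_in_probability :: "'b measure \<Rightarrow> (nat \<Rightarrow> 'b \<Rightarrow> ennreal) \<Rightarrow> bool" where
  "null_in_probability M R \<longleftrightarrow>
     (\<forall>n. R n \<in> borel_measurable M) \<and>
     (\<forall>\<epsilon>>0. (\<lambda>n. measure M {\<omega> \<in> space M. \<epsilon> < R n \<omega>}) \<longlonglongrightarrow> 0)"

text \<open>\<open>I\<close> is a continuous version of the process \<open>(\<integral>\<^sub>0\<^sup>t H dw)\<^sub>t\<close>: simple processes adapted to
  the filtration \<open>G\<close> approximate \<open>H\<close> in \<open>L\<^sup>2[0,T]\<close> in probability, and their integrals approximate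
  \<open>I\<close> uniformly on \<open>[0,T]\<close> in probability.\<close>

definition is_ito_integral ::
  "real \<Rightarrow> 'b measure \<Rightarrow> (real \<Rightarrow> 'b measure) \<Rightarrow> (real \<Rightarrow> 'b \<Rightarrow> real) \<Rightarrow>
     (real \<Rightarrow> 'b \<Rightarrow> real) \<Rightarrow> (real \<Rightarrow> 'b \<Rightarrow> real) \<Rightarrow> bool"
where
  "is_ito_integral T M G w H I \<longleftrightarrow>
     (\<forall>t\<in>{0..T}. I t \<in> borel_measurable M) \<and>
     (\<forall>\<omega>\<in>space M. continuous_on {0..T} (\<lambda>t. I t \<omega>)) \<and>
     (\<exists>k \<tau> \<eta>. (\<forall>n. simple_integrand T G (k n) (\<tau> n) (\<eta> n)) \<and>
        null_in_probability M
          (\<lambda>n \<omega>. \<integral>\<^sup>+s\<in>{0..T}.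
             ennreal ((simple_process (k n) (\<tau> n) (\<eta> n) s \<omega> - H s \<omega>)\<^sup>2) \<partial>lborel) \<and>
        null_in_probability M
          (\<lambda>n \<omega>. SUP t\<in>{0..T}.
             ennreal \<bar>simple_integral w (k n) (\<tau> n) (\<eta> n) t \<omega> - I t \<omega>\<bar>))"

subsection \<open>The processes \<open>g\<^sub>m\<close> and \<open>X\<^sub>m\<close>\<close>

text \<open>For \<open>m = 0\<close> both sums are empty, so sequences indexed from \<open>0\<close> instead of \<open>1\<close> only
  acquire a zero process as an additional first term.\<close>

definition partial_sums ::
  "(nat \<Rightarrow> nat \<Rightarrow> 'a \<Rightarrow> real) \<Rightarrow> nat \<Rightarrow> real \<Rightarrow> 'a \<Rightarrow> real"
where
  "partial_sums \<xi> m t \<omega> = (\<Sum>i=1..nat \<lfloor>real m * t\<rfloor>. \<xi> i m \<omega>)"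

definition weighted_sums ::
  "(real \<Rightarrow> 'a \<Rightarrow> real) \<Rightarrow> (nat \<Rightarrow> nat \<Rightarrow> 'a \<Rightarrow> real) \<Rightarrow> nat \<Rightarrow> real \<Rightarrow> 'a \<Rightarrow> real"
where
  "weighted_sums f \<xi> m t \<omega> =
     (\<Sum>i=1..nat \<lfloor>real m * t\<rfloor>. f (real i / real m) \<omega> * \<xi> i m \<omega>)"

end

theory Submission
  imports Defs
begin

text \<open>Let \<open>S\<^sub>n(f, h)\<close> be the Riemann sum of \<open>f\<close> against a path \<open>h\<close> along the dyadic grid of level \<open>n\<close>.
  Then \<open>S\<^sub>n\<^sub>+\<^sub>1 - S\<^sub>n\<close> is at most the Hoelder constant of \<open>f\<close> times \<open>2\<close> to the power \<open>-n \<alpha>\<close> times the sum,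
  over the \<open>2\<close> to the power \<open>n\<close> blocks, of the oscillations of \<open>h\<close>. For \<open>h = g\<^sub>m\<close> and \<open>h = w\<close> the fourth
  moments and a maximal inequality bound the expected oscillation of a block by its length to the
  power \<open>1/2\<close>, uniformly in \<open>m\<close>. As \<open>\<alpha> > 1/2\<close> the differences are summable, so that \<open>S\<^sub>n(f, g\<^sub>m)\<close> approximates
  \<open>X\<^sub>m\<close> uniformly in \<open>t\<close> and \<open>m\<close>, and \<open>S\<^sub>n(f, w)\<close> approximates a process \<open>I\<close>, pathwise in \<open>f\<close>: neither adaptedness
  of \<open>f\<close> nor independence of \<open>f\<close> and \<open>\<xi>\<close> matters. For fixed \<open>n\<close> only finitely many values of \<open>f\<close> occur; once
  these are rounded to a finite set, the \<open>\<F>\<close>-stable convergence of the finite dimensional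
  distributions of \<open>g\<^sub>m\<close> applies on each of the finitely many events on which the rounded values are
  constant. Finally \<open>I\<close> is the Ito integral, which is unique by the isometry for truncated simple
  integrands.\<close>

section \<open>A maximal inequality for fourth moments\<close>

text \<open>The moment bound is discrete: below the scale 1/m the increments of
  \<open>g\<^sub>m\<close> do not shrink with the length of a block. Lengths are therefore measured
  by a monotone function \<open>\<mu>\<close>, which is floor(m t)/m for \<open>g\<^sub>m\<close>
  and t for w, with total mass at most T. Estimates that are linear in the mass of a block add up to
  a bound uniform in m, even when most blocks contain no jump and some contain a whole one. The
  bound (ii) starts at j = 1 and does not see the first summand; that summand is removed, and its
  effect is estimated separately. The uniform topology makes D[0,T] non-separable, so evaluations at
  single times do not generate its Borel sets. Measurability of maps into it is obtained from
  uniform limits of maps that factor through a countable set. The Hoelder constant of f may fail to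
  be integrable and may depend on everything else. It is kept outside all expectations and
  controlled on an event of large probability.\<close>

lemma pow4_add_le:
  fixes a b :: real
  shows "(a + b)^4 \<le> 2 * a^4 + 125 * b^4"
proof -
  \<comment> \<open>By Hoelder's inequality p a^4 + q b^4 dominates (a + b)^4 once p^(-1/3) +
    q^(-1/3) \<le> 1. Here p = 2 and q = 5^3 qualify, and p + 1 < 4 is what the halving argument
    asks for. The first square absorbs the terms a^4 and a^3 b, the second completes the
    rest.\<close>
  have "2 * a^4 + 125 * b^4 - (a + b)^4
      = (a\<^sup>2 - 2*a*b - 7*b\<^sup>2)\<^sup>2 + b\<^sup>2 * (4 * (a - 4*b)\<^sup>2 + 11 * b\<^sup>2)"
    by (simp add: power2_eq_square power4_eq_xxxx algebra_simps)
  also have "\<dots> \<ge> 0" by (intro add_nonneg_nonneg mult_nonneg_nonneg) auto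
  finally show ?thesis by simp
qed

text \<open>Halving: if \<open>A\<^sub>r\<close> bounds the fourth moment of the maximum over \<open>2\<close> to the power \<open>r\<close> steps, then
  \<open>A\<^sub>r\<^sub>+\<^sub>1 \<le> A\<^sub>r + 2 A\<^sub>r + 125 E\<close>, where \<open>E\<close> is the fourth moment of the increment over the first half. The
  factor \<open>3\<close> is less than the factor \<open>4\<close> by which the squared length grows.\<close>

lemma maximal_inequality:
  fixes S :: "nat \<Rightarrow> 'a \<Rightarrow> real"
  assumes "\<And>k. k \<le> 2^r \<Longrightarrow> S k \<in> borel_measurable N"
    and "\<And>j k. j < k \<Longrightarrow> k \<le> 2^r \<Longrightarrow>
      (\<integral>\<^sup>+\<omega>. ennreal (\<bar>S k \<omega> - S j \<omega>\<bar>^4) \<partial>N) \<le> ennreal (C * (real k - real j)\<^sup>2)"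
    and C: "C \<ge> 0"
  shows "(\<integral>\<^sup>+\<omega>. ennreal ((MAX k\<in>{..2^r}. \<bar>S k \<omega> - S 0 \<omega>\<bar>)^4) \<partial>N) \<le> ennreal (125 * C * 4^r)"
  using assms(1,2)
proof (induction r arbitrary: S)
  case 0
  have *: "{..2^0} = {0, 1::nat}" by auto
  have "(\<integral>\<^sup>+\<omega>. ennreal ((MAX k\<in>{..2^0}. \<bar>S k \<omega> - S 0 \<omega>\<bar>)^4) \<partial>N)
      = (\<integral>\<^sup>+\<omega>. ennreal (\<bar>S 1 \<omega> - S 0 \<omega>\<bar>^4) \<partial>N)"
    unfolding * by (intro nn_integral_cong) (simp add: max_def)
  also have "\<dots> \<le> ennreal (C * (real 1 - real 0)\<^sup>2)" by (rule 0(2)) auto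
  also have "\<dots> \<le> ennreal (125 * C * 4^0)" using C by (intro ennreal_leI) auto
  finally show ?case .
next
  case (Suc r)
  define n :: nat where "n = 2^r"
  have n2: "2^Suc r = n + n" unfolding n_def by simp
  define V1 where "V1 \<omega> = (MAX k\<in>{..2^r}. \<bar>S k \<omega> - S 0 \<omega>\<bar>)" for \<omega>
  define V2 where "V2 \<omega> = (MAX k\<in>{..2^r}. \<bar>S (n + k) \<omega> - S (n + 0) \<omega>\<bar>)" for \<omega>
  have SM: "k \<le> n + n \<Longrightarrow> S k \<in> borel_measurable N" for k using Suc.prems(1) n2 by simp
  have V1m: "V1 \<in> borel_measurable N" unfolding V1_def
    by (intro borel_measurable_Max borel_measurable_abs borel_measurable_diff SM)
       (auto simp: n_def)
  have V2m: "V2 \<in> borel_measurable N" unfolding V2_def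
    by (intro borel_measurable_Max borel_measurable_abs borel_measurable_diff SM)
       (auto simp: n_def)
  note [measurable] = V1m V2m
  have [measurable]: "S n \<in> borel_measurable N" "S 0 \<in> borel_measurable N" by (auto intro: SM)
  have IH1: "(\<integral>\<^sup>+\<omega>. ennreal (V1 \<omega>^4) \<partial>N) \<le> ennreal (125 * C * 4^r)"
    unfolding V1_def using n2 by (intro Suc.IH SM Suc.prems(2)) (auto simp: n_def)
  have IH2: "(\<integral>\<^sup>+\<omega>. ennreal (V2 \<omega>^4) \<partial>N) \<le> ennreal (125 * C * 4^r)"
    unfolding V2_def
  proof (intro Suc.IH[where S = "\<lambda>k. S (n + k)"] SM)
    fix j k :: nat assume "j < k" "k \<le> 2^r"
    then have "(\<integral>\<^sup>+\<omega>. ennreal (\<bar>S (n+k) \<omega> - S (n+j) \<omega>\<bar>^4) \<partial>N) \<le> ennreal (C * (real (n+k) - real (n+j))\<^sup>2)"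
      using n2 by (intro Suc.prems(2)) (auto simp: n_def)
    then show "(\<integral>\<^sup>+\<omega>. ennreal (\<bar>S (n+k) \<omega> - S (n+j) \<omega>\<bar>^4) \<partial>N) \<le> ennreal (C * (real k - real j)\<^sup>2)"
      by simp
  qed (auto simp: n_def)
  have mid: "(\<integral>\<^sup>+\<omega>. ennreal (\<bar>S n \<omega> - S 0 \<omega>\<bar>^4) \<partial>N) \<le> ennreal (C * 4^r)"
  proof -
    have "(\<integral>\<^sup>+\<omega>. ennreal (\<bar>S n \<omega> - S 0 \<omega>\<bar>^4) \<partial>N) \<le> ennreal (C * (real n - real 0)\<^sup>2)"
      using n2 by (intro Suc.prems(2)) (auto simp: n_def)
    also have "(real n - real 0)\<^sup>2 = 4^r" by (simp add: n_def power2_eq_square flip: power_mult_distrib)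
    finally show ?thesis .
  qed
  \<comment> \<open>Only the half that contains a maximizer matters. In the second half the path
    restarts from \<open>S n\<close>, so the increment over the first half is added; summing the
    bounds of both cases avoids a case distinction under the integral.\<close>
  have pw: "(MAX k\<in>{..2^Suc r}. \<bar>S k \<omega> - S 0 \<omega>\<bar>)^4
      \<le> V1 \<omega>^4 + 2 * V2 \<omega>^4 + 125 * \<bar>S n \<omega> - S 0 \<omega>\<bar>^4" for \<omega>
  proof -
    have "(MAX k\<in>{..2^Suc r}. \<bar>S k \<omega> - S 0 \<omega>\<bar>) \<in> (\<lambda>k. \<bar>S k \<omega> - S 0 \<omega>\<bar>) ` {..2^Suc r}"
      by (intro Max_in) auto
    then obtain k where k: "k \<in> {..2^Suc r}" "(MAX k\<in>{..2^Suc r}. \<bar>S k \<omega> - S 0 \<omega>\<bar>) = \<bar>S k \<omega> - S 0 \<omega>\<bar>"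
      by (rule imageE)
    have pos: "0 \<le> V1 \<omega>^4" "0 \<le> 2 * V2 \<omega>^4" "0 \<le> 125 * \<bar>S n \<omega> - S 0 \<omega>\<bar>^4" by auto
    show ?thesis
    proof (cases "k \<le> n")
      case True
      then have "\<bar>S k \<omega> - S 0 \<omega>\<bar> \<le> V1 \<omega>" unfolding V1_def by (intro Max_ge) (auto simp: n_def)
      then have "\<bar>S k \<omega> - S 0 \<omega>\<bar>^4 \<le> V1 \<omega>^4" by (intro power_mono) auto
      then show ?thesis unfolding k(2) using pos by linarith
    next
      case False
      then have "\<bar>S (n + (k - n)) \<omega> - S (n + 0) \<omega>\<bar> \<le> V2 \<omega>"
        unfolding V2_def using k n2 False by (intro Max_ge) (auto intro!: image_eqI[where x="k - n"] simp: n_def)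
      then have "\<bar>S k \<omega> - S 0 \<omega>\<bar> \<le> V2 \<omega> + \<bar>S n \<omega> - S 0 \<omega>\<bar>" using False by simp
      then have "\<bar>S k \<omega> - S 0 \<omega>\<bar>^4 \<le> (V2 \<omega> + \<bar>S n \<omega> - S 0 \<omega>\<bar>)^4" by (intro power_mono) auto
      also have "\<dots> \<le> 2 * V2 \<omega>^4 + 125 * \<bar>S n \<omega> - S 0 \<omega>\<bar>^4" by (rule pow4_add_le)
      finally show ?thesis unfolding k(2) using pos by linarith
    qed
  qed
  have "(\<integral>\<^sup>+\<omega>. ennreal ((MAX k\<in>{..2^Suc r}. \<bar>S k \<omega> - S 0 \<omega>\<bar>)^4) \<partial>N)
      \<le> (\<integral>\<^sup>+\<omega>. ennreal (V1 \<omega>^4) + 2 * ennreal (V2 \<omega>^4) + 125 * ennreal (\<bar>S n \<omega> - S 0 \<omega>\<bar>^4) \<partial>N)"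
  proof (intro nn_integral_mono)
    fix \<omega>
    have "ennreal (V1 \<omega>^4) + 2 * ennreal (V2 \<omega>^4) + 125 * ennreal (\<bar>S n \<omega> - S 0 \<omega>\<bar>^4)
      = ennreal (V1 \<omega>^4 + 2 * V2 \<omega>^4 + 125 * \<bar>S n \<omega> - S 0 \<omega>\<bar>^4)"
      by (simp add: ennreal_mult)
    then show "ennreal ((MAX k\<in>{..2^Suc r}. \<bar>S k \<omega> - S 0 \<omega>\<bar>)^4)
      \<le> ennreal (V1 \<omega>^4) + 2 * ennreal (V2 \<omega>^4) + 125 * ennreal (\<bar>S n \<omega> - S 0 \<omega>\<bar>^4)"
      using pw[of \<omega>] by (metis ennreal_leI)
  qed
  also have "\<dots> = (\<integral>\<^sup>+\<omega>. ennreal (V1 \<omega>^4) \<partial>N) + 2 * (\<integral>\<^sup>+\<omega>. ennreal (V2 \<omega>^4) \<partial>N)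
      + 125 * (\<integral>\<^sup>+\<omega>. ennreal (\<bar>S n \<omega> - S 0 \<omega>\<bar>^4) \<partial>N)"
    by (simp add: nn_integral_add nn_integral_cmult)
  \<comment> \<open>The halves contribute 1 + 2 multiples of 125 C 4^r and the middle increment
    contributes the fourth: the constant 125 reproduces itself.\<close>
  also have "\<dots> \<le> ennreal (125 * C * 4^r) + 2 * ennreal (125 * C * 4^r) + 125 * ennreal (C * 4^r)"
    by (intro add_mono mult_left_mono IH1 IH2 mid) auto
  also have "\<dots> = ennreal (125 * C * 4^Suc r)"
    using C by (simp add: ennreal_mult' flip: ennreal_plus ennreal_numeral)
      (simp add: algebra_simps flip: ennreal_plus ennreal_numeral ennreal_mult')
  finally show ?case .
qed

text \<open>The oscillation over [a,b] enters through a measurable majorant, because a supremum over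
  uncountably many times need not be measurable; values in \<open>ennreal\<close> allow suprema of
  maxima. The function \<open>\<mu>\<close> replaces length: its total mass is bounded by
  \<open>T\<close>, while a single short block may still carry the mass of a jump.\<close>

definition dominated_increments ::
  "'a measure \<Rightarrow> real \<Rightarrow> (real \<Rightarrow> 'a \<Rightarrow> real) \<Rightarrow> (real \<Rightarrow> real) \<Rightarrow> real \<Rightarrow> bool"
where
  "dominated_increments N T H \<mu> C \<longleftrightarrow>
     (\<forall>t\<in>{0..T}. H t \<in> borel_measurable N) \<and> mono_on {0..T} \<mu> \<and> \<mu> T - \<mu> 0 \<le> T \<and> 0 \<le> C \<and>
     (\<forall>a b. 0 \<le> a \<and> a \<le> b \<and> b \<le> T \<longrightarrow>
       (\<exists>Y\<in>borel_measurable N.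
          (\<forall>\<omega>\<in>space N. \<forall>t\<in>{a..b}. ennreal \<bar>H t \<omega> - H a \<omega>\<bar> \<le> Y \<omega>) \<and>
          (\<integral>\<^sup>+\<omega>. Y \<omega> ^ 4 \<partial>N) \<le> ennreal (C * (\<mu> b - \<mu> a)\<^sup>2)))"

text \<open>Combines y \<le> s + y^2/s with y^2 \<le> \<delta> + y^4/\<delta>. The root of \<delta>
  that Hoelder's inequality would give is traded for a bound linear in \<delta>, so that a sum over
  blocks involves only their number and their total mass; \<open>s\<close> is free to balance the
  two.\<close>

lemma nn_integral_le_of_fourth_moment:
  fixes Y :: "'a \<Rightarrow> ennreal"
  assumes N: "prob_space N" and [measurable]: "Y \<in> borel_measurable N"
    and Y: "(\<integral>\<^sup>+\<omega>. Y \<omega> ^ 4 \<partial>N) \<le> ennreal (C * \<delta>\<^sup>2)" and C: "C \<ge> 0" and \<delta>: "\<delta> \<ge> 0" and s: "s > 0"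
  shows "(\<integral>\<^sup>+\<omega>. Y \<omega> \<partial>N) \<le> ennreal (s + (1 + C) * \<delta> / s)"
proof (cases "\<delta> = 0")
  \<comment> \<open>Division by \<delta> is void here, but the fourth moment vanishes, so
    \<open>Y\<close> is zero almost everywhere.\<close>
  case True
  then have "(\<integral>\<^sup>+\<omega>. Y \<omega> ^ 4 \<partial>N) = 0" using Y by simp
  then have "AE \<omega> in N. Y \<omega> ^ 4 = 0" by (subst (asm) nn_integral_0_iff_AE) auto
  then have "AE \<omega> in N. Y \<omega> = 0" by (rule AE_mp) (auto intro!: AE_I2)
  then have "(\<integral>\<^sup>+\<omega>. Y \<omega> \<partial>N) = 0" by (subst nn_integral_0_iff_AE) auto
  then show ?thesis by simp
next
  case False
  then have d: "\<delta> > 0" using \<delta> by simp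
  interpret prob_space N by fact
  have pw: "Y \<omega> \<le> ennreal (s + \<delta> / s) + ennreal (1 / (\<delta> * s)) * Y \<omega> ^ 4" for \<omega>
  proof (cases "Y \<omega>")
    case (real y)
    have "y \<le> s + y\<^sup>2 / s"
    proof (cases "y \<le> s")
      case False
      then have "y * s \<le> y\<^sup>2" using s unfolding power2_eq_square by (intro mult_left_mono) auto
      then have "y \<le> y\<^sup>2 / s" using s by (simp add: field_simps)
      then show ?thesis using s by simp
    qed (use s in \<open>auto intro: add_increasing2\<close>)
    moreover have "y\<^sup>2 \<le> \<delta> + (y\<^sup>2)\<^sup>2 / \<delta>"
    proof (cases "y\<^sup>2 \<le> \<delta>")
      case False
      then have "y\<^sup>2 * \<delta> \<le> (y\<^sup>2)\<^sup>2" using d unfolding power2_eq_square[of "y\<^sup>2"] by (intro mult_left_mono) auto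
      then have "y\<^sup>2 \<le> (y\<^sup>2)\<^sup>2 / \<delta>" using d by (simp add: field_simps)
      then show ?thesis using d by simp
    qed (use d in \<open>auto intro: add_increasing2\<close>)
    then have "y\<^sup>2 / s \<le> (\<delta> + (y\<^sup>2)\<^sup>2 / \<delta>) / s" using s by (intro divide_right_mono) auto
    ultimately have "y \<le> s + \<delta>/s + 1 / (\<delta> * s) * y^4"
      by (simp add: add_divide_distrib)
    then have "ennreal y \<le> ennreal (s + \<delta>/s + 1 / (\<delta> * s) * y^4)" by (rule ennreal_leI)
    also have "\<dots> = ennreal (s + \<delta> / s) + ennreal (1 / (\<delta> * s)) * ennreal y ^ 4"
      using s d real by (subst ennreal_plus) (auto simp: ennreal_power simp flip: ennreal_mult)
    finally show ?thesis using real by simp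
  next
    case top
    then show ?thesis using s d by (simp add: ennreal_mult_top)
  qed
  have "(\<integral>\<^sup>+\<omega>. Y \<omega> \<partial>N) \<le> (\<integral>\<^sup>+\<omega>. ennreal (s + \<delta> / s) + ennreal (1 / (\<delta> * s)) * Y \<omega> ^ 4 \<partial>N)"
    by (intro nn_integral_mono pw)
  also have "\<dots> = ennreal (s + \<delta> / s) + ennreal (1 / (\<delta> * s)) * (\<integral>\<^sup>+\<omega>. Y \<omega> ^ 4 \<partial>N)"
    by (simp add: nn_integral_add nn_integral_cmult emeasure_space_1)
  also have "\<dots> \<le> ennreal (s + \<delta> / s) + ennreal (1 / (\<delta> * s)) * ennreal (C * \<delta>\<^sup>2)"
    by (intro add_mono mult_left_mono Y) auto
  also have "\<dots> = ennreal (s + (1 + C) * \<delta> / s)"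
    using s d C by (subst ennreal_mult[symmetric], simp, simp, subst ennreal_plus[symmetric])
      (auto simp: field_simps power2_eq_square)
  finally show ?thesis .
qed

lemma emeasure_gt_le_fourth_moment:
  fixes Y :: "'a \<Rightarrow> ennreal"
  assumes [measurable]: "Y \<in> borel_measurable N" and e: "e > 0"
  shows "emeasure N {\<omega>\<in>space N. ennreal e < Y \<omega>} \<le> ennreal (1 / e^4) * (\<integral>\<^sup>+\<omega>. Y \<omega> ^ 4 \<partial>N)"
proof -
  have "emeasure N {\<omega>\<in>space N. ennreal e < Y \<omega>} = (\<integral>\<^sup>+\<omega>. indicator {\<omega>\<in>space N. ennreal e < Y \<omega>} \<omega> \<partial>N)"
    by (subst nn_integral_indicator) auto
  also have "\<dots> \<le> (\<integral>\<^sup>+\<omega>. ennreal (1 / e^4) * Y \<omega> ^ 4 \<partial>N)"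
  proof (intro nn_integral_mono)
    fix \<omega>
    have "1 \<le> ennreal (1 / e^4) * Y \<omega> ^ 4" if "ennreal e < Y \<omega>"
    proof -
      have "1 = ennreal (1 / e^4) * ennreal e ^ 4" using e by (simp add: ennreal_power flip: ennreal_mult)
      also have "\<dots> \<le> ennreal (1 / e^4) * Y \<omega> ^ 4" using that by (intro mult_left_mono power_mono) auto
      finally show ?thesis .
    qed
    then show "indicator {\<omega>\<in>space N. ennreal e < Y \<omega>} \<omega> \<le> ennreal (1 / e^4) * Y \<omega> ^ 4"
      by (auto split: split_indicator)
  qed
  also have "\<dots> = ennreal (1 / e^4) * (\<integral>\<^sup>+\<omega>. Y \<omega> ^ 4 \<partial>N)" by (simp add: nn_integral_cmult)
  finally show ?thesis .
qed

section \<open>Convergence in law tested on Lipschitz functionals\<close>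

lemma space_borel_of [simp]: "space (borel_of E) = topspace E"
  unfolding borel_of_def by (rule space_measure_of) (auto dest: openin_subset)

lemma openin_sets_borel_of: "openin E U \<Longrightarrow> U \<in> sets (borel_of E)"
  unfolding borel_of_def by (subst sets_measure_of) (auto dest: openin_subset)

lemma measurable_borel_ofI:
  assumes "\<And>\<omega>. \<omega> \<in> space N \<Longrightarrow> f \<omega> \<in> topspace E"
    and "\<And>U. openin E U \<Longrightarrow> f -` U \<inter> space N \<in> sets N"
  shows "f \<in> N \<rightarrow>\<^sub>M borel_of E"
  unfolding borel_of_def using assms by (intro measurable_measure_of) (auto dest: openin_subset)

lemma continuous_map_borel_of_measurable:
  assumes "continuous_map E euclideanreal \<phi>"
  shows "\<phi> \<in> borel_measurable (borel_of E)"
proof (rule borel_measurableI)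
  fix S :: "real set" assume "open S"
  then have "openin E {x \<in> topspace E. \<phi> x \<in> S}"
    using assms by (intro openin_continuous_map_preimage[of E euclideanreal]) auto
  then have "{x \<in> topspace E. \<phi> x \<in> S} \<in> sets (borel_of E)" by (rule openin_sets_borel_of)
  then show "\<phi> -` S \<inter> space (borel_of E) \<in> sets (borel_of E)"
    by (rule back_subst[where P = "\<lambda>x. x \<in> sets (borel_of E)"]) auto
qed

text \<open>A limit lies in an open set U exactly when, for some k, all but finitely many terms have
  a ball of radius beyond 1/(k+1) inside U. The sets of such points are open, so the preimage of U
  is a countable combination of measurable sets. The argument works with balls alone, which makes it
  fit for the non-separable space D[0,T].\<close>

lemma (in Metric_space) measurable_borel_of_limit:
  assumes Y: "\<And>r::nat. Y r \<in> N \<rightarrow>\<^sub>M borel_of mtopology"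
    and lim: "\<And>\<omega>. \<omega> \<in> space N \<Longrightarrow> limitin mtopology (\<lambda>r. Y r \<omega>) (Y' \<omega>) sequentially"
  shows "Y' \<in> N \<rightarrow>\<^sub>M borel_of mtopology"
proof (rule measurable_borel_ofI)
  show "\<omega> \<in> space N \<Longrightarrow> Y' \<omega> \<in> topspace mtopology" for \<omega>
    using lim[of \<omega>] by (simp add: limit_metric_sequentially)
  fix U assume U: "openin mtopology U"
  \<comment> \<open>The strict inequality leaves room to move the centre, and this makes
    \<open>W k\<close> open.\<close>
  define W where "W k = {x\<in>M. \<exists>e. e > 1 / real (Suc k) \<and> mball x e \<subseteq> U}" for k
  have W: "openin mtopology (W k)" for k
    unfolding openin_mtopology
  proof (intro conjI allI impI)
    fix x assume "x \<in> W k"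
    then obtain e where e: "x \<in> M" "e > 1 / real (Suc k)" "mball x e \<subseteq> U" by (auto simp: W_def)
    define p where "p = 1 / real (Suc k)"
    define \<delta> where "\<delta> = (e - p) / 2"
    have d: "\<delta> > 0" "e - \<delta> > 1 / real (Suc k)"
      using e(2) unfolding \<delta>_def p_def[symmetric] by (auto simp: field_simps)
    have "mball x \<delta> \<subseteq> W k"
    proof
      fix y assume y: "y \<in> mball x \<delta>"
      have "mball y (e - \<delta>) \<subseteq> mball x e"
      proof
        fix z assume z: "z \<in> mball y (e - \<delta>)"
        have "d x z \<le> d x y + d y z" using y z by (intro triangle) auto
        then show "z \<in> mball x e" using y z by auto
      qed
      then show "y \<in> W k" using y d e(3) by (auto simp: W_def)
    qed
    then show "\<exists>r>0. mball x r \<subseteq> W k" using d by blast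
  qed (auto simp: W_def)
  \<comment> \<open>Left to right, balls of half the radius around late terms stay inside U. Right
    to left, a late term in \<open>W k\<close> is closer to the limit than 1/(k+1), so its ball
    contains the limit.\<close>
  have eq: "Y' -` U \<inter> space N = (\<Union>k. \<Union>R. \<Inter>r\<in>{R..}. Y r -` W k \<inter> space N)"
  proof safe
    fix \<omega> assume w: "\<omega> \<in> space N" "Y' \<omega> \<in> U"
    obtain e where e: "e > 0" "mball (Y' \<omega>) e \<subseteq> U" using U w by (auto simp: openin_mtopology)
    obtain k :: nat where k: "1 / real (Suc k) < e / 2"
      using nat_approx_posE[of "e/2"] e by auto
    obtain R where R: "\<And>r. r \<ge> R \<Longrightarrow> Y r \<omega> \<in> M \<and> d (Y r \<omega>) (Y' \<omega>) < e / 2"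
      using lim[OF w(1)] e half_gt_zero[OF e(1)] unfolding limit_metric_sequentially by blast
    have "Y r \<omega> \<in> W k" if r: "r \<ge> R" for r
    proof -
      have "mball (Y r \<omega>) (e / 2) \<subseteq> mball (Y' \<omega>) e"
      proof
        fix z assume z: "z \<in> mball (Y r \<omega>) (e / 2)"
        have "Y' \<omega> \<in> M" using lim[OF w(1)] by (simp add: limit_metric_sequentially)
        then have "d (Y' \<omega>) z \<le> d (Y' \<omega>) (Y r \<omega>) + d (Y r \<omega>) z" using z R[OF r] by (intro triangle) auto
        then show "z \<in> mball (Y' \<omega>) e" using z R[OF r] \<open>Y' \<omega> \<in> M\<close> by (auto simp: commute)
      qed
      then show ?thesis using R[OF r] k e unfolding W_def
        by (intro CollectI conjI exI[of _ "e / 2"]) auto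
    qed
    then show "\<omega> \<in> (\<Union>k. \<Union>R. \<Inter>r\<in>{R..}. Y r -` W k \<inter> space N)" using w by blast
  next
    fix \<omega> k R assume a: "\<omega> \<in> (\<Inter>r\<in>{R..}. Y r -` W k \<inter> space N)"
    then have w: "\<omega> \<in> space N" by auto
    have "0 < 1 / real (Suc k)" by simp
    then obtain R' where R': "\<And>r. r \<ge> R' \<Longrightarrow> Y r \<omega> \<in> M \<and> d (Y r \<omega>) (Y' \<omega>) < 1 / real (Suc k)"
      using lim[OF w] unfolding limit_metric_sequentially by blast
    have "Y (max R R') \<omega> \<in> W k" using a by auto
    moreover have "d (Y (max R R') \<omega>) (Y' \<omega>) < 1 / real (Suc k)" using R'[of "max R R'"] by auto
    moreover have "Y' \<omega> \<in> M" using lim[OF w] by (simp add: limit_metric_sequentially)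
    ultimately show "\<omega> \<in> Y' -` U" by (fastforce simp: W_def)
  qed auto
  show "Y' -` U \<inter> space N \<in> sets N" unfolding eq
    by (intro sets.countable_UN'' sets.countable_INT' image_subsetI measurable_sets[OF Y] openin_sets_borel_of W) auto
qed

lemma tendsto_by_approximation:
  fixes a :: "nat \<Rightarrow> real"
  assumes "\<And>e. e > 0 \<Longrightarrow> \<exists>b b'. (\<forall>\<^sub>F n in sequentially. \<bar>a n - b n\<bar> \<le> e) \<and> \<bar>a' - b'\<bar> \<le> e \<and> b \<longlonglongrightarrow> b'"
  shows "a \<longlonglongrightarrow> a'"
proof (rule tendstoI)
  fix e :: real assume "e > 0"
  then obtain b b' where b: "\<forall>\<^sub>F n in sequentially. \<bar>a n - b n\<bar> \<le> e / 4" "\<bar>a' - b'\<bar> \<le> e / 4" "b \<longlonglongrightarrow> b'"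
    using assms[of "e / 4"] by auto
  have "\<forall>\<^sub>F n in sequentially. dist (b n) b' < e / 4" using b(3) \<open>e > 0\<close> by (intro tendstoD) auto
  with b(1) show "\<forall>\<^sub>F n in sequentially. dist (a n) a' < e"
    by eventually_elim (use b(2) \<open>e > 0\<close> in \<open>unfold dist_real_def, linarith\<close>)
qed

lemma bounded_integral_diff_le:
  fixes g h :: "'a \<Rightarrow> real"
  assumes N: "prob_space N" and [measurable]: "g \<in> borel_measurable N" "h \<in> borel_measurable N" "B \<in> sets N"
    and g: "\<And>\<omega>. \<omega> \<in> space N \<Longrightarrow> \<bar>g \<omega>\<bar> \<le> b" and h: "\<And>\<omega>. \<omega> \<in> space N \<Longrightarrow> \<bar>h \<omega>\<bar> \<le> b"
    and gh: "\<And>\<omega>. \<omega> \<in> space N - B \<Longrightarrow> \<bar>g \<omega> - h \<omega>\<bar> \<le> e" and e: "e \<ge> 0"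
  shows "\<bar>(\<integral>\<omega>. g \<omega> \<partial>N) - (\<integral>\<omega>. h \<omega> \<partial>N)\<bar> \<le> e + 2 * b * measure N B"
proof -
  interpret prob_space N by fact
  have ig: "integrable N g" by (rule integrable_const_bound[of _ b]) (use g in \<open>auto intro!: AE_I2\<close>)
  have ih: "integrable N h" by (rule integrable_const_bound[of _ b]) (use h in \<open>auto intro!: AE_I2\<close>)
  have b0: "b \<ge> 0" using g not_empty by (metis abs_ge_zero equals0I order_trans)
  have "\<bar>(\<integral>\<omega>. g \<omega> \<partial>N) - (\<integral>\<omega>. h \<omega> \<partial>N)\<bar> = \<bar>\<integral>\<omega>. g \<omega> - h \<omega> \<partial>N\<bar>" using ig ih by simp
  also have "\<dots> \<le> (\<integral>\<omega>. \<bar>g \<omega> - h \<omega>\<bar> \<partial>N)" by (rule integral_abs_bound)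
  also have "\<dots> \<le> (\<integral>\<omega>. e + 2 * b * indicator B \<omega> \<partial>N)"
  proof (rule integral_mono)
    fix \<omega> assume w: "\<omega> \<in> space N"
    show "\<bar>g \<omega> - h \<omega>\<bar> \<le> e + 2 * b * indicator B \<omega>"
      using g[OF w] h[OF w] gh[of \<omega>] w e by (cases "\<omega> \<in> B") auto
  qed (use ig ih in \<open>auto simp: less_top[symmetric]\<close>)
  also have "\<dots> = e + 2 * b * measure N B"
    by (subst Bochner_Integration.integral_add) (auto simp: prob_space less_top[symmetric])
  finally show ?thesis .
qed

section \<open>Lipschitz approximation from below and the portmanteau argument\<close>

context Metric_space begin

text \<open>The Pasch-Hausdorff envelope: for nonnegative \<phi> the largest k-Lipschitz function
  below \<phi>.\<close>

definition lipschitz_approx :: "('a \<Rightarrow> real) \<Rightarrow> nat \<Rightarrow> 'a \<Rightarrow> real" where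
  "lipschitz_approx \<phi> k x = (INF y\<in>M. \<phi> y + real k * d x y)"

context
  fixes \<phi> :: "'a \<Rightarrow> real"
  assumes pos: "\<And>x. x \<in> M \<Longrightarrow> 0 \<le> \<phi> x"
begin

lemma lipschitz_approx_le: "x \<in> M \<Longrightarrow> y \<in> M \<Longrightarrow> lipschitz_approx \<phi> k x \<le> \<phi> y + real k * d x y"
  unfolding lipschitz_approx_def
  by (rule cINF_lower) (auto intro!: bdd_belowI[of _ 0] add_nonneg_nonneg mult_nonneg_nonneg pos)

lemma lipschitz_approx_ge:
  "x \<in> M \<Longrightarrow> (\<And>y. y \<in> M \<Longrightarrow> c \<le> \<phi> y + real k * d x y) \<Longrightarrow> c \<le> lipschitz_approx \<phi> k x"
  unfolding lipschitz_approx_def by (rule cINF_greatest) auto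

lemma lipschitz_approx_nonneg: "x \<in> M \<Longrightarrow> 0 \<le> lipschitz_approx \<phi> k x"
  by (rule lipschitz_approx_ge) (auto intro!: add_nonneg_nonneg mult_nonneg_nonneg pos)

lemma lipschitz_approx_below: "x \<in> M \<Longrightarrow> lipschitz_approx \<phi> k x \<le> \<phi> x"
  using lipschitz_approx_le[of x x k] by simp

lemma lipschitz_approx_lipschitz:
  assumes "x \<in> M" "x' \<in> M"
  shows "\<bar>lipschitz_approx \<phi> k x - lipschitz_approx \<phi> k x'\<bar> \<le> real k * d x x'"
proof -
  have *: "lipschitz_approx \<phi> k x - real k * d x x' \<le> lipschitz_approx \<phi> k x'"
    if "x \<in> M" "x' \<in> M" for x x'
  proof (rule lipschitz_approx_ge)
    fix y assume y: "y \<in> M"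
    have "real k * d x y \<le> real k * (d x x' + d x' y)" using that y by (intro mult_left_mono triangle) auto
    then show "lipschitz_approx \<phi> k x - real k * d x x' \<le> \<phi> y + real k * d x' y"
      using lipschitz_approx_le[OF that(1) y, of k] by (simp add: algebra_simps)
  qed fact
  show ?thesis using *[OF assms] *[OF assms(2,1)] by (simp add: abs_le_iff commute)
qed

text \<open>Competitors y within distance \<delta> of x have values close to \<phi> x by continuity.
  For all others the penalty k \<delta> exceeds \<phi> x, and \<phi> y is nonnegative.\<close>

lemma lipschitz_approx_tendsto:
  assumes cont: "continuous_map mtopology euclideanreal \<phi>" and x: "x \<in> M"
  shows "(\<lambda>k. lipschitz_approx \<phi> k x) \<longlonglongrightarrow> \<phi> x"
proof (rule tendstoI)
  fix e :: real assume e: "e > 0"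
  obtain \<delta> where \<delta>: "\<delta> > 0" "\<And>y. y \<in> M \<Longrightarrow> d x y < \<delta> \<Longrightarrow> \<bar>\<phi> y - \<phi> x\<bar> < e / 2"
  proof -
    have "openin mtopology {y \<in> M. \<phi> y \<in> ball (\<phi> x) (e / 2)}"
      using openin_continuous_map_preimage[OF cont, of "ball (\<phi> x) (e/2)"] by simp
    moreover have "x \<in> {y \<in> M. \<phi> y \<in> ball (\<phi> x) (e / 2)}" using x e by auto
    ultimately obtain \<delta> where "\<delta> > 0" "mball x \<delta> \<subseteq> {y \<in> M. \<phi> y \<in> ball (\<phi> x) (e / 2)}"
      unfolding openin_mtopology by blast
    then show ?thesis using x by (intro that[of \<delta>]) (auto simp: dist_real_def subset_iff abs_minus_commute)
  qed
  have "\<forall>\<^sub>F k in sequentially. \<phi> x / \<delta> < real k"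
    using filterlim_at_top_dense[THEN iffD1, OF filterlim_real_sequentially] by blast
  then show "\<forall>\<^sub>F k in sequentially. dist (lipschitz_approx \<phi> k x) (\<phi> x) < e"
  proof eventually_elim
    case (elim k)
    have "\<phi> x - e / 2 \<le> lipschitz_approx \<phi> k x"
    proof (rule lipschitz_approx_ge[OF x])
      fix y assume y: "y \<in> M"
      show "\<phi> x - e / 2 \<le> \<phi> y + real k * d x y"
      proof (cases "d x y < \<delta>")
        case True
        have "0 \<le> real k * d x y" by simp
        then show ?thesis using \<delta>(2)[OF y True] by linarith
      next
        case False
        then have "\<phi> x \<le> real k * d x y"
        proof -
          have "\<phi> x < real k * \<delta>" using elim \<delta>(1) by (simp add: field_simps)
          also have "\<dots> \<le> real k * d x y" using False by (intro mult_left_mono) auto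
          finally show ?thesis by simp
        qed
        then show ?thesis using pos[OF y] e by linarith
      qed
    qed
    then show ?case using lipschitz_approx_below[OF x, of k] e by (simp add: dist_real_def)
  qed
qed

end

lemma lipschitz_continuous_map:
  assumes "\<And>x y. x \<in> M \<Longrightarrow> y \<in> M \<Longrightarrow> \<bar>\<psi> x - \<psi> y\<bar> \<le> L * d x y"
  shows "continuous_map mtopology euclideanreal \<psi>"
proof -
  have "Lipschitz_continuous_map Self euclidean_metric \<psi>"
    using assms by (auto simp: Lipschitz_continuous_map_def dist_real_def Self_def)
  from Lipschitz_continuous_imp_continuous_map[OF this] show ?thesis
    by (simp add: Self_def)
qed

text \<open>Envelopes lie below \<phi>, so convergence for them yields a lower bound in the limit,
  for nonnegative functionals. Applied to \<phi> + b and to b - \<phi> it yields both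
  directions.\<close>

lemma portmanteau_lipschitz:
  assumes N: "prob_space N" and N': "prob_space N'"
    and Y: "\<And>n. Y n \<in> N \<rightarrow>\<^sub>M borel_of mtopology" and Y': "Y' \<in> N' \<rightarrow>\<^sub>M borel_of mtopology"
    and lip: "\<And>\<psi> L b. (\<And>x y. x \<in> M \<Longrightarrow> y \<in> M \<Longrightarrow> \<bar>\<psi> x - \<psi> y\<bar> \<le> L * d x y) \<Longrightarrow>
      (\<And>x. x \<in> M \<Longrightarrow> \<bar>\<psi> x\<bar> \<le> b) \<Longrightarrow>
      (\<lambda>n. \<integral>\<omega>. \<psi> (Y n \<omega>) \<partial>N) \<longlonglongrightarrow> (\<integral>\<omega>. \<psi> (Y' \<omega>) \<partial>N')"
    and \<phi>: "continuous_map mtopology euclideanreal \<phi>" "bounded (\<phi> ` M)"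
  shows "(\<lambda>n. \<integral>\<omega>. \<phi> (Y n \<omega>) \<partial>N) \<longlonglongrightarrow> (\<integral>\<omega>. \<phi> (Y' \<omega>) \<partial>N')"
proof -
  interpret N: prob_space N by fact
  interpret N': prob_space N' by fact
  have YM: "\<omega> \<in> space N \<Longrightarrow> Y n \<omega> \<in> M" for n \<omega> using measurable_space[OF Y, of \<omega>] by simp
  have YM': "\<omega> \<in> space N' \<Longrightarrow> Y' \<omega> \<in> M" for \<omega> using measurable_space[OF Y', of \<omega>] by simp
  have lower: "\<forall>\<^sub>F n in sequentially. (\<integral>\<omega>. \<phi> (Y' \<omega>) \<partial>N') - e < (\<integral>\<omega>. \<phi> (Y n \<omega>) \<partial>N)"
    if c: "continuous_map mtopology euclideanreal \<phi>" and b: "\<And>x. x \<in> M \<Longrightarrow> 0 \<le> \<phi> x" "\<And>x. x \<in> M \<Longrightarrow> \<phi> x \<le> b"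
      and e: "e > 0" for \<phi> b e
  proof -
    let ?\<phi> = "lipschitz_approx \<phi>"
    have bb: "\<bar>?\<phi> k x\<bar> \<le> b" if "x \<in> M" for k x
      using lipschitz_approx_nonneg[of \<phi> x k] lipschitz_approx_below[of \<phi> x k] b that by force
    have lipk: "\<bar>?\<phi> k x - ?\<phi> k y\<bar> \<le> real k * d x y" if "x \<in> M" "y \<in> M" for k x y
      using lipschitz_approx_lipschitz[of \<phi> x y k] b that by auto
    have mk: "?\<phi> k \<in> borel_measurable (borel_of mtopology)" for k
      by (intro continuous_map_borel_of_measurable lipschitz_continuous_map[where L = "real k"] lipk)
    have m: "\<phi> \<in> borel_measurable (borel_of mtopology)" by (intro continuous_map_borel_of_measurable c)
    have "(\<lambda>k. \<integral>\<omega>. ?\<phi> k (Y' \<omega>) \<partial>N') \<longlonglongrightarrow> (\<integral>\<omega>. \<phi> (Y' \<omega>) \<partial>N')"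
    proof (rule integral_dominated_convergence[where w = "\<lambda>_. b"])
      show "(\<lambda>\<omega>. \<phi> (Y' \<omega>)) \<in> borel_measurable N'" by (rule measurable_compose[OF Y' m])
      show "(\<lambda>\<omega>. ?\<phi> k (Y' \<omega>)) \<in> borel_measurable N'" for k by (rule measurable_compose[OF Y' mk])
      show "AE \<omega> in N'. (\<lambda>k. ?\<phi> k (Y' \<omega>)) \<longlonglongrightarrow> \<phi> (Y' \<omega>)"
        using b YM' by (intro AE_I2 lipschitz_approx_tendsto c) auto
      show "AE \<omega> in N'. norm (?\<phi> k (Y' \<omega>)) \<le> b" for k using bb YM' by (intro AE_I2) auto
    qed auto
    then have "\<forall>\<^sub>F k in sequentially. dist (\<integral>\<omega>. ?\<phi> k (Y' \<omega>) \<partial>N') (\<integral>\<omega>. \<phi> (Y' \<omega>) \<partial>N') < e / 2"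
      using e by (intro tendstoD) auto
    then obtain k where k: "\<bar>(\<integral>\<omega>. ?\<phi> k (Y' \<omega>) \<partial>N') - (\<integral>\<omega>. \<phi> (Y' \<omega>) \<partial>N')\<bar> < e / 2"
      by (auto simp: eventually_sequentially dist_real_def)
    have "(\<lambda>n. \<integral>\<omega>. ?\<phi> k (Y n \<omega>) \<partial>N) \<longlonglongrightarrow> (\<integral>\<omega>. ?\<phi> k (Y' \<omega>) \<partial>N')"
      by (rule lip[of "?\<phi> k" "real k" b, OF lipk bb])
    then have "\<forall>\<^sub>F n in sequentially. dist (\<integral>\<omega>. ?\<phi> k (Y n \<omega>) \<partial>N) (\<integral>\<omega>. ?\<phi> k (Y' \<omega>) \<partial>N') < e / 2"
      using e by (intro tendstoD) auto
    then show ?thesis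
    proof eventually_elim
      case (elim n)
      have "(\<integral>\<omega>. ?\<phi> k (Y n \<omega>) \<partial>N) \<le> (\<integral>\<omega>. \<phi> (Y n \<omega>) \<partial>N)"
      proof (rule integral_mono)
        show "integrable N (\<lambda>\<omega>. ?\<phi> k (Y n \<omega>))"
          using bb YM by (intro N.integrable_const_bound[of _ b] AE_I2 measurable_compose[OF Y mk]) auto
        show "integrable N (\<lambda>\<omega>. \<phi> (Y n \<omega>))"
          using b YM by (intro N.integrable_const_bound[of _ b] AE_I2 measurable_compose[OF Y m]) auto
        show "?\<phi> k (Y n \<omega>) \<le> \<phi> (Y n \<omega>)" if "\<omega> \<in> space N" for \<omega>
          using b YM[OF that] by (intro lipschitz_approx_below) auto
      qed
      then show ?case using elim k unfolding dist_real_def by linarith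
    qed
  qed
  obtain b where b: "\<And>x. x \<in> M \<Longrightarrow> \<bar>\<phi> x\<bar> \<le> b" using \<phi>(2) unfolding bounded_iff by auto
  have m: "\<phi> \<in> borel_measurable (borel_of mtopology)" by (intro continuous_map_borel_of_measurable \<phi>)
  have i: "integrable N (\<lambda>\<omega>. \<phi> (Y n \<omega>))" for n
    using b YM by (intro N.integrable_const_bound[of _ b] AE_I2 measurable_compose[OF Y m]) auto
  have i': "integrable N' (\<lambda>\<omega>. \<phi> (Y' \<omega>))"
    using b YM' by (intro N'.integrable_const_bound[of _ b] AE_I2 measurable_compose[OF Y' m]) auto
  show ?thesis
  proof (rule tendstoI)
    fix e :: real assume e: "e > 0"
    have "\<forall>\<^sub>F n in sequentially. (\<integral>\<omega>. \<phi> (Y' \<omega>) + b \<partial>N') - e < (\<integral>\<omega>. \<phi> (Y n \<omega>) + b \<partial>N)"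
      using b e by (intro lower[of "\<lambda>x. \<phi> x + b" "2 * b"] continuous_map_add \<phi>) (force simp: abs_le_iff)+
    moreover have "\<forall>\<^sub>F n in sequentially. (\<integral>\<omega>. b - \<phi> (Y' \<omega>) \<partial>N') - e < (\<integral>\<omega>. b - \<phi> (Y n \<omega>) \<partial>N)"
      using b e by (intro lower[of "\<lambda>x. b - \<phi> x" "2 * b"] continuous_map_diff \<phi>) (force simp: abs_le_iff)+
    ultimately show "\<forall>\<^sub>F n in sequentially. dist (\<integral>\<omega>. \<phi> (Y n \<omega>) \<partial>N) (\<integral>\<omega>. \<phi> (Y' \<omega>) \<partial>N') < e"
      by eventually_elim (use i i' in \<open>simp add: dist_real_def N.prob_space N'.prob_space abs_less_iff\<close>)
  qed
qed

end

section \<open>Dyadic Riemann sums\<close>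

definition grid :: "real \<Rightarrow> nat \<Rightarrow> nat \<Rightarrow> real" where
  "grid T n j = T * real j / 2^n"

lemma grid_0 [simp]: "grid T n 0 = 0" and grid_last [simp]: "grid T n (2^n) = T"
  by (simp_all add: grid_def)

lemma grid_mono: "T > 0 \<Longrightarrow> grid T n i \<le> grid T n j \<longleftrightarrow> i \<le> j"
  by (simp add: grid_def divide_le_cancel)

lemma grid_strict_mono: "T > 0 \<Longrightarrow> grid T n i < grid T n j \<longleftrightarrow> i < j"
  by (simp add: grid_def divide_less_cancel)

lemma grid_in: "T > 0 \<Longrightarrow> j \<le> 2^n \<Longrightarrow> grid T n j \<in> {0..T}"
  using grid_mono[of T n 0 j] grid_mono[of T n j "2^n"] by simp

lemma grid_Suc_double: "grid T (Suc n) (2 * j) = grid T n j"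
  by (simp add: grid_def)

lemma grid_Suc_diff: "grid T n (Suc j) - grid T n j = T / 2^n"
  by (simp add: grid_def field_simps)

text \<open>Truncation to [-2^n, 2^n] makes the range finite. The resolution 4^(-n) is chosen
  against the 2^n terms of a Riemann sum of level n, whose rounding errors together are then of
  order 2^(-n).\<close>

definition rnd :: "nat \<Rightarrow> real \<Rightarrow> real" where
  "rnd n x = real_of_int \<lfloor>4^n * max (- (2^n)) (min (2^n) x)\<rfloor> / 4^n"

lemma rnd_measurable [measurable]: "rnd n \<in> borel_measurable borel"
  unfolding rnd_def by measurable

lemma rnd_clip: "\<bar>rnd n x - max (- (2^n)) (min (2^n) x)\<bar> \<le> 1 / 4^n"
proof -
  have *: "\<bar>real_of_int \<lfloor>c * y\<rfloor> / c - y\<bar> \<le> 1 / c" if "c > 0" for c y :: real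
  proof -
    have "real_of_int \<lfloor>c * y\<rfloor> / c - y = (real_of_int \<lfloor>c * y\<rfloor> - c * y) / c"
      using that by (simp add: field_simps)
    moreover have "\<bar>real_of_int \<lfloor>c * y\<rfloor> - c * y\<bar> \<le> 1" by linarith
    ultimately show ?thesis using that by (simp add: abs_divide divide_right_mono)
  qed
  show ?thesis unfolding rnd_def by (rule *) simp
qed

lemma rnd_error: "\<bar>x\<bar> \<le> 2^n \<Longrightarrow> \<bar>rnd n x - x\<bar> \<le> 1 / 4^n"
  using rnd_clip[of n x] by (simp add: min_def max_def abs_le_iff split: if_splits)

lemma abs_rnd_le: "\<bar>rnd n x\<bar> \<le> \<bar>x\<bar> + 1" and abs_rnd_le_pow: "\<bar>rnd n x\<bar> \<le> 2^n + 1"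
proof -
  have "1 / 4^n \<le> (1::real)" by simp
  then have *: "\<bar>rnd n x - max (- (2^n)) (min (2^n) x)\<bar> \<le> 1" using rnd_clip[of n x] by linarith
  have "(0::real) < 2^n" by simp
  then have "\<bar>max (- (2^n)) (min (2^n) x)\<bar> \<le> \<bar>x\<bar>" "\<bar>max (- (2^n)) (min (2^n) x)\<bar> \<le> 2^n"
    by (auto simp: min_def max_def)
  with * show "\<bar>rnd n x\<bar> \<le> \<bar>x\<bar> + 1" "\<bar>rnd n x\<bar> \<le> 2^n + 1" by linarith+
qed

lemma finite_range_rnd: "finite (range (rnd n))"
proof (rule finite_subset)
  show "range (rnd n) \<subseteq> (\<lambda>i. real_of_int i / 4^n) ` {\<lfloor>4^n * (- (2^n)) :: real\<rfloor> .. \<lfloor>4^n * 2^n :: real\<rfloor>}"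
  proof safe
    fix x :: real
    have p: "(0::real) < 2^n" by simp
    have "- (2^n) \<le> max (- (2^n)) (min (2^n) x)" by simp
    then have 1: "\<lfloor>4^n * (- (2^n)) :: real\<rfloor> \<le> \<lfloor>4^n * max (- (2^n)) (min (2^n) x)\<rfloor>"
      by (intro floor_mono mult_left_mono) auto
    have "max (- (2^n)) (min (2^n) x) \<le> 2^n" using p by linarith
    then have 2: "\<lfloor>4^n * max (- (2^n)) (min (2^n) x)\<rfloor> \<le> \<lfloor>4^n * 2^n :: real\<rfloor>"
      by (intro floor_mono mult_left_mono) auto
    show "rnd n x \<in> (\<lambda>i. real_of_int i / 4^n) ` {\<lfloor>4^n * (- (2^n)) :: real\<rfloor> .. \<lfloor>4^n * 2^n :: real\<rfloor>}"
      unfolding rnd_def by (rule imageI) (use 1 2 in \<open>simp only: atLeastAtMost_iff\<close>)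
  qed
qed simp

lemma sum_lessThan_double:
  fixes g :: "nat \<Rightarrow> 'b::comm_monoid_add"
  shows "(\<Sum>i<2*m. g i) = (\<Sum>j<m. g (2*j) + g (2*j+1))"
  by (induction m) (auto simp: algebra_simps)

lemma nn_suminf_tail_tendsto_0:
  fixes g :: "nat \<Rightarrow> ennreal"
  assumes "(\<Sum>i. g i) < \<infinity>"
  shows "(\<lambda>n. \<Sum>i. g (n + i)) \<longlonglongrightarrow> 0"
proof -
  have g: "g i < \<infinity>" for i
    using assms by (metis ennreal_suminf_lessD)
  define r where "r i = enn2real (g i)" for i
  have gr: "g i = ennreal (r i)" for i using g[of i] by (simp add: r_def)
  have r0: "r i \<ge> 0" for i by (simp add: r_def)
  have s: "summable r" using assms unfolding gr by (intro summable_suminf_not_top r0) auto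
  have sn: "summable (\<lambda>i. r (n + i))" for n
    using summable_ignore_initial_segment[OF s, of n] by (simp add: add.commute)
  have "(\<lambda>n. suminf r - (\<Sum>i<n. r i)) \<longlonglongrightarrow> suminf r - suminf r"
    by (intro tendsto_diff tendsto_const summable_LIMSEQ s)
  moreover have "suminf r - (\<Sum>i<n. r i) = (\<Sum>i. r (n + i))" for n
    using suminf_minus_initial_segment[OF s, of n] by (simp add: add.commute)
  ultimately have "(\<lambda>n. \<Sum>i. r (n + i)) \<longlonglongrightarrow> 0" by simp
  then have "(\<lambda>n. ennreal (\<Sum>i. r (n + i))) \<longlonglongrightarrow> ennreal 0" by (intro tendsto_ennrealI)
  moreover have "(\<Sum>i. g (n + i)) = ennreal (\<Sum>i. r (n + i))" for n
    unfolding gr by (rule suminf_ennreal2[OF r0 sn])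
  ultimately show ?thesis by simp
qed

lemma (in prob_space) tail_prob_lt:
  fixes X :: "'a \<Rightarrow> real"
  assumes [measurable]: "X \<in> borel_measurable M" and e: "e > 0"
  obtains R :: nat where "R \<ge> R0" "prob {\<omega>\<in>space M. real R < \<bar>X \<omega>\<bar>} < e"
proof -
  have "(\<lambda>R. prob {\<omega>\<in>space M. real R < \<bar>X \<omega>\<bar>}) \<longlonglongrightarrow> prob (\<Inter>R. {\<omega>\<in>space M. real R < \<bar>X \<omega>\<bar>})"
    by (intro finite_Lim_measure_decseq) (auto simp: decseq_def)
  moreover have "(\<Inter>R. {\<omega>\<in>space M. real R < \<bar>X \<omega>\<bar>}) = {}"
    by (auto, metis reals_Archimedean2 less_asym)
  ultimately have "(\<lambda>R. prob {\<omega>\<in>space M. real R < \<bar>X \<omega>\<bar>}) \<longlonglongrightarrow> 0" by simp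
  then have "\<forall>\<^sub>F R in sequentially. prob {\<omega>\<in>space M. real R < \<bar>X \<omega>\<bar>} < e"
    using e by (intro order_tendstoD)
  then obtain R1 where "\<And>R. R \<ge> R1 \<Longrightarrow> prob {\<omega>\<in>space M. real R < \<bar>X \<omega>\<bar>} < e"
    by (auto simp: eventually_sequentially)
  then show ?thesis by (intro that[of "max R0 R1"]) auto
qed

text \<open>One variable \<open>K\<close> bounds both the Hoelder quotient and f itself, so a single
  event {K \<le> R} controls every use of f. It is a measurable majorant rather than the seminorm,
  which is a supremum over uncountably many pairs. The locale is used on the base space and, along
  the projection, on the extension.\<close>

locale hoelder_process = prob_space N for N :: "'a measure" +
  fixes T \<alpha> :: real and f :: "real \<Rightarrow> 'a \<Rightarrow> real" and K :: "'a \<Rightarrow> real"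
  assumes T: "T > 0" and \<alpha>: "\<alpha> > 1 / 2"
    and f_measurable: "t \<in> {0..T} \<Longrightarrow> f t \<in> borel_measurable N"
    and K_measurable [measurable]: "K \<in> borel_measurable N"
    and hoelder: "\<omega> \<in> space N \<Longrightarrow> u \<in> {0..T} \<Longrightarrow> v \<in> {0..T} \<Longrightarrow> \<bar>f u \<omega> - f v \<omega>\<bar> \<le> K \<omega> * \<bar>u - v\<bar> powr \<alpha>"
    and f_bound: "\<omega> \<in> space N \<Longrightarrow> u \<in> {0..T} \<Longrightarrow> \<bar>f u \<omega>\<bar> \<le> K \<omega>"
begin

text \<open>Riemann sum of f against H stopped at t, with a Young integral as its limit. The values
  of f may be unbounded over the sample space, so these coefficients do not form a simple
  integrand.\<close>

definition young :: "(real \<Rightarrow> 'a \<Rightarrow> real) \<Rightarrow> nat \<Rightarrow> real \<Rightarrow> 'a \<Rightarrow> real" where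
  "young H n = simple_integral H (2^n) (grid T n) (\<lambda>j. f (grid T n j))"

definition f_rnd :: "nat \<Rightarrow> nat \<Rightarrow> 'a \<Rightarrow> real" where
  "f_rnd n j \<omega> = rnd n (f (grid T n j) \<omega>)"

definition young_rnd :: "(real \<Rightarrow> 'a \<Rightarrow> real) \<Rightarrow> nat \<Rightarrow> real \<Rightarrow> 'a \<Rightarrow> real" where
  "young_rnd H n = simple_integral H (2^n) (grid T n) (f_rnd n)"

lemma f_rnd_measurable: "j \<le> 2^n \<Longrightarrow> f_rnd n j \<in> borel_measurable N"
  unfolding f_rnd_def using f_measurable[OF grid_in[OF T, of j n]] by measurable

lemma K_nonneg: "\<omega> \<in> space N \<Longrightarrow> 0 \<le> K \<omega>"
  using f_bound[of \<omega> 0] T by force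

text \<open>On the left half of a block both sums use the value of f at the left end and cancel. On
  the right half the finer sum uses the midpoint, so one product of a difference of f and an
  increment of H is left per block.\<close>

lemma young_refine:
  "young H (Suc n) t \<omega> - young H n t \<omega> =
    (\<Sum>j<2^n. (f (grid T (Suc n) (2*j+1)) \<omega> - f (grid T n j) \<omega>) *
      (H (min (grid T n (Suc j)) t) \<omega> - H (min (grid T (Suc n) (2*j+1)) t) \<omega>))"
proof -
  have e: "grid T (Suc n) (Suc (2*j+1)) = grid T n (Suc j)" for j
    using grid_Suc_double[of T n "Suc j"] by simp
  show ?thesis
    unfolding young_def simple_integral_def power_Suc sum_lessThan_double sum_subtractf[symmetric]
    by (intro sum.cong refl) (simp only: grid_Suc_double e, simp add: algebra_simps)
qed

text \<open>Stopping at t leaves the increment whole, shortens it within [a,b], or kills it. The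
  oscillation bound covers all three cases and no longer depends on t.\<close>

lemma min_increment_le:
  fixes H :: "real \<Rightarrow> real"
  assumes Y: "\<And>s. s \<in> {a..b} \<Longrightarrow> ennreal \<bar>H s - H a\<bar> \<le> Y" and "a \<le> b"
  shows "ennreal \<bar>H (min b t) - H (min a t)\<bar> \<le> Y"
proof (cases "t \<le> a")
  case True
  then have "min b t = t" "min a t = t" using assms(2) by auto
  then show ?thesis by simp
next
  case False
  then show ?thesis using assms(2) Y[of "min b t"] by (auto simp: min_def split: if_splits)
qed

lemma dominated_increments_choice:
  assumes "dominated_increments N T H \<mu> C"
  shows "\<exists>Y. \<forall>a b. 0 \<le> a \<longrightarrow> a \<le> b \<longrightarrow> b \<le> T \<longrightarrow> Y a b \<in> borel_measurable N \<and>
      (\<forall>\<omega>\<in>space N. \<forall>t\<in>{a..b}. ennreal \<bar>H t \<omega> - H a \<omega>\<bar> \<le> Y a b \<omega>) \<and>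
      (\<integral>\<^sup>+\<omega>. Y a b \<omega> ^ 4 \<partial>N) \<le> ennreal (C * (\<mu> b - \<mu> a)\<^sup>2)"
proof (intro exI allI impI)
  let ?P = "\<lambda>a b Y. Y \<in> borel_measurable N \<and>
          (\<forall>\<omega>\<in>space N. \<forall>t\<in>{a..b}. ennreal \<bar>H t \<omega> - H a \<omega>\<bar> \<le> Y \<omega>) \<and>
          (\<integral>\<^sup>+\<omega>. Y \<omega> ^ 4 \<partial>N) \<le> ennreal (C * (\<mu> b - \<mu> a)\<^sup>2)"
  fix a b assume "0 \<le> a" "a \<le> b" "b \<le> T"
  then show "?P a b (SOME Y. ?P a b Y)"
    using assms unfolding dominated_increments_def Bex_def by (intro someI_ex[of "?P a b"]) blast
qed

text \<open>The subintervals lie in different blocks, so their masses are bounded by a telescoping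
  sum. The left ends are free because a refinement step sees only the right halves.\<close>

lemma sum_dominating_le:
  assumes dom: "dominated_increments N T H \<mu> C"
    and ab: "\<And>j. j < m \<Longrightarrow> grid T n j \<le> a j \<and> a j \<le> grid T n (Suc j)" and m: "m = 2^n"
  shows "(\<Sum>j<m. \<mu> (grid T n (Suc j)) - \<mu> (a j)) \<le> T"
proof -
  have mono: "mono_on {0..T} \<mu>" "\<mu> T - \<mu> 0 \<le> T" using dom by (auto simp: dominated_increments_def)
  have "(\<Sum>j<m. \<mu> (grid T n (Suc j)) - \<mu> (a j)) \<le> (\<Sum>j<m. \<mu> (grid T n (Suc j)) - \<mu> (grid T n j))"
  proof (intro sum_mono diff_left_mono)
    fix j assume "j \<in> {..<m}"
    then have j: "j < 2^n" using m by simp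
    have "grid T n j \<in> {0..T}" "grid T n (Suc j) \<in> {0..T}" using j by (auto intro!: grid_in[OF T] simp del: atLeastAtMost_iff)
    then show "\<mu> (grid T n j) \<le> \<mu> (a j)" using ab[of j] j m by (intro mono_onD[OF mono(1)]) auto
  qed
  also have "\<dots> = \<mu> T - \<mu> 0"
    using sum_lessThan_telescope[of "\<lambda>j. \<mu> (grid T n j)" m] m by simp
  finally show ?thesis using mono by simp
qed

text \<open>Factor gained per level: the mesh contributes 2^(-\<alpha>), the expected sum of
  oscillations 2^(1/2). It is below 1 because \<alpha> > 1/2.\<close>

definition rate :: real where "rate = 2 powr (1/2 - \<alpha>)"
definition rate_const :: "real \<Rightarrow> real" where
  "rate_const C = (T / 2) powr \<alpha> * (1 + (1 + C) * T) / (1 - rate)"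

lemma rate: "0 < rate" "rate < 1"
proof -
  have "2 powr (1/2 - \<alpha>) < 2 powr (0::real)" using \<alpha> by (intro powr_less_mono) auto
  then show "0 < rate" "rate < 1" by (auto simp: rate_def)
qed

text \<open>\<open>W n\<close> is the tail of a series of oscillation sums weighted by powers of the
  mesh, so it bounds all later differences at once, uniformly in t. The factor \<open>K\<close>
  stays outside, since it may lack moments and may depend on H; the expectation of
  \<open>W n\<close> decays geometrically with constants independent of H and
  \<open>\<mu>\<close>.\<close>

lemma young_dominated:
  assumes dom: "dominated_increments N T H \<mu> C"
  shows "\<exists>W :: nat \<Rightarrow> 'a \<Rightarrow> ennreal. (\<forall>n. W n \<in> borel_measurable N) \<and>
    (\<forall>n. (\<integral>\<^sup>+\<omega>. W n \<omega> \<partial>N) \<le> ennreal (rate_const C * rate ^ n)) \<and>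
    (\<forall>n n' \<omega> t. n \<le> n' \<longrightarrow> \<omega> \<in> space N \<longrightarrow> t \<in> {0..T} \<longrightarrow>
      ennreal \<bar>young H n' t \<omega> - young H n t \<omega>\<bar> \<le> ennreal (K \<omega>) * W n \<omega>) \<and>
    (\<forall>\<omega>. W 0 \<omega> < \<infinity> \<longrightarrow> (\<lambda>n. W n \<omega>) \<longlonglongrightarrow> 0)"
proof -
  define mid where "mid n j = grid T (Suc n) (2*j+1)" for n j
  have C: "C \<ge> 0" and mono: "mono_on {0..T} \<mu>" using dom by (auto simp: dominated_increments_def)
  have mid: "grid T n j \<le> mid n j" "mid n j \<le> grid T n (Suc j)" for n j
    unfolding mid_def grid_Suc_double[of T n j, symmetric] grid_Suc_double[of T n "Suc j", symmetric]
    using T by (auto simp: grid_mono)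
  have g: "0 \<le> grid T n j" "j < 2^n \<Longrightarrow> grid T n (Suc j) \<le> T" for j n
    using grid_in[OF T, of "Suc j" n] T by (auto simp: grid_def)
  obtain Y' where Y': "\<forall>a b. 0 \<le> a \<longrightarrow> a \<le> b \<longrightarrow> b \<le> T \<longrightarrow> Y' a b \<in> borel_measurable N \<and>
      (\<forall>\<omega>\<in>space N. \<forall>t\<in>{a..b}. ennreal \<bar>H t \<omega> - H a \<omega>\<bar> \<le> Y' a b \<omega>) \<and>
      (\<integral>\<^sup>+\<omega>. Y' a b \<omega> ^ 4 \<partial>N) \<le> ennreal (C * (\<mu> b - \<mu> a)\<^sup>2)"
    using dominated_increments_choice[OF dom] by (rule exE)
  define Y where "Y n j = Y' (mid n j) (grid T n (Suc j))" for n j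
  have m0: "0 \<le> mid n j" for n j using g(1) mid(1) by (rule order_trans)
  have Y0: "Y n j \<in> borel_measurable N \<and>
      (\<forall>\<omega>\<in>space N. \<forall>t\<in>{mid n j..grid T n (Suc j)}. ennreal \<bar>H t \<omega> - H (mid n j) \<omega>\<bar> \<le> Y n j \<omega>) \<and>
      (\<integral>\<^sup>+\<omega>. Y n j \<omega> ^ 4 \<partial>N) \<le> ennreal (C * (\<mu> (grid T n (Suc j)) - \<mu> (mid n j))\<^sup>2)" if "j < 2^n" for n j
    unfolding Y_def by (rule Y'[rule_format, OF m0 mid(2) g(2)[OF that]])
  have Y: "\<And>n j. j < 2^n \<Longrightarrow> Y n j \<in> borel_measurable N"
      "\<And>n j \<omega> t. j < 2^n \<Longrightarrow> \<omega> \<in> space N \<Longrightarrow> t \<in> {mid n j..grid T n (Suc j)} \<Longrightarrow> ennreal \<bar>H t \<omega> - H (mid n j) \<omega>\<bar> \<le> Y n j \<omega>"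
      "\<And>n j. j < 2^n \<Longrightarrow> (\<integral>\<^sup>+\<omega>. Y n j \<omega> ^ 4 \<partial>N) \<le> ennreal (C * (\<mu> (grid T n (Suc j)) - \<mu> (mid n j))\<^sup>2)"
    using Y0 by blast+
  define D where "D n \<omega> = (\<Sum>j<2^n. Y n j \<omega>)" for n \<omega>
  have D[measurable]: "D n \<in> borel_measurable N" for n unfolding D_def using Y(1) by (intro borel_measurable_sum) auto
  \<comment> \<open>Half a block length to the power \<alpha>: the distance from the left end of a
    block to its midpoint.\<close>
  define a where "a n = (T / 2^Suc n) powr \<alpha>" for n
  have a0: "a n \<ge> 0" for n by (simp add: a_def)
  have ED: "(\<integral>\<^sup>+\<omega>. D n \<omega> \<partial>N) \<le> ennreal ((1 + (1 + C) * T) * 2 powr (n / 2))" for n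
  proof -
    \<comment> \<open>Balances 2^n s against (1 + C) T / s: both become multiples of
      2^(n/2).\<close>
    define s :: real where "s = 2 powr (- (n / 2))"
    have s: "s > 0" by (simp add: s_def)
    define \<delta> where "\<delta> j = \<mu> (grid T n (Suc j)) - \<mu> (mid n j)" for j
    have d0: "\<delta> j \<ge> 0" if "j < 2^n" for j
      using mid[of n j] g(1)[of n j] g(2)[of j n] that unfolding \<delta>_def by (auto intro!: mono_onD[OF mono])
    have Y3: "(\<integral>\<^sup>+\<omega>. Y n j \<omega> ^ 4 \<partial>N) \<le> ennreal (C * (\<delta> j)\<^sup>2)" if "j < 2^n" for j
      using Y(3)[OF that] unfolding \<delta>_def .
    have "(\<integral>\<^sup>+\<omega>. D n \<omega> \<partial>N) = (\<Sum>j<2^n. \<integral>\<^sup>+\<omega>. Y n j \<omega> \<partial>N)"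
      unfolding D_def by (intro nn_integral_sum Y(1)) simp
    also have "\<dots> \<le> (\<Sum>j<2^n. ennreal (s + (1 + C) * \<delta> j / s))"
      by (intro sum_mono nn_integral_le_of_fourth_moment[OF prob_space_axioms] Y(1) d0 C s
          Y3) auto
    also have "\<dots> = ennreal (\<Sum>j<2^n. s + (1 + C) * \<delta> j / s)"
    proof (rule sum_ennreal)
      fix j :: nat assume "j \<in> {..<2^n}"
      then have "\<delta> j \<ge> 0" by (intro d0) simp
      then show "0 \<le> s + (1 + C) * \<delta> j / s" using s C by simp
    qed
    also have "\<dots> \<le> ennreal ((1 + (1 + C) * T) * 2 powr (n / 2))"
    proof (rule ennreal_leI)
      have "(\<Sum>j<2^n. s + (1 + C) * \<delta> j / s) = 2^n * s + (1 + C) * (\<Sum>j<2^n. \<delta> j) / s"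
        by (simp add: sum.distrib sum_divide_distrib sum_distrib_left)
      also have "\<dots> \<le> 2^n * s + (1 + C) * T / s"
        using s C sum_dominating_le[OF dom, where m = "2^n" and n = n and a = "mid n"] mid
        unfolding \<delta>_def by (intro add_left_mono divide_right_mono mult_left_mono) auto
      also have "2^n * s = 2 powr (n / 2)"
        by (simp add: s_def powr_realpow[symmetric] powr_add[symmetric])
      also have "(1 + C) * T / s = (1 + C) * T * 2 powr (n / 2)"
        by (simp add: s_def powr_minus divide_simps)
      finally show "(\<Sum>j<2^n. s + (1 + C) * \<delta> j / s) \<le> (1 + (1 + C) * T) * 2 powr (n / 2)"
        by (simp add: algebra_simps)
    qed
    finally show ?thesis .
  qed
  \<comment> \<open>A tail of one series, so that finiteness of \<open>W 0\<close> alone forces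
    \<open>W n\<close> to tend to 0.\<close>
  define W where "W n \<omega> = (\<Sum>i. ennreal (a (n + i)) * D (n + i) \<omega>)" for n \<omega>
  have W1: "(\<integral>\<^sup>+\<omega>. W n \<omega> \<partial>N) \<le> ennreal (rate_const C * rate ^ n)" for n
  proof -
    define c where "c = (T / 2) powr \<alpha> * (1 + (1 + C) * T)"
    have c0: "c \<ge> 0" using T C by (simp add: c_def)
    have "(\<integral>\<^sup>+\<omega>. W n \<omega> \<partial>N) = (\<Sum>i. ennreal (a (n + i)) * (\<integral>\<^sup>+\<omega>. D (n + i) \<omega> \<partial>N))"
      unfolding W_def by (simp add: nn_integral_suminf nn_integral_cmult)
    also have "\<dots> \<le> (\<Sum>i. ennreal (c * rate ^ n * rate ^ i))"
    proof (intro suminf_le summableI)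
      fix i
      have "ennreal (a (n + i)) * (\<integral>\<^sup>+\<omega>. D (n + i) \<omega> \<partial>N)
        \<le> ennreal (a (n + i)) * ennreal ((1 + (1 + C) * T) * 2 powr (real (n + i) / 2))"
        by (intro mult_left_mono ED) simp
      also have "\<dots> = ennreal (a (n + i) * ((1 + (1 + C) * T) * 2 powr (real (n + i) / 2)))"
        by (rule ennreal_mult'[OF a0, symmetric])
      also have "a (n + i) * ((1 + (1 + C) * T) * 2 powr (real (n + i) / 2)) = c * rate ^ n * rate ^ i"
      proof -
        have e1: "a l = (T / 2) powr \<alpha> * 2 powr (- \<alpha> * real l)" for l
        proof -
          have "T / 2^Suc l = (T / 2) * 2 powr (- real l)"
            by (simp add: powr_minus powr_realpow divide_simps)
          then have "a l = (T / 2) powr \<alpha> * (2 powr (- real l)) powr \<alpha>"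
            unfolding a_def using T by (simp only: powr_mult)
          also have "(2 powr (- real l)) powr \<alpha> = 2 powr (- \<alpha> * real l)"
            by (simp add: powr_powr mult.commute)
          finally show ?thesis .
        qed
        have e2: "2 powr (- \<alpha> * real l) * 2 powr (real l / 2) = rate ^ l" for l
        proof -
          have "2 powr (- \<alpha> * real l) * 2 powr (real l / 2) = 2 powr (- \<alpha> * real l + real l / 2)"
            by (rule powr_add[symmetric])
          also have "- \<alpha> * real l + real l / 2 = (1/2 - \<alpha>) * real l" by (simp add: algebra_simps)
          also have "2 powr \<dots> = rate powr real l" by (simp add: rate_def powr_powr)
          also have "\<dots> = rate ^ l" using rate(1) by (rule powr_realpow)
          finally show ?thesis .
        qed
        have "a l * ((1 + (1 + C) * T) * 2 powr (real l / 2)) = c * rate ^ l" for l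
          unfolding c_def e1 e2[symmetric] by (simp only: mult_ac)
        from this[of "n + i"] show ?thesis by (simp only: power_add mult.assoc)
      qed
      finally show "ennreal (a (n + i)) * (\<integral>\<^sup>+\<omega>. D (n + i) \<omega> \<partial>N) \<le> ennreal (c * rate ^ n * rate ^ i)" .
    qed
    also have "\<dots> = ennreal (\<Sum>i. c * rate ^ n * rate ^ i)"
    proof (rule suminf_ennreal2)
      show "0 \<le> c * rate ^ n * rate ^ i" for i using c0 rate(1) by simp
      show "summable (\<lambda>i. c * rate ^ n * rate ^ i)"
        by (intro summable_mult summable_geometric) (use rate in simp)
    qed
    also have "(\<Sum>i. c * rate ^ n * rate ^ i) = c * rate ^ n * (\<Sum>i. rate ^ i)"
      by (intro suminf_mult summable_geometric) (use rate in simp)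
    also have "(\<Sum>i. rate ^ i) = 1 / (1 - rate)" by (intro suminf_geometric) (use rate in simp)
    also have "c * rate ^ n * (1 / (1 - rate)) = rate_const C * rate ^ n"
      by (simp add: rate_const_def c_def)
    finally show ?thesis .
  qed
  have W2: "W n \<in> borel_measurable N" for n unfolding W_def by (intro borel_measurable_suminf_order borel_measurable_times D) simp
  have W3: "ennreal \<bar>young H n' t \<omega> - young H n t \<omega>\<bar> \<le> ennreal (K \<omega>) * W n \<omega>"
    if nn': "n \<le> n'" and w: "\<omega> \<in> space N" for n n' \<omega> t
  proof -
    have step: "ennreal \<bar>young H (Suc l) t \<omega> - young H l t \<omega>\<bar> \<le> ennreal (K \<omega>) * (ennreal (a l) * D l \<omega>)" for l
    proof -
      have "\<bar>young H (Suc l) t \<omega> - young H l t \<omega>\<bar>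
        \<le> (\<Sum>j<2^l. \<bar>(f (mid l j) \<omega> - f (grid T l j) \<omega>) * (H (min (grid T l (Suc j)) t) \<omega> - H (min (mid l j) t) \<omega>)\<bar>)"
        unfolding young_refine mid_def[symmetric] by (rule sum_abs)
      also have "\<dots> \<le> (\<Sum>j<2^l. K \<omega> * a l * \<bar>H (min (grid T l (Suc j)) t) \<omega> - H (min (mid l j) t) \<omega>\<bar>)"
      proof (intro sum_mono)
        fix j :: nat assume j: "j \<in> {..<2^l}"
        have 1: "mid l j \<in> {0..T}" using mid[of l j] g(1)[of l j] g(2)[of j l] j by auto
        have 2: "grid T l j \<in> {0..T}" using mid[of l j] g(1)[of l j] g(2)[of j l] j by auto
        have 3: "mid l j - grid T l j = T / 2^Suc l"
          using grid_Suc_diff[of T "Suc l" "2*j"] by (simp add: mid_def grid_Suc_double)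
        have 4: "\<bar>mid l j - grid T l j\<bar> = T / 2^Suc l"
          unfolding 3 using T by simp
        have "\<bar>f (mid l j) \<omega> - f (grid T l j) \<omega>\<bar> \<le> K \<omega> * a l"
          using hoelder[OF w 1 2] unfolding a_def 4 .
        then show "\<bar>(f (mid l j) \<omega> - f (grid T l j) \<omega>) * (H (min (grid T l (Suc j)) t) \<omega> - H (min (mid l j) t) \<omega>)\<bar>
           \<le> K \<omega> * a l * \<bar>H (min (grid T l (Suc j)) t) \<omega> - H (min (mid l j) t) \<omega>\<bar>"
          unfolding abs_mult by (intro mult_right_mono) auto
      qed
      finally have "ennreal \<bar>young H (Suc l) t \<omega> - young H l t \<omega>\<bar> \<le>
        ennreal (K \<omega> * a l * (\<Sum>j<2^l. \<bar>H (min (grid T l (Suc j)) t) \<omega> - H (min (mid l j) t) \<omega>\<bar>))"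
        unfolding sum_distrib_left by (rule ennreal_leI)
      also have "\<dots> = ennreal (K \<omega>) * (ennreal (a l) * (\<Sum>j<2^l. ennreal \<bar>H (min (grid T l (Suc j)) t) \<omega> - H (min (mid l j) t) \<omega>\<bar>))"
        using K_nonneg[OF w] a0[of l] by (simp add: ennreal_mult' sum_nonneg mult.assoc)
      also have "\<dots> \<le> ennreal (K \<omega>) * (ennreal (a l) * D l \<omega>)"
        unfolding D_def by (intro mult_left_mono sum_mono min_increment_le Y(2)[OF _ w] mid) auto
      finally show ?thesis .
    qed
    have "ennreal \<bar>young H (n + k) t \<omega> - young H n t \<omega>\<bar> \<le> ennreal (K \<omega>) * (\<Sum>i<k. ennreal (a (n + i)) * D (n + i) \<omega>)" for k
    proof (induction k)
      case (Suc k)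
      have "\<bar>young H (n + Suc k) t \<omega> - young H n t \<omega>\<bar>
        \<le> \<bar>young H (n + k) t \<omega> - young H n t \<omega>\<bar> + \<bar>young H (Suc (n + k)) t \<omega> - young H (n + k) t \<omega>\<bar>" by simp
      then have "ennreal \<bar>young H (n + Suc k) t \<omega> - young H n t \<omega>\<bar>
        \<le> ennreal \<bar>young H (n + k) t \<omega> - young H n t \<omega>\<bar> + ennreal \<bar>young H (Suc (n + k)) t \<omega> - young H (n + k) t \<omega>\<bar>"
        by (metis abs_ge_zero ennreal_leI ennreal_plus)
      also have "\<dots> \<le> ennreal (K \<omega>) * (\<Sum>i<k. ennreal (a (n + i)) * D (n + i) \<omega>) + ennreal (K \<omega>) * (ennreal (a (n + k)) * D (n + k) \<omega>)"
        by (intro add_mono Suc.IH step)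
      finally show ?case by (simp add: distrib_left)
    qed simp
    from this[of "n' - n"] have "ennreal \<bar>young H n' t \<omega> - young H n t \<omega>\<bar> \<le> ennreal (K \<omega>) * (\<Sum>i<n'-n. ennreal (a (n + i)) * D (n + i) \<omega>)"
      using nn' by simp
    also have "\<dots> \<le> ennreal (K \<omega>) * W n \<omega>"
      unfolding W_def by (intro mult_left_mono sum_le_suminf summableI) auto
    finally show ?thesis .
  qed
  have W4: "(\<lambda>n. W n \<omega>) \<longlonglongrightarrow> 0" if "W 0 \<omega> < \<infinity>" for \<omega>
    using that unfolding W_def by (intro nn_suminf_tail_tendsto_0) simp
  show ?thesis
  proof (intro exI[of _ W] conjI allI impI)
    show "W n \<in> borel_measurable N" for n by (rule W2)
    show "(\<integral>\<^sup>+\<omega>. W n \<omega> \<partial>N) \<le> ennreal (rate_const C * rate ^ n)" for n by (rule W1)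
    show "ennreal \<bar>young H n' t \<omega> - young H n t \<omega>\<bar> \<le> ennreal (K \<omega>) * W n \<omega>"
      if "n \<le> n'" "\<omega> \<in> space N" "t \<in> {0..T}" for n n' \<omega> t using that(1,2) by (rule W3)
    show "(\<lambda>n. W n \<omega>) \<longlonglongrightarrow> 0" if "W 0 \<omega> < \<infinity>" for \<omega> using that by (rule W4)
  qed
qed

end

text \<open>At t = T the value is 2^n, one past the index of the last block; arguments about the
  block of t treat this case apart.\<close>

definition gidx :: "real \<Rightarrow> nat \<Rightarrow> real \<Rightarrow> nat" where
  "gidx T n t = nat \<lfloor>2^n / T * t\<rfloor>"

lemma gidx:
  assumes T: "T > 0" and t: "t \<in> {0..T}"
  shows "gidx T n t \<le> 2^n" "grid T n (gidx T n t) \<le> t" "t < grid T n (Suc (gidx T n t))"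
proof -
  have nn: "0 \<le> 2^n / T * t" using T t by simp
  have r: "real (gidx T n t) = real_of_int \<lfloor>2^n / T * t\<rfloor>" using nn by (simp add: gidx_def)
  have 1: "real (gidx T n t) \<le> 2^n / T * t" unfolding r by linarith
  have 2: "2^n / T * t < real (Suc (gidx T n t))" using r by simp linarith
  have "2^n / T * t \<le> 2^n / T * T" using T t by (intro mult_left_mono) auto
  from order_trans[OF 1 this] have "real (gidx T n t) \<le> 2^n" using T by simp
  then show "gidx T n t \<le> 2^n" by (metis of_nat_le_iff of_nat_numeral of_nat_power)
  show "grid T n (gidx T n t) \<le> t" "t < grid T n (Suc (gidx T n t))"
    using 1 2 T by (simp_all add: grid_def field_simps)
qed

text \<open>Blocks before that of t contribute equally to both integrals and later blocks contribute
  nothing. Only the block of t is left, and none at all when t = T.\<close>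

lemma simple_integral_grid_diff:
  assumes T: "T > 0" and t: "t \<in> {0..T}" and i: "i = gidx T n t"
  shows "simple_integral H (2^n) (grid T n) \<eta> t \<omega> - simple_integral H (2^n) (grid T n) \<eta> (grid T n i) \<omega>
    = (if i < 2^n then \<eta> i \<omega> * (H t \<omega> - H (grid T n i) \<omega>) else 0)"
proof -
  let ?u = "grid T n"
  note g = gidx[OF T t, of n, folded i]
  have "simple_integral H (2^n) ?u \<eta> t \<omega> - simple_integral H (2^n) ?u \<eta> (?u i) \<omega> =
    (\<Sum>j<2^n. if j = i then \<eta> i \<omega> * (H t \<omega> - H (?u i) \<omega>) else 0)"
    unfolding simple_integral_def sum_subtractf[symmetric]
  proof (intro sum.cong refl)
    fix j assume "j \<in> {..<2^n::nat}"
    consider "j < i" | "j = i" | "j > i" by linarith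
    then show "\<eta> j \<omega> * (H (min (?u (Suc j)) t) \<omega> - H (min (?u j) t) \<omega>) -
      \<eta> j \<omega> * (H (min (?u (Suc j)) (?u i)) \<omega> - H (min (?u j) (?u i)) \<omega>) =
      (if j = i then \<eta> i \<omega> * (H t \<omega> - H (?u i) \<omega>) else 0)"
    proof cases
      case 1
      then have "?u (Suc j) \<le> ?u i" "?u j \<le> ?u i" using T by (auto simp: grid_mono)
      then show ?thesis using 1 g by (simp add: min_def)
    next
      case 2
      have "?u i \<le> ?u (Suc i)" using T by (simp add: grid_mono)
      then show ?thesis using 2 g by (simp add: min_def)
    next
      case 3
      then have "?u (Suc i) \<le> ?u j" "?u j \<le> ?u (Suc j)" "?u i \<le> ?u (Suc i)"
        using T by (auto simp: grid_mono)
      then have "min (?u (Suc j)) t = t" "min (?u j) t = t" "min (?u (Suc j)) (?u i) = ?u i" "min (?u j) (?u i) = ?u i"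
        using g by auto
      then show ?thesis using 3 by simp
    qed
  qed
  also have "\<dots> = (if i < 2^n then \<eta> i \<omega> * (H t \<omega> - H (?u i) \<omega>) else 0)"
    by (subst sum.delta) auto
  finally show ?thesis .
qed

lemma simple_integral_at_grid:
  assumes T: "T > 0" and i: "i \<le> 2^n"
  shows "simple_integral H (2^n) (grid T n) \<eta> (grid T n i) \<omega>
    = (\<Sum>j<i. \<eta> j \<omega> * (H (grid T n (Suc j)) \<omega> - H (grid T n j) \<omega>))"
  unfolding simple_integral_def
proof (rule sum.mono_neutral_cong_right)
  show "\<forall>j\<in>{..<2^n} - {..<i}. \<eta> j \<omega> * (H (min (grid T n (Suc j)) (grid T n i)) \<omega> -
      H (min (grid T n j) (grid T n i)) \<omega>) = 0"
  proof
    fix j assume "j \<in> {..<2^n} - {..<i}"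
    then have "grid T n i \<le> grid T n j" "grid T n i \<le> grid T n (Suc j)" using T by (auto simp: grid_mono)
    then have "min (grid T n (Suc j)) (grid T n i) = grid T n i" "min (grid T n j) (grid T n i) = grid T n i" by auto
    then show "\<eta> j \<omega> * (H (min (grid T n (Suc j)) (grid T n i)) \<omega> - H (min (grid T n j) (grid T n i)) \<omega>) = 0"
      by simp
  qed
  fix j assume "j \<in> {..<i}"
  then have "grid T n j \<le> grid T n i" "grid T n (Suc j) \<le> grid T n i" using T by (auto simp: grid_mono)
  then show "\<eta> j \<omega> * (H (min (grid T n (Suc j)) (grid T n i)) \<omega> - H (min (grid T n j) (grid T n i)) \<omega>)
      = \<eta> j \<omega> * (H (grid T n (Suc j)) \<omega> - H (grid T n j) \<omega>)"
    by (simp add: min_absorb1)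
qed (use i in auto)

lemma nn_markov:
  assumes [measurable]: "X \<in> borel_measurable N" and "e > 0"
  shows "emeasure N {\<omega>\<in>space N. ennreal e < X \<omega>} \<le> ennreal (1 / e) * (\<integral>\<^sup>+\<omega>. X \<omega> \<partial>N)"
proof -
  have "emeasure N {\<omega>\<in>space N. ennreal e < X \<omega>} = (\<integral>\<^sup>+\<omega>. indicator {\<omega>\<in>space N. ennreal e < X \<omega>} \<omega> \<partial>N)"
    by (subst nn_integral_indicator) auto
  also have "\<dots> \<le> (\<integral>\<^sup>+\<omega>. ennreal (1 / e) * X \<omega> \<partial>N)"
  proof (intro nn_integral_mono)
    fix \<omega>
    have "1 \<le> ennreal (1 / e) * X \<omega>" if "ennreal e < X \<omega>"
    proof -
      have "1 = ennreal (1 / e) * ennreal e" using \<open>e > 0\<close> by (simp flip: ennreal_mult)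
      also have "\<dots> \<le> ennreal (1 / e) * X \<omega>" using that by (intro mult_left_mono) auto
      finally show ?thesis .
    qed
    then show "indicator {\<omega>\<in>space N. ennreal e < X \<omega>} \<omega> \<le> ennreal (1 / e) * X \<omega>"
      by (auto split: split_indicator)
  qed
  also have "\<dots> = ennreal (1 / e) * (\<integral>\<^sup>+\<omega>. X \<omega> \<partial>N)" by (simp add: nn_integral_cmult)
  finally show ?thesis .
qed

lemma (in prob_space) prob_le_of_emeasure_le:
  "emeasure M A \<le> ennreal x \<Longrightarrow> 0 \<le> x \<Longrightarrow> prob A \<le> x"
  by (simp add: measure_def enn2real_leI)

section \<open>Rounded Riemann sums, uniformly over the integrators\<close>

context hoelder_process begin

text \<open>When K is at most 2^n the truncation in \<open>rnd\<close> is inactive. Then 2^n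
  coefficients are off by at most 4^(-n) each, and each stopped increment is at most 2 y.\<close>

lemma young_rnd_error:
  assumes w: "\<omega> \<in> space N" and K: "K \<omega> \<le> 2^n" and t: "t \<in> {0..T}"
    and y: "\<And>s. s \<in> {0..T} \<Longrightarrow> \<bar>H s \<omega> - H 0 \<omega>\<bar> \<le> y"
  shows "\<bar>young_rnd H n t \<omega> - young H n t \<omega>\<bar> \<le> 2 * y / 2^n"
proof -
  let ?u = "grid T n"
  have "\<bar>young_rnd H n t \<omega> - young H n t \<omega>\<bar>
    \<le> (\<Sum>j<2^n. \<bar>(f_rnd n j \<omega> - f (?u j) \<omega>) * (H (min (?u (Suc j)) t) \<omega> - H (min (?u j) t) \<omega>)\<bar>)"
    unfolding young_rnd_def young_def simple_integral_def sum_subtractf[symmetric] left_diff_distrib[symmetric]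
    by (rule sum_abs)
  also have "\<dots> \<le> (\<Sum>j<(2::nat)^n. 1 / 4^n * (2 * y))"
  proof (intro sum_mono)
    fix j assume "j \<in> {..<(2::nat)^n}"
    then have j: "?u j \<in> {0..T}" "?u (Suc j) \<in> {0..T}" by (auto intro!: grid_in[OF T] simp del: atLeastAtMost_iff)
    have "\<bar>f (?u j) \<omega>\<bar> \<le> 2^n" using f_bound[OF w j(1)] K by simp
    then have 1: "\<bar>f_rnd n j \<omega> - f (?u j) \<omega>\<bar> \<le> 1 / 4^n" unfolding f_rnd_def by (rule rnd_error)
    have "\<bar>H (min (?u (Suc j)) t) \<omega> - H 0 \<omega>\<bar> \<le> y" "\<bar>H (min (?u j) t) \<omega> - H 0 \<omega>\<bar> \<le> y"
      using j t by (intro y; auto simp: min_def)+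
    then have 2: "\<bar>H (min (?u (Suc j)) t) \<omega> - H (min (?u j) t) \<omega>\<bar> \<le> 2 * y" by linarith
    show "\<bar>(f_rnd n j \<omega> - f (?u j) \<omega>) * (H (min (?u (Suc j)) t) \<omega> - H (min (?u j) t) \<omega>)\<bar> \<le> 1 / 4^n * (2 * y)"
      unfolding abs_mult by (intro mult_mono 1 2) auto
  qed
  also have "\<dots> = 2 * y / 2^n"
  proof -
    have "(4::real)^n = 2^n * 2^n" by (simp flip: power_mult_distrib)
    then show ?thesis by (simp add: field_simps)
  qed
  finally show ?thesis .
qed

text \<open>\<open>n0\<close> and \<delta> are fixed before H and \<open>\<mu>\<close>, which makes
  the estimate uniform in m. The exceptional set is a union of four events of probability below e/4:
  K exceeds R, the tail \<open>W n\<close> exceeds \<epsilon>, the total oscillation exceeds S, or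
  some block oscillates by more than \<eta>. The last inequality moves from t to the preceding grid
  point, so that finitely many values of H remain; it rests on blocks of small mass, hence the
  condition with \<delta>.\<close>

lemma uniform_approximation:
  assumes e: "e > 0" and C: "C \<ge> 0"
  shows "\<exists>n0 \<delta>. \<delta> > 0 \<and> (\<forall>n\<ge>n0. \<forall>H \<mu>. dominated_increments N T H \<mu> C \<longrightarrow>
      (\<forall>j<2^n. \<mu> (grid T n (Suc j)) - \<mu> (grid T n j) \<le> \<delta>) \<longrightarrow>
      (\<exists>B\<in>events. prob B < e \<and> (\<forall>\<omega>\<in>space N - B. \<forall>t\<in>{0..T}.
         (\<forall>n'\<ge>n. \<bar>young H n' t \<omega> - young_rnd H n t \<omega>\<bar> \<le> e) \<and>
         \<bar>young_rnd H n t \<omega> - young_rnd H n (grid T n (gidx T n t)) \<omega>\<bar> \<le> e)))"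
proof -
  obtain R :: nat where R: "R \<ge> 1" "prob {\<omega>\<in>space N. real R < \<bar>K \<omega>\<bar>} < e / 4"
    using tail_prob_lt[OF K_measurable, of "e/4" 1] e by (metis zero_less_divide_iff zero_less_numeral)
  \<comment> \<open>Since S \<ge> 1, the fourth power in Markov's inequality may be weakened to S
    itself, so a threshold of order 1/e suffices.\<close>
  define S where "S = (4 * (C + 1) * (T + 1)\<^sup>2 / e + 1)"
  have S1: "S \<ge> 1" using e C T by (simp add: S_def)
  have S: "1 / S^4 * (C * T\<^sup>2) < e / 4"
  proof -
    have "1 / S^4 * (C * T\<^sup>2) \<le> 1 / S * ((C + 1) * (T + 1)\<^sup>2)"
      using S1 C T power_increasing[of 1 4 S]
      by (intro mult_mono divide_left_mono power_mono) auto
    also have "\<dots> < e / 4"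
    proof -
      have "4 * ((C + 1) * (T + 1)\<^sup>2) < S * e" using e by (simp add: S_def field_simps)
      then show ?thesis using S1 by (simp add: field_simps)
    qed
    finally show ?thesis .
  qed
  \<comment> \<open>Where K \<le> R, the bound K W n for all later differences is then at most
    e/2.\<close>
  define \<epsilon> where "\<epsilon> = e / (2 * real R)"
  have \<epsilon>: "\<epsilon> > 0" using e R by (simp add: \<epsilon>_def)
  \<comment> \<open>Where K \<le> R, the rounded values are at most R + 1, so one block moves the
    sum by at most e.\<close>
  define \<eta> where "\<eta> = e / (real R + 1)"
  have \<eta>: "\<eta> > 0" using e R by (simp add: \<eta>_def)
  define D where "D = (C + 1) * (T + 1)"
  have D: "D > 0" using C T by (simp add: D_def)
  \<comment> \<open>Solves \<delta> D / \<eta>^4 = e/8; D dominates C T and is positive also for C =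
    0.\<close>
  define \<delta> where "\<delta> = e / 8 * \<eta>^4 / D"
  have \<delta>: "\<delta> > 0" using e \<eta> D by (simp add: \<delta>_def)
  have \<delta>2: "1 / \<eta>^4 * (C * \<delta> * T) < e / 4"
  proof -
    have "1 / \<eta>^4 * (C * \<delta> * T) \<le> 1 / \<eta>^4 * ((C + 1) * \<delta> * (T + 1))"
      using \<eta> C T \<delta> by (intro mult_left_mono mult_mono) auto
    also have "(C + 1) * \<delta> * (T + 1) = \<delta> * D" by (simp add: D_def)
    also have "1 / \<eta>^4 * (\<delta> * D) = e / 8" using \<eta> D by (simp add: \<delta>_def)
    finally show ?thesis using e by linarith
  qed
  have "(\<lambda>n. 1 / \<epsilon> * (rate_const C * rate ^ n)) \<longlonglongrightarrow> 1 / \<epsilon> * (rate_const C * 0)"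
    using rate by (intro tendsto_intros LIMSEQ_power_zero) auto
  then have "\<forall>\<^sub>F n in sequentially. 1 / \<epsilon> * (rate_const C * rate ^ n) < e / 4"
    using e by (intro order_tendstoD) auto
  moreover have "(\<lambda>n. 2 * S * (1/2)^n) \<longlonglongrightarrow> 2 * S * 0"
    by (intro tendsto_intros LIMSEQ_power_zero) auto
  then have "\<forall>\<^sub>F n in sequentially. 2 * S * (1/2)^n < e / 2"
    using e by (intro order_tendstoD) auto
  moreover have "\<forall>\<^sub>F n in sequentially. R \<le> n" by (rule eventually_ge_at_top)
  ultimately have "\<forall>\<^sub>F n in sequentially. 1 / \<epsilon> * (rate_const C * rate ^ n) < e / 4 \<and> 2 * S * (1/2)^n < e / 2 \<and> R \<le> n"
    by eventually_elim simp
  then obtain n0 where n0: "\<And>n. n \<ge> n0 \<Longrightarrow> 1 / \<epsilon> * (rate_const C * rate ^ n) < e / 4"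
      "\<And>n. n \<ge> n0 \<Longrightarrow> 2 * S * (1/2)^n < e / 2" "\<And>n. n \<ge> n0 \<Longrightarrow> R \<le> n"
    unfolding eventually_sequentially by blast
  show ?thesis
  proof (intro exI[of _ n0] exI[of _ \<delta>] conjI \<delta> allI impI)
    fix n H \<mu> assume n: "n \<ge> n0" and dom: "dominated_increments N T H \<mu> C"
      and small: "\<forall>j<2^n. \<mu> (grid T n (Suc j)) - \<mu> (grid T n j) \<le> \<delta>"
    have mono: "mono_on {0..T} \<mu>" "\<mu> T - \<mu> 0 \<le> T" using dom by (auto simp: dominated_increments_def)
    obtain Y where Y: "\<forall>a b. 0 \<le> a \<longrightarrow> a \<le> b \<longrightarrow> b \<le> T \<longrightarrow> Y a b \<in> borel_measurable N \<and>
      (\<forall>\<omega>\<in>space N. \<forall>t\<in>{a..b}. ennreal \<bar>H t \<omega> - H a \<omega>\<bar> \<le> Y a b \<omega>) \<and>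
      (\<integral>\<^sup>+\<omega>. Y a b \<omega> ^ 4 \<partial>N) \<le> ennreal (C * (\<mu> b - \<mu> a)\<^sup>2)"
      using dominated_increments_choice[OF dom] by (rule exE)
    obtain W where W: "\<forall>n. W n \<in> borel_measurable N"
        "\<forall>n. (\<integral>\<^sup>+\<omega>. W n \<omega> \<partial>N) \<le> ennreal (rate_const C * rate ^ n)"
        "\<forall>n n' \<omega> t. n \<le> n' \<longrightarrow> \<omega> \<in> space N \<longrightarrow> t \<in> {0..T} \<longrightarrow>
          ennreal \<bar>young H n' t \<omega> - young H n t \<omega>\<bar> \<le> ennreal (K \<omega>) * W n \<omega>"
      using young_dominated[OF dom] by blast
    let ?u = "grid T n"
    have rc: "rate_const C \<ge> 0" using rate C T by (simp add: rate_const_def)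
    define B1 where "B1 = {\<omega>\<in>space N. real R < \<bar>K \<omega>\<bar>}"
    define B2 where "B2 = {\<omega>\<in>space N. ennreal \<epsilon> < W n \<omega>}"
    define B3 where "B3 = {\<omega>\<in>space N. ennreal S < Y 0 T \<omega>}"
    define Bj where "Bj j = {\<omega>\<in>space N. ennreal \<eta> < Y (?u j) (?u (Suc j)) \<omega>}" for j
    have u1: "0 \<le> ?u j" for j using T by (simp add: grid_def)
    have u2: "?u j \<le> ?u (Suc j)" for j using T by (simp add: grid_mono)
    note u = u1 u2
    have uT: "?u (Suc j) \<le> T" if "j < 2^n" for j using grid_in[OF T, of "Suc j" n] that by auto
    have YT: "Y 0 T \<in> borel_measurable N" using Y T by auto
    have Yj: "Y (?u j) (?u (Suc j)) \<in> borel_measurable N" if "j < 2^n" for j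
      using Y u uT[OF that] by auto
    have m1: "B1 \<in> events" unfolding B1_def by measurable
    have m2: "B2 \<in> events" unfolding B2_def using W(1)[rule_format, of n] by measurable
    have m3: "B3 \<in> events" unfolding B3_def using YT by measurable
    have mj: "Bj j \<in> events" if "j < 2^n" for j unfolding Bj_def using Yj[OF that] by measurable
    have p2: "prob B2 < e / 4"
    proof -
      have "emeasure N B2 \<le> ennreal (1 / \<epsilon>) * (\<integral>\<^sup>+\<omega>. W n \<omega> \<partial>N)"
        unfolding B2_def by (intro nn_markov W(1)[rule_format] \<epsilon>)
      also have "\<dots> \<le> ennreal (1 / \<epsilon>) * ennreal (rate_const C * rate ^ n)"
        by (intro mult_left_mono W(2)[rule_format]) simp
      also have "\<dots> = ennreal (1 / \<epsilon> * (rate_const C * rate ^ n))"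
        using \<epsilon> by (intro ennreal_mult'[symmetric]) simp
      finally have "prob B2 \<le> 1 / \<epsilon> * (rate_const C * rate ^ n)"
        using \<epsilon> rc rate by (intro prob_le_of_emeasure_le) auto
      then show ?thesis using n0(1)[OF n] by linarith
    qed
    have p3: "prob B3 < e / 4"
    proof -
      have "emeasure N B3 \<le> ennreal (1 / S^4) * (\<integral>\<^sup>+\<omega>. Y 0 T \<omega> ^ 4 \<partial>N)"
        unfolding B3_def using S1 by (intro emeasure_gt_le_fourth_moment YT) auto
      also have "\<dots> \<le> ennreal (1 / S^4) * ennreal (C * T\<^sup>2)"
      proof (intro mult_left_mono)
        have "(\<integral>\<^sup>+\<omega>. Y 0 T \<omega> ^ 4 \<partial>N) \<le> ennreal (C * (\<mu> T - \<mu> 0)\<^sup>2)" using Y T by auto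
        also have "\<dots> \<le> ennreal (C * T\<^sup>2)"
          using mono C T mono_onD[OF mono(1), of 0 T] by (intro ennreal_leI mult_left_mono power_mono) auto
        finally show "(\<integral>\<^sup>+\<omega>. Y 0 T \<omega> ^ 4 \<partial>N) \<le> ennreal (C * T\<^sup>2)" .
      qed simp
      also have "\<dots> = ennreal (1 / S^4 * (C * T\<^sup>2))"
        using S1 by (intro ennreal_mult'[symmetric]) simp
      finally have "prob B3 \<le> 1 / S^4 * (C * T\<^sup>2)"
        using C S1 by (intro prob_le_of_emeasure_le) auto
      then show ?thesis using S by linarith
    qed
    \<comment> \<open>In the union bound the squared mass of a block is split: one factor is bounded
      by \<delta>, the other sums to at most T.\<close>
    have pj: "prob (\<Union>j<2^n. Bj j) < e / 4"
    proof -
      define \<delta>' where "\<delta>' j = \<mu> (?u (Suc j)) - \<mu> (?u j)" for j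
      have d': "0 \<le> \<delta>' j" "\<delta>' j \<le> \<delta>" if "j < 2^n" for j
        using small that u(1)[of j] u(1)[of "Suc j"] u(2)[of j] uT[OF that] unfolding \<delta>'_def
        by (auto intro!: mono_onD[OF mono(1)])
      have pj1: "prob (Bj j) \<le> 1 / \<eta>^4 * (C * \<delta> * \<delta>' j)" if j: "j < 2^n" for j
      proof -
        have "emeasure N (Bj j) \<le> ennreal (1 / \<eta>^4) * (\<integral>\<^sup>+\<omega>. Y (?u j) (?u (Suc j)) \<omega> ^ 4 \<partial>N)"
          unfolding Bj_def using \<eta> by (intro emeasure_gt_le_fourth_moment Yj j) auto
        also have "\<dots> \<le> ennreal (1 / \<eta>^4) * ennreal (C * (\<delta>' j)\<^sup>2)"
          unfolding \<delta>'_def using Y u uT[OF j] by (intro mult_left_mono) auto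
        also have "\<dots> = ennreal (1 / \<eta>^4 * (C * (\<delta>' j)\<^sup>2))"
          using \<eta> by (intro ennreal_mult'[symmetric]) simp
        finally have "prob (Bj j) \<le> 1 / \<eta>^4 * (C * (\<delta>' j)\<^sup>2)"
          using C \<eta> by (intro prob_le_of_emeasure_le) auto
        also have "\<dots> \<le> 1 / \<eta>^4 * (C * (\<delta> * \<delta>' j))"
          unfolding power2_eq_square using d'[OF j] C \<eta> by (intro mult_left_mono mult_right_mono) auto
        finally show ?thesis by (simp add: mult.assoc)
      qed
      have "prob (\<Union>j<2^n. Bj j) \<le> (\<Sum>j<2^n. prob (Bj j))"
        using mj by (intro finite_measure_subadditive_finite) auto
      also have "\<dots> \<le> (\<Sum>j<2^n. 1 / \<eta>^4 * (C * \<delta> * \<delta>' j))" by (intro sum_mono pj1) auto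
      also have "\<dots> = 1 / \<eta>^4 * (C * \<delta> * (\<Sum>j<2^n. \<delta>' j))" by (simp add: sum_distrib_left)
      also have "(\<Sum>j<2^n. \<delta>' j) = \<mu> T - \<mu> 0"
        unfolding \<delta>'_def using sum_lessThan_telescope[of "\<lambda>j. \<mu> (?u j)" "2^n"] by simp
      also have "1 / \<eta>^4 * (C * \<delta> * (\<mu> T - \<mu> 0)) \<le> 1 / \<eta>^4 * (C * \<delta> * T)"
        using C \<delta> \<eta> mono(2) by (intro mult_left_mono) auto
      finally show ?thesis using \<delta>2 by linarith
    qed
    have mU: "(\<Union>j<2^n. Bj j) \<in> events" using mj by (intro sets.finite_UN) auto
    let ?B = "B1 \<union> B2 \<union> B3 \<union> (\<Union>j<2^n. Bj j)"
    have "prob ?B \<le> prob B1 + prob B2 + prob B3 + prob (\<Union>j<2^n. Bj j)"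
      using measure_Un_le[of "B1 \<union> B2 \<union> B3" N "\<Union>j<2^n. Bj j"] m1 m2 m3 mU
        measure_Un_le[of "B1 \<union> B2" N B3] measure_Un_le[of B1 N B2] by force
    also have "\<dots> < e" using R(2) p2 p3 pj unfolding B1_def by linarith
    finally have pB: "prob ?B < e" .
    show "\<exists>B\<in>events. prob B < e \<and> (\<forall>\<omega>\<in>space N - B. \<forall>t\<in>{0..T}.
         (\<forall>n'\<ge>n. \<bar>young H n' t \<omega> - young_rnd H n t \<omega>\<bar> \<le> e) \<and>
         \<bar>young_rnd H n t \<omega> - young_rnd H n (grid T n (gidx T n t)) \<omega>\<bar> \<le> e)"
    proof (intro bexI[of _ ?B] conjI pB ballI allI impI)
      show "?B \<in> events" using m1 m2 m3 mU by auto
      fix \<omega> t assume w: "\<omega> \<in> space N - ?B" and t: "t \<in> {0..T}"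
      have ws: "\<omega> \<in> space N" using w by auto
      have Kw: "K \<omega> \<le> real R" using w by (auto simp: B1_def not_less)
      have Ww: "W n \<omega> \<le> ennreal \<epsilon>" using w by (auto simp: B2_def not_less)
      have Yw: "Y 0 T \<omega> \<le> ennreal S" using w by (auto simp: B3_def not_less)
      have Ywj: "Y (?u j) (?u (Suc j)) \<omega> \<le> ennreal \<eta>" if "j < 2^n" for j
        using w that by (auto simp: Bj_def not_less)
      show "\<bar>young H n' t \<omega> - young_rnd H n t \<omega>\<bar> \<le> e" if n': "n' \<ge> n" for n'
      proof -
        have "ennreal \<bar>young H n' t \<omega> - young H n t \<omega>\<bar> \<le> ennreal (K \<omega>) * W n \<omega>"
          using W(3) n' ws t by auto
        also have "\<dots> \<le> ennreal (real R) * ennreal \<epsilon>" by (intro mult_mono ennreal_leI Kw Ww) auto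
        also have "\<dots> = ennreal (e / 2)"
          using R(1) e unfolding \<epsilon>_def by (subst ennreal_mult'[symmetric]) auto
        finally have 1: "\<bar>young H n' t \<omega> - young H n t \<omega>\<bar> \<le> e / 2" using e by (subst (asm) ennreal_le_iff) auto
        have "real R \<le> 2^n"
        proof -
          have "real R \<le> real n" using n0(3)[OF n] by simp
          also have "\<dots> \<le> 2^n" using of_nat_less_two_power[of n, where 'a = real] by simp
          finally show ?thesis .
        qed
        with Kw have K2: "K \<omega> \<le> 2^n" by (rule order_trans)
        have "\<bar>H s \<omega> - H 0 \<omega>\<bar> \<le> S" if "s \<in> {0..T}" for s
        proof -
          have "ennreal \<bar>H s \<omega> - H 0 \<omega>\<bar> \<le> Y 0 T \<omega>" using Y T ws that by auto
          also note Yw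
          finally show ?thesis using S1 by (subst (asm) ennreal_le_iff) auto
        qed
        from young_rnd_error[where H = H and y = S, OF ws K2 t this] have "\<bar>young_rnd H n t \<omega> - young H n t \<omega>\<bar> \<le> 2 * S * (1/2)^n"
          by (simp add: power_divide)
        then show ?thesis using 1 n0(2)[OF n] by linarith
      qed
      show "\<bar>young_rnd H n t \<omega> - young_rnd H n (?u (gidx T n t)) \<omega>\<bar> \<le> e"
      proof (cases "gidx T n t < 2^n")
        case False
        then show ?thesis unfolding young_rnd_def simple_integral_grid_diff[OF T t refl] using e by simp
      next
        case True
        let ?i = "gidx T n t"
        note g = gidx[OF T t, of n]
        have "ennreal \<bar>H t \<omega> - H (?u ?i) \<omega>\<bar> \<le> Y (?u ?i) (?u (Suc ?i)) \<omega>"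
          using Y u uT[OF True] ws g by auto
        also have "\<dots> \<le> ennreal \<eta>" by (rule Ywj[OF True])
        finally have h: "\<bar>H t \<omega> - H (?u ?i) \<omega>\<bar> \<le> \<eta>" using \<eta> by (subst (asm) ennreal_le_iff) auto
        have "\<bar>f_rnd n ?i \<omega>\<bar> \<le> \<bar>f (?u ?i) \<omega>\<bar> + 1" unfolding f_rnd_def by (rule abs_rnd_le)
        also have "\<dots> \<le> real R + 1" using f_bound[OF ws, of "?u ?i"] grid_in[OF T g(1)] Kw by auto
        finally have "\<bar>f_rnd n ?i \<omega> * (H t \<omega> - H (?u ?i) \<omega>)\<bar> \<le> (real R + 1) * \<eta>"
          unfolding abs_mult using h by (intro mult_mono) auto
        also have "\<dots> = e" by (simp add: \<eta>_def)
        finally show ?thesis unfolding young_rnd_def simple_integral_grid_diff[OF T t refl] using True by simp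
      qed
    qed
  qed
qed

end

section \<open>The path space\<close>

definition D_metric :: "real \<Rightarrow> (real \<Rightarrow> real) metric" where
  "D_metric T = submetric (funspace {0..T} euclidean_metric) {x. cadlag_on T x}"

lemma D_space_eq: "D_space T = mtopology_of (D_metric T)"
  by (simp add: D_space_def D_metric_def)

lemma mspace_D_metric:
  "x \<in> mspace (D_metric T) \<longleftrightarrow> cadlag_on T x \<and> x \<in> extensional {0..T} \<and> bounded (x ` {0..T})"
proof -
  have "Metric_space.mbounded UNIV dist S \<longleftrightarrow> bounded S" for S :: "real set"
    by (rule mbounded_iff_bounded)
  then show ?thesis
    by (auto simp: D_metric_def Met_TC.fspace_def)
qed

lemma mdist_D_metric_le:
  assumes "T \<ge> 0" "x \<in> mspace (D_metric T)" "y \<in> mspace (D_metric T)"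
  shows "mdist (D_metric T) x y \<le> r \<longleftrightarrow> (\<forall>t\<in>{0..T}. \<bar>x t - y t\<bar> \<le> r)"
  using assms funspace_mdist_le[of x "{0..T}" euclidean_metric y r]
  by (simp add: D_metric_def dist_real_def)

lemma cadlag_on_cong:
  assumes "cadlag_on T x" "\<And>t. t \<in> {0..T} \<Longrightarrow> x t = y t"
  shows "cadlag_on T y"
  unfolding cadlag_on_def
proof (intro conjI ballI)
  fix t assume t: "t \<in> {0..<T}"
  have "\<forall>\<^sub>F s in at_right t. s \<in> {t<..<T}" using t by (intro eventually_at_rightI[of t T]) auto
  then have "\<forall>\<^sub>F s in at_right t. x s = y s" by eventually_elim (use t assms(2) in auto)
  moreover have "(x \<longlongrightarrow> x t) (at_right t)" using assms(1) t by (auto simp: cadlag_on_def)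
  ultimately show "(y \<longlongrightarrow> y t) (at_right t)"
    using assms(2)[of t] t by (auto intro: Lim_transform_eventually)
next
  fix t assume t: "t \<in> {0<..T}"
  have "\<forall>\<^sub>F s in at_left t. s \<in> {0<..<t}" using t by (intro eventually_at_leftI[of 0 t]) auto
  then have ev: "\<forall>\<^sub>F s in at_left t. x s = y s" by eventually_elim (use t assms(2) in auto)
  obtain l where "(x \<longlongrightarrow> l) (at_left t)" using assms(1) t unfolding cadlag_on_def by blast
  then show "\<exists>l. (y \<longlongrightarrow> l) (at_left t)" using ev by (auto intro: Lim_transform_eventually)
qed

lemma restrict_in_D:
  assumes "cadlag_on T x" "bounded (x ` {0..T})"
  shows "restrict x {0..T} \<in> mspace (D_metric T)"
proof -
  have "cadlag_on T (restrict x {0..T})" by (rule cadlag_on_cong[OF assms(1)]) simp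
  moreover have "restrict x {0..T} ` {0..T} = x ` {0..T}" by simp
  ultimately show ?thesis using assms(2) by (simp add: mspace_D_metric)
qed

lemma continuous_in_D:
  assumes "continuous_on {0..T} x"
  shows "restrict x {0..T} \<in> mspace (D_metric T)"
proof (rule restrict_in_D)
  show "bounded (x ` {0..T})" by (intro compact_imp_bounded compact_continuous_image assms) simp
  show "cadlag_on T x"
    unfolding cadlag_on_def
  proof (intro conjI ballI)
    fix t assume t: "t \<in> {0..<T}"
    then have "(x \<longlongrightarrow> x t) (at t within {0..T})" using assms by (auto simp: continuous_on_def)
    then have "(x \<longlongrightarrow> x t) (at t within {t..T})" by (rule tendsto_within_subset) (use t in auto)
    then show "(x \<longlongrightarrow> x t) (at_right t)" using at_within_Icc_at_right[of t T] t by simp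
  next
    fix t assume t: "t \<in> {0<..T}"
    then have "(x \<longlongrightarrow> x t) (at t within {0..T})" using assms by (auto simp: continuous_on_def)
    then have "(x \<longlongrightarrow> x t) (at t within {0..t})" by (rule tendsto_within_subset) (use t in auto)
    then have "(x \<longlongrightarrow> x t) (at_left t)" using at_within_Icc_at_left[of 0 t] t by simp
    then show "\<exists>l. (x \<longlongrightarrow> l) (at_left t)" by blast
  qed
qed

lemma step_path_in_D:
  fixes g :: "nat \<Rightarrow> real"
  assumes c: "c \<ge> 0"
  shows "(\<lambda>t\<in>{0..T}. g (nat \<lfloor>c * t\<rfloor>)) \<in> mspace (D_metric T)"
proof (rule restrict_in_D)
  show "bounded ((\<lambda>t. g (nat \<lfloor>c * t\<rfloor>)) ` {0..T})"
  proof (rule finite_imp_bounded, rule finite_subset)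
    show "(\<lambda>t. g (nat \<lfloor>c * t\<rfloor>)) ` {0..T} \<subseteq> g ` {..nat \<lfloor>c * T\<rfloor>}"
      using c by (auto intro!: imageI nat_mono floor_mono mult_left_mono)
  qed simp
  show "cadlag_on T (\<lambda>t. g (nat \<lfloor>c * t\<rfloor>))"
    unfolding cadlag_on_def
  proof (intro conjI ballI)
    fix t assume t: "t \<in> {0..<T}"
    have "\<forall>\<^sub>F s in at_right t. \<lfloor>c * s\<rfloor> = \<lfloor>c * t\<rfloor>"
    proof (cases "c = 0")
      case False
      then have c: "c > 0" using c by simp
      have "t < (real_of_int \<lfloor>c * t\<rfloor> + 1) / c" using c by (simp add: field_simps) linarith
      then show ?thesis
      proof (rule eventually_at_rightI[rotated])
        fix s assume s: "s \<in> {t<..<(real_of_int \<lfloor>c * t\<rfloor> + 1) / c}"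
        then have "c * s < real_of_int \<lfloor>c * t\<rfloor> + 1" using c by (simp add: field_simps)
        moreover have "c * t \<le> c * s" using s c by (intro mult_left_mono) auto
        ultimately show "\<lfloor>c * s\<rfloor> = \<lfloor>c * t\<rfloor>" by linarith
      qed
    qed simp
    then have "\<forall>\<^sub>F s in at_right t. g (nat \<lfloor>c * t\<rfloor>) = g (nat \<lfloor>c * s\<rfloor>)" by eventually_elim simp
    then show "((\<lambda>t. g (nat \<lfloor>c * t\<rfloor>)) \<longlongrightarrow> g (nat \<lfloor>c * t\<rfloor>)) (at_right t)"
      by (rule Lim_transform_eventually[OF tendsto_const])
  next
    fix t assume t: "t \<in> {0<..T}"
    \<comment> \<open>For c > 0, slightly to the left of t the floor of c s is ceil(c t) - 1,
      whether or not c t is an integer.\<close>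
    have "\<forall>\<^sub>F s in at_left t. \<lfloor>c * s\<rfloor> = (if c = 0 then 0 else \<lceil>c * t\<rceil> - 1)"
    proof (cases "c = 0")
      case False
      then have c: "c > 0" using c by simp
      have "(real_of_int \<lceil>c * t\<rceil> - 1) / c < t" using c by (simp add: field_simps) linarith
      then show ?thesis
      proof (rule eventually_at_leftI[rotated])
        fix s assume s: "s \<in> {(real_of_int \<lceil>c * t\<rceil> - 1) / c<..<t}"
        then have 1: "real_of_int \<lceil>c * t\<rceil> - 1 < c * s" using c by (simp add: field_simps)
        have 2: "c * s < c * t" using s c by simp
        have "\<lfloor>c * s\<rfloor> = \<lceil>c * t\<rceil> - 1" using 1 2 by linarith
        then show "\<lfloor>c * s\<rfloor> = (if c = 0 then 0 else \<lceil>c * t\<rceil> - 1)" using c by simp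
      qed
    qed simp
    then have "\<forall>\<^sub>F s in at_left t. g (nat (if c = 0 then 0 else \<lceil>c * t\<rceil> - 1)) = g (nat \<lfloor>c * s\<rfloor>)"
      by eventually_elim simp
    from Lim_transform_eventually[OF tendsto_const this]
    show "\<exists>l. ((\<lambda>t. g (nat \<lfloor>c * t\<rfloor>)) \<longlongrightarrow> l) (at_left t)" by (rule exI)
  qed
qed

section \<open>Measurability of maps into the path space\<close>

lemma measurable_int_list:
  fixes X :: "nat \<Rightarrow> 'a \<Rightarrow> int"
  assumes "\<And>i. i < k \<Longrightarrow> X i \<in> N \<rightarrow>\<^sub>M count_space UNIV"
  shows "(\<lambda>\<omega>. map (\<lambda>i. X i \<omega>) [0..<k]) \<in> N \<rightarrow>\<^sub>M count_space UNIV"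
  unfolding measurable_count_space_eq2_countable
proof (intro conjI ballI)
  fix l :: "int list"
  have *: "map (\<lambda>i. X i \<omega>) [0..<k] = l \<longleftrightarrow> length l = k \<and> (\<forall>i\<in>{..<k}. X i \<omega> = l ! i)" for \<omega>
    by (subst list_eq_iff_nth_eq) auto
  have "{\<omega>\<in>space N. \<forall>i\<in>{..<k}. X i \<omega> = l ! i} \<in> sets N"
  proof (rule sets.sets_Collect_finite_All)
    fix i assume "i \<in> {..<k}"
    then have [measurable]: "X i \<in> N \<rightarrow>\<^sub>M count_space UNIV" using assms by simp
    show "{\<omega>\<in>space N. X i \<omega> = l ! i} \<in> sets N" by measurable
  qed simp_all
  moreover have "(\<lambda>\<omega>. map (\<lambda>i. X i \<omega>) [0..<k]) -` {l} \<inter> space N =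
    (if length l = k then {\<omega>\<in>space N. \<forall>i\<in>{..<k}. X i \<omega> = l ! i} else {})"
    using * by auto
  ultimately show "(\<lambda>\<omega>. map (\<lambda>i. X i \<omega>) [0..<k]) -` {l} \<inter> space N \<in> sets N" by simp
qed simp

definition dyadic :: "nat \<Rightarrow> real \<Rightarrow> real" where
  "dyadic r x = real_of_int \<lfloor>2^r * x\<rfloor> / 2^r"

lemma dyadic_error: "\<bar>dyadic r x - x\<bar> \<le> 1 / 2^r"
proof -
  have "dyadic r x - x = (real_of_int \<lfloor>2^r * x\<rfloor> - 2^r * x) / 2^r"
    by (simp add: dyadic_def field_simps)
  moreover have "\<bar>real_of_int \<lfloor>2^r * x\<rfloor> - 2^r * x\<bar> \<le> 1" by linarith
  ultimately show ?thesis by (simp add: abs_divide divide_right_mono)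
qed

lemma pow_half_eventually_le:
  fixes e :: real
  assumes "e > 0"
  shows "\<forall>\<^sub>F r in sequentially. c / 2^r \<le> e"
proof -
  have "(\<lambda>r. c * (1/2)^r) \<longlonglongrightarrow> c * 0" by (intro tendsto_intros LIMSEQ_power_zero) simp
  then have "\<forall>\<^sub>F r in sequentially. c * (1/2)^r < e" using assms by (intro order_tendstoD) auto
  then show ?thesis by eventually_elim (simp add: power_divide)
qed

lemma prod_D_topology:
  "prod_topology (D_space T) euclideanreal =
    Metric_space.mtopology (mspace (D_metric T) \<times> UNIV) (prod_dist (mdist (D_metric T)) dist)"
proof -
  interpret Metric_space12 "mspace (D_metric T)" "mdist (D_metric T)" UNIV "dist :: real \<Rightarrow> real \<Rightarrow> real"
    by (simp add: Metric_space12_def Met_TC.Metric_space_axioms)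
  show ?thesis using mtopology_prod_metric by (simp add: D_space_eq mtopology_of_def)
qed

text \<open>Measurability of all coordinates does not give Borel measurability for the uniform
  topology. Here the path is a uniform limit of functions of \<open>V r\<close>, which takes values
  in the countable set of integer lists; every map out of a countable discrete space is measurable,
  and limits preserve this. \<open>Z\<close> is rounded in the same way, so that the pair is handled
  at once.\<close>

lemma pair_measurable_D:
  fixes V :: "nat \<Rightarrow> 'a \<Rightarrow> int list"
  assumes T: "T \<ge> 0" and Z: "Z \<in> borel_measurable N"
    and Y: "\<And>\<omega>. \<omega> \<in> space N \<Longrightarrow> Y \<omega> \<in> mspace (D_metric T)"
    and V: "\<And>r. V r \<in> N \<rightarrow>\<^sub>M count_space UNIV"
    and \<Psi>: "\<And>r l. \<Psi> r l \<in> mspace (D_metric T)"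
    and lim: "\<And>\<omega> e. \<omega> \<in> space N \<Longrightarrow> e > 0 \<Longrightarrow>
      \<forall>\<^sub>F r in sequentially. \<forall>t\<in>{0..T}. \<bar>\<Psi> r (V r \<omega>) t - Y \<omega> t\<bar> \<le> e"
  shows "(\<lambda>\<omega>. (Y \<omega>, Z \<omega>)) \<in> N \<rightarrow>\<^sub>M borel_of (prod_topology (D_space T) euclideanreal)"
  unfolding prod_D_topology
proof -
  interpret Metric_space12 "mspace (D_metric T)" "mdist (D_metric T)" UNIV "dist :: real \<Rightarrow> real \<Rightarrow> real"
    by (simp add: Metric_space12_def Met_TC.Metric_space_axioms)
  show "(\<lambda>\<omega>. (Y \<omega>, Z \<omega>)) \<in> N \<rightarrow>\<^sub>M borel_of Prod_metric.mtopology"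
  proof (rule Prod_metric.measurable_borel_of_limit[where Y = "\<lambda>r \<omega>. (\<Psi> r (V r \<omega>), dyadic r (Z \<omega>))"])
    fix r
    have "(\<lambda>\<omega>. (V r \<omega>, \<lfloor>2^r * Z \<omega>\<rfloor>)) \<in> N \<rightarrow>\<^sub>M count_space UNIV \<Otimes>\<^sub>M count_space UNIV"
      using V Z by measurable
    then have 1: "(\<lambda>\<omega>. (V r \<omega>, \<lfloor>2^r * Z \<omega>\<rfloor>)) \<in> N \<rightarrow>\<^sub>M count_space UNIV"
      by (simp add: pair_measure_countable)
    have 2: "(\<lambda>(l, i). (\<Psi> r l, real_of_int i / 2^r)) \<in> count_space UNIV \<rightarrow>\<^sub>M borel_of Prod_metric.mtopology"
      using \<Psi> by (auto simp: measurable_count_space_eq1)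
    from measurable_compose[OF 1 2]
    show "(\<lambda>\<omega>. (\<Psi> r (V r \<omega>), dyadic r (Z \<omega>))) \<in> N \<rightarrow>\<^sub>M borel_of Prod_metric.mtopology"
      by (simp add: dyadic_def)
  next
    fix \<omega> assume w: "\<omega> \<in> space N"
    show "limitin Prod_metric.mtopology (\<lambda>r. (\<Psi> r (V r \<omega>), dyadic r (Z \<omega>))) (Y \<omega>, Z \<omega>) sequentially"
      unfolding Prod_metric.limitin_metric
    proof (intro conjI allI impI)
      fix e :: real assume e: "e > 0"
      have "\<forall>\<^sub>F r in sequentially. \<forall>t\<in>{0..T}. \<bar>\<Psi> r (V r \<omega>) t - Y \<omega> t\<bar> \<le> e / 3" using lim[OF w, of "e / 3"] e by simp
      moreover have "\<forall>\<^sub>F r in sequentially. 1 / 2^r \<le> e / 3" using e by (intro pow_half_eventually_le) simp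
      ultimately show "\<forall>\<^sub>F r in sequentially. (\<Psi> r (V r \<omega>), dyadic r (Z \<omega>)) \<in> mspace (D_metric T) \<times> UNIV \<and>
        prod_dist (mdist (D_metric T)) dist (\<Psi> r (V r \<omega>), dyadic r (Z \<omega>)) (Y \<omega>, Z \<omega>) < e"
      proof eventually_elim
        case (elim r)
        have "prod_dist (mdist (D_metric T)) dist (\<Psi> r (V r \<omega>), dyadic r (Z \<omega>)) (Y \<omega>, Z \<omega>)
          \<le> mdist (D_metric T) (\<Psi> r (V r \<omega>)) (Y \<omega>) + dist (dyadic r (Z \<omega>)) (Z \<omega>)"
          using \<Psi> Y[OF w] by (intro prod_metric_le_components) auto
        also have "mdist (D_metric T) (\<Psi> r (V r \<omega>)) (Y \<omega>) \<le> e / 3"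
          using elim \<Psi> Y[OF w] T by (subst mdist_D_metric_le) auto
        also have "dist (dyadic r (Z \<omega>)) (Z \<omega>) \<le> e / 3"
          using dyadic_error[of r "Z \<omega>"] elim by (simp add: dist_real_def)
        finally show ?case using \<Psi> e by auto
      qed
    qed (use Y[OF w] in auto)
  qed
qed

text \<open>The Lipschitz condition is phrased with an arbitrary pointwise bound r, the form in
  which path estimates arrive. The constant doubles because the product metric dominates each of the
  two component distances.\<close>

lemma measurable_of_pair_measurable:
  assumes p: "(\<lambda>\<omega>. (Y \<omega>, Z \<omega>)) \<in> N \<rightarrow>\<^sub>M borel_of (prod_topology (D_space T) euclideanreal)"
    and T: "T \<ge> 0"
    and lip: "\<And>x y r z z'. x \<in> mspace (D_metric T) \<Longrightarrow> y \<in> mspace (D_metric T) \<Longrightarrow>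
      (\<forall>t\<in>{0..T}. \<bar>x t - y t\<bar> \<le> r) \<Longrightarrow> \<bar>\<psi> (x, z) - \<psi> (y, z')\<bar> \<le> L * (r + \<bar>z - z'\<bar>)" and L: "L \<ge> 0"
  shows "(\<lambda>\<omega>. \<psi> (Y \<omega>, Z \<omega>)) \<in> borel_measurable N"
proof -
  interpret Metric_space12 "mspace (D_metric T)" "mdist (D_metric T)" UNIV "dist :: real \<Rightarrow> real \<Rightarrow> real"
    by (simp add: Metric_space12_def Met_TC.Metric_space_axioms)
  have "continuous_map Prod_metric.mtopology euclideanreal \<psi>"
  proof (rule Prod_metric.lipschitz_continuous_map[where L = "2 * L"])
    fix p q :: "(real \<Rightarrow> real) \<times> real" assume pq: "p \<in> mspace (D_metric T) \<times> UNIV" "q \<in> mspace (D_metric T) \<times> (UNIV :: real set)"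
    have le: "\<forall>t\<in>{0..T}. \<bar>fst p t - fst q t\<bar> \<le> mdist (D_metric T) (fst p) (fst q)"
      using pq mdist_D_metric_le[OF T, of "fst p" "fst q" "mdist (D_metric T) (fst p) (fst q)"] by auto
    have "\<bar>\<psi> p - \<psi> q\<bar> \<le> L * (mdist (D_metric T) (fst p) (fst q) + dist (snd p) (snd q))"
      using lip[OF _ _ le, of "snd p" "snd q"] pq by (auto simp: dist_real_def)
    also have "\<dots> \<le> L * (prod_dist (mdist (D_metric T)) dist p q + prod_dist (mdist (D_metric T)) dist p q)"
      using L component_le_prod_metric(1)[of "fst p" "fst q" "snd p" "snd q"]
        component_le_prod_metric(2)[of "snd p" "snd q" "fst p" "fst q"]
      by (intro mult_left_mono add_mono) simp_all
    finally show "\<bar>\<psi> p - \<psi> q\<bar> \<le> 2 * L * prod_dist (mdist (D_metric T)) dist p q" by simp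
  qed
  then show ?thesis
    using p unfolding prod_D_topology by (intro measurable_compose[OF _ continuous_map_borel_of_measurable]) auto
qed

text \<open>By the portmanteau argument it is enough to test with Lipschitz functionals of the pair
  (path, Z). Rounding Z changes them little off the event |Z| > R. The rounded variable has finitely
  many values c, and on the event that it equals c the functional depends on the path alone. This
  reduces stable convergence to one event A and one Lipschitz functional of the path.\<close>

lemma converges_stably_D_criterion:
  assumes ext: "prob_extension M M' \<pi>" and T: "T \<ge> 0"
    and Y: "\<And>n Z. Z \<in> borel_measurable M \<Longrightarrow>
      (\<lambda>\<omega>. (Y n \<omega>, Z \<omega>)) \<in> M \<rightarrow>\<^sub>M borel_of (prod_topology (D_space T) euclideanreal)"
    and Y': "\<And>Z. Z \<in> borel_measurable M' \<Longrightarrow>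
      (\<lambda>\<omega>. (Y' \<omega>, Z \<omega>)) \<in> M' \<rightarrow>\<^sub>M borel_of (prod_topology (D_space T) euclideanreal)"
    and core: "\<And>A h L b. A \<in> sets M \<Longrightarrow> 0 \<le> L \<Longrightarrow>
      (\<And>x y r. x \<in> mspace (D_metric T) \<Longrightarrow> y \<in> mspace (D_metric T) \<Longrightarrow>
        (\<forall>t\<in>{0..T}. \<bar>x t - y t\<bar> \<le> r) \<Longrightarrow> \<bar>h x - h y\<bar> \<le> L * r) \<Longrightarrow>
      (\<And>x. x \<in> mspace (D_metric T) \<Longrightarrow> \<bar>h x\<bar> \<le> b) \<Longrightarrow>
      (\<lambda>n. \<integral>\<omega>. indicator A \<omega> * h (Y n \<omega>) \<partial>M) \<longlonglongrightarrow> (\<integral>\<omega>. indicator A (\<pi> \<omega>) * h (Y' \<omega>) \<partial>M')"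
  shows "converges_stably (D_space T) M Y M' \<pi> Y'"
  unfolding converges_stably_def converges_in_law_def
proof (intro conjI ext allI impI)
  interpret M: prob_space M using ext by (simp add: prob_extension_def)
  interpret M': prob_space M' using ext by (simp add: prob_extension_def)
  have \<pi>[measurable]: "\<pi> \<in> M' \<rightarrow>\<^sub>M M" and distr: "distr M' M \<pi> = M"
    using ext by (auto simp: prob_extension_def)
  let ?E = "prod_topology (D_space T) euclideanreal"
  fix Z :: "'a \<Rightarrow> real" assume Z[measurable]: "Z \<in> borel_measurable M"
  show "\<And>n. (\<lambda>\<omega>. (Y n \<omega>, Z \<omega>)) \<in> M \<rightarrow>\<^sub>M borel_of ?E" by (rule Y[OF Z])
  have Zp: "(\<lambda>\<omega>. Z (\<pi> \<omega>)) \<in> borel_measurable M'" by measurable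
  show "(\<lambda>\<omega>. (Y' \<omega>, Z (\<pi> \<omega>))) \<in> M' \<rightarrow>\<^sub>M borel_of ?E" by (rule Y'[OF Zp])
  have YD: "Y n \<omega> \<in> mspace (D_metric T)" if "\<omega> \<in> space M" for n \<omega>
    using measurable_space[OF Y[OF Z] that] by (simp add: D_space_eq)
  have YD': "Y' \<omega> \<in> mspace (D_metric T)" if "\<omega> \<in> space M'" for \<omega>
    using measurable_space[OF Y'[OF Zp] that] by (simp add: D_space_eq)
  fix \<phi> :: "(real \<Rightarrow> real) \<times> real \<Rightarrow> real"
  assume \<phi>: "continuous_map ?E euclideanreal \<phi> \<and> bounded (\<phi> ` topspace ?E)"
  interpret E: Metric_space12 "mspace (D_metric T)" "mdist (D_metric T)" UNIV "dist :: real \<Rightarrow> real \<Rightarrow> real"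
    by (simp add: Metric_space12_def Met_TC.Metric_space_axioms)
  note E_eq = prod_D_topology[of T]
  show "(\<lambda>n. \<integral>\<omega>. \<phi> (Y n \<omega>, Z \<omega>) \<partial>M) \<longlonglongrightarrow> (\<integral>\<omega>'. \<phi> (Y' \<omega>', Z (\<pi> \<omega>')) \<partial>M')"
  proof (rule E.Prod_metric.portmanteau_lipschitz[where Y = "\<lambda>n \<omega>. (Y n \<omega>, Z \<omega>)" and Y' = "\<lambda>\<omega>. (Y' \<omega>, Z (\<pi> \<omega>))"])
    show "prob_space M" "prob_space M'" by (rule M.prob_space_axioms, rule M'.prob_space_axioms)
    show "\<And>n. (\<lambda>\<omega>. (Y n \<omega>, Z \<omega>)) \<in> M \<rightarrow>\<^sub>M borel_of E.Prod_metric.mtopology"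
      using Y[OF Z] by (simp add: E_eq)
    show "(\<lambda>\<omega>. (Y' \<omega>, Z (\<pi> \<omega>))) \<in> M' \<rightarrow>\<^sub>M borel_of E.Prod_metric.mtopology"
      using Y'[OF Zp] by (simp add: E_eq)
    show "continuous_map E.Prod_metric.mtopology euclideanreal \<phi>" using \<phi> by (simp add: E_eq)
    show "bounded (\<phi> ` (mspace (D_metric T) \<times> UNIV))" using \<phi> by (simp add: D_space_eq)
    fix \<psi> :: "(real \<Rightarrow> real) \<times> real \<Rightarrow> real" and L b
    assume lip: "\<And>x y. x \<in> mspace (D_metric T) \<times> UNIV \<Longrightarrow> y \<in> mspace (D_metric T) \<times> UNIV \<Longrightarrow>
        \<bar>\<psi> x - \<psi> y\<bar> \<le> L * prod_dist (mdist (D_metric T)) dist x y"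
      and bd: "\<And>x. x \<in> mspace (D_metric T) \<times> UNIV \<Longrightarrow> \<bar>\<psi> x\<bar> \<le> b"
    have lip': "\<bar>\<psi> (x, z) - \<psi> (y, z')\<bar> \<le> \<bar>L\<bar> * (r + \<bar>z - z'\<bar>)"
      if "x \<in> mspace (D_metric T)" "y \<in> mspace (D_metric T)" "\<forall>t\<in>{0..T}. \<bar>x t - y t\<bar> \<le> r" for x y r z z'
    proof -
      let ?d = "prod_dist (mdist (D_metric T)) dist (x, z) (y, z')"
      have "\<bar>\<psi> (x, z) - \<psi> (y, z')\<bar> \<le> L * ?d" using that by (intro lip) auto
      also have "\<dots> \<le> \<bar>L\<bar> * ?d" using E.Prod_metric.nonneg by (intro mult_right_mono) auto
      also have "?d \<le> mdist (D_metric T) x y + dist z z'" using that by (intro E.prod_metric_le_components) auto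
      also have "mdist (D_metric T) x y \<le> r" using that T by (subst mdist_D_metric_le) auto
      finally show ?thesis by (simp add: dist_real_def mult_left_mono)
    qed
    have b0: "0 \<le> b"
    proof -
      obtain \<omega> where "\<omega> \<in> space M" using M.not_empty by blast
      then show ?thesis using bd[of "(Y 0 \<omega>, Z \<omega>)"] YD[of \<omega> 0] by force
    qed
    have m\<psi>: "(\<lambda>\<omega>. \<psi> (Y n \<omega>, Z' \<omega>)) \<in> borel_measurable M" if "Z' \<in> borel_measurable M" for n Z'
      by (rule measurable_of_pair_measurable[where L = "\<bar>L\<bar>", OF Y[OF that] T lip']) auto
    have m\<psi>': "(\<lambda>\<omega>. \<psi> (Y' \<omega>, Z' \<omega>)) \<in> borel_measurable M'" if "Z' \<in> borel_measurable M'" for Z'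
      by (rule measurable_of_pair_measurable[where L = "\<bar>L\<bar>", OF Y'[OF that] T lip']) auto
    show "(\<lambda>n. \<integral>\<omega>. \<psi> (Y n \<omega>, Z \<omega>) \<partial>M) \<longlonglongrightarrow> (\<integral>\<omega>. \<psi> (Y' \<omega>, Z (\<pi> \<omega>)) \<partial>M')"
    proof (rule tendsto_by_approximation)
      fix e :: real assume e: "e > 0"
      \<comment> \<open>The summand 1 keeps q positive when b = 0; \<eta> is chosen so that 2 b
        \<eta> \<le> e/2.\<close>
      define q where "q = 2 * b + 1"
      have q: "q > 0" using b0 by (simp add: q_def)
      define \<eta> where "\<eta> = e / (2 * q)"
      have \<eta>: "\<eta> > 0" using e q by (simp add: \<eta>_def)
      obtain R :: nat where R: "M.prob {\<omega>\<in>space M. real R < \<bar>Z \<omega>\<bar>} < \<eta>"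
        using M.tail_prob_lt[OF Z \<eta>, of 0] by metis
      have "\<forall>\<^sub>F k in sequentially. \<bar>L\<bar> / 2^k \<le> e / 2" using e by (intro pow_half_eventually_le) simp
      moreover have "\<forall>\<^sub>F k in sequentially. R \<le> k" by (rule eventually_ge_at_top)
      ultimately have "\<forall>\<^sub>F k in sequentially. \<bar>L\<bar> / 2^k \<le> e / 2 \<and> R \<le> k" by eventually_elim simp
      then obtain k where k: "\<bar>L\<bar> / 2^k \<le> e / 2" "R \<le> k"
        unfolding eventually_sequentially by blast
      \<comment> \<open>Makes the truncation at 2^k inactive where |Z| \<le> R.\<close>
      have Rk: "real R \<le> 2^k"
        using k(2) of_nat_less_two_power[of k, where 'a = real] by linarith
      have L4: "\<bar>L\<bar> * (1 / 4^k) \<le> e / 2"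
      proof -
        have "(2::real)^k \<le> 4^k" by (intro power_mono) auto
        then have "\<bar>L\<bar> / 4^k \<le> \<bar>L\<bar> / 2^k" by (intro divide_left_mono) auto
        also note k(1)
        finally show ?thesis by simp
      qed
      define B where "B = {\<omega>\<in>space M. real R < \<bar>Z \<omega>\<bar>}"
      have B[measurable]: "B \<in> sets M" unfolding B_def by measurable
      define B' where "B' = \<pi> -` B \<inter> space M'"
      have B'[measurable]: "B' \<in> sets M'" unfolding B'_def by (rule measurable_sets[OF \<pi> B])
      \<comment> \<open>The projection preserves the measure, so one tail estimate serves both
        spaces.\<close>
      have pB': "M'.prob B' = M.prob B"
        unfolding B'_def using measure_distr[OF \<pi> B] distr by simp
      have small: "e / 2 + 2 * b * M.prob B \<le> e"
      proof -
        have "2 * b * M.prob B \<le> q * \<eta>" using R b0 unfolding B_def q_def by (intro mult_mono) auto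
        also have "\<dots> = e / 2" using q by (simp add: \<eta>_def)
        finally show ?thesis by simp
      qed
      have Zk[measurable]: "(\<lambda>\<omega>. rnd k (Z \<omega>)) \<in> borel_measurable M" by measurable
      have Zk': "(\<lambda>\<omega>. rnd k (Z (\<pi> \<omega>))) \<in> borel_measurable M'" by measurable
      have diff: "\<bar>\<psi> (x, z) - \<psi> (x, rnd k z)\<bar> \<le> e / 2" if "x \<in> mspace (D_metric T)" "\<bar>z\<bar> \<le> real R" for x z
      proof -
        have "\<bar>\<psi> (x, z) - \<psi> (x, rnd k z)\<bar> \<le> \<bar>L\<bar> * (0 + \<bar>z - rnd k z\<bar>)" using that by (intro lip') auto
        also have "\<dots> \<le> \<bar>L\<bar> * (1 / 4^k)"
          using rnd_error[of z k] that(2) Rk by (intro mult_left_mono) (auto simp: abs_minus_commute)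
        also note L4
        finally show ?thesis .
      qed
      let ?b = "\<lambda>n. \<integral>\<omega>. \<psi> (Y n \<omega>, rnd k (Z \<omega>)) \<partial>M"
      let ?b' = "\<integral>\<omega>. \<psi> (Y' \<omega>, rnd k (Z (\<pi> \<omega>))) \<partial>M'"
      have 1: "\<bar>(\<integral>\<omega>. \<psi> (Y n \<omega>, Z \<omega>) \<partial>M) - ?b n\<bar> \<le> e" for n
      proof (rule order_trans[OF bounded_integral_diff_le small])
        show "prob_space M" by (rule M.prob_space_axioms)
        show "\<bar>\<psi> (Y n \<omega>, Z \<omega>)\<bar> \<le> b" "\<bar>\<psi> (Y n \<omega>, rnd k (Z \<omega>))\<bar> \<le> b" if "\<omega> \<in> space M" for \<omega>
          using bd YD[OF that] by auto
        show "\<bar>\<psi> (Y n \<omega>, Z \<omega>) - \<psi> (Y n \<omega>, rnd k (Z \<omega>))\<bar> \<le> e / 2" if "\<omega> \<in> space M - B" for \<omega>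
          using that YD by (intro diff) (auto simp: B_def)
      qed (use e in \<open>auto intro!: m\<psi>\<close>)
      have 2: "\<bar>(\<integral>\<omega>. \<psi> (Y' \<omega>, Z (\<pi> \<omega>)) \<partial>M') - ?b'\<bar> \<le> e"
      proof (rule order_trans[OF bounded_integral_diff_le[where B = B'] small[folded pB']])
        show "prob_space M'" by (rule M'.prob_space_axioms)
        show "\<bar>\<psi> (Y' \<omega>, Z (\<pi> \<omega>))\<bar> \<le> b" "\<bar>\<psi> (Y' \<omega>, rnd k (Z (\<pi> \<omega>)))\<bar> \<le> b" if "\<omega> \<in> space M'" for \<omega>
          using bd YD'[OF that] by auto
        show "\<bar>\<psi> (Y' \<omega>, Z (\<pi> \<omega>)) - \<psi> (Y' \<omega>, rnd k (Z (\<pi> \<omega>)))\<bar> \<le> e / 2" if "\<omega> \<in> space M' - B'" for \<omega>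
          using that YD' measurable_space[OF \<pi>, of \<omega>] by (intro diff) (auto simp: B_def B'_def)
      qed (use e in \<open>auto intro!: m\<psi>' Zp Zk'\<close>)
      define C where "C = range (rnd k)"
      have finC: "finite C" unfolding C_def by (rule finite_range_rnd)
      define A where "A c = {\<omega>\<in>space M. rnd k (Z \<omega>) = c}" for c
      have A[measurable]: "A c \<in> sets M" for c unfolding A_def by measurable
      have dec: "\<psi> (x, rnd k (Z \<omega>)) = (\<Sum>c\<in>C. indicator (A c) \<omega> * \<psi> (x, c))" if "\<omega> \<in> space M" for x \<omega>
      proof -
        have "(\<Sum>c\<in>C. indicator (A c) \<omega> * \<psi> (x, c)) = (\<Sum>c\<in>C. if c = rnd k (Z \<omega>) then \<psi> (x, c) else 0)"
          using that by (intro sum.cong refl) (auto simp: A_def indicator_def)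
        also have "\<dots> = \<psi> (x, rnd k (Z \<omega>))" using finC by (subst sum.delta) (auto simp: C_def)
        finally show ?thesis by simp
      qed
      have b_eq: "?b n = (\<Sum>c\<in>C. \<integral>\<omega>. indicator (A c) \<omega> * \<psi> (Y n \<omega>, c) \<partial>M)" for n
      proof -
        have "?b n = (\<integral>\<omega>. (\<Sum>c\<in>C. indicator (A c) \<omega> * \<psi> (Y n \<omega>, c)) \<partial>M)"
          by (intro Bochner_Integration.integral_cong refl dec)
        also have "\<dots> = (\<Sum>c\<in>C. \<integral>\<omega>. indicator (A c) \<omega> * \<psi> (Y n \<omega>, c) \<partial>M)"
        proof (rule Bochner_Integration.integral_sum)
          fix c
          have [measurable]: "(\<lambda>\<omega>. \<psi> (Y n \<omega>, c)) \<in> borel_measurable M" by (rule m\<psi>) simp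
          show "integrable M (\<lambda>\<omega>. indicator (A c) \<omega> * \<psi> (Y n \<omega>, c))"
            using bd YD b0 by (intro M.integrable_const_bound[of _ b] AE_I2) (auto simp: indicator_def)
        qed
        finally show ?thesis .
      qed
      have b_eq': "?b' = (\<Sum>c\<in>C. \<integral>\<omega>. indicator (A c) (\<pi> \<omega>) * \<psi> (Y' \<omega>, c) \<partial>M')"
      proof -
        have "?b' = (\<integral>\<omega>. (\<Sum>c\<in>C. indicator (A c) (\<pi> \<omega>) * \<psi> (Y' \<omega>, c)) \<partial>M')"
          by (intro Bochner_Integration.integral_cong refl dec measurable_space[OF \<pi>])
        also have "\<dots> = (\<Sum>c\<in>C. \<integral>\<omega>. indicator (A c) (\<pi> \<omega>) * \<psi> (Y' \<omega>, c) \<partial>M')"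
        proof (rule Bochner_Integration.integral_sum)
          fix c
          have [measurable]: "(\<lambda>\<omega>. \<psi> (Y' \<omega>, c)) \<in> borel_measurable M'" by (rule m\<psi>') simp
          show "integrable M' (\<lambda>\<omega>. indicator (A c) (\<pi> \<omega>) * \<psi> (Y' \<omega>, c))"
            using bd YD' b0 by (intro M'.integrable_const_bound[of _ b] AE_I2) (auto simp: indicator_def)
        qed
        finally show ?thesis .
      qed
      have 3: "?b \<longlonglongrightarrow> ?b'"
        unfolding b_eq b_eq'
      proof (rule tendsto_sum)
        fix c
        show "(\<lambda>n. \<integral>\<omega>. indicator (A c) \<omega> * \<psi> (Y n \<omega>, c) \<partial>M) \<longlonglongrightarrow> (\<integral>\<omega>. indicator (A c) (\<pi> \<omega>) * \<psi> (Y' \<omega>, c) \<partial>M')"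
        proof (rule core[where h = "\<lambda>x. \<psi> (x, c)" and L = "\<bar>L\<bar>" and b = b, OF A])
          show "\<bar>\<psi> (x, c) - \<psi> (y, c)\<bar> \<le> \<bar>L\<bar> * r"
            if "x \<in> mspace (D_metric T)" "y \<in> mspace (D_metric T)" "\<forall>t\<in>{0..T}. \<bar>x t - y t\<bar> \<le> r" for x y r
            using lip'[OF that, of c c] by simp
        qed (use bd in auto)
      qed
      show "\<exists>b b'. (\<forall>\<^sub>F n in sequentially. \<bar>(\<integral>\<omega>. \<psi> (Y n \<omega>, Z \<omega>) \<partial>M) - b n\<bar> \<le> e) \<and>
          \<bar>(\<integral>\<omega>. \<psi> (Y' \<omega>, Z (\<pi> \<omega>)) \<partial>M') - b'\<bar> \<le> e \<and> b \<longlonglongrightarrow> b'"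
        using 1 2 3 by (intro exI[of _ ?b] exI[of _ ?b']) auto
    qed
  qed
qed

section \<open>Increments of partial sums and of Brownian motion\<close>

text \<open>The maximal inequality is applied to the n summands between times a and b, padded to a
  power of two. Padding at most doubles their number, so 4^r \<le> 4 n^2, and 500 = 4 * 125. The
  moment hypothesis includes j = 0; it is met by the array without its first summand.\<close>

lemma partial_sums_dominated:
  fixes \<xi> :: "nat \<Rightarrow> nat \<Rightarrow> 'a \<Rightarrow> real"
  assumes T: "T > 0" and m: "m \<ge> 1" and C: "C \<ge> 0"
    and \<xi>: "\<And>i. 1 \<le> i \<Longrightarrow> i \<le> nat \<lfloor>real m * T\<rfloor> \<Longrightarrow> \<xi> i m \<in> borel_measurable M"
    and moment: "\<And>j k. j < k \<Longrightarrow> k \<le> nat \<lfloor>real m * T\<rfloor> \<Longrightarrow>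
      (\<integral>\<^sup>+\<omega>. ennreal (\<bar>\<Sum>i=j+1..k. \<xi> i m \<omega>\<bar> ^ 4) \<partial>M) \<le> ennreal (C * ((real k - real j) / real m)\<^sup>2)"
  shows "dominated_increments M T (partial_sums \<xi> m) (\<lambda>t. real (nat \<lfloor>real m * t\<rfloor>) / real m) (500 * C)"
proof -
  define N where "N t = nat \<lfloor>real m * t\<rfloor>" for t
  have Nmono: "N a \<le> N b" if "a \<le> b" for a b
    unfolding N_def using that by (intro nat_mono floor_mono mult_left_mono) auto
  have m0: "real m > 0" using m by simp
  have meas: "(\<lambda>\<omega>. \<Sum>i=1..k. \<xi> i m \<omega>) \<in> borel_measurable M" if "k \<le> N T" for k
    using that unfolding N_def by (intro borel_measurable_sum \<xi>) auto
  have ps: "partial_sums \<xi> m t \<omega> = (\<Sum>i=1..N t. \<xi> i m \<omega>)" for t \<omega>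
    by (simp add: partial_sums_def N_def)
  show ?thesis
    unfolding dominated_increments_def N_def[symmetric]
  proof (intro conjI ballI allI impI)
    show "partial_sums \<xi> m t \<in> borel_measurable M" if "t \<in> {0..T}" for t
      unfolding ps[abs_def] using that by (intro meas Nmono) simp
    show "mono_on {0..T} (\<lambda>t. real (N t) / real m)"
      by (intro mono_onI divide_right_mono of_nat_mono Nmono) auto
    have "real (N T) \<le> real m * T" using T unfolding N_def by (simp add: of_nat_nat)
    then show "real (N T) / real m - real (N 0) / real m \<le> T" using m0 by (simp add: N_def field_simps)
    show "0 \<le> 500 * C" using C by simp
    fix a b :: real assume ab: "0 \<le> a \<and> a \<le> b \<and> b \<le> T"
    define n where "n = N b - N a"
    have Nab: "N a \<le> N b" "N b \<le> N T" using ab by (auto intro: Nmono)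
    show "\<exists>Y\<in>borel_measurable M. (\<forall>\<omega>\<in>space M. \<forall>t\<in>{a..b}. ennreal \<bar>partial_sums \<xi> m t \<omega> - partial_sums \<xi> m a \<omega>\<bar> \<le> Y \<omega>) \<and>
        (\<integral>\<^sup>+\<omega>. Y \<omega> ^ 4 \<partial>M) \<le> ennreal (500 * C * (real (N b) / real m - real (N a) / real m)\<^sup>2)"
    proof (cases "n = 0")
      \<comment> \<open>There is no jump in (a,b]: the path is constant there, and the mass of the
        interval is zero as well.\<close>
      case True
      have const: "partial_sums \<xi> m t \<omega> - partial_sums \<xi> m a \<omega> = 0" if "t \<in> {a..b}" for t \<omega>
      proof -
        have "N t = N a" using Nmono[of a t] Nmono[of t b] that True by (simp add: n_def)
        then show ?thesis by (simp add: ps)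
      qed
      show ?thesis
      proof (intro bexI[of _ "\<lambda>_. 0"] conjI ballI)
        show "ennreal \<bar>partial_sums \<xi> m t \<omega> - partial_sums \<xi> m a \<omega>\<bar> \<le> 0" if "t \<in> {a..b}" for t \<omega>
          unfolding const[OF that] by simp
      qed simp_all
    next
      case False
      then obtain r0 where r0: "2^r0 \<le> n" "n < 2^Suc r0" using ex_power_ivl1[of 2 n] by auto
      define r where "r = Suc r0"
      have r: "n \<le> 2^r" "2^r \<le> 2 * n" using r0 by (auto simp: r_def)
      \<comment> \<open>\<open>min k n\<close> freezes the path after its n genuine steps. Frozen
        increments vanish, and partly frozen ones are shorter than k - j, so the moment bound
        persists.\<close>
      define S where "S k \<omega> = (\<Sum>i=1..N a + min k n. \<xi> i m \<omega>)" for k \<omega>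
      have Sm: "S k \<in> borel_measurable M" for k
        unfolding S_def[abs_def] using Nab by (intro meas) (auto simp: n_def)
      have Sdiff: "S k \<omega> - S j \<omega> = (\<Sum>i=N a + min j n + 1..N a + min k n. \<xi> i m \<omega>)" if "j \<le> k" for j k \<omega>
      proof -
        have e: "N a + min k n = (N a + min j n) + (min k n - min j n)" using that by simp
        have "(\<Sum>i=1..N a + min k n. \<xi> i m \<omega>) = (\<Sum>i=1..N a + min j n. \<xi> i m \<omega>)
            + (\<Sum>i=N a + min j n + 1..N a + min k n. \<xi> i m \<omega>)"
          unfolding e by (rule sum.ub_add_nat) simp
        then show ?thesis by (simp add: S_def)
      qed
      have "(\<integral>\<^sup>+\<omega>. ennreal ((MAX k\<in>{..2^r}. \<bar>S k \<omega> - S 0 \<omega>\<bar>)^4) \<partial>M) \<le> ennreal (125 * (C / (real m)\<^sup>2) * 4^r)"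
      proof (rule maximal_inequality)
        fix j k :: nat assume jk: "j < k"
        show "(\<integral>\<^sup>+\<omega>. ennreal (\<bar>S k \<omega> - S j \<omega>\<bar>^4) \<partial>M) \<le> ennreal (C / (real m)\<^sup>2 * (real k - real j)\<^sup>2)"
        proof (cases "min j n < min k n")
          case True
          have "(\<integral>\<^sup>+\<omega>. ennreal (\<bar>S k \<omega> - S j \<omega>\<bar>^4) \<partial>M)
              = (\<integral>\<^sup>+\<omega>. ennreal (\<bar>\<Sum>i=(N a + min j n) + 1..N a + min k n. \<xi> i m \<omega>\<bar>^4) \<partial>M)"
            using jk by (simp add: Sdiff)
          also have "\<dots> \<le> ennreal (C * ((real (N a + min k n) - real (N a + min j n)) / real m)\<^sup>2)"
            using True Nab by (intro moment) (auto simp: n_def N_def[symmetric])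
          also have "\<dots> \<le> ennreal (C / (real m)\<^sup>2 * (real k - real j)\<^sup>2)"
          proof (rule ennreal_leI)
            have "(real (min k n) - real (min j n))\<^sup>2 \<le> (real k - real j)\<^sup>2"
              using jk True by (intro power_mono) (auto simp: min_def)
            then have "C * (real (min k n) - real (min j n))\<^sup>2 / (real m)\<^sup>2 \<le> C * (real k - real j)\<^sup>2 / (real m)\<^sup>2"
              using C by (intro divide_right_mono mult_left_mono) auto
            then show "C * ((real (N a + min k n) - real (N a + min j n)) / real m)\<^sup>2 \<le> C / (real m)\<^sup>2 * (real k - real j)\<^sup>2"
              by (simp add: power_divide)
          qed
          finally show ?thesis .
        next
          case False
          then have "min j n = min k n" using jk by auto
          then have "S j = S k" by (simp add: S_def[abs_def])
          then show ?thesis by simp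
        qed
      qed (use C Sm in auto)
      also have "\<dots> \<le> ennreal (500 * C * (real (N b) / real m - real (N a) / real m)\<^sup>2)"
      proof (rule ennreal_leI)
        have "(4::real)^r = (2^r)\<^sup>2" by (simp add: power2_eq_square flip: power_mult_distrib)
        also have "\<dots> \<le> (2 * real n)\<^sup>2"
        proof (intro power_mono)
          show "2^r \<le> 2 * real n" using r(2) by (metis of_nat_le_iff of_nat_mult of_nat_numeral of_nat_power)
        qed simp
        finally have "4^r \<le> 4 * (real n)\<^sup>2" by (simp add: power_mult_distrib)
        then have "125 * (C / (real m)\<^sup>2) * 4^r \<le> 125 * (C / (real m)\<^sup>2) * (4 * (real n)\<^sup>2)"
          using C by (intro mult_left_mono) auto
        also have "\<dots> = 500 * C * (real n / real m)\<^sup>2" by (simp add: power_divide)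
        also have "real n / real m = real (N b) / real m - real (N a) / real m"
          using Nab by (simp add: n_def of_nat_diff diff_divide_distrib)
        finally show "125 * (C / (real m)\<^sup>2) * 4^r \<le> 500 * C * (real (N b) / real m - real (N a) / real m)\<^sup>2" .
      qed
      finally have bound: "(\<integral>\<^sup>+\<omega>. ennreal ((MAX k\<in>{..2^r}. \<bar>S k \<omega> - S 0 \<omega>\<bar>)^4) \<partial>M)
        \<le> ennreal (500 * C * (real (N b) / real m - real (N a) / real m)\<^sup>2)" .
      show ?thesis
      proof (intro bexI[of _ "\<lambda>\<omega>. ennreal (MAX k\<in>{..2^r}. \<bar>S k \<omega> - S 0 \<omega>\<bar>)"] conjI ballI)
        have [measurable]: "(\<lambda>\<omega>. MAX k\<in>{..2^r}. \<bar>S k \<omega> - S 0 \<omega>\<bar>) \<in> borel_measurable M"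
          by (intro borel_measurable_Max borel_measurable_abs borel_measurable_diff Sm) auto
        show "(\<lambda>\<omega>. ennreal (MAX k\<in>{..2^r}. \<bar>S k \<omega> - S 0 \<omega>\<bar>)) \<in> borel_measurable M" by measurable
        have nn: "0 \<le> (MAX k\<in>{..2^r}. \<bar>S k \<omega> - S 0 \<omega>\<bar>)" for \<omega>
          by (rule order_trans[OF _ Max_ge[of _ "\<bar>S 0 \<omega> - S 0 \<omega>\<bar>"]]) auto
        show "(\<integral>\<^sup>+\<omega>. (ennreal (MAX k\<in>{..2^r}. \<bar>S k \<omega> - S 0 \<omega>\<bar>)) ^ 4 \<partial>M)
          \<le> ennreal (500 * C * (real (N b) / real m - real (N a) / real m)\<^sup>2)"
          using bound nn by (simp add: ennreal_power)
        fix \<omega> t assume t: "t \<in> {a..b}"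
        have Nt: "N a \<le> N t" "N t \<le> N b" using t by (auto intro: Nmono)
        have "S (N t - N a) \<omega> = partial_sums \<xi> m t \<omega>" "S 0 \<omega> = partial_sums \<xi> m a \<omega>"
          using Nt by (simp_all add: S_def ps n_def)
        moreover have "\<bar>S (N t - N a) \<omega> - S 0 \<omega>\<bar> \<le> (MAX k\<in>{..2^r}. \<bar>S k \<omega> - S 0 \<omega>\<bar>)"
          using Nt r by (intro Max_ge) (auto simp: n_def)
        ultimately show "ennreal \<bar>partial_sums \<xi> m t \<omega> - partial_sums \<xi> m a \<omega>\<bar> \<le> ennreal (MAX k\<in>{..2^r}. \<bar>S k \<omega> - S 0 \<omega>\<bar>)"
          by (intro ennreal_leI) simp
      qed
    qed
  qed
qed

lemma (in prob_space) normal_fourth_moment: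
  assumes X: "distributed M lborel X (normal_density 0 \<sigma>)" and \<sigma>: "\<sigma> > 0"
  shows "(\<integral>\<^sup>+\<omega>. ennreal (\<bar>X \<omega>\<bar>^4) \<partial>M) = ennreal (3 * \<sigma>^4)"
proof -
  have "(\<integral>\<^sup>+\<omega>. ennreal (\<bar>X \<omega>\<bar>^4) \<partial>M) = (\<integral>\<^sup>+x. ennreal (normal_density 0 \<sigma> x) * ennreal (\<bar>x\<bar>^4) \<partial>lborel)"
    by (rule distributed_nn_integral[OF X, symmetric]) simp
  also have "\<dots> = (\<integral>\<^sup>+x. ennreal (normal_density 0 \<sigma> x * (x - 0)^(2 * 2)) \<partial>lborel)"
    by (intro nn_integral_cong) (simp add: ennreal_mult normal_density_nonneg)
  also have "\<dots> = ennreal (\<integral>x. normal_density 0 \<sigma> x * (x - 0)^(2 * 2) \<partial>lborel)"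
    by (rule nn_integral_eq_integral[OF integrable.intros[OF normal_moment_even[OF \<sigma>]]])
      (auto intro!: AE_I2 mult_nonneg_nonneg normal_density_nonneg)
  also have "(\<integral>x. normal_density 0 \<sigma> x * (x - 0)^(2 * 2) \<partial>lborel) = fact (2 * 2) / ((2 / \<sigma>\<^sup>2)^2 * fact 2)"
    by (rule integral_normal_moment_even[OF \<sigma>])
  also have "fact (2 * 2) / ((2 / \<sigma>\<^sup>2)^2 * fact 2) = 3 * \<sigma>^4"
    using \<sigma> by (simp add: fact_numeral power_divide power_mult[symmetric])
  finally show ?thesis .
qed

text \<open>The fourth moment of a normal increment is 3 times its squared length, and 375 = 3 *
  125. The maximal inequality is used on the dyadic grids of [a,b] with a bound independent of the
  level; continuity of the paths recovers the supremum from the dyadic points.\<close>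

lemma brownian_motion_dominated:
  assumes T: "T > 0" and bm: "standard_brownian_motion T M w"
  shows "dominated_increments M T w (\<lambda>t. t) 375"
  unfolding dominated_increments_def
proof (intro conjI ballI allI impI)
  interpret prob_space M using bm by (simp add: standard_brownian_motion_def)
  have wm: "w t \<in> borel_measurable M" if "t \<in> {0..T}" for t
    using bm that by (auto simp: standard_brownian_motion_def)
  have wc: "continuous_on {0..T} (\<lambda>t. w t \<omega>)" if "\<omega> \<in> space M" for \<omega>
    using bm that by (auto simp: standard_brownian_motion_def)
  show "t \<in> {0..T} \<Longrightarrow> w t \<in> borel_measurable M" for t by (rule wm)
  fix a b :: real assume ab: "0 \<le> a \<and> a \<le> b \<and> b \<le> T"
  show "\<exists>Y\<in>borel_measurable M. (\<forall>\<omega>\<in>space M. \<forall>t\<in>{a..b}. ennreal \<bar>w t \<omega> - w a \<omega>\<bar> \<le> Y \<omega>) \<and>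
        (\<integral>\<^sup>+\<omega>. Y \<omega> ^ 4 \<partial>M) \<le> ennreal (375 * (b - a)\<^sup>2)"
  proof (cases "a = b")
    case True
    then show ?thesis by (intro bexI[of _ "\<lambda>_. 0"]) auto
  next
    case False
    define L where "L = b - a"
    have L: "L > 0" using ab False by (simp add: L_def)
    define p where "p r k = a + grid L r k" for r k
    have pin: "p r k \<in> {a..b}" if "k \<le> 2^r" for r k
      using grid_in[OF L that] by (auto simp: p_def L_def)
    have pin': "p r k \<in> {0..T}" if "k \<le> 2^r" for r k using pin[OF that] ab by auto
    define V where "V r \<omega> = (MAX k\<in>{..2^r}. \<bar>w (p r k) \<omega> - w (p r 0) \<omega>\<bar>)" for r \<omega>
    have p0: "p r 0 = a" for r by (simp add: p_def)
    have Vm[measurable]: "V r \<in> borel_measurable M" for r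
      unfolding V_def[abs_def] by (intro borel_measurable_Max borel_measurable_abs borel_measurable_diff wm pin') auto
    have V0: "0 \<le> V r \<omega>" for r \<omega>
      unfolding V_def by (rule order_trans[OF _ Max_ge[of _ "\<bar>w (p r 0) \<omega> - w (p r 0) \<omega>\<bar>"]]) auto
    have Vint: "(\<integral>\<^sup>+\<omega>. ennreal (V r \<omega>^4) \<partial>M) \<le> ennreal (375 * L\<^sup>2)" for r
    proof -
      have "(\<integral>\<^sup>+\<omega>. ennreal (V r \<omega>^4) \<partial>M) \<le> ennreal (125 * (3 * (L / 2^r)\<^sup>2) * 4^r)"
        unfolding V_def
      proof (rule maximal_inequality[where S = "\<lambda>k. w (p r k)"])
        show "k \<le> 2^r \<Longrightarrow> w (p r k) \<in> borel_measurable M" for k by (intro wm pin')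
        fix j k :: nat assume jk: "j < k" "k \<le> 2^r"
        have lt: "p r j < p r k" using jk L by (simp add: p_def grid_strict_mono)
        have d: "p r k - p r j = L / 2^r * (real k - real j)" by (simp add: p_def grid_def field_simps)
        have "distributed M lborel (\<lambda>\<omega>. w (p r k) \<omega> - w (p r j) \<omega>) (normal_density 0 (sqrt (p r k - p r j)))"
          using bm lt pin'[of j r] pin'[of k r] jk by (auto simp: standard_brownian_motion_def)
        then have "(\<integral>\<^sup>+\<omega>. ennreal (\<bar>w (p r k) \<omega> - w (p r j) \<omega>\<bar>^4) \<partial>M) = ennreal (3 * sqrt (p r k - p r j)^4)"
          using lt by (intro normal_fourth_moment) auto
        also have "sqrt (p r k - p r j)^4 = (sqrt (p r k - p r j)^2)^2" by simp
        also have "\<dots> = (p r k - p r j)\<^sup>2" using lt by (subst real_sqrt_pow2) auto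
        finally show "(\<integral>\<^sup>+\<omega>. ennreal (\<bar>w (p r k) \<omega> - w (p r j) \<omega>\<bar>^4) \<partial>M) \<le> ennreal (3 * (L / 2^r)\<^sup>2 * (real k - real j)\<^sup>2)"
          unfolding d by (simp add: power_mult_distrib power_divide)
      qed simp
      also have "125 * (3 * (L / 2^r)\<^sup>2) * 4^r = 375 * L\<^sup>2"
      proof -
        have "(4::real)^r = (2^r)\<^sup>2" by (simp add: power2_eq_square flip: power_mult_distrib)
        then show ?thesis by (simp add: power_divide)
      qed
      finally show ?thesis .
    qed
    \<comment> \<open>The grids are nested, so the maxima increase and monotone convergence applies
      to their fourth powers.\<close>
    have Vinc: "V r \<omega> \<le> V (Suc r) \<omega>" for r \<omega>
      unfolding V_def p0
    proof (rule Max.boundedI)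
      fix v assume "v \<in> (\<lambda>k. \<bar>w (p r k) \<omega> - w a \<omega>\<bar>) ` {..2^r}"
      then obtain k where k: "k \<le> 2^r" "v = \<bar>w (p r k) \<omega> - w a \<omega>\<bar>" by auto
      have "p r k = p (Suc r) (2 * k)" by (simp add: p_def grid_Suc_double)
      then show "v \<le> (MAX k\<in>{..2^Suc r}. \<bar>w (p (Suc r) k) \<omega> - w a \<omega>\<bar>)"
        using k by (intro Max_ge) auto
    qed auto
    define Y where "Y \<omega> = (SUP r. ennreal (V r \<omega>))" for \<omega>
    have Ym[measurable]: "Y \<in> borel_measurable M" unfolding Y_def[abs_def] by measurable
    have inc: "incseq (\<lambda>r. ennreal (V r \<omega>))" for \<omega> using Vinc by (intro incseq_SucI ennreal_leI)
    have inc4: "incseq (\<lambda>r. ennreal (V r \<omega>) ^ 4)" for \<omega>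
      using inc[of \<omega>] by (auto simp: incseq_def intro!: power_mono)
    have Y4: "Y \<omega> ^ 4 = (SUP r. ennreal (V r \<omega>) ^ 4)" for \<omega>
    proof (rule LIMSEQ_unique)
      have l: "(\<lambda>r. ennreal (V r \<omega>)) \<longlonglongrightarrow> Y \<omega>" unfolding Y_def by (rule LIMSEQ_SUP[OF inc])
      have "(\<lambda>r. ennreal (V r \<omega>) * ennreal (V r \<omega>)) \<longlonglongrightarrow> Y \<omega> * Y \<omega>"
        by (rule tendsto_mult_ennreal[OF l l]) auto
      note l2 = this
      have "(\<lambda>r. (ennreal (V r \<omega>) * ennreal (V r \<omega>)) * (ennreal (V r \<omega>) * ennreal (V r \<omega>))) \<longlonglongrightarrow> (Y \<omega> * Y \<omega>) * (Y \<omega> * Y \<omega>)"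
        by (rule tendsto_mult_ennreal[OF l2 l2]) (auto simp: ennreal_mult_eq_top_iff)
      then show "(\<lambda>r. ennreal (V r \<omega>) ^ 4) \<longlonglongrightarrow> Y \<omega> ^ 4" by (simp add: power4_eq_xxxx mult.assoc)
      show "(\<lambda>r. ennreal (V r \<omega>) ^ 4) \<longlonglongrightarrow> (SUP r. ennreal (V r \<omega>) ^ 4)" by (rule LIMSEQ_SUP[OF inc4])
    qed
    show ?thesis
    proof (intro bexI[of _ Y] conjI ballI)
      have "(\<integral>\<^sup>+\<omega>. Y \<omega> ^ 4 \<partial>M) = (SUP r. \<integral>\<^sup>+\<omega>. ennreal (V r \<omega>) ^ 4 \<partial>M)"
        unfolding Y4 using inc4 by (intro nn_integral_monotone_convergence_SUP) (auto simp: incseq_def le_fun_def)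
      also have "\<dots> \<le> ennreal (375 * L\<^sup>2)"
        using Vint V0 by (intro SUP_least) (simp add: ennreal_power)
      finally show "(\<integral>\<^sup>+\<omega>. Y \<omega> ^ 4 \<partial>M) \<le> ennreal (375 * (b - a)\<^sup>2)" by (simp add: L_def)
      fix \<omega> t assume w: "\<omega> \<in> space M" and t: "t \<in> {a..b}"
      define s where "s r = p r (gidx L r (t - a))" for r
      have ta: "t - a \<in> {0..L}" using t by (simp add: L_def)
      have sin: "s r \<in> {0..T}" for r unfolding s_def by (intro pin' gidx(1)[OF L ta])
      have sle: "\<bar>s r - t\<bar> \<le> L / 2^r" for r
        using gidx(2,3)[OF L ta, of r] grid_Suc_diff[of L r "gidx L r (t - a)"] by (simp add: s_def p_def)
      have "s \<longlonglongrightarrow> t"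
      proof (rule LIM_zero_cancel, rule Lim_null_comparison)
        show "\<forall>\<^sub>F r in sequentially. norm (s r - t) \<le> L * (1/2)^r" using sle by (simp add: power_divide)
        have "(\<lambda>r. L * (1/2)^r) \<longlonglongrightarrow> L * 0" by (intro tendsto_intros LIMSEQ_power_zero) simp
        then show "(\<lambda>r. L * (1/2)^r) \<longlonglongrightarrow> 0" by simp
      qed
      then have "(\<lambda>r. w (s r) \<omega>) \<longlonglongrightarrow> w t \<omega>"
        using wc[OF w] sin t ab by (intro continuous_on_tendsto_compose[OF wc[OF w]]) auto
      then have lim: "(\<lambda>r. ennreal \<bar>w (s r) \<omega> - w a \<omega>\<bar>) \<longlonglongrightarrow> ennreal \<bar>w t \<omega> - w a \<omega>\<bar>"
        by (intro tendsto_intros tendsto_ennrealI)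
      have le: "ennreal \<bar>w (s r) \<omega> - w a \<omega>\<bar> \<le> Y \<omega>" for r
      proof -
        have "\<bar>w (s r) \<omega> - w a \<omega>\<bar> \<le> V r \<omega>"
          unfolding V_def p0 s_def using gidx(1)[OF L ta, of r] by (intro Max_ge) auto
        then have "ennreal \<bar>w (s r) \<omega> - w a \<omega>\<bar> \<le> ennreal (V r \<omega>)" by (rule ennreal_leI)
        also have "\<dots> \<le> Y \<omega>" unfolding Y_def by (rule SUP_upper) simp
        finally show ?thesis .
      qed
      show "ennreal \<bar>w t \<omega> - w a \<omega>\<bar> \<le> Y \<omega>" by (rule LIMSEQ_le_const2[OF lim]) (use le in blast)
    qed (rule Ym)
  qed
qed (auto simp: mono_on_def)

section \<open>From finite dimensional distributions to paths\<close>

text \<open>The path is determined by finitely many real variables. Rounding each of them gives an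
  integer list from which the path is recovered up to 2^(-r).\<close>

lemma step_path_pair_measurable:
  assumes T: "T \<ge> 0" and c: "c \<ge> 0" and Z: "Z \<in> borel_measurable N"
    and X: "\<And>i. i \<le> nat \<lfloor>c * T\<rfloor> \<Longrightarrow> X i \<in> borel_measurable N"
  shows "(\<lambda>\<omega>. ((\<lambda>t\<in>{0..T}. X (nat \<lfloor>c * t\<rfloor>) \<omega>), Z \<omega>)) \<in> N \<rightarrow>\<^sub>M borel_of (prod_topology (D_space T) euclideanreal)"
proof (rule pair_measurable_D[OF T Z, where
      V = "\<lambda>r \<omega>. map (\<lambda>i. \<lfloor>2^r * X i \<omega>\<rfloor>) [0..<Suc (nat \<lfloor>c * T\<rfloor>)]" and
      \<Psi> = "\<lambda>r l. \<lambda>t\<in>{0..T}. real_of_int (l ! nat \<lfloor>c * t\<rfloor>) / 2^r"])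
  show "(\<lambda>t\<in>{0..T}. X (nat \<lfloor>c * t\<rfloor>) \<omega>) \<in> mspace (D_metric T)" for \<omega>
    by (rule step_path_in_D[OF c])
  show "(\<lambda>t\<in>{0..T}. real_of_int (l ! nat \<lfloor>c * t\<rfloor>) / 2^r) \<in> mspace (D_metric T)" for r :: nat and l
    by (rule step_path_in_D[OF c, of "\<lambda>i. real_of_int (l ! i) / 2^r"])
  show "(\<lambda>\<omega>. map (\<lambda>i. \<lfloor>2^r * X i \<omega>\<rfloor>) [0..<Suc (nat \<lfloor>c * T\<rfloor>)]) \<in> N \<rightarrow>\<^sub>M count_space UNIV" for r
  proof (rule measurable_int_list)
    fix i assume "i < Suc (nat \<lfloor>c * T\<rfloor>)"
    then have [measurable]: "X i \<in> borel_measurable N" by (intro X) simp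
    show "(\<lambda>\<omega>. \<lfloor>2^r * X i \<omega>\<rfloor>) \<in> N \<rightarrow>\<^sub>M count_space UNIV" by measurable
  qed
  fix \<omega> and e :: real assume e: "e > 0"
  have "\<forall>\<^sub>F r in sequentially. 1 / 2^r \<le> e" by (rule pow_half_eventually_le[OF e])
  then show "\<forall>\<^sub>F r in sequentially. \<forall>t\<in>{0..T}. \<bar>(\<lambda>t\<in>{0..T}. real_of_int
      (map (\<lambda>i. \<lfloor>2^r * X i \<omega>\<rfloor>) [0..<Suc (nat \<lfloor>c * T\<rfloor>)] ! nat \<lfloor>c * t\<rfloor>) / 2^r) t - (\<lambda>t\<in>{0..T}. X (nat \<lfloor>c * t\<rfloor>) \<omega>) t\<bar> \<le> e"
  proof eventually_elim
    case (elim r)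
    show ?case
    proof
      fix t assume t: "t \<in> {0..T}"
      have "nat \<lfloor>c * t\<rfloor> \<le> nat \<lfloor>c * T\<rfloor>" using t c by (intro nat_mono floor_mono mult_left_mono) auto
      then have "map (\<lambda>i. \<lfloor>2^r * X i \<omega>\<rfloor>) [0..<Suc (nat \<lfloor>c * T\<rfloor>)] ! nat \<lfloor>c * t\<rfloor> = \<lfloor>2^r * X (nat \<lfloor>c * t\<rfloor>) \<omega>\<rfloor>"
        by (subst nth_map) (auto simp del: upt_Suc)
      then show "\<bar>(\<lambda>t\<in>{0..T}. real_of_int
      (map (\<lambda>i. \<lfloor>2^r * X i \<omega>\<rfloor>) [0..<Suc (nat \<lfloor>c * T\<rfloor>)] ! nat \<lfloor>c * t\<rfloor>) / 2^r) t - (\<lambda>t\<in>{0..T}. X (nat \<lfloor>c * t\<rfloor>) \<omega>) t\<bar> \<le> e"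
        using dyadic_error[of r "X (nat \<lfloor>c * t\<rfloor>) \<omega>"] elim t unfolding dyadic_def by (simp del: upt_Suc)
    qed
  qed
qed

text \<open>By uniform continuity the path can be read off, up to a uniformly small error, from
  rounded values at the dyadic points.\<close>

lemma continuous_path_pair_measurable:
  assumes T: "T > 0" and Z: "Z \<in> borel_measurable N"
    and I: "\<And>t. t \<in> {0..T} \<Longrightarrow> I t \<in> borel_measurable N"
    and cont: "\<And>\<omega>. \<omega> \<in> space N \<Longrightarrow> continuous_on {0..T} (\<lambda>t. I t \<omega>)"
  shows "(\<lambda>\<omega>. (path_of T I \<omega>, Z \<omega>)) \<in> N \<rightarrow>\<^sub>M borel_of (prod_topology (D_space T) euclideanreal)"
proof (rule pair_measurable_D[OF _ Z, where
      V = "\<lambda>r \<omega>. map (\<lambda>i. \<lfloor>2^r * I (grid T r i) \<omega>\<rfloor>) [0..<Suc (2^r)]" and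
      \<Psi> = "\<lambda>r l. \<lambda>t\<in>{0..T}. real_of_int (l ! gidx T r t) / 2^r"])
  show "0 \<le> T" using T by simp
  show "path_of T I \<omega> \<in> mspace (D_metric T)" if "\<omega> \<in> space N" for \<omega>
    unfolding path_of_def by (rule continuous_in_D[OF cont[OF that]])
  show "(\<lambda>t\<in>{0..T}. real_of_int (l ! gidx T r t) / 2^r) \<in> mspace (D_metric T)" for r :: nat and l
    unfolding gidx_def using T by (intro step_path_in_D[of _ "\<lambda>i. real_of_int (l ! i) / 2^r"]) simp
  show "(\<lambda>\<omega>. map (\<lambda>i. \<lfloor>2^r * I (grid T r i) \<omega>\<rfloor>) [0..<Suc (2^r)]) \<in> N \<rightarrow>\<^sub>M count_space UNIV" for r
  proof (rule measurable_int_list)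
    fix i :: nat assume "i < Suc (2^r)"
    then have [measurable]: "I (grid T r i) \<in> borel_measurable N" by (intro I grid_in[OF T]) simp
    show "(\<lambda>\<omega>. \<lfloor>2^r * I (grid T r i) \<omega>\<rfloor>) \<in> N \<rightarrow>\<^sub>M count_space UNIV" by measurable
  qed
  fix \<omega> and e :: real assume w: "\<omega> \<in> space N" and e: "e > 0"
  have "uniformly_continuous_on {0..T} (\<lambda>t. I t \<omega>)"
    by (rule compact_uniformly_continuous[OF cont[OF w]]) simp
  then obtain d where d: "d > 0"
    "\<And>s t. s \<in> {0..T} \<Longrightarrow> t \<in> {0..T} \<Longrightarrow> \<bar>s - t\<bar> < d \<Longrightarrow> \<bar>I s \<omega> - I t \<omega>\<bar> < e / 2"
    unfolding uniformly_continuous_on_def dist_real_def using half_gt_zero[OF e] by metis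
  have "\<forall>\<^sub>F r in sequentially. 1 / 2^r \<le> e / 2" using e by (intro pow_half_eventually_le) simp
  moreover have "\<forall>\<^sub>F r in sequentially. T / 2^r \<le> d / 2" using d by (intro pow_half_eventually_le) simp
  ultimately show "\<forall>\<^sub>F r in sequentially. \<forall>t\<in>{0..T}. \<bar>(\<lambda>t\<in>{0..T}. real_of_int
      (map (\<lambda>i. \<lfloor>2^r * I (grid T r i) \<omega>\<rfloor>) [0..<Suc (2^r)] ! gidx T r t) / 2^r) t - path_of T I \<omega> t\<bar> \<le> e"
  proof eventually_elim
    case (elim r)
    show ?case
    proof
      fix t assume t: "t \<in> {0..T}"
      note g = gidx[OF T t, of r]
      have 1: "map (\<lambda>i. \<lfloor>2^r * I (grid T r i) \<omega>\<rfloor>) [0..<Suc (2^r)] ! gidx T r t = \<lfloor>2^r * I (grid T r (gidx T r t)) \<omega>\<rfloor>"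
        using g(1) by (subst nth_map) (auto simp del: upt_Suc)
      have "\<bar>grid T r (gidx T r t) - t\<bar> \<le> T / 2^r"
        using g(2,3) grid_Suc_diff[of T r "gidx T r t"] by simp
      then have "\<bar>I (grid T r (gidx T r t)) \<omega> - I t \<omega>\<bar> < e / 2"
        using elim d(1) by (intro d(2) grid_in[OF T g(1)] t) linarith
      then show "\<bar>(\<lambda>t\<in>{0..T}. real_of_int
      (map (\<lambda>i. \<lfloor>2^r * I (grid T r i) \<omega>\<rfloor>) [0..<Suc (2^r)] ! gidx T r t) / 2^r) t - path_of T I \<omega> t\<bar> \<le> e"
        using dyadic_error[of r "I (grid T r (gidx T r t)) \<omega>"] elim(1) t
        unfolding dyadic_def path_of_def restrict_apply'[OF t] 1 by linarith
    qed
  qed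
qed

definition D_lipschitz :: "real \<Rightarrow> real \<Rightarrow> real \<Rightarrow> ((real \<Rightarrow> real) \<Rightarrow> real) \<Rightarrow> bool" where
  "D_lipschitz T L b h \<longleftrightarrow> 0 \<le> L \<and>
     (\<forall>x\<in>mspace (D_metric T). \<forall>y\<in>mspace (D_metric T). \<forall>r.
        (\<forall>t\<in>{0..T}. \<bar>x t - y t\<bar> \<le> r) \<longrightarrow> \<bar>h x - h y\<bar> \<le> L * r) \<and>
     (\<forall>x\<in>mspace (D_metric T). \<bar>h x\<bar> \<le> b)"

lemma D_lipschitz_measurable:
  assumes h: "D_lipschitz T L b h" and T: "T \<ge> 0"
    and p: "(\<lambda>\<omega>. (Y \<omega>, 0 :: real)) \<in> N \<rightarrow>\<^sub>M borel_of (prod_topology (D_space T) euclideanreal)"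
  shows "(\<lambda>\<omega>. h (Y \<omega>)) \<in> borel_measurable N"
proof -
  have L: "0 \<le> L" using h by (simp add: D_lipschitz_def)
  have "\<bar>h x - h y\<bar> \<le> L * (r + \<bar>z - z'\<bar>)"
    if "x \<in> mspace (D_metric T)" "y \<in> mspace (D_metric T)" "\<forall>t\<in>{0..T}. \<bar>x t - y t\<bar> \<le> r" for x y r z z'
  proof -
    have "\<bar>h x - h y\<bar> \<le> L * r" using h that by (auto simp: D_lipschitz_def)
    also have "\<dots> \<le> L * (r + \<bar>z - z'\<bar>)" using L by (intro mult_left_mono) auto
    finally show ?thesis .
  qed
  then show ?thesis
    using measurable_of_pair_measurable[OF p T, where \<psi> = "\<lambda>(x, z). h x" and L = L] L by simp
qed

section \<open>Test functionals of finitely many coordinates\<close>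

lemma lipschitz_coordinates_continuous:
  fixes G :: "(nat \<Rightarrow> real) \<Rightarrow> real"
  assumes lip: "\<And>x y. \<bar>G x - G y\<bar> \<le> L * (\<Sum>l<k. \<bar>x l - y l\<bar>)"
  shows "continuous_map (product_topology (\<lambda>_. euclideanreal) {..<k}) euclideanreal G"
  unfolding continuous_map_eq_topcontinuous_at topcontinuous_at_def
proof (intro ballI conjI allI impI)
  let ?E = "product_topology (\<lambda>_. euclideanreal) {..<k}"
  fix x V assume x: "x \<in> topspace ?E" and V: "openin euclideanreal V \<and> G x \<in> V"
  then obtain e where e: "e > 0" "ball (G x) e \<subseteq> V" by (auto simp: open_contains_ball)
  define d where "d = e / (\<bar>L\<bar> + 1)"
  have d: "d > 0" using e by (simp add: d_def)
  have "continuous_map ?E euclideanreal (\<lambda>y. \<Sum>l<k. \<bar>x l - y l\<bar>)"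
    by (intro continuous_map_sum continuous_map_real_abs continuous_map_diff continuous_map_product_projection) auto
  then have "openin ?E {y \<in> topspace ?E. (\<Sum>l<k. \<bar>x l - y l\<bar>) \<in> {..<d}}"
    by (rule openin_continuous_map_preimage) simp
  moreover have "G y \<in> V" if "(\<Sum>l<k. \<bar>x l - y l\<bar>) < d" for y
  proof -
    have s: "0 \<le> (\<Sum>l<k. \<bar>x l - y l\<bar>)" by (intro sum_nonneg) auto
    have "\<bar>G x - G y\<bar> \<le> L * (\<Sum>l<k. \<bar>x l - y l\<bar>)" by (rule lip)
    also have "\<dots> \<le> (\<bar>L\<bar> + 1) * (\<Sum>l<k. \<bar>x l - y l\<bar>)" using s by (intro mult_right_mono) auto
    also have "\<dots> < (\<bar>L\<bar> + 1) * d" using that by (intro mult_strict_left_mono) auto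
    also have "\<dots> = e" by (simp add: d_def)
    finally show ?thesis using e by (auto simp: dist_real_def subset_iff)
  qed
  ultimately show "\<exists>U. openin ?E U \<and> x \<in> U \<and> (\<forall>y\<in>U. G y \<in> V)"
    using x d by (intro exI[of _ "{y \<in> topspace ?E. (\<Sum>l<k. \<bar>x l - y l\<bar>) \<in> {..<d}}"]) auto
qed auto

text \<open>Stable convergence is tested with the indicator of A as Z and with G times the last
  coordinate truncated to [0,1]: a bounded continuous functional whose truncation is the identity on
  indicators.\<close>

lemma fdd_converge_lipschitz:
  fixes G :: "(nat \<Rightarrow> real) \<Rightarrow> real"
  assumes fdd: "fdd_converge_stably T M Y M' \<pi> Y'" and k: "k \<ge> 1"
    and s: "\<And>l. l < k \<Longrightarrow> s l \<in> {0..T}" and A: "A \<in> sets M"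
    and lip: "\<And>x y. \<bar>G x - G y\<bar> \<le> L * (\<Sum>l<k. \<bar>x l - y l\<bar>)" and bd: "\<And>x. \<bar>G x\<bar> \<le> b"
  shows "(\<lambda>n. \<integral>\<omega>. indicator A \<omega> * G (\<lambda>l. Y n (s l) \<omega>) \<partial>M)
    \<longlonglongrightarrow> (\<integral>\<omega>. indicator A (\<pi> \<omega>) * G (\<lambda>l. Y' (s l) \<omega>) \<partial>M')"
proof -
  let ?E = "product_topology (\<lambda>_::nat. euclideanreal) {..<k}"
  have "converges_stably ?E M (\<lambda>m \<omega>. \<lambda>l\<in>{..<k}. Y m (s l) \<omega>) M' \<pi> (\<lambda>\<omega>'. \<lambda>l\<in>{..<k}. Y' (s l) \<omega>')"
    using fdd k s by (auto simp: fdd_converge_stably_def)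
  then have "converges_in_law (prod_topology ?E euclideanreal)
          M (\<lambda>n \<omega>. ((\<lambda>l\<in>{..<k}. Y n (s l) \<omega>), indicator A \<omega> :: real)) M' (\<lambda>\<omega>'. ((\<lambda>l\<in>{..<k}. Y' (s l) \<omega>'), indicator A (\<pi> \<omega>')))"
    using A unfolding converges_stably_def by auto
  then have law: "\<And>\<phi>. continuous_map (prod_topology ?E euclideanreal) euclideanreal \<phi> \<Longrightarrow>
        bounded (\<phi> ` topspace (prod_topology ?E euclideanreal)) \<Longrightarrow>
        (\<lambda>n. \<integral>\<omega>. \<phi> ((\<lambda>l\<in>{..<k}. Y n (s l) \<omega>), indicator A \<omega>) \<partial>M)
        \<longlonglongrightarrow> (\<integral>\<omega>'. \<phi> ((\<lambda>l\<in>{..<k}. Y' (s l) \<omega>'), indicator A (\<pi> \<omega>')) \<partial>M')"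
    unfolding converges_in_law_def by blast
  let ?\<phi> = "\<lambda>p. G (fst p) * max 0 (min 1 (snd p))"
  \<comment> \<open>The Lipschitz bound sees only the coordinates below k, so extensional
    restriction does not change G.\<close>
  have G: "G (\<lambda>l\<in>{..<k}. y l) = G y" for y
  proof -
    have "\<bar>G (\<lambda>l\<in>{..<k}. y l) - G y\<bar> \<le> L * (\<Sum>l<k. \<bar>(\<lambda>l\<in>{..<k}. y l) l - y l\<bar>)" by (rule lip)
    also have "\<dots> = 0" by simp
    finally show ?thesis by simp
  qed
  have "continuous_map (prod_topology ?E euclideanreal) euclideanreal ?\<phi>"
    by (intro continuous_map_real_mult continuous_map_real_max continuous_map_real_min
        continuous_map_compose[OF continuous_map_fst lipschitz_coordinates_continuous[OF lip], unfolded comp_def]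
        continuous_map_snd) auto
  moreover have "bounded (?\<phi> ` topspace (prod_topology ?E euclideanreal))"
  proof (rule boundedI[of _ b])
    fix v assume "v \<in> ?\<phi> ` topspace (prod_topology ?E euclideanreal)"
    then obtain p where p: "v = ?\<phi> p" by auto
    have "\<bar>v\<bar> \<le> b * 1" unfolding p abs_mult by (intro mult_mono bd) (use bd[of "fst p"] in auto)
    then show "norm v \<le> b" by simp
  qed
  ultimately have "(\<lambda>n. \<integral>\<omega>. ?\<phi> ((\<lambda>l\<in>{..<k}. Y n (s l) \<omega>), indicator A \<omega>) \<partial>M)
        \<longlonglongrightarrow> (\<integral>\<omega>'. ?\<phi> ((\<lambda>l\<in>{..<k}. Y' (s l) \<omega>'), indicator A (\<pi> \<omega>')) \<partial>M')" by (rule law)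
  moreover have "max 0 (min 1 (indicator B x :: real)) = indicator B x" for B :: "'c set" and x
    by (auto simp: indicator_def)
  ultimately show ?thesis by (simp add: G mult.commute)
qed

text \<open>The consequence of finite dimensional stable convergence on which the passage to paths
  rests. It speaks of integrals only, so it can be transferred to the array without its first
  summand by a direct estimate.\<close>

definition fdd_lipschitz_convergence ::
  "real \<Rightarrow> 'a measure \<Rightarrow> (nat \<Rightarrow> real \<Rightarrow> 'a \<Rightarrow> real) \<Rightarrow> 'b measure \<Rightarrow> ('b \<Rightarrow> 'a) \<Rightarrow> (real \<Rightarrow> 'b \<Rightarrow> real) \<Rightarrow> bool"
where
  "fdd_lipschitz_convergence T M H M' \<pi> w \<longleftrightarrow>
    (\<forall>k\<ge>1. \<forall>s. (\<forall>l<k. s l \<in> {0..T}) \<longrightarrow> (\<forall>A\<in>sets M. \<forall>(G :: (nat \<Rightarrow> real) \<Rightarrow> real) L b.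
      (\<forall>x y. \<bar>G x - G y\<bar> \<le> L * (\<Sum>l<k. \<bar>x l - y l\<bar>)) \<and> (\<forall>x. \<bar>G x\<bar> \<le> b) \<longrightarrow>
      (\<lambda>n. \<integral>\<omega>. indicator A \<omega> * G (\<lambda>l. H n (s l) \<omega>) \<partial>M)
        \<longlonglongrightarrow> (\<integral>\<omega>. indicator A (\<pi> \<omega>) * G (\<lambda>l. w (s l) \<omega>) \<partial>M')))"

text \<open>Riemann sum up to the last grid point that is not after t. Dropping the unfinished block
  makes this a step path that depends on y only through its values at the 2^n + 1 grid
  points.\<close>

definition grid_path :: "real \<Rightarrow> nat \<Rightarrow> (nat \<Rightarrow> real) \<Rightarrow> (nat \<Rightarrow> real) \<Rightarrow> real \<Rightarrow> real" where
  "grid_path T n a y = (\<lambda>t\<in>{0..T}. \<Sum>j<gidx T n t. a j * (y (Suc j) - y j))"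

lemma grid_path_in_D: "T > 0 \<Longrightarrow> grid_path T n a y \<in> mspace (D_metric T)"
  unfolding grid_path_def gidx_def by (rule step_path_in_D) simp

lemma grid_path_measurable:
  assumes T: "T > 0" and a: "\<And>j. j < 2^n \<Longrightarrow> a j \<in> borel_measurable N"
    and y: "\<And>j. j \<le> 2^n \<Longrightarrow> y j \<in> borel_measurable N" and h: "D_lipschitz T L b h"
  shows "(\<lambda>\<omega>. h (grid_path T n (\<lambda>j. a j \<omega>) (\<lambda>j. y j \<omega>))) \<in> borel_measurable N"
proof (rule D_lipschitz_measurable[OF h])
  show "(\<lambda>\<omega>. (grid_path T n (\<lambda>j. a j \<omega>) (\<lambda>j. y j \<omega>), 0)) \<in> N \<rightarrow>\<^sub>M borel_of (prod_topology (D_space T) euclideanreal)"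
    unfolding grid_path_def gidx_def
  proof (rule step_path_pair_measurable[where X = "\<lambda>i \<omega>. \<Sum>j<i. a j \<omega> * (y (Suc j) \<omega> - y j \<omega>)"])
    fix i assume "i \<le> nat \<lfloor>2^n / T * T\<rfloor>"
    then have "i \<le> 2^n" using T by (metis gidx_def gidx(1) atLeastAtMost_iff less_imp_le order_refl order_trans)
    then show "(\<lambda>\<omega>. \<Sum>j<i. a j \<omega> * (y (Suc j) \<omega> - y j \<omega>)) \<in> borel_measurable N"
      by (intro borel_measurable_sum borel_measurable_times borel_measurable_diff a y) auto
  qed (use T in auto)
qed (use T in simp)

text \<open>As the coefficients take finitely many values, the sample space splits into finitely
  many events on which they are constants a. On such an event the functional is a Lipschitz function
  of the values of H at the grid points, and the event itself serves as the set against which stable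
  convergence is tested.\<close>

lemma grid_path_convergence:
  assumes ext: "prob_extension M M' \<pi>" and T: "T > 0"
    and fdd: "fdd_lipschitz_convergence T M H M' \<pi> w"
    and Hm: "\<And>m t. t \<in> {0..T} \<Longrightarrow> H m t \<in> borel_measurable M"
    and wm: "\<And>t. t \<in> {0..T} \<Longrightarrow> w t \<in> borel_measurable M'"
    and c: "\<And>j. j < 2^n \<Longrightarrow> c j \<in> borel_measurable M"
    and C: "finite C" "\<And>j \<omega>. c j \<omega> \<in> C"
    and h: "D_lipschitz T L b h" and A: "A \<in> sets M"
  shows "(\<lambda>m. \<integral>\<omega>. indicator A \<omega> * h (grid_path T n (\<lambda>j. c j \<omega>) (\<lambda>j. H m (grid T n j) \<omega>)) \<partial>M)
    \<longlonglongrightarrow> (\<integral>\<omega>. indicator A (\<pi> \<omega>) * h (grid_path T n (\<lambda>j. c j (\<pi> \<omega>)) (\<lambda>j. w (grid T n j) \<omega>)) \<partial>M')"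
proof -
  interpret M: prob_space M using ext by (simp add: prob_extension_def)
  interpret M': prob_space M' using ext by (simp add: prob_extension_def)
  have \<pi>[measurable]: "\<pi> \<in> M' \<rightarrow>\<^sub>M M" using ext by (auto simp: prob_extension_def)
  let ?q = "2^n :: nat"
  define P where "P = PiE {..<?q} (\<lambda>_. C)"
  have finP: "finite P" unfolding P_def by (intro finite_PiE C) auto
  define B where "B a = A \<inter> {\<omega>\<in>space M. \<forall>j\<in>{..<?q}. c j \<omega> = a j}" for a
  have B: "B a \<in> sets M" for a
  proof -
    have "{\<omega>\<in>space M. \<forall>j\<in>{..<?q}. c j \<omega> = a j} \<in> sets M"
    proof (rule sets.sets_Collect_finite_All)
      fix j assume "j \<in> {..<?q}"
      then have [measurable]: "c j \<in> borel_measurable M" by (intro c) simp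
      show "{\<omega>\<in>space M. c j \<omega> = a j} \<in> sets M" by measurable
    qed simp
    then show ?thesis unfolding B_def using A by auto
  qed
  have bd: "\<bar>h (grid_path T n a y)\<bar> \<le> b" for a y
    using h grid_path_in_D[OF T] by (auto simp: D_lipschitz_def)
  have L: "0 \<le> L" using h by (simp add: D_lipschitz_def)
  have b0: "0 \<le> b" using bd[of "\<lambda>_. 0" "\<lambda>_. 0"] by linarith
  have gcong: "grid_path T n a y = grid_path T n a' y" if "\<And>j. j < ?q \<Longrightarrow> a j = a' j" for a a' y
    unfolding grid_path_def
  proof (rule restrict_ext)
    fix t assume "t \<in> {0..T}"
    from gidx(1)[OF T this, of n] show "(\<Sum>j<gidx T n t. a j * (y (Suc j) - y j)) = (\<Sum>j<gidx T n t. a' j * (y (Suc j) - y j))"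
      using that by (intro sum.cong) auto
  qed
  have dec: "indicator A \<omega> * h (grid_path T n (\<lambda>j. c j \<omega>) y) = (\<Sum>a\<in>P. indicator (B a) \<omega> * h (grid_path T n a y))"
    if w: "\<omega> \<in> space M" for \<omega> y
  proof -
    define a0 where "a0 = (\<lambda>j\<in>{..<?q}. c j \<omega>)"
    have "(\<Sum>a\<in>P. indicator (B a) \<omega> * h (grid_path T n a y))
      = (\<Sum>a\<in>P. if a = a0 then indicator A \<omega> * h (grid_path T n a y) else 0)"
    proof (intro sum.cong refl)
      fix a assume a: "a \<in> P"
      have "(\<forall>j\<in>{..<?q}. c j \<omega> = a j) \<longleftrightarrow> a = a0"
        using a unfolding P_def a0_def by (auto simp: PiE_def extensional_def restrict_def fun_eq_iff)
      then show "indicator (B a) \<omega> * h (grid_path T n a y) = (if a = a0 then indicator A \<omega> * h (grid_path T n a y) else 0)"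
        using w by (auto simp: B_def indicator_def)
    qed
    also have "\<dots> = indicator A \<omega> * h (grid_path T n a0 y)"
      using finP C(2) by (subst sum.delta) (auto simp: P_def a0_def)
    also have "grid_path T n a0 y = grid_path T n (\<lambda>j. c j \<omega>) y" by (rule gcong) (simp add: a0_def)
    finally show ?thesis by simp
  qed
  have 1: "(\<integral>\<omega>. indicator A \<omega> * h (grid_path T n (\<lambda>j. c j \<omega>) (\<lambda>j. H m (grid T n j) \<omega>)) \<partial>M)
    = (\<Sum>a\<in>P. \<integral>\<omega>. indicator (B a) \<omega> * h (grid_path T n a (\<lambda>j. H m (grid T n j) \<omega>)) \<partial>M)" for m
  proof -
    have "(\<integral>\<omega>. indicator A \<omega> * h (grid_path T n (\<lambda>j. c j \<omega>) (\<lambda>j. H m (grid T n j) \<omega>)) \<partial>M)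
      = (\<integral>\<omega>. (\<Sum>a\<in>P. indicator (B a) \<omega> * h (grid_path T n a (\<lambda>j. H m (grid T n j) \<omega>))) \<partial>M)"
      by (intro Bochner_Integration.integral_cong refl dec)
    also have "\<dots> = (\<Sum>a\<in>P. \<integral>\<omega>. indicator (B a) \<omega> * h (grid_path T n a (\<lambda>j. H m (grid T n j) \<omega>)) \<partial>M)"
    proof (rule Bochner_Integration.integral_sum)
      fix a
      note [measurable] = B[of a]
      have [measurable]: "(\<lambda>\<omega>. h (grid_path T n a (\<lambda>j. H m (grid T n j) \<omega>))) \<in> borel_measurable M"
        using grid_path_measurable[OF T _ _ h, of n "\<lambda>j \<omega>. a j" M "\<lambda>j. H m (grid T n j)"] Hm grid_in[OF T] by simp
      show "integrable M (\<lambda>\<omega>. indicator (B a) \<omega> * h (grid_path T n a (\<lambda>j. H m (grid T n j) \<omega>)))"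
        using bd b0 by (intro M.integrable_const_bound[of _ b] AE_I2) (auto simp: indicator_def)
    qed
    finally show ?thesis .
  qed
  have 2: "(\<integral>\<omega>. indicator A (\<pi> \<omega>) * h (grid_path T n (\<lambda>j. c j (\<pi> \<omega>)) (\<lambda>j. w (grid T n j) \<omega>)) \<partial>M')
    = (\<Sum>a\<in>P. \<integral>\<omega>. indicator (B a) (\<pi> \<omega>) * h (grid_path T n a (\<lambda>j. w (grid T n j) \<omega>)) \<partial>M')"
  proof -
    have "(\<integral>\<omega>. indicator A (\<pi> \<omega>) * h (grid_path T n (\<lambda>j. c j (\<pi> \<omega>)) (\<lambda>j. w (grid T n j) \<omega>)) \<partial>M')
      = (\<integral>\<omega>. (\<Sum>a\<in>P. indicator (B a) (\<pi> \<omega>) * h (grid_path T n a (\<lambda>j. w (grid T n j) \<omega>))) \<partial>M')"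
      by (intro Bochner_Integration.integral_cong refl dec measurable_space[OF \<pi>])
    also have "\<dots> = (\<Sum>a\<in>P. \<integral>\<omega>. indicator (B a) (\<pi> \<omega>) * h (grid_path T n a (\<lambda>j. w (grid T n j) \<omega>)) \<partial>M')"
    proof (rule Bochner_Integration.integral_sum)
      fix a
      note [measurable] = B[of a]
      have [measurable]: "(\<lambda>\<omega>. h (grid_path T n a (\<lambda>j. w (grid T n j) \<omega>))) \<in> borel_measurable M'"
        using grid_path_measurable[OF T _ _ h, of n "\<lambda>j \<omega>. a j" M' "\<lambda>j. w (grid T n j)"] wm grid_in[OF T] by simp
      show "integrable M' (\<lambda>\<omega>. indicator (B a) (\<pi> \<omega>) * h (grid_path T n a (\<lambda>j. w (grid T n j) \<omega>)))"
        using bd b0 by (intro M'.integrable_const_bound[of _ b] AE_I2) (auto simp: indicator_def)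
    qed
    finally show ?thesis .
  qed
  show ?thesis unfolding 1 2
  proof (rule tendsto_sum)
    fix a
    \<comment> \<open>If y changes by s in total, each of its increments changes by at most 2 s, and
      increment j is weighted by |a j|.\<close>
    define La where "La = L * (2 * (\<Sum>j<?q. \<bar>a j\<bar>))"
    have lipG: "\<bar>h (grid_path T n a x) - h (grid_path T n a y)\<bar> \<le> La * (\<Sum>l<Suc ?q. \<bar>x l - y l\<bar>)" for x y
    proof -
      let ?s = "\<Sum>l<Suc ?q. \<bar>x l - y l\<bar>"
      have s: "\<bar>x l - y l\<bar> \<le> ?s" if "l \<le> ?q" for l
        using that by (intro member_le_sum[of l "{..<Suc ?q}" "\<lambda>l. \<bar>x l - y l\<bar>"]) auto
      have s0: "0 \<le> ?s" by (intro sum_nonneg) auto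
      have "\<bar>grid_path T n a x t - grid_path T n a y t\<bar> \<le> 2 * (\<Sum>j<?q. \<bar>a j\<bar>) * ?s" if t: "t \<in> {0..T}" for t
      proof -
        have g: "gidx T n t \<le> ?q" by (rule gidx(1)[OF T t])
        have "\<bar>grid_path T n a x t - grid_path T n a y t\<bar>
          = \<bar>\<Sum>j<gidx T n t. a j * ((x (Suc j) - y (Suc j)) - (x j - y j))\<bar>"
          using t by (simp add: grid_path_def sum_subtractf[symmetric] algebra_simps)
        also have "\<dots> \<le> (\<Sum>j<gidx T n t. \<bar>a j * ((x (Suc j) - y (Suc j)) - (x j - y j))\<bar>)" by (rule sum_abs)
        also have "\<dots> \<le> (\<Sum>j<gidx T n t. \<bar>a j\<bar> * (2 * ?s))"
        proof (rule sum_mono)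
          fix j assume "j \<in> {..<gidx T n t}"
          then have "j \<le> ?q" "Suc j \<le> ?q" using g by auto
          from s[OF this(1)] s[OF this(2)] have "\<bar>(x (Suc j) - y (Suc j)) - (x j - y j)\<bar> \<le> 2 * ?s" by linarith
          then show "\<bar>a j * ((x (Suc j) - y (Suc j)) - (x j - y j))\<bar> \<le> \<bar>a j\<bar> * (2 * ?s)"
            unfolding abs_mult by (intro mult_left_mono) auto
        qed
        also have "\<dots> \<le> (\<Sum>j<?q. \<bar>a j\<bar> * (2 * ?s))" using g s0 by (intro sum_mono2) auto
        also have "\<dots> = 2 * (\<Sum>j<?q. \<bar>a j\<bar>) * ?s" by (simp add: sum_distrib_left sum_distrib_right mult_ac)
        finally show ?thesis .
      qed
      then have "\<bar>h (grid_path T n a x) - h (grid_path T n a y)\<bar> \<le> L * (2 * (\<Sum>j<?q. \<bar>a j\<bar>) * ?s)"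
        using h grid_path_in_D[OF T] unfolding D_lipschitz_def by blast
      then show ?thesis by (simp add: La_def mult.assoc)
    qed
    show "(\<lambda>m. \<integral>\<omega>. indicator (B a) \<omega> * h (grid_path T n a (\<lambda>j. H m (grid T n j) \<omega>)) \<partial>M)
      \<longlonglongrightarrow> (\<integral>\<omega>. indicator (B a) (\<pi> \<omega>) * h (grid_path T n a (\<lambda>j. w (grid T n j) \<omega>)) \<partial>M')"
      using fdd[unfolded fdd_lipschitz_convergence_def, rule_format, of "Suc ?q" "grid T n" "B a"
          "\<lambda>y. h (grid_path T n a y)" La b] grid_in[OF T] B lipG bd by (auto simp: less_Suc_eq_le)
  qed
qed

lemma hoelder_process_lift:
  assumes ext: "prob_extension M M' \<pi>" and hp: "hoelder_process M T \<alpha> f K"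
  shows "hoelder_process M' T \<alpha> (\<lambda>t \<omega>. f t (\<pi> \<omega>)) (\<lambda>\<omega>. K (\<pi> \<omega>))"
proof -
  interpret hoelder_process M T \<alpha> f K by fact
  interpret M': prob_space M' using ext by (simp add: prob_extension_def)
  have \<pi>: "\<pi> \<in> M' \<rightarrow>\<^sub>M M" using ext by (simp add: prob_extension_def)
  show ?thesis
  proof
    show "(\<lambda>\<omega>. f t (\<pi> \<omega>)) \<in> borel_measurable M'" if "t \<in> {0..T}" for t
      by (rule measurable_compose[OF \<pi> f_measurable[OF that]])
    show "(\<lambda>\<omega>. K (\<pi> \<omega>)) \<in> borel_measurable M'" by (rule measurable_compose[OF \<pi> K_measurable])
  qed (use T \<alpha> hoelder f_bound measurable_space[OF \<pi>] in auto)
qed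

lemma (in hoelder_process) grid_path_young_rnd:
  assumes "t \<in> {0..T}"
  shows "grid_path T n (\<lambda>j. f_rnd n j \<omega>) (\<lambda>j. H (grid T n j) \<omega>) t = young_rnd H n (grid T n (gidx T n t)) \<omega>"
  unfolding young_rnd_def simple_integral_at_grid[OF T gidx(1)[OF T assms]] grid_path_def using assms by simp

text \<open>Off B the paths differ by at most e between the limit and the rounded sum of level n,
  and by at most e between t and its grid point. On B both integrands are bounded by b, which costs
  at most 2 b e.\<close>

lemma (in hoelder_process) path_integral_approximation:
  assumes B: "B \<in> events" "prob B < e" and e: "e \<ge> 0"
    and close: "\<And>\<omega> t. \<omega> \<in> space N - B \<Longrightarrow> t \<in> {0..T} \<Longrightarrow>
      (\<forall>n'\<ge>n. \<bar>young H n' t \<omega> - young_rnd H n t \<omega>\<bar> \<le> e) \<and>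
      \<bar>young_rnd H n t \<omega> - young_rnd H n (grid T n (gidx T n t)) \<omega>\<bar> \<le> e"
    and X: "\<And>\<omega> t. \<omega> \<in> space N - B \<Longrightarrow> t \<in> {0..T} \<Longrightarrow> (\<lambda>n. young H n t \<omega>) \<longlonglongrightarrow> X t \<omega>"
    and pX: "(\<lambda>\<omega>. (path_of T X \<omega>, 0 :: real)) \<in> N \<rightarrow>\<^sub>M borel_of (prod_topology (D_space T) euclideanreal)"
    and Hm: "\<And>t. t \<in> {0..T} \<Longrightarrow> H t \<in> borel_measurable N"
    and h: "D_lipschitz T L b h" and A: "A \<in> events"
  shows "\<bar>(\<integral>\<omega>. indicator A \<omega> * h (path_of T X \<omega>) \<partial>N)
    - (\<integral>\<omega>. indicator A \<omega> * h (grid_path T n (\<lambda>j. f_rnd n j \<omega>) (\<lambda>j. H (grid T n j) \<omega>)) \<partial>N)\<bar> \<le> 2 * (L + b) * e"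
proof -
  let ?P = "\<lambda>\<omega>. grid_path T n (\<lambda>j. f_rnd n j \<omega>) (\<lambda>j. H (grid T n j) \<omega>)"
  note [measurable] = A B(1)
  have XD: "path_of T X \<omega> \<in> mspace (D_metric T)" if "\<omega> \<in> space N" for \<omega>
    using measurable_space[OF pX that] by (simp add: D_space_eq)
  have bd: "\<bar>h x\<bar> \<le> b" if "x \<in> mspace (D_metric T)" for x using h that by (auto simp: D_lipschitz_def)
  have L: "0 \<le> L" using h by (simp add: D_lipschitz_def)
  have b0: "0 \<le> b" using bd[OF grid_path_in_D[OF T, of n "\<lambda>_. 0" "\<lambda>_. 0"]] by linarith
  have [measurable]: "(\<lambda>\<omega>. h (path_of T X \<omega>)) \<in> borel_measurable N"
    using T by (intro D_lipschitz_measurable[OF h _ pX]) simp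
  have [measurable]: "(\<lambda>\<omega>. h (?P \<omega>)) \<in> borel_measurable N"
    using f_rnd_measurable Hm grid_in[OF T] by (intro grid_path_measurable[OF T _ _ h]) auto
  have "\<bar>(\<integral>\<omega>. indicator A \<omega> * h (path_of T X \<omega>) \<partial>N) - (\<integral>\<omega>. indicator A \<omega> * h (?P \<omega>) \<partial>N)\<bar>
    \<le> L * (2 * e) + 2 * b * prob B"
  proof (rule bounded_integral_diff_le[OF prob_space_axioms])
    fix \<omega> assume w: "\<omega> \<in> space N"
    show "\<bar>indicator A \<omega> * h (path_of T X \<omega>)\<bar> \<le> b" using bd[OF XD[OF w]] b0 by (auto simp: indicator_def)
    show "\<bar>indicator A \<omega> * h (?P \<omega>)\<bar> \<le> b" using bd[OF grid_path_in_D[OF T]] b0 by (auto simp: indicator_def)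
  next
    fix \<omega> assume w: "\<omega> \<in> space N - B"
    have "\<bar>path_of T X \<omega> t - ?P \<omega> t\<bar> \<le> 2 * e" if t: "t \<in> {0..T}" for t
    proof -
      \<comment> \<open>The bound holds for every n' \<ge> n, so it passes to the limit X.\<close>
      have "(\<lambda>n'. \<bar>young H n' t \<omega> - young_rnd H n t \<omega>\<bar>) \<longlonglongrightarrow> \<bar>X t \<omega> - young_rnd H n t \<omega>\<bar>"
        by (intro tendsto_intros X w t)
      then have "\<bar>X t \<omega> - young_rnd H n t \<omega>\<bar> \<le> e"
        by (rule LIMSEQ_le_const2) (use close[OF w t] in blast)
      moreover have "\<bar>young_rnd H n t \<omega> - young_rnd H n (grid T n (gidx T n t)) \<omega>\<bar> \<le> e" using close[OF w t] by blast
      ultimately show ?thesis unfolding grid_path_young_rnd[OF t] using t by (simp add: path_of_def)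
    qed
    then have "\<bar>h (path_of T X \<omega>) - h (?P \<omega>)\<bar> \<le> L * (2 * e)"
      using h XD[of \<omega>] grid_path_in_D[OF T] w unfolding D_lipschitz_def by blast
    then show "\<bar>indicator A \<omega> * h (path_of T X \<omega>) - indicator A \<omega> * h (?P \<omega>)\<bar> \<le> L * (2 * e)"
      using L e by (auto simp: indicator_def)
  qed (use L e in auto)
  also have "\<dots> \<le> L * (2 * e) + 2 * b * e" using B(2) b0 by (intro add_left_mono mult_left_mono) auto
  finally show ?thesis by (simp add: algebra_simps)
qed

text \<open>Three comparisons: replacement by level n on the base space, uniformly in m; the same
  replacement on the extension; convergence at the fixed level n. The order of choice matters: n is
  fixed first by e, and m tends to infinity afterwards, when each block of level n carries little
  mass of \<open>\<mu> m\<close>.\<close>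

lemma stable_convergence_core:
  assumes ext: "prob_extension M M' \<pi>" and hp: "hoelder_process M T \<alpha> f K" and C: "C \<ge> 0" "C' \<ge> 0"
    and dom: "\<And>m. m \<ge> 1 \<Longrightarrow> dominated_increments M T (H m) (\<mu> m) C"
    and Hm: "\<And>m t. t \<in> {0..T} \<Longrightarrow> H m t \<in> borel_measurable M"
    and mesh: "\<And>\<delta>. \<delta> > 0 \<Longrightarrow> \<exists>n1. \<forall>n\<ge>n1. \<forall>\<^sub>F m in sequentially. \<forall>j<2^n.
      \<mu> m (grid T n (Suc j)) - \<mu> m (grid T n j) \<le> \<delta>"
    and wdom: "dominated_increments M' T w (\<lambda>t. t) C'"
    and fdd: "fdd_lipschitz_convergence T M H M' \<pi> w"
    and X: "\<And>m \<omega> t. m \<ge> 1 \<Longrightarrow> \<omega> \<in> space M \<Longrightarrow> t \<in> {0..T} \<Longrightarrow>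
      (\<lambda>n. simple_integral (H m) (2^n) (grid T n) (\<lambda>j. f (grid T n j)) t \<omega>) \<longlonglongrightarrow> X m t \<omega>"
    and pX: "\<And>m. (\<lambda>\<omega>. (path_of T (X m) \<omega>, 0 :: real)) \<in> M \<rightarrow>\<^sub>M borel_of (prod_topology (D_space T) euclideanreal)"
    and I: "AE \<omega> in M'. \<forall>t\<in>{0..T}.
      (\<lambda>n. simple_integral w (2^n) (grid T n) (\<lambda>j \<omega>. f (grid T n j) (\<pi> \<omega>)) t \<omega>) \<longlonglongrightarrow> I t \<omega>"
    and pI: "(\<lambda>\<omega>. (path_of T I \<omega>, 0 :: real)) \<in> M' \<rightarrow>\<^sub>M borel_of (prod_topology (D_space T) euclideanreal)"
    and h: "D_lipschitz T L b h" and A: "A \<in> sets M"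
  shows "(\<lambda>m. \<integral>\<omega>. indicator A \<omega> * h (path_of T (X m) \<omega>) \<partial>M)
    \<longlonglongrightarrow> (\<integral>\<omega>. indicator A (\<pi> \<omega>) * h (path_of T I \<omega>) \<partial>M')"
proof (rule tendsto_by_approximation)
  interpret P: hoelder_process M T \<alpha> f K by fact
  interpret P': hoelder_process M' T \<alpha> "\<lambda>t \<omega>. f t (\<pi> \<omega>)" "\<lambda>\<omega>. K (\<pi> \<omega>)"
    by (rule hoelder_process_lift[OF ext hp])
  have \<pi>: "\<pi> \<in> M' \<rightarrow>\<^sub>M M" using ext by (simp add: prob_extension_def)
  note T = P.T
  have wm: "w t \<in> borel_measurable M'" if "t \<in> {0..T}" for t
    using wdom that by (auto simp: dominated_increments_def)
  have L: "0 \<le> L" using h by (simp add: D_lipschitz_def)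
  have b0: "0 \<le> b" using h grid_path_in_D[OF T, of 0 "\<lambda>_. 0" "\<lambda>_. 0"] by (force simp: D_lipschitz_def)
  fix e0 :: real assume e0: "e0 > 0"
  \<comment> \<open>The summand 1 keeps q positive when L and b vanish.\<close>
  define q where "q = L + b + 1"
  have q: "q > 0" using L b0 by (simp add: q_def)
  define e where "e = e0 / (2 * q)"
  have e: "e > 0" using e0 q by (simp add: e_def)
  have small: "2 * (L + b) * e \<le> e0"
  proof -
    have "2 * (L + b) * e \<le> 2 * q * e" using e by (intro mult_right_mono) (auto simp: q_def)
    also have "\<dots> = e0" using q by (simp add: e_def)
    finally show ?thesis .
  qed
  obtain n0 \<delta> where n0: "\<delta> > 0" "\<And>n H \<mu>. n \<ge> n0 \<Longrightarrow> dominated_increments M T H \<mu> C \<Longrightarrow>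
      (\<forall>j<2^n. \<mu> (grid T n (Suc j)) - \<mu> (grid T n j) \<le> \<delta>) \<Longrightarrow>
      (\<exists>B\<in>sets M. P.prob B < e \<and> (\<forall>\<omega>\<in>space M - B. \<forall>t\<in>{0..T}.
         (\<forall>n'\<ge>n. \<bar>P.young H n' t \<omega> - P.young_rnd H n t \<omega>\<bar> \<le> e) \<and>
         \<bar>P.young_rnd H n t \<omega> - P.young_rnd H n (grid T n (gidx T n t)) \<omega>\<bar> \<le> e))"
    using P.uniform_approximation[OF e C(1)] by metis
  obtain n0' \<delta>' where n0': "\<delta>' > 0" "\<And>n H \<mu>. n \<ge> n0' \<Longrightarrow> dominated_increments M' T H \<mu> C' \<Longrightarrow>
      (\<forall>j<2^n. \<mu> (grid T n (Suc j)) - \<mu> (grid T n j) \<le> \<delta>') \<Longrightarrow>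
      (\<exists>B\<in>sets M'. P'.prob B < e \<and> (\<forall>\<omega>\<in>space M' - B. \<forall>t\<in>{0..T}.
         (\<forall>n'\<ge>n. \<bar>P'.young H n' t \<omega> - P'.young_rnd H n t \<omega>\<bar> \<le> e) \<and>
         \<bar>P'.young_rnd H n t \<omega> - P'.young_rnd H n (grid T n (gidx T n t)) \<omega>\<bar> \<le> e))"
    using P'.uniform_approximation[OF e C(2)] by metis
  obtain n1 where n1: "\<And>n. n \<ge> n1 \<Longrightarrow> \<forall>\<^sub>F m in sequentially. \<forall>j<2^n.
      \<mu> m (grid T n (Suc j)) - \<mu> m (grid T n j) \<le> \<delta>" using mesh[OF n0(1)] by blast
  obtain n2 where n2: "\<And>n. n \<ge> n2 \<Longrightarrow> T / 2^n \<le> \<delta>'"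
    using pow_half_eventually_le[OF n0'(1), of T] unfolding eventually_sequentially by blast
  define n where "n = max (max n0 n0') (max n1 n2)"
  have nn: "n \<ge> n0" "n \<ge> n0'" "n \<ge> n1" "n \<ge> n2" by (auto simp: n_def)
  let ?b = "\<lambda>m. \<integral>\<omega>. indicator A \<omega> * h (grid_path T n (\<lambda>j. P.f_rnd n j \<omega>) (\<lambda>j. H m (grid T n j) \<omega>)) \<partial>M"
  let ?b' = "\<integral>\<omega>. indicator A (\<pi> \<omega>) * h (grid_path T n (\<lambda>j. P.f_rnd n j (\<pi> \<omega>)) (\<lambda>j. w (grid T n j) \<omega>)) \<partial>M'"
  have "\<forall>\<^sub>F m in sequentially. 1 \<le> m" by (rule eventually_ge_at_top)
  then have 1: "\<forall>\<^sub>F m in sequentially. \<bar>(\<integral>\<omega>. indicator A \<omega> * h (path_of T (X m) \<omega>) \<partial>M) - ?b m\<bar> \<le> e0"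
    using n1[OF nn(3)]
  proof eventually_elim
    case (elim m)
    obtain B where B: "B \<in> sets M" "P.prob B < e"
      "\<And>\<omega> t. \<omega> \<in> space M - B \<Longrightarrow> t \<in> {0..T} \<Longrightarrow> (\<forall>n'\<ge>n. \<bar>P.young (H m) n' t \<omega> - P.young_rnd (H m) n t \<omega>\<bar> \<le> e) \<and>
         \<bar>P.young_rnd (H m) n t \<omega> - P.young_rnd (H m) n (grid T n (gidx T n t)) \<omega>\<bar> \<le> e"
      using n0(2)[OF nn(1) dom[OF elim(1)] elim(2)] by blast
    have "\<bar>(\<integral>\<omega>. indicator A \<omega> * h (path_of T (X m) \<omega>) \<partial>M) - ?b m\<bar> \<le> 2 * (L + b) * e"
    proof (rule P.path_integral_approximation[OF B(1,2) less_imp_le[OF e] B(3) _ pX Hm h A])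
      show "(\<lambda>n. P.young (H m) n t \<omega>) \<longlonglongrightarrow> X m t \<omega>" if "\<omega> \<in> space M - B" "t \<in> {0..T}" for \<omega> t
        unfolding P.young_def using X[OF elim(1) _ that(2), of \<omega>] that by auto
    qed
    then show ?case using small by linarith
  qed
  have 2: "\<bar>(\<integral>\<omega>. indicator A (\<pi> \<omega>) * h (path_of T I \<omega>) \<partial>M') - ?b'\<bar> \<le> e0"
  proof -
    have "\<forall>j<2^n. grid T n (Suc j) - grid T n j \<le> \<delta>'" using n2[OF nn(4)] by (simp add: grid_Suc_diff)
    from n0'(2)[OF nn(2) wdom this] obtain B where B: "B \<in> sets M'" "P'.prob B < e"
      "\<And>\<omega> t. \<omega> \<in> space M' - B \<Longrightarrow> t \<in> {0..T} \<Longrightarrow> (\<forall>n'\<ge>n. \<bar>P'.young w n' t \<omega> - P'.young_rnd w n t \<omega>\<bar> \<le> e) \<and>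
         \<bar>P'.young_rnd w n t \<omega> - P'.young_rnd w n (grid T n (gidx T n t)) \<omega>\<bar> \<le> e"
      by blast
    \<comment> \<open>The null set on which the Riemann sums may fail to converge to I is added to
      the exceptional set, which turns the almost sure statement into a pathwise one.\<close>
    from I obtain N where N: "N \<in> null_sets M'" "{\<omega>\<in>space M'. \<not> (\<forall>t\<in>{0..T}.
      (\<lambda>n. simple_integral w (2^n) (grid T n) (\<lambda>j \<omega>. f (grid T n j) (\<pi> \<omega>)) t \<omega>) \<longlonglongrightarrow> I t \<omega>)} \<subseteq> N"
      by (auto elim!: AE_E intro: that simp: null_sets_def)
    have pB: "P'.prob (B \<union> N) < e" using B N by (simp add: measure_Un_null_set)
    define A' where "A' = \<pi> -` A \<inter> space M'"
    have A': "A' \<in> sets M'" unfolding A'_def by (rule measurable_sets[OF \<pi> A])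
    have f_rnd: "P'.f_rnd n j \<omega> = P.f_rnd n j (\<pi> \<omega>)" for j \<omega> by (simp add: P.f_rnd_def P'.f_rnd_def)
    have main: "\<bar>(\<integral>\<omega>. indicator A' \<omega> * h (path_of T I \<omega>) \<partial>M')
      - (\<integral>\<omega>. indicator A' \<omega> * h (grid_path T n (\<lambda>j. P'.f_rnd n j \<omega>) (\<lambda>j. w (grid T n j) \<omega>)) \<partial>M')\<bar> \<le> 2 * (L + b) * e"
    proof (rule P'.path_integral_approximation[where B = "B \<union> N", OF _ pB less_imp_le[OF e] _ _ pI wm h A'])
      show "B \<union> N \<in> sets M'" using B N by auto
      show "(\<forall>n'\<ge>n. \<bar>P'.young w n' t \<omega> - P'.young_rnd w n t \<omega>\<bar> \<le> e) \<and>
         \<bar>P'.young_rnd w n t \<omega> - P'.young_rnd w n (grid T n (gidx T n t)) \<omega>\<bar> \<le> e"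
        if "\<omega> \<in> space M' - (B \<union> N)" "t \<in> {0..T}" for \<omega> t using B(3) that by blast
      show "(\<lambda>n. P'.young w n t \<omega>) \<longlonglongrightarrow> I t \<omega>" if "\<omega> \<in> space M' - (B \<union> N)" "t \<in> {0..T}" for \<omega> t
        unfolding P'.young_def using N(2) that by blast
    qed
    have "indicator A' \<omega> = (indicator A (\<pi> \<omega>) :: real)" if "\<omega> \<in> space M'" for \<omega>
      using that by (auto simp: A'_def indicator_def)
    then have ind: "(\<integral>\<omega>. indicator A' \<omega> * g \<omega> \<partial>M') = (\<integral>\<omega>. indicator A (\<pi> \<omega>) * g \<omega> \<partial>M')" for g :: "'b \<Rightarrow> real"
      by (intro Bochner_Integration.integral_cong) auto
    show ?thesis using order_trans[OF main small] unfolding f_rnd ind .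
  qed
  have 3: "?b \<longlonglongrightarrow> ?b'"
  proof (rule grid_path_convergence[OF ext T fdd Hm wm _ finite_range_rnd _ h A])
    show "j < 2^n \<Longrightarrow> P.f_rnd n j \<in> borel_measurable M" for j by (intro P.f_rnd_measurable) simp
    show "P.f_rnd n j \<omega> \<in> range (rnd n)" for j \<omega> by (simp add: P.f_rnd_def)
  qed
  show "\<exists>b b'. (\<forall>\<^sub>F m in sequentially. \<bar>(\<integral>\<omega>. indicator A \<omega> * h (path_of T (X m) \<omega>) \<partial>M) - b m\<bar> \<le> e0) \<and>
    \<bar>(\<integral>\<omega>. indicator A (\<pi> \<omega>) * h (path_of T I \<omega>) \<partial>M') - b'\<bar> \<le> e0 \<and> b \<longlonglongrightarrow> b'"
    using 1 2 3 by (intro exI[of _ ?b] exI[of _ ?b']) auto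
qed

section \<open>Existence of the Ito integral\<close>

text \<open>The indicators of {e < R n} are eventually 0 at almost every point; dominated
  convergence gives their integrals.\<close>

lemma null_in_probability_AE:
  assumes N: "prob_space N" and [measurable]: "\<And>n. R n \<in> borel_measurable N"
    and lim: "AE \<omega> in N. (\<lambda>n. R n \<omega>) \<longlonglongrightarrow> 0"
  shows "null_in_probability N R"
  unfolding null_in_probability_def
proof (intro conjI allI impI)
  interpret prob_space N by fact
  fix e :: ennreal assume e: "e > 0"
  have "(\<lambda>n. \<integral>\<omega>. indicator {\<omega>\<in>space N. e < R n \<omega>} \<omega> \<partial>N) \<longlonglongrightarrow> (\<integral>\<omega>. (0 :: real) \<partial>N)"
  proof (rule integral_dominated_convergence[where w = "\<lambda>_. 1"])
    show "AE \<omega> in N. (\<lambda>n. indicator {\<omega>\<in>space N. e < R n \<omega>} \<omega> :: real) \<longlonglongrightarrow> 0"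
      using lim
    proof eventually_elim
      case (elim \<omega>)
      have "\<forall>\<^sub>F n in sequentially. R n \<omega> < e" by (rule order_tendstoD(2)[OF elim e])
      then have "\<forall>\<^sub>F n in sequentially. 0 = (indicator {\<omega>\<in>space N. e < R n \<omega>} \<omega> :: real)"
        by eventually_elim (auto simp: indicator_def)
      then show ?case by (rule Lim_transform_eventually[OF tendsto_const])
    qed
  qed (auto simp: indicator_def)
  then show "(\<lambda>n. prob {\<omega>\<in>space N. e < R n \<omega>}) \<longlonglongrightarrow> 0" by simp
qed fact

text \<open>Blocks are open on the left and closed on the right, as in
  \<open>simple_process\<close>; hence the ceiling minus one as index, and the exclusion of s =
  0.\<close>

lemma grid_interval:
  assumes T: "T > 0" and s: "s \<in> {0<..T}"
  obtains j where "j < 2^n" "grid T n j < s" "s \<le> grid T n (Suc j)"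
proof -
  let ?x = "2^n / T * s"
  have x: "0 < ?x" using T s by simp
  have "?x \<le> 2^n / T * T" using T s by (intro mult_left_mono) auto
  then have x2: "?x \<le> 2^n" using T by simp
  define j where "j = nat (\<lceil>?x\<rceil> - 1)"
  have r: "real j = real_of_int \<lceil>?x\<rceil> - 1" using x unfolding j_def by linarith
  have 1: "real j < ?x" unfolding r by linarith
  have 2: "?x \<le> real (Suc j)" using r by linarith
  have "real j < 2^n" using 1 x2 by linarith
  then have "j < 2^n" by (metis of_nat_less_iff of_nat_numeral of_nat_power)
  moreover have "grid T n j < s" using 1 T by (simp add: grid_def field_simps)
  moreover have "s \<le> grid T n (Suc j)" using 2 T by (simp add: grid_def field_simps)
  ultimately show ?thesis by (rule that)
qed

lemma simple_process_grid:
  assumes T: "T > 0" and j: "j < 2^n" "grid T n j < s" "s \<le> grid T n (Suc j)"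
  shows "simple_process (2^n) (grid T n) \<eta> s \<omega> = \<eta> j \<omega>"
proof -
  have "simple_process (2^n) (grid T n) \<eta> s \<omega> = (\<Sum>i<2^n. if i = j then \<eta> i \<omega> else 0)"
    unfolding simple_process_def
  proof (intro sum.cong refl)
    fix i
    consider "i < j" | "i = j" | "j < i" by linarith
    then show "\<eta> i \<omega> * indicator {grid T n i<..grid T n (Suc i)} s = (if i = j then \<eta> i \<omega> else 0)"
    proof cases
      case 1
      then have "grid T n (Suc i) \<le> grid T n j" using T by (simp add: grid_mono)
      then show ?thesis using 1 j by (auto simp: indicator_def)
    next
      case 3
      then have "grid T n (Suc j) \<le> grid T n i" using T by (simp add: grid_mono)
      then show ?thesis using 3 j by (auto simp: indicator_def)
    qed (use j in \<open>auto simp: indicator_def\<close>)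
  qed
  also have "\<dots> = \<eta> j \<omega>" using j by (subst sum.delta) auto
  finally show ?thesis .
qed

section \<open>Approximation of f by simple processes\<close>

context hoelder_process begin

lemma f_continuous:
  assumes w: "\<omega> \<in> space N"
  shows "continuous_on {0..T} (\<lambda>t. f t \<omega>)"
  unfolding continuous_on_def
proof
  fix t assume t: "t \<in> {0..T}"
  have "((\<lambda>s. f s \<omega> - f t \<omega>) \<longlongrightarrow> 0) (at t within {0..T})"
  proof (rule Lim_null_comparison)
    have "\<forall>\<^sub>F s in at t within {0..T}. s \<in> {0..T}" by (simp add: eventually_at_filter)
    then show "\<forall>\<^sub>F s in at t within {0..T}. norm (f s \<omega> - f t \<omega>) \<le> K \<omega> * \<bar>s - t\<bar> powr \<alpha>"
      by eventually_elim (use hoelder[OF w _ t] in auto)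
    have "((\<lambda>s. \<bar>s - t\<bar>) \<longlongrightarrow> \<bar>t - t\<bar>) (at t within {0..T})" by (intro tendsto_intros)
    then have "((\<lambda>s. \<bar>s - t\<bar> powr \<alpha>) \<longlongrightarrow> 0) (at t within {0..T})"
      using \<alpha> by (intro tendsto_zero_powrI[OF _ tendsto_const]) auto
    then have "((\<lambda>s. K \<omega> * \<bar>s - t\<bar> powr \<alpha>) \<longlongrightarrow> K \<omega> * 0) (at t within {0..T})" by (intro tendsto_intros)
    then show "((\<lambda>s. K \<omega> * \<bar>s - t\<bar> powr \<alpha>) \<longlongrightarrow> 0) (at t within {0..T})" by simp
  qed
  then show "((\<lambda>t. f t \<omega>) \<longlongrightarrow> f t \<omega>) (at t within {0..T})" by (rule LIM_zero_cancel)
qed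

text \<open>Extends f constantly beyond [0,T], where nothing is assumed about it, so that joint
  measurability can be stated on the whole line.\<close>

definition clamp :: "real \<Rightarrow> real" where "clamp s = max 0 (min T s)"

lemma clamp: "clamp s \<in> {0..T}" "s \<in> {0..T} \<Longrightarrow> clamp s = s"
  using T by (auto simp: clamp_def)

text \<open>With times rounded to multiples of 2^(-r), f is glued from countably many measurable
  variables. Continuity of the paths carries joint measurability to the limit.\<close>

lemma f_jointly_measurable: "(\<lambda>p. f (clamp (snd p)) (fst p)) \<in> borel_measurable (N \<Otimes>\<^sub>M lborel)"
proof (rule borel_measurable_LIMSEQ_real[where u = "\<lambda>r p. f (clamp (dyadic r (snd p))) (fst p)"])
  fix r
  show "(\<lambda>p. f (clamp (dyadic r (snd p))) (fst p)) \<in> borel_measurable (N \<Otimes>\<^sub>M lborel)"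
    unfolding dyadic_def
  proof (rule measurable_compose_countable[where f = "\<lambda>i p. f (clamp (real_of_int i / 2^r)) (fst p)"])
    show "(\<lambda>p. f (clamp (real_of_int i / 2^r)) (fst p)) \<in> borel_measurable (N \<Otimes>\<^sub>M lborel)" for i
      by (rule measurable_compose[OF measurable_fst f_measurable[OF clamp(1)]])
    show "(\<lambda>p. \<lfloor>2^r * (snd p :: real)\<rfloor>) \<in> N \<Otimes>\<^sub>M lborel \<rightarrow>\<^sub>M count_space UNIV" by measurable
  qed
next
  fix p :: "'a \<times> real" assume "p \<in> space (N \<Otimes>\<^sub>M lborel)"
  then have w: "fst p \<in> space N" by (auto simp: space_pair_measure)
  have "(\<lambda>r. dyadic r (snd p)) \<longlonglongrightarrow> snd p"
  proof (rule LIM_zero_cancel, rule Lim_null_comparison)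
    show "\<forall>\<^sub>F r in sequentially. norm (dyadic r (snd p) - snd p) \<le> (1/2)^r"
      using dyadic_error by (simp add: power_divide)
    show "(\<lambda>r. (1/2::real)^r) \<longlonglongrightarrow> 0" by (intro LIMSEQ_power_zero) simp
  qed
  then have "(\<lambda>r. clamp (dyadic r (snd p))) \<longlonglongrightarrow> clamp (snd p)"
    unfolding clamp_def by (intro tendsto_intros)
  then show "(\<lambda>r. f (clamp (dyadic r (snd p))) (fst p)) \<longlonglongrightarrow> f (clamp (snd p)) (fst p)"
    by (intro continuous_on_tendsto_compose[OF f_continuous[OF w]] clamp) (auto intro!: always_eventually clamp simp del: atLeastAtMost_iff)
qed

text \<open>The error at s is the rounding error 4^(-n) plus the Hoelder bound for one mesh width.
  It is uniform in s once 2^n exceeds K, so the convergence holds at every sample point.\<close>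

lemma simple_process_L2:
  defines "R \<equiv> \<lambda>n \<omega>. \<integral>\<^sup>+s\<in>{0..T}. ennreal ((simple_process (2^n) (grid T n) (f_rnd n) s \<omega> - f s \<omega>)\<^sup>2) \<partial>lborel"
  shows "R n \<in> borel_measurable N" and "\<omega> \<in> space N \<Longrightarrow> (\<lambda>n. R n \<omega>) \<longlonglongrightarrow> 0"
proof -
  have "(\<lambda>p. ennreal ((simple_process (2^n) (grid T n) (f_rnd n) (snd p) (fst p) - f (clamp (snd p)) (fst p))\<^sup>2) * indicator {0..T} (snd p))
    \<in> borel_measurable (N \<Otimes>\<^sub>M lborel)"
  proof -
    note [measurable] = f_jointly_measurable
    have [measurable]: "(\<lambda>p. simple_process (2^n) (grid T n) (f_rnd n) (snd p) (fst p)) \<in> borel_measurable (N \<Otimes>\<^sub>M lborel)"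
      unfolding simple_process_def
    proof (rule borel_measurable_sum)
      fix j assume "j \<in> {..<2^n::nat}"
      then have [measurable]: "f_rnd n j \<in> borel_measurable N" by (intro f_rnd_measurable) simp
      show "(\<lambda>p. f_rnd n j (fst p) * indicator {grid T n j<..grid T n (Suc j)} (snd p)) \<in> borel_measurable (N \<Otimes>\<^sub>M lborel)"
        by measurable
    qed
    show ?thesis by measurable
  qed
  then have "(\<lambda>(\<omega>, s). ennreal ((simple_process (2^n) (grid T n) (f_rnd n) s \<omega> - f (clamp s) \<omega>)\<^sup>2) * indicator {0..T} s)
    \<in> borel_measurable (N \<Otimes>\<^sub>M lborel)" by (simp add: case_prod_beta)
  then have "(\<lambda>\<omega>. \<integral>\<^sup>+s. ennreal ((simple_process (2^n) (grid T n) (f_rnd n) s \<omega> - f (clamp s) \<omega>)\<^sup>2) * indicator {0..T} s \<partial>lborel) \<in> borel_measurable N"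
    by (rule lborel.borel_measurable_nn_integral)
  moreover have "(\<integral>\<^sup>+s. ennreal ((simple_process (2^n) (grid T n) (f_rnd n) s \<omega> - f (clamp s) \<omega>)\<^sup>2) * indicator {0..T} s \<partial>lborel) = R n \<omega>" for \<omega>
    unfolding R_def using clamp(2) by (intro nn_integral_cong) (auto simp: indicator_def)
  ultimately show "R n \<in> borel_measurable N" by simp
  assume w: "\<omega> \<in> space N"
  define c where "c n = 1 / 4^n + K \<omega> * (T / 2^n) powr \<alpha>" for n :: nat
  have K0: "0 \<le> K \<omega>" by (rule K_nonneg[OF w])
  have c0: "0 \<le> c n" for n using K0 by (simp add: c_def)
  have "(\<lambda>n. T * (1/2)^n) \<longlonglongrightarrow> T * 0" by (intro tendsto_intros LIMSEQ_power_zero) simp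
  then have "(\<lambda>n. (T / 2^n) powr \<alpha>) \<longlonglongrightarrow> 0"
    using \<alpha> T by (intro tendsto_zero_powrI[OF _ tendsto_const]) (auto simp: power_divide)
  moreover have "(\<lambda>n. (1/4::real)^n) \<longlonglongrightarrow> 0" by (intro LIMSEQ_power_zero) simp
  ultimately have "(\<lambda>n. (1/4)^n + K \<omega> * (T / 2^n) powr \<alpha>) \<longlonglongrightarrow> 0 + K \<omega> * 0"
    by (intro tendsto_add tendsto_mult tendsto_const)
  then have "c \<longlonglongrightarrow> 0" by (simp add: c_def[abs_def] power_divide)
  then have "(\<lambda>n. (c n)\<^sup>2 * T) \<longlonglongrightarrow> 0\<^sup>2 * T" by (intro tendsto_intros)
  then have lim: "(\<lambda>n. ennreal ((c n)\<^sup>2 * T)) \<longlonglongrightarrow> 0" using tendsto_ennrealI[of "\<lambda>n. (c n)\<^sup>2 * T" 0] by simp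
  have "\<forall>\<^sub>F n in sequentially. nat \<lceil>K \<omega>\<rceil> \<le> n" by (rule eventually_ge_at_top)
  then have "\<forall>\<^sub>F n in sequentially. R n \<omega> \<le> ennreal ((c n)\<^sup>2 * T)"
  proof eventually_elim
    case (elim n)
    have "K \<omega> \<le> real n" using elim by linarith
    also have "real n \<le> 2^n" using of_nat_less_two_power[of n, where 'a = real] by simp
    finally have K: "K \<omega> \<le> 2^n" .
    have pw: "\<bar>simple_process (2^n) (grid T n) (f_rnd n) s \<omega> - f s \<omega>\<bar> \<le> c n" if s: "s \<in> {0<..T}" for s
    proof -
      obtain j where j: "j < 2^n" "grid T n j < s" "s \<le> grid T n (Suc j)" by (rule grid_interval[OF T s])
      have u: "grid T n j \<in> {0..T}" using j by (intro grid_in[OF T]) simp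
      have "\<bar>f (grid T n j) \<omega>\<bar> \<le> 2^n" using f_bound[OF w u] K by linarith
      then have 1: "\<bar>f_rnd n j \<omega> - f (grid T n j) \<omega>\<bar> \<le> 1 / 4^n" unfolding f_rnd_def by (rule rnd_error)
      have "\<bar>f (grid T n j) \<omega> - f s \<omega>\<bar> \<le> K \<omega> * \<bar>grid T n j - s\<bar> powr \<alpha>" using s by (intro hoelder[OF w u]) auto
      also have "\<dots> \<le> K \<omega> * (T / 2^n) powr \<alpha>"
      proof -
        have "\<bar>grid T n j - s\<bar> \<le> T / 2^n" using j grid_Suc_diff[of T n j] by linarith
        then show ?thesis using K0 \<alpha> by (intro mult_left_mono powr_mono2) auto
      qed
      finally show ?thesis using 1 unfolding simple_process_grid[OF T j] c_def by linarith
    qed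
    have "R n \<omega> \<le> (\<integral>\<^sup>+s. ennreal ((c n)\<^sup>2) * indicator {0..T} s \<partial>lborel)"
      unfolding R_def
    proof (rule nn_integral_mono_AE)
      \<comment> \<open>The time s = 0 lies in no block, so the simple process is 0 there; this is a
        null set.\<close>
      have "AE s in lborel. s \<noteq> (0::real)" by (rule AE_lborel_singleton)
      then show "AE s in lborel. ennreal ((simple_process (2^n) (grid T n) (f_rnd n) s \<omega> - f s \<omega>)\<^sup>2) * indicator {0..T} s
        \<le> ennreal ((c n)\<^sup>2) * indicator {0..T} s"
      proof eventually_elim
        case (elim s)
        show ?case
        proof (cases "s \<in> {0..T}")
          case True
          then have "s \<in> {0<..T}" using elim by auto
          from pw[OF this] have "(simple_process (2^n) (grid T n) (f_rnd n) s \<omega> - f s \<omega>)\<^sup>2 \<le> (c n)\<^sup>2"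
            by (rule abs_le_square_iff[THEN iffD1, OF order_trans]) simp
          then show ?thesis by (intro mult_right_mono ennreal_leI) auto
        qed simp
      qed
    qed
    also have "\<dots> = ennreal ((c n)\<^sup>2 * T)" using T by (simp add: nn_integral_cmult_indicator ennreal_mult)
    finally show ?case .
  qed
  then show "(\<lambda>n. R n \<omega>) \<longlonglongrightarrow> 0"
    by (intro tendsto_sandwich[OF _ _ tendsto_const lim]) auto
qed

end

text \<open>Turns the supremum over [0,T] into a countable one, which yields measurability and lets
  statements at dyadic times extend to all times.\<close>

lemma SUP_continuous_grid:
  assumes T: "T > 0" and x: "continuous_on {0..T} x"
  shows "(SUP t\<in>{0..T}. ennreal \<bar>x t\<bar>) = (SUP r. SUP i\<in>{..2^r}. ennreal \<bar>x (grid T r i)\<bar>)"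
proof (rule antisym)
  show "(SUP r. SUP i\<in>{..2^r}. ennreal \<bar>x (grid T r i)\<bar>) \<le> (SUP t\<in>{0..T}. ennreal \<bar>x t\<bar>)"
    by (intro SUP_least SUP_upper grid_in[OF T]) simp
  show "(SUP t\<in>{0..T}. ennreal \<bar>x t\<bar>) \<le> (SUP r. SUP i\<in>{..2^r}. ennreal \<bar>x (grid T r i)\<bar>)"
  proof (rule SUP_least)
    fix t assume t: "t \<in> {0..T}"
    have "(\<lambda>r. grid T r (gidx T r t)) \<longlonglongrightarrow> t"
    proof (rule LIM_zero_cancel, rule Lim_null_comparison)
      have "\<bar>grid T r (gidx T r t) - t\<bar> \<le> T * (1/2)^r" for r
        using gidx(2,3)[OF T t, of r] grid_Suc_diff[of T r "gidx T r t"] by (simp add: power_divide)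
      then show "\<forall>\<^sub>F r in sequentially. norm (grid T r (gidx T r t) - t) \<le> T * (1/2)^r" by simp
      have "(\<lambda>r. T * (1/2)^r) \<longlonglongrightarrow> T * 0" by (intro tendsto_intros LIMSEQ_power_zero) simp
      then show "(\<lambda>r. T * (1/2)^r) \<longlonglongrightarrow> 0" by simp
    qed
    then have "(\<lambda>r. x (grid T r (gidx T r t))) \<longlonglongrightarrow> x t"
      by (intro continuous_on_tendsto_compose[OF x] t) (auto intro!: always_eventually grid_in[OF T] gidx(1)[OF T t] simp del: atLeastAtMost_iff)
    then have lim: "(\<lambda>r. ennreal \<bar>x (grid T r (gidx T r t))\<bar>) \<longlonglongrightarrow> ennreal \<bar>x t\<bar>"
      by (intro tendsto_ennrealI tendsto_intros)
    have le: "ennreal \<bar>x (grid T r (gidx T r t))\<bar> \<le> (SUP r. SUP i\<in>{..2^r}. ennreal \<bar>x (grid T r i)\<bar>)" for r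
      using gidx(1)[OF T t, of r] by (intro SUP_upper2[of r] SUP_upper2[of "gidx T r t"]) auto
    show "ennreal \<bar>x t\<bar> \<le> (SUP r. SUP i\<in>{..2^r}. ennreal \<bar>x (grid T r i)\<bar>)"
      by (rule LIMSEQ_le_const2[OF lim]) (use le in blast)
  qed
qed

lemma simple_integral_continuous:
  assumes w: "continuous_on {0..T} (\<lambda>t. w t \<omega>)" and \<tau>: "\<And>j. j \<le> k \<Longrightarrow> \<tau> j \<in> {0..T}"
  shows "continuous_on {0..T} (\<lambda>t. simple_integral w k \<tau> \<eta> t \<omega>)"
proof -
  have "continuous_on {0..T} (\<lambda>t. w (min (\<tau> j) t) \<omega>)" if "j \<le> k" for j
    by (rule continuous_on_compose2[OF w]) (use \<tau>[OF that] in \<open>auto intro!: continuous_intros\<close>)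
  then show ?thesis unfolding simple_integral_def by (intro continuous_intros) auto
qed

lemma simple_integral_measurable:
  assumes w: "\<And>t. t \<in> {0..T} \<Longrightarrow> w t \<in> borel_measurable N" and \<tau>: "\<And>j. j \<le> k \<Longrightarrow> \<tau> j \<in> {0..T}"
    and \<eta>: "\<And>j. j < k \<Longrightarrow> \<eta> j \<in> borel_measurable N" and t: "t \<in> {0..T}"
  shows "simple_integral w k \<tau> \<eta> t \<in> borel_measurable N"
proof -
  have "min (\<tau> j) t \<in> {0..T}" if "j \<le> k" for j using \<tau>[OF that] t by (auto simp: min_def)
  then show ?thesis unfolding simple_integral_def[abs_def]
    by (intro borel_measurable_sum borel_measurable_times borel_measurable_diff w \<eta>) auto
qed

lemma space_enlarged_filtration [simp]: "space (enlarged_filtration M M' \<pi> w t) = space M'"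
  unfolding enlarged_filtration_def by (rule space_measure_of) auto

lemma sets_enlarged_filtration:
  "sets (enlarged_filtration M M' \<pi> w t) = sigma_sets (space M')
       ({\<pi> -` A \<inter> space M' | A. A \<in> sets M} \<union> (\<Union>s\<in>{0..t}. {w s -` B \<inter> space M' | B. B \<in> sets borel}))"
  unfolding enlarged_filtration_def by (rule sets_measure_of) auto

lemma projection_measurable_enlarged_filtration:
  assumes "\<pi> \<in> M' \<rightarrow>\<^sub>M M"
  shows "\<pi> \<in> enlarged_filtration M M' \<pi> w t \<rightarrow>\<^sub>M M"
proof (rule measurableI)
  show "\<omega> \<in> space (enlarged_filtration M M' \<pi> w t) \<Longrightarrow> \<pi> \<omega> \<in> space M" for \<omega>
    using measurable_space[OF assms] by simp
  show "\<pi> -` A \<inter> space (enlarged_filtration M M' \<pi> w t) \<in> sets (enlarged_filtration M M' \<pi> w t)"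
    if "A \<in> sets M" for A
    using that unfolding sets_enlarged_filtration by (auto intro: sigma_sets.Basic)
qed

text \<open>The rounded values of f serve as simple integrands, because these must be bounded. They
  are adapted since the filtration contains the lifted base events from time 0 on. Where
  \<open>W 0\<close> is finite, the unrounded sums are uniformly Cauchy by the tail bound, and the
  rounding error vanishes pathwise.\<close>

lemma ito_integral_exists:
  assumes ext: "prob_extension M M' \<pi>" and hp: "hoelder_process M T \<alpha> f K"
    and wdom: "dominated_increments M' T w (\<lambda>t. t) C"
    and wc: "\<And>\<omega>. \<omega> \<in> space M' \<Longrightarrow> continuous_on {0..T} (\<lambda>t. w t \<omega>)"
  shows "\<exists>I. is_ito_integral T M' (enlarged_filtration M M' \<pi> w) w (\<lambda>s \<omega>'. f s (\<pi> \<omega>')) I \<and>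
    (AE \<omega> in M'. \<forall>t\<in>{0..T}.
      (\<lambda>n. simple_integral w (2^n) (grid T n) (\<lambda>j \<omega>. f (grid T n j) (\<pi> \<omega>)) t \<omega>) \<longlonglongrightarrow> I t \<omega>)"
proof -
  interpret P: hoelder_process M T \<alpha> f K by fact
  interpret P': hoelder_process M' T \<alpha> "\<lambda>t \<omega>. f t (\<pi> \<omega>)" "\<lambda>\<omega>. K (\<pi> \<omega>)"
    by (rule hoelder_process_lift[OF ext hp])
  have \<pi>: "\<pi> \<in> M' \<rightarrow>\<^sub>M M" using ext by (simp add: prob_extension_def)
  note T = P.T
  have wm: "w t \<in> borel_measurable M'" if "t \<in> {0..T}" for t
    using wdom that by (auto simp: dominated_increments_def)
  have gin: "\<And>j. j \<le> 2^n \<Longrightarrow> grid T n j \<in> {0..T}" for n by (rule grid_in[OF T])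
  obtain W where W: "\<And>n. W n \<in> borel_measurable M'"
      "\<And>n. (\<integral>\<^sup>+\<omega>. W n \<omega> \<partial>M') \<le> ennreal (P.rate_const C * P.rate ^ n)"
      "\<And>n n' \<omega> t. n \<le> n' \<Longrightarrow> \<omega> \<in> space M' \<Longrightarrow> t \<in> {0..T} \<Longrightarrow>
        ennreal \<bar>P'.young w n' t \<omega> - P'.young w n t \<omega>\<bar> \<le> ennreal (K (\<pi> \<omega>)) * W n \<omega>"
      "\<And>\<omega>. W 0 \<omega> < \<infinity> \<Longrightarrow> (\<lambda>n. W n \<omega>) \<longlonglongrightarrow> 0"
    using P'.young_dominated[OF wdom] by blast
  note [measurable] = W(1)
  have ym: "P'.young w n t \<in> borel_measurable M'" if "t \<in> {0..T}" for n t
    unfolding P'.young_def using gin that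
    by (intro simple_integral_measurable[where T = T] wm P'.f_measurable) auto
  have yc: "continuous_on {0..T} (\<lambda>t. P'.young w n t \<omega>)" if "\<omega> \<in> space M'" for n \<omega>
    unfolding P'.young_def using gin by (intro simple_integral_continuous wc that) auto
  \<comment> \<open>The value 0 where \<open>W 0\<close> is infinite keeps every path continuous, as
    the definition of the integral demands at each sample point, and keeps I measurable.\<close>
  define I where "I t \<omega> = (if W 0 \<omega> < \<infinity> then lim (\<lambda>n. P'.young w n t \<omega>) else 0)" for t \<omega>
  have cauchy: "\<exists>n. \<forall>n'\<ge>n. \<forall>t\<in>{0..T}. \<bar>P'.young w n' t \<omega> - P'.young w n t \<omega>\<bar> \<le> e"
    if w: "\<omega> \<in> space M'" "W 0 \<omega> < \<infinity>" and e: "e > 0" for \<omega> and e :: real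
  proof -
    have "(\<lambda>n. ennreal (K (\<pi> \<omega>)) * W n \<omega>) \<longlonglongrightarrow> ennreal (K (\<pi> \<omega>)) * 0"
      by (intro tendsto_mult_ennreal tendsto_const W(4) w) auto
    then have "\<forall>\<^sub>F n in sequentially. ennreal (K (\<pi> \<omega>)) * W n \<omega> < ennreal e"
      using e by (intro order_tendstoD(2)) auto
    then obtain n where n: "ennreal (K (\<pi> \<omega>)) * W n \<omega> < ennreal e"
      unfolding eventually_sequentially by blast
    have "\<bar>P'.young w n' t \<omega> - P'.young w n t \<omega>\<bar> \<le> e" if "n' \<ge> n" "t \<in> {0..T}" for n' t
    proof -
      have "ennreal \<bar>P'.young w n' t \<omega> - P'.young w n t \<omega>\<bar> \<le> ennreal e"
        using W(3)[OF that(1) w(1) that(2)] n by (meson le_less_trans less_imp_le)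
      then show ?thesis using e by (subst (asm) ennreal_le_iff) auto
    qed
    then show ?thesis by blast
  qed
  have conv: "(\<lambda>n. P'.young w n t \<omega>) \<longlonglongrightarrow> I t \<omega>"
    if w: "\<omega> \<in> space M'" "W 0 \<omega> < \<infinity>" and t: "t \<in> {0..T}" for \<omega> t
  proof -
    have "Cauchy (\<lambda>n. P'.young w n t \<omega>)"
    proof (rule CauchyI')
      fix e :: real assume "e > 0"
      then obtain n where n: "\<And>n'. n' \<ge> n \<Longrightarrow> \<bar>P'.young w n' t \<omega> - P'.young w n t \<omega>\<bar> \<le> e / 3"
        using cauchy[OF w, of "e / 3"] t by (metis zero_less_divide_iff zero_less_numeral)
      have "dist (P'.young w a t \<omega>) (P'.young w b t \<omega>) < e" if "a \<ge> n" "b > a" for a b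
        using n[of a] n[of b] that \<open>e > 0\<close> unfolding dist_real_def by linarith
      then show "\<exists>M. \<forall>m\<ge>M. \<forall>n>m. dist (P'.young w m t \<omega>) (P'.young w n t \<omega>) < e" by blast
    qed
    then show ?thesis using w(2) by (simp add: I_def convergent_LIMSEQ_iff[symmetric] Cauchy_convergent)
  qed
  have unif: "\<exists>n. \<forall>n'\<ge>n. \<forall>t\<in>{0..T}. \<bar>P'.young w n' t \<omega> - I t \<omega>\<bar> \<le> e"
    if w: "\<omega> \<in> space M'" "W 0 \<omega> < \<infinity>" and e: "e > 0" for \<omega> and e :: real
  proof -
    obtain n where n: "\<And>n' t. n' \<ge> n \<Longrightarrow> t \<in> {0..T} \<Longrightarrow> \<bar>P'.young w n' t \<omega> - P'.young w n t \<omega>\<bar> \<le> e / 2"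
      using cauchy[OF w, of "e / 2"] e by (metis half_gt_zero)
    have "\<bar>P'.young w n' t \<omega> - I t \<omega>\<bar> \<le> e" if n': "n' \<ge> n" and t: "t \<in> {0..T}" for n' t
    proof -
      have "(\<lambda>l. \<bar>P'.young w n' t \<omega> - P'.young w l t \<omega>\<bar>) \<longlonglongrightarrow> \<bar>P'.young w n' t \<omega> - I t \<omega>\<bar>"
        by (intro tendsto_intros conv w t)
      moreover have "\<bar>P'.young w n' t \<omega> - P'.young w l t \<omega>\<bar> \<le> e" if "l \<ge> n" for l
        using n[OF n' t] n[OF that t] by linarith
      ultimately show ?thesis by (intro LIMSEQ_le_const2) blast+
    qed
    then show ?thesis by blast
  qed
  have AEW: "AE \<omega> in M'. W 0 \<omega> < \<infinity>"
  proof -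
    have "(\<integral>\<^sup>+\<omega>. W 0 \<omega> \<partial>M') \<noteq> \<infinity>" using W(2)[of 0] by (auto simp: top_unique)
    then have "AE \<omega> in M'. W 0 \<omega> \<noteq> \<infinity>" by (intro nn_integral_noteq_infinite) auto
    then show ?thesis by eventually_elim (simp add: top.not_eq_extremum)
  qed
  have Im: "I t \<in> borel_measurable M'" if "t \<in> {0..T}" for t
  proof -
    note [measurable] = ym[OF that]
    show ?thesis unfolding I_def[abs_def] by measurable
  qed
  have Ic: "continuous_on {0..T} (\<lambda>t. I t \<omega>)" if w: "\<omega> \<in> space M'" for \<omega>
  proof (cases "W 0 \<omega> < \<infinity>")
    case True
    have "uniform_limit {0..T} (\<lambda>n t. P'.young w n t \<omega>) (\<lambda>t. I t \<omega>) sequentially"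
    proof (rule uniform_limitI)
      fix e :: real assume "e > 0"
      then obtain n where "\<And>n' t. n' \<ge> n \<Longrightarrow> t \<in> {0..T} \<Longrightarrow> \<bar>P'.young w n' t \<omega> - I t \<omega>\<bar> \<le> e / 2"
        using unif[OF w True, of "e / 2"] by (metis half_gt_zero)
      then show "\<forall>\<^sub>F n in sequentially. \<forall>t\<in>{0..T}. dist (P'.young w n t \<omega>) (I t \<omega>) < e"
        unfolding eventually_sequentially dist_real_def using \<open>e > 0\<close> by (intro exI[of _ n]) fastforce
    qed
    then show ?thesis by (rule uniform_limit_theorem[rotated]) (use yc[OF w] in auto)
  qed (simp add: I_def)
  have sint: "simple_integrand T (enlarged_filtration M M' \<pi> w) (2^n) (grid T n) (P'.f_rnd n)" for n
    unfolding simple_integrand_def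
  proof (intro conjI allI impI)
    show "P'.f_rnd n j \<in> borel_measurable (enlarged_filtration M M' \<pi> w (grid T n j))" if "j < 2^n" for j
    proof -
      have "j \<le> 2^n" using that by simp
      note [measurable] = P.f_measurable[OF gin[OF this]]
      have "(\<lambda>\<omega>. rnd n (f (grid T n j) \<omega>)) \<in> borel_measurable M" by measurable
      then show ?thesis unfolding P'.f_rnd_def[abs_def]
        by (rule measurable_compose[OF projection_measurable_enlarged_filtration[OF \<pi>]])
    qed
    show "\<exists>B. \<forall>j<2^n. \<forall>\<omega>\<in>space (enlarged_filtration M M' \<pi> w (grid T n j)). \<bar>P'.f_rnd n j \<omega>\<bar> \<le> B"
      by (intro exI[of _ "2^n + 1"]) (simp add: P'.f_rnd_def abs_rnd_le_pow)
  qed (use T in \<open>auto simp: grid_mono\<close>)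
  define R where "R n \<omega> = (SUP t\<in>{0..T}. ennreal \<bar>simple_integral w (2^n) (grid T n) (P'.f_rnd n) t \<omega> - I t \<omega>\<bar>)" for n \<omega>
  have Rc: "continuous_on {0..T} (\<lambda>t. simple_integral w (2^n) (grid T n) (P'.f_rnd n) t \<omega> - I t \<omega>)" if "\<omega> \<in> space M'" for n \<omega>
    using gin by (intro continuous_on_diff simple_integral_continuous wc Ic that) auto
  have Rm: "R n \<in> borel_measurable M'" for n
  proof -
    have "(\<lambda>\<omega>. SUP r. SUP i\<in>{..2^r}. ennreal \<bar>simple_integral w (2^n) (grid T n) (P'.f_rnd n) (grid T r i) \<omega> - I (grid T r i) \<omega>\<bar>) \<in> borel_measurable M'"
    proof (intro borel_measurable_SUP)
      fix r and i :: nat assume "i \<in> {..2^r}"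
      then have i: "grid T r i \<in> {0..T}" using gin by simp
      have [measurable]: "I (grid T r i) \<in> borel_measurable M'" by (rule Im[OF i])
      have [measurable]: "simple_integral w (2^n) (grid T n) (P'.f_rnd n) (grid T r i) \<in> borel_measurable M'"
        using gin by (intro simple_integral_measurable[where T = T] wm P'.f_rnd_measurable i) auto
      show "(\<lambda>\<omega>. ennreal \<bar>simple_integral w (2^n) (grid T n) (P'.f_rnd n) (grid T r i) \<omega> - I (grid T r i) \<omega>\<bar>) \<in> borel_measurable M'"
        by measurable
    qed auto
    then show ?thesis
      unfolding R_def[abs_def] by (subst measurable_cong[OF SUP_continuous_grid[OF T Rc]]) auto
  qed
  have R0: "(\<lambda>n. R n \<omega>) \<longlonglongrightarrow> 0" if w: "\<omega> \<in> space M'" "W 0 \<omega> < \<infinity>" for \<omega>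
  proof -
    \<comment> \<open>A continuous path on [0,T] is bounded; the bound may depend on the sample
      point, as only pathwise convergence is claimed.\<close>
    obtain y where y: "\<And>s. s \<in> {0..T} \<Longrightarrow> \<bar>w s \<omega> - w 0 \<omega>\<bar> \<le> y"
    proof -
      have "compact ((\<lambda>s. w s \<omega> - w 0 \<omega>) ` {0..T})"
        using wc[OF w(1)] by (intro compact_continuous_image continuous_intros) auto
      then have "bounded ((\<lambda>s. w s \<omega> - w 0 \<omega>) ` {0..T})" by (rule compact_imp_bounded)
      then obtain y where "\<forall>s\<in>{0..T}. \<bar>w s \<omega> - w 0 \<omega>\<bar> \<le> y" by (auto simp: bounded_iff)
      then show ?thesis by (intro that[of y]) blast
    qed
    have "R n \<omega> \<le> ennreal e" if "K (\<pi> \<omega>) \<le> 2^n" "2 * y / 2^n \<le> e / 2"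
      "\<And>t. t \<in> {0..T} \<Longrightarrow> \<bar>P'.young w n t \<omega> - I t \<omega>\<bar> \<le> e / 2" for n e
      unfolding R_def
    proof (intro SUP_least ennreal_leI)
      fix t assume t: "t \<in> {0..T}"
      show "\<bar>simple_integral w (2^n) (grid T n) (P'.f_rnd n) t \<omega> - I t \<omega>\<bar> \<le> e"
        using P'.young_rnd_error[where H = w and y = y, OF w(1) that(1) t y] that(2) that(3)[OF t]
        unfolding P'.young_rnd_def by linarith
    qed
    note bound = this
    show ?thesis
    proof (rule order_tendstoI)
      fix a :: ennreal assume "0 < a"
      then obtain e where e: "e > 0" "ennreal e < a"
      proof -
        obtain b where "0 < b" "b < a" using dense[OF \<open>0 < a\<close>] by blast
        then show ?thesis using that[of "enn2real b"] by (cases b) auto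
      qed
      obtain n where n: "\<And>n' t. n' \<ge> n \<Longrightarrow> t \<in> {0..T} \<Longrightarrow> \<bar>P'.young w n' t \<omega> - I t \<omega>\<bar> \<le> e / 2"
        using unif[OF w, of "e / 2"] e by (metis half_gt_zero)
      have "\<forall>\<^sub>F n' in sequentially. n \<le> n'" by (rule eventually_ge_at_top)
      moreover have "\<forall>\<^sub>F n' in sequentially. nat \<lceil>K (\<pi> \<omega>)\<rceil> \<le> n'" by (rule eventually_ge_at_top)
      moreover have "\<forall>\<^sub>F n' in sequentially. 2 * y / 2^n' \<le> e / 2" using e by (intro pow_half_eventually_le) simp
      ultimately show "\<forall>\<^sub>F n in sequentially. R n \<omega> < a"
      proof eventually_elim
        case (elim n')
        have "K (\<pi> \<omega>) \<le> real n'" using elim(2) by linarith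
        also have "real n' \<le> 2^n'" using of_nat_less_two_power[of n', where 'a = real] by simp
        finally have "R n' \<omega> \<le> ennreal e" by (intro bound elim(3) n elim(1))
        then show ?case using e(2) by (rule le_less_trans)
      qed
    qed simp
  qed
  have "is_ito_integral T M' (enlarged_filtration M M' \<pi> w) w (\<lambda>s \<omega>'. f s (\<pi> \<omega>')) I"
    unfolding is_ito_integral_def
  proof (intro conjI ballI exI allI)
    show "simple_integrand T (enlarged_filtration M M' \<pi> w) (2^n) (grid T n) (P'.f_rnd n)" for n by (rule sint)
    show "null_in_probability M' (\<lambda>n \<omega>. \<integral>\<^sup>+s\<in>{0..T}.
             ennreal ((simple_process (2^n) (grid T n) (P'.f_rnd n) s \<omega> - f s (\<pi> \<omega>))\<^sup>2) \<partial>lborel)"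
      by (intro null_in_probability_AE P'.prob_space_axioms P'.simple_process_L2 AE_I2)
    show "null_in_probability M' (\<lambda>n \<omega>. SUP t\<in>{0..T}.
             ennreal \<bar>simple_integral w (2^n) (grid T n) (P'.f_rnd n) t \<omega> - I t \<omega>\<bar>)"
      unfolding R_def[symmetric]
    proof (rule null_in_probability_AE[OF P'.prob_space_axioms Rm])
      show "AE \<omega> in M'. (\<lambda>n. R n \<omega>) \<longlonglongrightarrow> 0"
        using AEW AE_space by eventually_elim (rule R0)
    qed
  qed (use Im Ic in auto)
  moreover have "AE \<omega> in M'. \<forall>t\<in>{0..T}. (\<lambda>n. P'.young w n t \<omega>) \<longlonglongrightarrow> I t \<omega>"
    using AEW AE_space by eventually_elim (use conv in blast)
  ultimately show ?thesis unfolding P'.young_def by blast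
qed

section \<open>Uniqueness of the Ito integral\<close>

text \<open>Partial sums of nonnegative terms increase, so the kept terms form an initial stretch
  whose sum is empty or one of the partial sums that are at most \<delta>. This takes the place of a
  stopping time when a simple integrand is truncated.\<close>

lemma sum_truncated_le:
  fixes c :: "nat \<Rightarrow> real"
  assumes "\<And>j. j < k \<Longrightarrow> 0 \<le> c j" and "0 \<le> \<delta>"
  shows "(\<Sum>j<k. if (\<Sum>i\<le>j. c i) \<le> \<delta> then c j else 0) \<le> \<delta>"
  using assms(1)
proof (induction k)
  case (Suc k)
  show ?case
  proof (cases "(\<Sum>i\<le>k. c i) \<le> \<delta>")
    case True
    have "(\<Sum>j<Suc k. if (\<Sum>i\<le>j. c i) \<le> \<delta> then c j else 0) \<le> (\<Sum>j<Suc k. c j)"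
      using Suc.prems by (intro sum_mono) auto
    also have "\<dots> = (\<Sum>i\<le>k. c i)" by (simp add: lessThan_Suc_atMost)
    finally show ?thesis using True by linarith
  qed (use Suc in auto)
qed (use assms in simp)

lemma sum_telescope_between:
  fixes F :: "real \<Rightarrow> real"
  assumes \<sigma>: "\<And>i j. i < j \<Longrightarrow> j \<le> n \<Longrightarrow> \<sigma> i < \<sigma> j" and pq: "p \<le> q" "q \<le> n"
  shows "(\<Sum>i<n. if \<sigma> p \<le> \<sigma> i \<and> \<sigma> (Suc i) \<le> \<sigma> q then F (\<sigma> (Suc i)) - F (\<sigma> i) else 0) = F (\<sigma> q) - F (\<sigma> p)"
proof -
  have le: "\<sigma> i \<le> \<sigma> j \<longleftrightarrow> i \<le> j" if "i \<le> n" "j \<le> n" for i j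
    using \<sigma>[of i j] \<sigma>[of j i] that by (cases "i = j"; cases "i < j") auto
  have "(\<Sum>i<n. if \<sigma> p \<le> \<sigma> i \<and> \<sigma> (Suc i) \<le> \<sigma> q then F (\<sigma> (Suc i)) - F (\<sigma> i) else 0)
    = (\<Sum>i\<in>{p..<q}. F (\<sigma> (Suc i)) - F (\<sigma> i))"
    using pq by (intro sum.mono_neutral_cong_right) (auto simp: le)
  also have "\<dots> = F (\<sigma> q) - F (\<sigma> p)"
    using sum_Suc_diff'[of p q "\<lambda>i. F (\<sigma> i)"] pq by simp
  finally show ?thesis .
qed

text \<open>The indicator of a block is an increment of the function that is 1 from s on and 0
  before. In this form processes and integrals are one expression for two choices of a function F,
  and a single refinement lemma serves both.\<close>

lemma simple_process_as_increments:
  assumes "\<And>j. j < k \<Longrightarrow> \<tau> j \<le> \<tau> (Suc j)"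
  shows "simple_process k \<tau> \<eta> s \<omega> = (\<Sum>j<k. \<eta> j \<omega> * ((if s \<le> \<tau> (Suc j) then 1 else 0) - (if s \<le> \<tau> j then 1 else 0)))"
  unfolding simple_process_def
proof (intro sum.cong refl)
  fix j assume "j \<in> {..<k}"
  then have "\<tau> j \<le> \<tau> (Suc j)" using assms by simp
  then show "\<eta> j \<omega> * indicator {\<tau> j<..\<tau> (Suc j)} s = \<eta> j \<omega> * ((if s \<le> \<tau> (Suc j) then 1 else 0) - (if s \<le> \<tau> j then 1 else 0))"
    by (auto simp: indicator_def)
qed

text \<open>The coefficient on block i of a finer partition: the sum picks the
  \<open>\<eta> j\<close> whose interval contains the block. For strictly increasing
  \<open>\<sigma>\<close> and monotone \<open>\<tau>\<close> at most one j qualifies, as a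
  degenerate interval contains no block.\<close>

definition refine_integrand :: "nat \<Rightarrow> (nat \<Rightarrow> real) \<Rightarrow> (nat \<Rightarrow> 'b \<Rightarrow> real) \<Rightarrow> (nat \<Rightarrow> real) \<Rightarrow> nat \<Rightarrow> 'b \<Rightarrow> real" where
  "refine_integrand k \<tau> \<eta> \<sigma> i \<omega> = (\<Sum>j<k. if \<tau> j \<le> \<sigma> i \<and> \<sigma> (Suc i) \<le> \<tau> (Suc j) then \<eta> j \<omega> else 0)"

text \<open>Each interval of \<open>\<tau>\<close> is a union of consecutive blocks of
  \<open>\<sigma>\<close>, over which F telescopes.\<close>

lemma refine_integrand_sum:
  fixes F :: "real \<Rightarrow> real"
  assumes \<sigma>: "\<And>i j. i < j \<Longrightarrow> j \<le> n \<Longrightarrow> \<sigma> i < \<sigma> j"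
    and \<tau>: "\<And>j. j < k \<Longrightarrow> \<tau> j \<le> \<tau> (Suc j)" and sub: "\<And>j. j \<le> k \<Longrightarrow> \<tau> j \<in> \<sigma> ` {..n}"
  shows "(\<Sum>i<n. refine_integrand k \<tau> \<eta> \<sigma> i \<omega> * (F (\<sigma> (Suc i)) - F (\<sigma> i))) = (\<Sum>j<k. \<eta> j \<omega> * (F (\<tau> (Suc j)) - F (\<tau> j)))"
proof -
  have "(\<Sum>i<n. refine_integrand k \<tau> \<eta> \<sigma> i \<omega> * (F (\<sigma> (Suc i)) - F (\<sigma> i)))
    = (\<Sum>i<n. \<Sum>j<k. \<eta> j \<omega> * (if \<tau> j \<le> \<sigma> i \<and> \<sigma> (Suc i) \<le> \<tau> (Suc j) then F (\<sigma> (Suc i)) - F (\<sigma> i) else 0))"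
    unfolding refine_integrand_def sum_distrib_right by (intro sum.cong refl) auto
  also have "\<dots> = (\<Sum>j<k. \<eta> j \<omega> * (\<Sum>i<n. if \<tau> j \<le> \<sigma> i \<and> \<sigma> (Suc i) \<le> \<tau> (Suc j) then F (\<sigma> (Suc i)) - F (\<sigma> i) else 0))"
    by (subst sum.swap) (simp add: sum_distrib_left)
  also have "\<dots> = (\<Sum>j<k. \<eta> j \<omega> * (F (\<tau> (Suc j)) - F (\<tau> j)))"
  proof (intro sum.cong refl arg_cong2[where f = "(*)"])
    fix j assume "j \<in> {..<k}"
    then have j: "j < k" by simp
    obtain p where p: "p \<le> n" "\<tau> j = \<sigma> p" using sub[of j] j by auto
    obtain q where q: "q \<le> n" "\<tau> (Suc j) = \<sigma> q" using sub[of "Suc j"] j by auto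
    have "p \<le> q" using \<tau>[OF j] \<sigma>[of q p] p q by (cases "p \<le> q") auto
    then show "(\<Sum>i<n. if \<tau> j \<le> \<sigma> i \<and> \<sigma> (Suc i) \<le> \<tau> (Suc j) then F (\<sigma> (Suc i)) - F (\<sigma> i) else 0) = F (\<tau> (Suc j)) - F (\<tau> j)"
      unfolding p q using \<sigma> q by (intro sum_telescope_between) auto
  qed
  finally show ?thesis .
qed

section \<open>Brownian increments and the enlarged filtration\<close>

locale base_brownian =
  fixes M :: "'a measure" and M' :: "'b measure" and \<pi> :: "'b \<Rightarrow> 'a" and T :: real and w :: "real \<Rightarrow> 'b \<Rightarrow> real"
  assumes ext: "prob_extension M M' \<pi>" and T: "T > 0"
    and bm: "standard_brownian_motion T M' w" and indep: "indep_of_base T M M' \<pi> w"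
begin

sublocale prob_space M' using ext by (simp add: prob_extension_def)

lemma \<pi>_measurable [measurable]: "\<pi> \<in> M' \<rightarrow>\<^sub>M M" using ext by (simp add: prob_extension_def)

lemma w_measurable: "t \<in> {0..T} \<Longrightarrow> w t \<in> borel_measurable M'"
  using bm by (simp add: standard_brownian_motion_def)

abbreviation "G \<equiv> enlarged_filtration M M' \<pi> w"

lemma G_mono: "s \<le> t \<Longrightarrow> sets (G s) \<subseteq> sets (G t)"
  unfolding sets_enlarged_filtration by (intro sigma_sets_mono' Un_mono order_refl UN_mono) auto

lemma G_sub: "t \<le> T \<Longrightarrow> sets (G t) \<subseteq> events"
  unfolding sets_enlarged_filtration
  by (rule sets.sigma_sets_subset) (use w_measurable in \<open>auto intro!: measurable_sets[OF \<pi>_measurable] measurable_sets[OF w_measurable]\<close>)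

lemma measurable_G_mono: "X \<in> borel_measurable (G s) \<Longrightarrow> s \<le> t \<Longrightarrow> X \<in> borel_measurable (G t)"
  using G_mono[of s t] by (auto simp: measurable_def space_enlarged_filtration)

lemma measurable_G_sub: "X \<in> borel_measurable (G t) \<Longrightarrow> t \<le> T \<Longrightarrow> X \<in> borel_measurable M'"
  using G_sub[of t] by (auto simp: measurable_def space_enlarged_filtration)

lemma w_G_measurable: "s \<in> {0..t} \<Longrightarrow> w s \<in> borel_measurable (G t)"
  unfolding measurable_def space_enlarged_filtration sets_enlarged_filtration by (auto intro!: sigma_sets.Basic)

definition cylinder :: "real set \<Rightarrow> (real \<Rightarrow> real set) \<Rightarrow> 'b set" where
  "cylinder J B = {\<omega>\<in>space M'. \<forall>r\<in>J. w r \<omega> \<in> B r}"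

lemma cylinder_event:
  assumes "finite J" "J \<subseteq> {0..T}" "\<And>r. r \<in> J \<Longrightarrow> B r \<in> sets borel"
  shows "cylinder J B \<in> events"
  unfolding cylinder_def
proof (rule sets.sets_Collect_finite_All[OF _ assms(1)])
  fix r assume r: "r \<in> J"
  then have "w r -` B r \<inter> space M' \<in> events" using assms by (intro measurable_sets[OF w_measurable]) auto
  then show "{\<omega>\<in>space M'. w r \<omega> \<in> B r} \<in> events" by (rule back_subst[where P = "\<lambda>x. x \<in> events"]) auto
qed

text \<open>Brownian motion is given through independence of consecutive increments. The values at
  the times in J are partial sums of increments before a, so the cylinder and the last increment are
  functions of disjoint groups of independent variables.\<close>

lemma increment_indep_cylinder:
  assumes ab: "0 \<le> a" "a < b" "b \<le> T" and J: "finite J" "J \<subseteq> {0..a}"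
    and B: "\<And>r. r \<in> J \<Longrightarrow> B r \<in> sets borel" and D: "D \<in> sets borel"
  shows "prob (cylinder J B \<inter> {\<omega>\<in>space M'. w b \<omega> - w a \<omega> \<in> D})
    = prob (cylinder J B) * prob {\<omega>\<in>space M'. w b \<omega> - w a \<omega> \<in> D}"
proof -
  \<comment> \<open>The time 0 anchors the partial sums; a is included so that the last increment is
    exactly w b - w a.\<close>
  define S where "S = sorted_list_of_set (J \<union> {0, a})"
  have S: "set S = J \<union> {0, a}" "sorted_wrt (<) S" unfolding S_def
    by (rule set_sorted_list_of_set, use J in simp) (rule strict_sorted_list_of_set)
  define n where "n = length S"
  define t where "t i = (S @ [b]) ! i" for i
  have sw: "sorted_wrt (<) (S @ [b])" using S J ab by (auto simp: sorted_wrt_append)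
  have tlt: "t i < t j" if "i < j" "j \<le> n" for i j
    unfolding t_def using sw that by (auto simp: sorted_wrt_iff_nth_less n_def)
  have n1: "n \<ge> 1" unfolding n_def using S(1) by (cases S) auto
  have tS: "t i = S ! i" if "i < n" for i using that by (simp add: t_def n_def nth_append)
  have tn: "t n = b" by (simp add: t_def n_def)
  have tin: "t i \<in> J \<union> {0, a}" if "i < n" for i
    unfolding tS[OF that] S(1)[symmetric] using that by (simp add: n_def)
  have mem: "\<exists>i<n. r = t i" if r: "r \<in> J \<union> {0, a}" for r
  proof -
    obtain i where "i < length S" "S ! i = r" using r unfolding S(1)[symmetric] by (auto simp: in_set_conv_nth)
    then show ?thesis using tS[of i] by (auto simp: n_def)
  qed
  have t0: "t 0 = 0"
  proof -
    obtain i where i: "i < n" "0 = t i" using mem[of 0] by auto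
    have "0 \<le> t 0" using tin[of 0] n1 J ab by auto
    then show ?thesis using tlt[of 0 i] i by (cases i) auto
  qed
  have ta: "t (n - 1) = a"
  proof -
    obtain i where i: "i < n" "a = t i" using mem[of a] by auto
    have "t (n - 1) \<le> a" using tin[of "n - 1"] n1 J ab by auto
    moreover have "i < n - 1 \<or> i = n - 1" using i by linarith
    ultimately show ?thesis using tlt[of i "n - 1"] i by auto
  qed
  have tT: "t i \<in> {0..T}" if "i \<le> n" for i
  proof (cases "i < n")
    case True
    then show ?thesis using tin[OF True] J ab by auto
  next
    case False
    then show ?thesis using that tn ab by auto
  qed
  let ?X = "\<lambda>i \<omega>. w (t (Suc i)) \<omega> - w (t i) \<omega>"
  have iv: "indep_vars (\<lambda>_. borel) ?X {..<n}"
  proof -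
    have "0 \<le> t 0 \<and> (\<forall>i<n. t i < t (Suc i)) \<and> t n \<le> T" using t0 tn ab tlt by auto
    then show ?thesis using bm unfolding standard_brownian_motion_def by blast
  qed
  \<comment> \<open>Increments before a against the last one; for a = 0 the first group is
    empty.\<close>
  let ?A = "{..<n-1}" and ?B = "{n-1}"
  have ivr: "indep_var (PiM ?A (\<lambda>_. borel)) (\<lambda>\<omega>. \<lambda>i\<in>?A. ?X i \<omega>) (PiM ?B (\<lambda>_. borel)) (\<lambda>\<omega>. \<lambda>i\<in>?B. ?X i \<omega>)"
    using n1 by (intro indep_var_restrict[OF iv]) auto
  define U where "U = {x\<in>space (PiM ?A (\<lambda>_. borel :: real measure)). \<forall>i\<in>{i. i < n \<and> t i \<in> J}. (\<Sum>l<i. x l) \<in> B (t i)}"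
  define V where "V = {x\<in>space (PiM ?B (\<lambda>_. borel :: real measure)). x (n-1) \<in> D}"
  have U: "U \<in> sets (PiM ?A (\<lambda>_. borel))"
    unfolding U_def
  proof (rule sets.sets_Collect_finite_All)
    fix i assume i: "i \<in> {i. i < n \<and> t i \<in> J}"
    have [measurable]: "(\<lambda>x. \<Sum>l<i. x l) \<in> borel_measurable (PiM ?A (\<lambda>_. borel :: real measure))"
      using i by (intro borel_measurable_sum measurable_component_singleton) auto
    have [measurable]: "B (t i) \<in> sets borel" using i B by auto
    show "{x\<in>space (PiM ?A (\<lambda>_. borel :: real measure)). (\<Sum>l<i. x l) \<in> B (t i)} \<in> sets (PiM ?A (\<lambda>_. borel))" by measurable
  qed auto
  have V: "V \<in> sets (PiM ?B (\<lambda>_. borel))"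
  proof -
    have [measurable]: "(\<lambda>x. x (n-1)) \<in> borel_measurable (PiM ?B (\<lambda>_. borel :: real measure))"
      by (rule measurable_component_singleton) simp
    show ?thesis unfolding V_def using D by measurable
  qed
  have sumX: "(\<Sum>l<i. ?X l \<omega>) = w (t i) \<omega> - w 0 \<omega>" for i \<omega>
    using sum_lessThan_telescope[of "\<lambda>l. w (t l) \<omega>" i] t0 by simp
  have EU: "(\<lambda>\<omega>. \<lambda>i\<in>?A. ?X i \<omega>) -` U \<inter> space M' = {\<omega>\<in>space M'. \<forall>r\<in>J. w r \<omega> - w 0 \<omega> \<in> B r}"
  proof -
    have "(\<Sum>l<i. (\<lambda>i\<in>?A. ?X i \<omega>) l) = w (t i) \<omega> - w 0 \<omega>" if "i < n" for i \<omega>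
      unfolding sumX[symmetric] using that by (intro sum.cong) auto
    then have "(\<lambda>\<omega>. \<lambda>i\<in>?A. ?X i \<omega>) -` U \<inter> space M' = {\<omega>\<in>space M'. \<forall>i\<in>{i. i < n \<and> t i \<in> J}. w (t i) \<omega> - w 0 \<omega> \<in> B (t i)}"
      by (auto simp: U_def space_PiM)
    also have "\<dots> = {\<omega>\<in>space M'. \<forall>r\<in>J. w r \<omega> - w 0 \<omega> \<in> B r}" using mem by blast
    finally show ?thesis .
  qed
  have EV: "(\<lambda>\<omega>. \<lambda>i\<in>?B. ?X i \<omega>) -` V \<inter> space M' = {\<omega>\<in>space M'. w b \<omega> - w a \<omega> \<in> D}"
    using n1 ta tn by (auto simp: V_def space_PiM)
  let ?E1 = "{\<omega>\<in>space M'. \<forall>r\<in>J. w r \<omega> - w 0 \<omega> \<in> B r}" and ?F = "{\<omega>\<in>space M'. w b \<omega> - w a \<omega> \<in> D}"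
  have E1: "?E1 \<in> events" unfolding EU[symmetric] by (rule measurable_sets[OF indep_var_rv1[OF ivr] U])
  have F: "?F \<in> events" unfolding EV[symmetric] by (rule measurable_sets[OF indep_var_rv2[OF ivr] V])
  have C: "cylinder J B \<in> events" using J ab B by (intro cylinder_event) auto
  have "(\<lambda>\<omega>. (\<lambda>i\<in>?A. ?X i \<omega>, \<lambda>i\<in>?B. ?X i \<omega>)) -` (U \<times> V) \<inter> space M' = ?E1 \<inter> ?F"
    unfolding EU[symmetric] EV[symmetric] by auto
  then have prod: "prob (?E1 \<inter> ?F) = prob ?E1 * prob ?F"
    using indep_varD[OF ivr U V] unfolding EU EV by simp
  \<comment> \<open>Partial sums recover w - w 0. As w 0 vanishes only almost surely, the events are
    compared up to null sets.\<close>
  have w0: "AE \<omega> in M'. w 0 \<omega> = 0" using bm by (simp add: standard_brownian_motion_def)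
  have "prob (cylinder J B) = prob ?E1"
    by (rule finite_measure_eq_AE[OF _ C E1]) (use w0 in \<open>eventually_elim, auto simp: cylinder_def\<close>)
  moreover have "prob (cylinder J B \<inter> ?F) = prob (?E1 \<inter> ?F)"
  proof (rule finite_measure_eq_AE)
    show "AE \<omega> in M'. (\<omega> \<in> cylinder J B \<inter> ?F) = (\<omega> \<in> ?E1 \<inter> ?F)"
      using w0 by eventually_elim (auto simp: cylinder_def)
  qed (use C E1 F in auto)
  ultimately show ?thesis using prod by simp
qed

text \<open>Base events intersected with cylinders at times up to a form a generator of
  \<open>G a\<close> that is stable under intersection. For these, independence of the base and the
  whole path splits off the base event from cylinder and increment together, and the cylinder lemma
  then separates the latter two.\<close>

lemma increment_indep_set:
  assumes ab: "0 \<le> a" "a < b" "b \<le> T"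
  shows "indep_set (sets (G a)) {(\<lambda>\<omega>. w b \<omega> - w a \<omega>) -` D \<inter> space M' | D. D \<in> sets borel}"
proof -
  define gen where "gen = {(\<pi> -` A \<inter> space M') \<inter> cylinder J B | A J B.
    A \<in> sets M \<and> finite J \<and> J \<subseteq> {0..a} \<and> (\<forall>r\<in>J. B r \<in> sets borel)}"
  let ?\<Delta> = "\<lambda>\<omega>. w b \<omega> - w a \<omega>"
  let ?F = "{?\<Delta> -` D \<inter> space M' | D. D \<in> sets borel}"
  have ba: "b \<in> {0..T}" "a \<in> {0..T}" using ab by auto
  have \<Delta>m: "?\<Delta> \<in> borel_measurable M'" by (intro borel_measurable_diff w_measurable ba)
  have path: "path_of T w \<omega> \<in> space (PiM {0..T} (\<lambda>_. borel))" for \<omega>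
    by (simp add: path_of_def space_PiM)
  have base: "prob ((\<pi> -` A \<inter> space M') \<inter> (path_of T w -` Q \<inter> space M')) = prob (\<pi> -` A \<inter> space M') * prob (path_of T w -` Q \<inter> space M')"
    if "A \<in> sets M" "Q \<in> sets (PiM {0..T} (\<lambda>_. borel))" for A Q
    using indep that unfolding indep_of_base_def by (intro indep_setD) auto
  have "indep_set gen ?F"
  proof (rule indep_setI)
    show "gen \<subseteq> events"
      unfolding gen_def using ab by (auto intro!: sets.Int measurable_sets[OF \<pi>_measurable] cylinder_event)
    show "?F \<subseteq> events" by (auto intro!: measurable_sets[OF \<Delta>m])
    fix E F assume "E \<in> gen" "F \<in> ?F"
    then obtain A J B D where A: "A \<in> sets M" and J: "finite J" "J \<subseteq> {0..a}" and B': "\<forall>r\<in>J. B r \<in> sets borel"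
      and D: "D \<in> sets borel" and EF: "E = (\<pi> -` A \<inter> space M') \<inter> cylinder J B" "F = ?\<Delta> -` D \<inter> space M'"
      unfolding gen_def by blast
    have B: "B r \<in> sets borel" if "r \<in> J" for r using B' that by blast
    let ?P = "PiM {0..T} (\<lambda>_. borel :: real measure)"
    \<comment> \<open>Cylinder and increment event are expressed as events of path space, so that
      \<open>indep_of_base\<close> applies to their intersection.\<close>
    define Q1 where "Q1 = {x\<in>space ?P. \<forall>r\<in>J. x r \<in> B r}"
    define Q2 where "Q2 = {x\<in>space ?P. x b - x a \<in> D}"
    have Q1: "Q1 \<in> sets ?P"
      unfolding Q1_def
    proof (rule sets.sets_Collect_finite_All[OF _ J(1)])
      fix r assume r: "r \<in> J"
      have [measurable]: "(\<lambda>x. x r) \<in> borel_measurable ?P" using r J ab by (intro measurable_component_singleton) auto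
      note [measurable] = B[OF r]
      show "{x\<in>space ?P. x r \<in> B r} \<in> sets ?P" by measurable
    qed
    have Q2: "Q2 \<in> sets ?P"
    proof -
      have [measurable]: "(\<lambda>x. x b) \<in> borel_measurable ?P" "(\<lambda>x. x a) \<in> borel_measurable ?P"
        using ba by (auto intro!: measurable_component_singleton)
      show ?thesis unfolding Q2_def using D by measurable
    qed
    have e1: "path_of T w -` Q1 \<inter> space M' = cylinder J B"
    proof -
      have "path_of T w \<omega> r = w r \<omega>" if "r \<in> J" for \<omega> r using that J ab by (auto simp: path_of_def)
      then show ?thesis unfolding Q1_def cylinder_def using path by auto
    qed
    have e2: "path_of T w -` Q2 \<inter> space M' = F"
      unfolding Q2_def EF using path ba by (auto simp: path_of_def)
    have F: "F = {\<omega>\<in>space M'. w b \<omega> - w a \<omega> \<in> D}" unfolding EF by auto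
    have "path_of T w -` (Q1 \<inter> Q2) \<inter> space M' = cylinder J B \<inter> F" using e1 e2 by auto
    then have "prob (E \<inter> F) = prob (\<pi> -` A \<inter> space M') * prob (cylinder J B \<inter> F)"
      using base[OF A, of "Q1 \<inter> Q2"] Q1 Q2 unfolding EF(1) by (simp add: Int_assoc)
    also have "\<dots> = prob (\<pi> -` A \<inter> space M') * prob (cylinder J B) * prob F"
      unfolding F using increment_indep_cylinder[OF ab J B D] by simp
    also have "prob (\<pi> -` A \<inter> space M') * prob (cylinder J B) = prob E"
      using base[OF A Q1] unfolding e1 EF(1) by simp
    finally show "prob (E \<inter> F) = prob E * prob F" .
  qed
  moreover have "Int_stable gen"
  proof (rule Int_stableI)
    fix E E' assume "E \<in> gen" "E' \<in> gen"
    then obtain A J B A' J' B' where A: "A \<in> sets M" "A' \<in> sets M" and J: "finite J" "J \<subseteq> {0..a}" "finite J'" "J' \<subseteq> {0..a}"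
      and B: "\<forall>r\<in>J. B r \<in> sets borel" "\<forall>r\<in>J'. B' r \<in> sets borel"
      and E: "E = (\<pi> -` A \<inter> space M') \<inter> cylinder J B" "E' = (\<pi> -` A' \<inter> space M') \<inter> cylinder J' B'"
      unfolding gen_def by blast
    \<comment> \<open>A time in only one of the two index sets receives \<open>UNIV\<close> from the
      other.\<close>
    define B'' where "B'' r = (if r \<in> J then B r else UNIV) \<inter> (if r \<in> J' then B' r else UNIV)" for r
    have "E \<inter> E' = (\<pi> -` (A \<inter> A') \<inter> space M') \<inter> cylinder (J \<union> J') B''"
      unfolding E cylinder_def B''_def by (auto split: if_splits)
    moreover have "\<forall>r\<in>J \<union> J'. B'' r \<in> sets borel" using B by (auto simp: B''_def)
    ultimately show "E \<inter> E' \<in> gen"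
      unfolding gen_def using A J by (intro CollectI exI[of _ "A \<inter> A'"] exI[of _ "J \<union> J'"] exI[of _ B'']) auto
  qed
  moreover have "Int_stable ?F"
  proof (rule Int_stableI)
    fix E E' assume "E \<in> ?F" "E' \<in> ?F"
    then obtain D D' where "D \<in> sets borel" "D' \<in> sets borel" "E = ?\<Delta> -` D \<inter> space M'" "E' = ?\<Delta> -` D' \<inter> space M'" by blast
    then show "E \<inter> E' \<in> ?F" by (intro CollectI exI[of _ "D \<inter> D'"]) auto
  qed
  ultimately have I: "indep_set (sigma_sets (space M') gen) (sigma_sets (space M') ?F)" by (rule indep_set_sigma_sets)
  have sub: "sets (G a) \<subseteq> sigma_sets (space M') gen"
    unfolding sets_enlarged_filtration
  proof (rule sigma_sets_mono)
    show "{\<pi> -` A \<inter> space M' | A. A \<in> sets M} \<union> (\<Union>s\<in>{0..a}. {w s -` B \<inter> space M' | B. B \<in> sets borel}) \<subseteq> sigma_sets (space M') gen"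
    proof (intro Un_least subsetI)
      fix E assume "E \<in> {\<pi> -` A \<inter> space M' | A. A \<in> sets M}"
      then obtain A where A: "A \<in> sets M" "E = \<pi> -` A \<inter> space M'" by blast
      then have "E \<in> gen" unfolding gen_def
        by (intro CollectI exI[of _ A] exI[of _ "{}"]) (auto simp: cylinder_def)
      then show "E \<in> sigma_sets (space M') gen" by (rule sigma_sets.Basic)
    next
      fix E assume "E \<in> (\<Union>s\<in>{0..a}. {w s -` B \<inter> space M' | B. B \<in> sets borel})"
      then obtain s B where s: "s \<in> {0..a}" "B \<in> sets borel" "E = w s -` B \<inter> space M'" by blast
      have "E = (\<pi> -` space M \<inter> space M') \<inter> cylinder {s} (\<lambda>_. B)"
        using measurable_space[OF \<pi>_measurable] s by (auto simp: cylinder_def)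
      then have "E \<in> gen" unfolding gen_def using s
        by (intro CollectI exI[of _ "space M"] exI[of _ "{s}"] exI[of _ "\<lambda>_. B"]) auto
      then show "E \<in> sigma_sets (space M') gen" by (rule sigma_sets.Basic)
    qed
  qed
  show ?thesis
  proof (rule indep_setI)
    show "sets (G a) \<subseteq> events" using ab by (intro G_sub) simp
    show "?F \<subseteq> events" by (auto intro!: measurable_sets[OF \<Delta>m])
    show "E \<in> sets (G a) \<Longrightarrow> F \<in> ?F \<Longrightarrow> prob (E \<inter> F) = prob E * prob F" for E F
      using sub by (intro indep_setD[OF I]) (auto intro: sigma_sets.Basic)
  qed
qed

lemma increment_indep_var:
  assumes ab: "0 \<le> a" "a < b" "b \<le> T" and X: "X \<in> borel_measurable (G a)"
  shows "indep_var borel X borel (\<lambda>\<omega>. w b \<omega> - w a \<omega>)"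
proof -
  let ?\<Delta> = "\<lambda>\<omega>. w b \<omega> - w a \<omega>"
  have Xm: "X \<in> borel_measurable M'" using measurable_G_sub[OF X] ab by simp
  have \<Delta>m: "?\<Delta> \<in> borel_measurable M'" using ab by (intro borel_measurable_diff w_measurable) auto
  have s1: "sigma_sets (space M') {X -` A \<inter> space M' | A. A \<in> sets borel} = {X -` A \<inter> space M' | A. A \<in> sets borel}"
    by (rule sigma_sets_vimage_commute[symmetric, of X "space M'" UNIV "sets borel", simplified, THEN trans]) (auto simp: sets.sigma_sets_eq[of borel, simplified])
  have s2: "sigma_sets (space M') {?\<Delta> -` A \<inter> space M' | A. A \<in> sets borel} = {?\<Delta> -` A \<inter> space M' | A. A \<in> sets borel}"
    by (rule sigma_sets_vimage_commute[symmetric, of ?\<Delta> "space M'" UNIV "sets borel", simplified, THEN trans]) (auto simp: sets.sigma_sets_eq[of borel, simplified])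
  have "indep_set {X -` A \<inter> space M' | A. A \<in> sets borel} {?\<Delta> -` A \<inter> space M' | A. A \<in> sets borel}"
  proof (rule indep_setI)
    show "{X -` A \<inter> space M' | A. A \<in> sets borel} \<subseteq> events" by (auto intro!: measurable_sets[OF Xm])
    show "{?\<Delta> -` A \<inter> space M' | A. A \<in> sets borel} \<subseteq> events" by (auto intro!: measurable_sets[OF \<Delta>m])
    show "prob (E \<inter> F) = prob E * prob F" if "E \<in> {X -` A \<inter> space M' | A. A \<in> sets borel}"
      "F \<in> {?\<Delta> -` A \<inter> space M' | A. A \<in> sets borel}" for E F
    proof (rule indep_setD[OF increment_indep_set[OF ab]])
      show "E \<in> sets (G a)" using that(1) measurable_sets[OF X] by (auto simp: space_enlarged_filtration)
    qed (rule that(2))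
  qed
  then show ?thesis unfolding indep_var_eq s1 s2 using Xm \<Delta>m by auto
qed

lemma increment_moments:
  assumes ab: "0 \<le> a" "a < b" "b \<le> T"
  shows "integrable M' (\<lambda>\<omega>. w b \<omega> - w a \<omega>)" "expectation (\<lambda>\<omega>. w b \<omega> - w a \<omega>) = 0"
    "integrable M' (\<lambda>\<omega>. (w b \<omega> - w a \<omega>)\<^sup>2)" "expectation (\<lambda>\<omega>. (w b \<omega> - w a \<omega>)\<^sup>2) = b - a"
proof -
  let ?\<sigma> = "sqrt (b - a)"
  have \<sigma>: "?\<sigma> > 0" using ab by simp
  have d: "distributed M' lborel (\<lambda>\<omega>. w b \<omega> - w a \<omega>) (normal_density 0 ?\<sigma>)"
    using bm ab unfolding standard_brownian_motion_def by blast
  have nn: "\<And>x. 0 \<le> normal_density 0 ?\<sigma> x" by simp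
  show "integrable M' (\<lambda>\<omega>. w b \<omega> - w a \<omega>)"
    using distributed_integrable[OF d _ nn, where g = "\<lambda>x. x"] integrable_normal_moment[OF \<sigma>, of 0 1] by simp
  show "integrable M' (\<lambda>\<omega>. (w b \<omega> - w a \<omega>)\<^sup>2)"
    using distributed_integrable[OF d _ nn, where g = "\<lambda>x. x\<^sup>2"] integrable_normal_moment[OF \<sigma>, of 0 2] by simp
  show "expectation (\<lambda>\<omega>. w b \<omega> - w a \<omega>) = 0"
    by (rule normal_distributed_expectation[OF \<sigma> d])
  have "expectation (\<lambda>\<omega>. (w b \<omega> - w a \<omega>)\<^sup>2) = (\<integral>x. normal_density 0 ?\<sigma> x * x\<^sup>2 \<partial>lborel)"
    using distributed_integral[OF d _ nn, where g = "\<lambda>x. x\<^sup>2"] by simp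
  also have "\<dots> = ?\<sigma>\<^sup>2"
    using integral_normal_moment_even[OF \<sigma>, of 0 1] \<sigma> by (simp add: fact_numeral)
  finally show "expectation (\<lambda>\<omega>. (w b \<omega> - w a \<omega>)\<^sup>2) = b - a" using ab by simp
qed

text \<open>The past sum times \<open>z k\<close> is measurable at time \<open>a k\<close>, hence
  independent of the next increment, whose mean is 0: the cross term vanishes. Boundedness of z and
  square integrability of the past sum make the products integrable.\<close>

lemma isometry:
  assumes a: "\<And>j. j < k \<Longrightarrow> a j \<le> a (Suc j)" "0 \<le> a 0" "a k \<le> T"
    and z: "\<And>j. j < k \<Longrightarrow> z j \<in> borel_measurable (G (a j))"
    and bd: "\<And>j \<omega>. j < k \<Longrightarrow> \<omega> \<in> space M' \<Longrightarrow> \<bar>z j \<omega>\<bar> \<le> B"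
  defines "S \<equiv> \<lambda>k \<omega>. \<Sum>j<k. z j \<omega> * (w (a (Suc j)) \<omega> - w (a j) \<omega>)"
  shows "integrable M' (\<lambda>\<omega>. (S k \<omega>)\<^sup>2) \<and>
    expectation (\<lambda>\<omega>. (S k \<omega>)\<^sup>2) = expectation (\<lambda>\<omega>. \<Sum>j<k. (z j \<omega>)\<^sup>2 * (a (Suc j) - a j))"
  using a z bd
proof (induction k)
  case 0
  then show ?case by (simp add: S_def)
next
  case (Suc k)
  have akk: "a k \<le> a (Suc k)" "a (Suc k) \<le> T" using Suc.prems by auto
  have amono: "a i \<le> a k" if "i \<le> k" for i
    using that
  proof (induction rule: inc_induct)
    case (step n)
    then have "a n \<le> a (Suc n)" using Suc.prems(1)[of n] by simp
    then show ?case using step by simp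
  qed simp
  have a0: "0 \<le> a i" if "i \<le> k" for i
    using that
  proof (induction i)
    case (Suc i)
    then have "a i \<le> a (Suc i)" using Suc.prems \<open>\<And>j. j < Suc k \<Longrightarrow> a j \<le> a (Suc j)\<close> by simp
    then show ?case using Suc by simp
  qed (use Suc.prems in simp)
  have IH: "integrable M' (\<lambda>\<omega>. (S k \<omega>)\<^sup>2)"
    "expectation (\<lambda>\<omega>. (S k \<omega>)\<^sup>2) = expectation (\<lambda>\<omega>. \<Sum>j<k. (z j \<omega>)\<^sup>2 * (a (Suc j) - a j))"
    using Suc.IH Suc.prems akk by auto
  have zm: "z j \<in> borel_measurable M'" if "j \<le> k" for j
    using measurable_G_sub[OF Suc.prems(4), of j] amono[OF that] akk that by auto
  have Sk: "S (Suc k) \<omega> = S k \<omega> + z k \<omega> * (w (a (Suc k)) \<omega> - w (a k) \<omega>)" for \<omega> by (simp add: S_def)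
  have z2i: "integrable M' (\<lambda>\<omega>. (z j \<omega>)\<^sup>2 * c)" if "j \<le> k" for j c
  proof -
    note [measurable] = zm[OF that]
    have "\<bar>z j \<omega>\<bar>\<^sup>2 \<le> B\<^sup>2" if "\<omega> \<in> space M'" for \<omega>
      using Suc.prems(5)[of j \<omega>] \<open>j \<le> k\<close> that by (intro power_mono) auto
    then have "integrable M' (\<lambda>\<omega>. (z j \<omega>)\<^sup>2)"
      by (intro integrable_const_bound[of _ "B\<^sup>2"] AE_I2) auto
    then show ?thesis by simp
  qed
  show ?case
  proof (cases "a k = a (Suc k)")
    \<comment> \<open>A degenerate interval adds nothing; the normal law is available only for
      positive length.\<close>
    case True
    then show ?thesis using IH by (simp add: Sk)
  next
    case False
    then have lt: "0 \<le> a k" "a k < a (Suc k)" "a (Suc k) \<le> T" using akk a0[of k] by auto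
    let ?\<Delta> = "\<lambda>\<omega>. w (a (Suc k)) \<omega> - w (a k) \<omega>"
    note mom = increment_moments[OF lt]
    have SG: "S k \<in> borel_measurable (G (a k))"
      unfolding S_def
    proof (intro borel_measurable_sum borel_measurable_times borel_measurable_diff)
      fix j assume "j \<in> {..<k}"
      then have j: "j < k" by simp
      show "z j \<in> borel_measurable (G (a k))"
        using measurable_G_mono[OF Suc.prems(4)[of j] amono[of j]] j by simp
      show "w (a (Suc j)) \<in> borel_measurable (G (a k))" "w (a j) \<in> borel_measurable (G (a k))"
        using j amono[of "Suc j"] amono[of j] a0[of j] a0[of "Suc j"] by (auto intro!: w_G_measurable)
    qed
    have Sm: "S k \<in> borel_measurable M'" using measurable_G_sub[OF SG] lt by simp
    have zG: "z k \<in> borel_measurable (G (a k))" by (rule Suc.prems(4)) simp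
    note [measurable] = Sm zm[of k, simplified]
    have Si: "integrable M' (S k)" by (rule square_integrable_imp_integrable[OF Sm IH(1)])
    have Szi: "integrable M' (\<lambda>\<omega>. S k \<omega> * z k \<omega>)"
    proof (rule Bochner_Integration.integrable_bound)
      show "integrable M' (\<lambda>\<omega>. B * \<bar>S k \<omega>\<bar>)" using Si by simp
      show "AE \<omega> in M'. norm (S k \<omega> * z k \<omega>) \<le> norm (B * \<bar>S k \<omega>\<bar>)"
      proof (rule AE_I2)
        fix \<omega> assume "\<omega> \<in> space M'"
        then have "\<bar>z k \<omega>\<bar> \<le> B" using Suc.prems(5)[of k \<omega>] by simp
        then have "\<bar>S k \<omega>\<bar> * \<bar>z k \<omega>\<bar> \<le> \<bar>S k \<omega>\<bar> * \<bar>B\<bar>" by (intro mult_left_mono) auto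
        then show "norm (S k \<omega> * z k \<omega>) \<le> norm (B * \<bar>S k \<omega>\<bar>)" by (simp add: abs_mult mult.commute)
      qed
    qed measurable
    have iv1: "indep_var borel (\<lambda>\<omega>. S k \<omega> * z k \<omega>) borel ?\<Delta>"
      using lt SG zG by (intro increment_indep_var borel_measurable_times)
    have c1: "integrable M' (\<lambda>\<omega>. (S k \<omega> * z k \<omega>) * ?\<Delta> \<omega>)" "expectation (\<lambda>\<omega>. (S k \<omega> * z k \<omega>) * ?\<Delta> \<omega>) = 0"
      using indep_var_integrable[OF iv1 Szi mom(1)] indep_var_lebesgue_integral[OF iv1 Szi mom(1)] mom(2) by auto
    have iv2: "indep_var borel (\<lambda>\<omega>. (z k \<omega>)\<^sup>2) borel (\<lambda>\<omega>. (?\<Delta> \<omega>)\<^sup>2)"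
      using indep_var_compose[OF increment_indep_var[OF lt zG], of "\<lambda>x. x\<^sup>2" borel "\<lambda>x. x\<^sup>2" borel]
      by (simp add: comp_def)
    have zi: "integrable M' (\<lambda>\<omega>. (z k \<omega>)\<^sup>2)" using z2i[of k 1] by simp
    have c2: "integrable M' (\<lambda>\<omega>. (z k \<omega>)\<^sup>2 * (?\<Delta> \<omega>)\<^sup>2)"
      "expectation (\<lambda>\<omega>. (z k \<omega>)\<^sup>2 * (?\<Delta> \<omega>)\<^sup>2) = expectation (\<lambda>\<omega>. (z k \<omega>)\<^sup>2) * (a (Suc k) - a k)"
      using indep_var_integrable[OF iv2 zi mom(3)] indep_var_lebesgue_integral[OF iv2 zi mom(3)] mom(4) by auto
    have eq: "(S (Suc k) \<omega>)\<^sup>2 = (S k \<omega>)\<^sup>2 + 2 * ((S k \<omega> * z k \<omega>) * ?\<Delta> \<omega>) + (z k \<omega>)\<^sup>2 * (?\<Delta> \<omega>)\<^sup>2" for \<omega>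
      unfolding Sk by (simp add: power2_eq_square algebra_simps)
    have "expectation (\<lambda>\<omega>. (S (Suc k) \<omega>)\<^sup>2) = expectation (\<lambda>\<omega>. \<Sum>j<k. (z j \<omega>)\<^sup>2 * (a (Suc j) - a j))
      + expectation (\<lambda>\<omega>. (z k \<omega>)\<^sup>2 * (a (Suc k) - a k))"
      unfolding eq using IH c1 c2 by simp
    also have "\<dots> = expectation (\<lambda>\<omega>. \<Sum>j<Suc k. (z j \<omega>)\<^sup>2 * (a (Suc j) - a j))"
      by (subst Bochner_Integration.integral_add[symmetric]) (intro Bochner_Integration.integrable_sum z2i, simp_all add: zi)
    finally show ?thesis unfolding eq using IH c1 c2 by simp
  qed
qed

end

section \<open>Tail bounds and the comparison of two approximations\<close>

context base_brownian begin

text \<open>An inequality of Lenglart type. The integrand is set to zero as soon as its accumulated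
  squared norm exceeds \<delta>. By the isometry the truncated integral has second moment at most
  \<delta>, and it agrees with the original one unless the total squared norm exceeds
  \<delta>.\<close>

lemma truncated_tail:
  assumes a: "\<And>j. j < k \<Longrightarrow> a j \<le> a (Suc j)" "0 \<le> a 0" "a k \<le> T"
    and z: "\<And>j. j < k \<Longrightarrow> z j \<in> borel_measurable (G (a j))"
    and bd: "\<And>j \<omega>. j < k \<Longrightarrow> \<omega> \<in> space M' \<Longrightarrow> \<bar>z j \<omega>\<bar> \<le> B"
    and e: "e > 0" and \<delta>: "\<delta> \<ge> 0"
  shows "prob {\<omega>\<in>space M'. e < \<bar>\<Sum>j<k. z j \<omega> * (w (a (Suc j)) \<omega> - w (a j) \<omega>)\<bar>}
    \<le> prob {\<omega>\<in>space M'. \<delta> < (\<Sum>j<k. (z j \<omega>)\<^sup>2 * (a (Suc j) - a j))} + \<delta> / e\<^sup>2"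
proof -
  have amono: "a i \<le> a j" if "i \<le> j" "j \<le> k" for i j
    using that
  proof (induction rule: inc_induct)
    case (step n)
    then have "a n \<le> a (Suc n)" using a(1)[of n] by simp
    then show ?case using step by simp
  qed simp
  have ain: "a j \<in> {0..T}" if "j \<le> k" for j using amono[of 0 j] amono[of j k] a that by auto
  define c where "c j \<omega> = (z j \<omega>)\<^sup>2 * (a (Suc j) - a j)" for j \<omega>
  have c0: "0 \<le> c j \<omega>" if "j < k" for j \<omega> using a(1)[OF that] by (simp add: c_def)
  \<comment> \<open>The sum includes the current term \<open>c j\<close>. This is still known at
    time \<open>a j\<close>, because \<open>z j\<close> is and the interval lengths are
    deterministic.\<close>
  define y where "y j \<omega> = (if (\<Sum>i\<le>j. c i \<omega>) \<le> \<delta> then z j \<omega> else 0)" for j \<omega>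
  have yG: "y j \<in> borel_measurable (G (a j))" if j: "j < k" for j
  proof -
    have [measurable]: "z i \<in> borel_measurable (G (a j))" if "i \<le> j" for i
      using measurable_G_mono[OF z[of i] amono[of i j]] that j by simp
    have [measurable]: "(\<lambda>\<omega>. \<Sum>i\<le>j. c i \<omega>) \<in> borel_measurable (G (a j))"
      unfolding c_def by (intro borel_measurable_sum borel_measurable_times borel_measurable_power) auto
    show ?thesis unfolding y_def[abs_def] by measurable
  qed
  have ybd: "\<bar>y j \<omega>\<bar> \<le> B" if "j < k" "\<omega> \<in> space M'" for j \<omega>
    using bd[OF that] by (auto simp: y_def)
  define S where "S \<omega> = (\<Sum>j<k. y j \<omega> * (w (a (Suc j)) \<omega> - w (a j) \<omega>))" for \<omega>
  have iso: "integrable M' (\<lambda>\<omega>. (S \<omega>)\<^sup>2)" "expectation (\<lambda>\<omega>. (S \<omega>)\<^sup>2) = expectation (\<lambda>\<omega>. \<Sum>j<k. (y j \<omega>)\<^sup>2 * (a (Suc j) - a j))"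
    unfolding S_def using isometry[of k a y B, OF a yG ybd] by auto
  have yle: "(\<Sum>j<k. (y j \<omega>)\<^sup>2 * (a (Suc j) - a j)) \<le> \<delta>" for \<omega>
  proof -
    have "(\<Sum>j<k. (y j \<omega>)\<^sup>2 * (a (Suc j) - a j)) = (\<Sum>j<k. if (\<Sum>i\<le>j. c i \<omega>) \<le> \<delta> then c j \<omega> else 0)"
      by (intro sum.cong refl) (simp add: y_def c_def)
    also have "\<dots> \<le> \<delta>" using c0 \<delta> by (intro sum_truncated_le) auto
    finally show ?thesis .
  qed
  have zm: "z j \<in> borel_measurable M'" if "j < k" for j
    using measurable_G_sub[OF z[OF that]] ain[of j] that by simp
  have ym: "y j \<in> borel_measurable M'" if "j < k" for j
    using measurable_G_sub[OF yG[OF that]] ain[of j] that by simp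
  have Sm[measurable]: "S \<in> borel_measurable M'"
    unfolding S_def[abs_def] using ym ain
    by (intro borel_measurable_sum borel_measurable_times borel_measurable_diff w_measurable) auto
  have Qm[measurable]: "(\<lambda>\<omega>. \<Sum>j<k. (z j \<omega>)\<^sup>2 * (a (Suc j) - a j)) \<in> borel_measurable M'"
    using zm by (intro borel_measurable_sum borel_measurable_times borel_measurable_power) auto
  have "prob {\<omega>\<in>space M'. e < \<bar>\<Sum>j<k. z j \<omega> * (w (a (Suc j)) \<omega> - w (a j) \<omega>)\<bar>}
    \<le> prob ({\<omega>\<in>space M'. \<delta> < (\<Sum>j<k. (z j \<omega>)\<^sup>2 * (a (Suc j) - a j))} \<union> {\<omega>\<in>space M'. e\<^sup>2 \<le> (S \<omega>)\<^sup>2})"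
  proof (rule finite_measure_mono)
    show "{\<omega>\<in>space M'. e < \<bar>\<Sum>j<k. z j \<omega> * (w (a (Suc j)) \<omega> - w (a j) \<omega>)\<bar>} \<subseteq>
      {\<omega>\<in>space M'. \<delta> < (\<Sum>j<k. (z j \<omega>)\<^sup>2 * (a (Suc j) - a j))} \<union> {\<omega>\<in>space M'. e\<^sup>2 \<le> (S \<omega>)\<^sup>2}"
    proof safe
      fix \<omega> assume w: "\<omega> \<in> space M'" and big: "e < \<bar>\<Sum>j<k. z j \<omega> * (w (a (Suc j)) \<omega> - w (a j) \<omega>)\<bar>"
        and n: "\<not> e\<^sup>2 \<le> (S \<omega>)\<^sup>2"
      show "\<delta> < (\<Sum>j<k. (z j \<omega>)\<^sup>2 * (a (Suc j) - a j))"
      proof (rule ccontr)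
        assume "\<not> \<delta> < (\<Sum>j<k. (z j \<omega>)\<^sup>2 * (a (Suc j) - a j))"
        then have tot: "(\<Sum>j<k. c j \<omega>) \<le> \<delta>" by (simp add: c_def)
        have "y j \<omega> = z j \<omega>" if "j < k" for j
        proof -
          have "(\<Sum>i\<le>j. c i \<omega>) \<le> (\<Sum>i<k. c i \<omega>)" using that c0 by (intro sum_mono2) auto
          then show ?thesis using tot by (simp add: y_def)
        qed
        then have "S \<omega> = (\<Sum>j<k. z j \<omega> * (w (a (Suc j)) \<omega> - w (a j) \<omega>))" by (simp add: S_def)
        then have "e < \<bar>S \<omega>\<bar>" using big by simp
        then have "e\<^sup>2 \<le> \<bar>S \<omega>\<bar>\<^sup>2" using e by (intro power_mono) auto
        then show False using n by simp
      qed
    qed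
  qed measurable
  also have "\<dots> \<le> prob {\<omega>\<in>space M'. \<delta> < (\<Sum>j<k. (z j \<omega>)\<^sup>2 * (a (Suc j) - a j))} + prob {\<omega>\<in>space M'. e\<^sup>2 \<le> (S \<omega>)\<^sup>2}"
    by (rule measure_Un_le) measurable
  also have "prob {\<omega>\<in>space M'. e\<^sup>2 \<le> (S \<omega>)\<^sup>2} \<le> expectation (\<lambda>\<omega>. (S \<omega>)\<^sup>2) / e\<^sup>2"
    using e by (intro integral_Markov_inequality_measure[where A = "space M'", OF iso(1)]) auto
  also have "expectation (\<lambda>\<omega>. (S \<omega>)\<^sup>2) \<le> \<delta>"
  proof -
    have "expectation (\<lambda>\<omega>. \<Sum>j<k. (y j \<omega>)\<^sup>2 * (a (Suc j) - a j)) \<le> expectation (\<lambda>\<omega>. \<delta>)"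
    proof (rule integral_mono)
      have [measurable]: "(\<lambda>\<omega>. \<Sum>j<k. (y j \<omega>)\<^sup>2 * (a (Suc j) - a j)) \<in> borel_measurable M'"
        using ym by (intro borel_measurable_sum borel_measurable_times borel_measurable_power) auto
      have "0 \<le> (\<Sum>j<k. (y j \<omega>)\<^sup>2 * (a (Suc j) - a j))" for \<omega> using a(1) by (intro sum_nonneg mult_nonneg_nonneg) auto
      then show "integrable M' (\<lambda>\<omega>. \<Sum>j<k. (y j \<omega>)\<^sup>2 * (a (Suc j) - a j))"
        using yle by (intro integrable_const_bound[of _ \<delta>] AE_I2) auto
    qed (use yle in auto)
    then show ?thesis using iso(2) by (simp add: prob_space)
  qed
  finally show ?thesis using e by (simp add: divide_right_mono)
qed

text \<open>Stopping at t amounts to a simple integrand on the points min(\<sigma> j, t), whose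
  squared norm is at most the original one.\<close>

lemma simple_integral_tail:
  assumes si: "simple_integrand T G n \<sigma> \<zeta>" and t: "t \<in> {0..T}" and e: "e > 0" and \<delta>: "\<delta> \<ge> 0"
  shows "prob {\<omega>\<in>space M'. e < \<bar>simple_integral w n \<sigma> \<zeta> t \<omega>\<bar>}
    \<le> prob {\<omega>\<in>space M'. \<delta> < (\<Sum>j<n. (\<zeta> j \<omega>)\<^sup>2 * (\<sigma> (Suc j) - \<sigma> j))} + \<delta> / e\<^sup>2"
proof -
  have \<sigma>: "0 \<le> \<sigma> 0" "\<And>j. j < n \<Longrightarrow> \<sigma> j \<le> \<sigma> (Suc j)" "\<sigma> n \<le> T"
    and \<zeta>: "\<And>j. j < n \<Longrightarrow> \<zeta> j \<in> borel_measurable (G (\<sigma> j))"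
    using si by (auto simp: simple_integrand_def)
  obtain B where B: "\<And>j \<omega>. j < n \<Longrightarrow> \<omega> \<in> space M' \<Longrightarrow> \<bar>\<zeta> j \<omega>\<bar> \<le> B"
    using si unfolding simple_integrand_def space_enlarged_filtration by blast
  define a where "a j = min (\<sigma> j) t" for j
  \<comment> \<open>For \<sigma> j beyond t the stopped point is t, where \<open>\<zeta> j\<close>
    may not yet be measurable. The stopped increment is zero from \<sigma> j = t on, so the
    coefficient can be replaced by 0.\<close>
  define z where "z j \<omega> = (if \<sigma> j < t then \<zeta> j \<omega> else 0)" for j \<omega>
  have eq: "simple_integral w n \<sigma> \<zeta> t \<omega> = (\<Sum>j<n. z j \<omega> * (w (a (Suc j)) \<omega> - w (a j) \<omega>))" for \<omega>
    unfolding simple_integral_def a_def z_def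
  proof (intro sum.cong refl)
    fix j assume "j \<in> {..<n}"
    then have "\<sigma> j \<le> \<sigma> (Suc j)" using \<sigma> by simp
    then show "\<zeta> j \<omega> * (w (min (\<sigma> (Suc j)) t) \<omega> - w (min (\<sigma> j) t) \<omega>) =
         (if \<sigma> j < t then \<zeta> j \<omega> else 0) * (w (min (\<sigma> (Suc j)) t) \<omega> - w (min (\<sigma> j) t) \<omega>)"
      by (auto simp: min_def)
  qed
  have \<sigma>in: "\<sigma> j \<le> T" if "j \<le> n" for j
    using that
  proof (induction rule: inc_induct)
    case (step i)
    then show ?case using \<sigma>(2)[of i] by simp
  qed (use \<sigma> in simp)
  have am: "a j \<le> a (Suc j)" if "j < n" for j using \<sigma>(2)[OF that] by (simp add: a_def min_def)
  have zG: "z j \<in> borel_measurable (G (a j))" if "j < n" for j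
  proof (cases "\<sigma> j < t")
    case True
    then have "z j = \<zeta> j" "a j = \<sigma> j" by (auto simp: z_def a_def)
    then show ?thesis using \<zeta>[OF that] by simp
  next
    case False
    then have "z j = (\<lambda>_. 0)" by (auto simp: z_def)
    then show ?thesis by simp
  qed
  have B0: "\<bar>z j \<omega>\<bar> \<le> B" if "j < n" "\<omega> \<in> space M'" for j \<omega>
    using B[OF that] by (auto simp: z_def)
  have "prob {\<omega>\<in>space M'. e < \<bar>simple_integral w n \<sigma> \<zeta> t \<omega>\<bar>}
    \<le> prob {\<omega>\<in>space M'. \<delta> < (\<Sum>j<n. (z j \<omega>)\<^sup>2 * (a (Suc j) - a j))} + \<delta> / e\<^sup>2"
    unfolding eq using \<sigma> t by (intro truncated_tail[where B = B] am zG B0 e \<delta>) (auto simp: a_def min_def)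
  also have "prob {\<omega>\<in>space M'. \<delta> < (\<Sum>j<n. (z j \<omega>)\<^sup>2 * (a (Suc j) - a j))}
    \<le> prob {\<omega>\<in>space M'. \<delta> < (\<Sum>j<n. (\<zeta> j \<omega>)\<^sup>2 * (\<sigma> (Suc j) - \<sigma> j))}"
  proof (rule finite_measure_mono)
    have "(\<Sum>j<n. (z j \<omega>)\<^sup>2 * (a (Suc j) - a j)) \<le> (\<Sum>j<n. (\<zeta> j \<omega>)\<^sup>2 * (\<sigma> (Suc j) - \<sigma> j))" for \<omega>
    proof (intro sum_mono mult_mono)
      fix j assume "j \<in> {..<n}"
      then have j: "j < n" by simp
      show "a (Suc j) - a j \<le> \<sigma> (Suc j) - \<sigma> j" using \<sigma>(2)[OF j] by (simp add: a_def min_def)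
      show "0 \<le> a (Suc j) - a j" using am[OF j] by simp
    qed (auto simp: z_def)
    then show "{\<omega>\<in>space M'. \<delta> < (\<Sum>j<n. (z j \<omega>)\<^sup>2 * (a (Suc j) - a j))} \<subseteq>
      {\<omega>\<in>space M'. \<delta> < (\<Sum>j<n. (\<zeta> j \<omega>)\<^sup>2 * (\<sigma> (Suc j) - \<sigma> j))}" by (auto intro: less_le_trans)
    have [measurable]: "(\<lambda>\<omega>. \<Sum>j<n. (\<zeta> j \<omega>)\<^sup>2 * (\<sigma> (Suc j) - \<sigma> j)) \<in> borel_measurable M'"
      using \<zeta> \<sigma>in by (intro borel_measurable_sum borel_measurable_times borel_measurable_power measurable_G_sub[OF \<zeta>]) auto
    show "{\<omega>\<in>space M'. \<delta> < (\<Sum>j<n. (\<zeta> j \<omega>)\<^sup>2 * (\<sigma> (Suc j) - \<sigma> j))} \<in> events" by measurable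
  qed
  finally show ?thesis by simp
qed

lemma refine_integrand_measurable:
  assumes \<eta>: "\<And>j. j < k \<Longrightarrow> \<eta> j \<in> borel_measurable (G (\<tau> j))"
  shows "refine_integrand k \<tau> \<eta> \<sigma> i \<in> borel_measurable (G (\<sigma> i))"
  unfolding refine_integrand_def[abs_def]
proof (rule borel_measurable_sum)
  fix j assume "j \<in> {..<k}"
  then have "j < k" by simp
  then show "(\<lambda>\<omega>. if \<tau> j \<le> \<sigma> i \<and> \<sigma> (Suc i) \<le> \<tau> (Suc j) then \<eta> j \<omega> else 0) \<in> borel_measurable (G (\<sigma> i))"
    using measurable_G_mono[OF \<eta>[of j], of "\<sigma> i"] by (cases "\<tau> j \<le> \<sigma> i \<and> \<sigma> (Suc i) \<le> \<tau> (Suc j)") auto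
qed

lemma refine_integrand_bound:
  assumes "\<And>j. j < k \<Longrightarrow> \<bar>\<eta> j \<omega>\<bar> \<le> B"
  shows "\<bar>refine_integrand k \<tau> \<eta> \<sigma> i \<omega>\<bar> \<le> real k * \<bar>B\<bar>"
proof -
  have "\<bar>refine_integrand k \<tau> \<eta> \<sigma> i \<omega>\<bar> \<le> (\<Sum>j<k. \<bar>if \<tau> j \<le> \<sigma> i \<and> \<sigma> (Suc i) \<le> \<tau> (Suc j) then \<eta> j \<omega> else 0\<bar>)"
    unfolding refine_integrand_def by (rule sum_abs)
  also have "\<dots> \<le> (\<Sum>j<k. \<bar>B\<bar>)"
  proof (rule sum_mono)
    fix j assume "j \<in> {..<k}"
    then show "\<bar>if \<tau> j \<le> \<sigma> i \<and> \<sigma> (Suc i) \<le> \<tau> (Suc j) then \<eta> j \<omega> else 0\<bar> \<le> \<bar>B\<bar>"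
      using assms[of j] by auto
  qed
  finally show ?thesis by simp
qed

text \<open>The points of both partitions are sorted into one strictly increasing list. This removes
  the degenerate intervals that simple integrands allow and makes the squared norm of the difference
  computable block by block.\<close>

lemma merge_simple:
  assumes s1: "simple_integrand T G k \<tau> \<eta>" and s2: "simple_integrand T G k' \<tau>' \<eta>'"
  shows "\<exists>n \<sigma> \<zeta>. simple_integrand T G n \<sigma> \<zeta> \<and> (\<forall>i j. i < j \<longrightarrow> j \<le> n \<longrightarrow> \<sigma> i < \<sigma> j) \<and>
    (\<forall>s \<omega>. simple_process n \<sigma> \<zeta> s \<omega> = simple_process k \<tau> \<eta> s \<omega> - simple_process k' \<tau>' \<eta>' s \<omega>) \<and>
    (\<forall>t \<omega>. simple_integral w n \<sigma> \<zeta> t \<omega> = simple_integral w k \<tau> \<eta> t \<omega> - simple_integral w k' \<tau>' \<eta>' t \<omega>)"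
proof -
  have in1: "\<tau> j \<in> {0..T}" if "j \<le> k" and s: "simple_integrand T G k \<tau> \<eta>" for j k and \<tau> :: "nat \<Rightarrow> real" and \<eta> :: "nat \<Rightarrow> 'b \<Rightarrow> real"
  proof -
    have m: "0 \<le> \<tau> 0" "\<And>j. j < k \<Longrightarrow> \<tau> j \<le> \<tau> (Suc j)" "\<tau> k \<le> T" using s by (auto simp: simple_integrand_def)
    have "\<tau> j \<le> T" using \<open>j \<le> k\<close>
    proof (induction rule: inc_induct)
      case (step i)
      then show ?case using m(2)[of i] by simp
    qed (use m in simp)
    moreover have "0 \<le> \<tau> j" using \<open>j \<le> k\<close>
    proof (induction j)
      case (Suc j)
      then show ?case using m(2)[of j] by simp
    qed (use m in simp)
    ultimately show ?thesis by simp
  qed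
  define P where "P = \<tau> ` {..k} \<union> \<tau>' ` {..k'}"
  have P: "finite P" "P \<noteq> {}" "P \<subseteq> {0..T}" unfolding P_def using in1[OF _ s1] in1[OF _ s2] by auto
  define S where "S = sorted_list_of_set P"
  have setS: "set S = P" unfolding S_def by (rule set_sorted_list_of_set[OF P(1)])
  have sw: "sorted_wrt (<) S" unfolding S_def by (rule strict_sorted_list_of_set)
  \<comment> \<open>Counts blocks, one fewer than the points.\<close>
  define n where "n = length S - 1"
  have len: "length S = Suc n" using P(2) setS by (cases S) (auto simp: n_def)
  define \<sigma> where "\<sigma> i = S ! i" for i
  have \<sigma>: "\<sigma> i < \<sigma> j" if "i < j" "j \<le> n" for i j
    unfolding \<sigma>_def using sw that len by (auto simp: sorted_wrt_iff_nth_less)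
  have \<sigma>P: "P = \<sigma> ` {..n}"
    unfolding setS[symmetric] \<sigma>_def set_conv_nth len by (auto simp: less_Suc_eq_le)
  have \<sigma>in: "\<sigma> i \<in> {0..T}" if "i \<le> n" for i using \<sigma>P P(3) that by auto
  define \<zeta> where "\<zeta> i \<omega> = refine_integrand k \<tau> \<eta> \<sigma> i \<omega> - refine_integrand k' \<tau>' \<eta>' \<sigma> i \<omega>" for i \<omega>
  have m1: "\<And>j. j < k \<Longrightarrow> \<tau> j \<le> \<tau> (Suc j)" and m2: "\<And>j. j < k' \<Longrightarrow> \<tau>' j \<le> \<tau>' (Suc j)"
    using s1 s2 by (auto simp: simple_integrand_def)
  have sub1: "\<tau> j \<in> \<sigma> ` {..n}" if "j \<le> k" for j unfolding \<sigma>P[symmetric] P_def using that by auto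
  have sub2: "\<tau>' j \<in> \<sigma> ` {..n}" if "j \<le> k'" for j unfolding \<sigma>P[symmetric] P_def using that by auto
  have gen: "(\<Sum>i<n. \<zeta> i \<omega> * (F (\<sigma> (Suc i)) - F (\<sigma> i))) =
    (\<Sum>j<k. \<eta> j \<omega> * (F (\<tau> (Suc j)) - F (\<tau> j))) - (\<Sum>j<k'. \<eta>' j \<omega> * (F (\<tau>' (Suc j)) - F (\<tau>' j)))" for F :: "real \<Rightarrow> real" and \<omega>
    unfolding \<zeta>_def left_diff_distrib sum_subtractf
    using refine_integrand_sum[where \<sigma> = \<sigma> and n = n and F = F and k = k and \<tau> = \<tau> and \<eta> = \<eta> and \<omega> = \<omega>, OF \<sigma> m1 sub1]
      refine_integrand_sum[where \<sigma> = \<sigma> and n = n and F = F and k = k' and \<tau> = \<tau>' and \<eta> = \<eta>' and \<omega> = \<omega>, OF \<sigma> m2 sub2] by simp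
  have m: "\<And>i. i < n \<Longrightarrow> \<sigma> i \<le> \<sigma> (Suc i)" using \<sigma> by (simp add: less_imp_le)
  show ?thesis
  proof (rule exI[of _ n], rule exI[of _ \<sigma>], rule exI[of _ \<zeta>], intro conjI allI impI)
    show "simple_integrand T G n \<sigma> \<zeta>"
      unfolding simple_integrand_def
    proof (intro conjI allI impI)
      show "\<zeta> j \<in> borel_measurable (G (\<sigma> j))" for j
        unfolding \<zeta>_def[abs_def] using s1 s2
        by (intro borel_measurable_diff refine_integrand_measurable) (auto simp: simple_integrand_def)
      obtain B B' where B: "\<And>j \<omega>. j < k \<Longrightarrow> \<omega> \<in> space M' \<Longrightarrow> \<bar>\<eta> j \<omega>\<bar> \<le> B" "\<And>j \<omega>. j < k' \<Longrightarrow> \<omega> \<in> space M' \<Longrightarrow> \<bar>\<eta>' j \<omega>\<bar> \<le> B'"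
        using s1 s2 unfolding simple_integrand_def space_enlarged_filtration by metis
      have "\<bar>\<zeta> j \<omega>\<bar> \<le> real k * \<bar>B\<bar> + real k' * \<bar>B'\<bar>" if "\<omega> \<in> space M'" for j \<omega>
        using refine_integrand_bound[of k \<eta> \<omega> B \<tau> \<sigma> j] refine_integrand_bound[of k' \<eta>' \<omega> B' \<tau>' \<sigma> j] B that
        unfolding \<zeta>_def by (intro order_trans[OF abs_triangle_ineq4] add_mono) auto
      then show "\<exists>B. \<forall>j<n. \<forall>\<omega>\<in>space (G (\<sigma> j)). \<bar>\<zeta> j \<omega>\<bar> \<le> B" unfolding space_enlarged_filtration by blast
    qed (use \<sigma>in[of 0] \<sigma>in[of n] m in auto)
    show "simple_process n \<sigma> \<zeta> s \<omega> = simple_process k \<tau> \<eta> s \<omega> - simple_process k' \<tau>' \<eta>' s \<omega>" for s \<omega>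
    proof -
      let ?F = "\<lambda>x. if s \<le> x then 1 else (0 :: real)"
      have "simple_process n \<sigma> \<zeta> s \<omega> = (\<Sum>i<n. \<zeta> i \<omega> * (?F (\<sigma> (Suc i)) - ?F (\<sigma> i)))"
        by (rule simple_process_as_increments) (rule m)
      moreover have "simple_process k \<tau> \<eta> s \<omega> = (\<Sum>i<k. \<eta> i \<omega> * (?F (\<tau> (Suc i)) - ?F (\<tau> i)))"
        by (rule simple_process_as_increments) (rule m1)
      moreover have "simple_process k' \<tau>' \<eta>' s \<omega> = (\<Sum>i<k'. \<eta>' i \<omega> * (?F (\<tau>' (Suc i)) - ?F (\<tau>' i)))"
        by (rule simple_process_as_increments) (rule m2)
      ultimately show ?thesis using gen[of \<omega> ?F] by linarith
    qed
    show "simple_integral w n \<sigma> \<zeta> t \<omega> = simple_integral w k \<tau> \<eta> t \<omega> - simple_integral w k' \<tau>' \<eta>' t \<omega>" for t \<omega>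
      unfolding simple_integral_def by (rule gen[of \<omega> "\<lambda>x. w (min x t) \<omega>"])
  qed (fact \<sigma>)
qed

text \<open>The blocks are disjoint, so at each s at most one summand survives and squaring commutes
  with the sum.\<close>

lemma simple_process_square_integral:
  assumes \<sigma>: "\<And>i j. i < j \<Longrightarrow> j \<le> n \<Longrightarrow> \<sigma> i < \<sigma> j" and r: "0 \<le> \<sigma> 0" "\<sigma> n \<le> T"
  shows "(\<integral>\<^sup>+s\<in>{0..T}. ennreal ((simple_process n \<sigma> \<zeta> s \<omega>)\<^sup>2) \<partial>lborel) = ennreal (\<Sum>i<n. (\<zeta> i \<omega>)\<^sup>2 * (\<sigma> (Suc i) - \<sigma> i))"
proof -
  have le: "\<sigma> i \<le> \<sigma> j" if "i \<le> j" "j \<le> n" for i j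
    using \<sigma>[of i j] that by (cases "i = j") auto
  have pw: "ennreal ((simple_process n \<sigma> \<zeta> s \<omega>)\<^sup>2) * indicator {0..T} s = (\<Sum>i<n. ennreal ((\<zeta> i \<omega>)\<^sup>2) * indicator {\<sigma> i<..\<sigma> (Suc i)} s)" for s
  proof (cases "\<exists>i<n. s \<in> {\<sigma> i<..\<sigma> (Suc i)}")
    case True
    then obtain i where i: "i < n" "\<sigma> i < s" "s \<le> \<sigma> (Suc i)" by auto
    have other: "s \<in> {\<sigma> j<..\<sigma> (Suc j)} \<longleftrightarrow> j = i" if "j < n" for j
    proof -
      consider "j < i" | "j = i" | "j > i" by linarith
      then show ?thesis
      proof cases
        case 1
        then have "\<sigma> (Suc j) \<le> \<sigma> i" using i by (intro le) auto
        then show ?thesis using 1 i by auto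
      next
        case 3
        then have "\<sigma> (Suc i) \<le> \<sigma> j" using that by (intro le) auto
        then show ?thesis using 3 i by auto
      qed (use i in auto)
    qed
    have "simple_process n \<sigma> \<zeta> s \<omega> = (\<Sum>j<n. if j = i then \<zeta> j \<omega> else 0)"
      unfolding simple_process_def by (intro sum.cong refl) (use other in \<open>simp add: indicator_def\<close>)
    also have "\<dots> = \<zeta> i \<omega>" using i by (subst sum.delta) auto
    finally have 1: "simple_process n \<sigma> \<zeta> s \<omega> = \<zeta> i \<omega>" .
    have "(\<Sum>j<n. ennreal ((\<zeta> j \<omega>)\<^sup>2) * indicator {\<sigma> j<..\<sigma> (Suc j)} s) = (\<Sum>j<n. if j = i then ennreal ((\<zeta> j \<omega>)\<^sup>2) else 0)"
      by (intro sum.cong refl) (use other in \<open>simp add: indicator_def\<close>)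
    also have "\<dots> = ennreal ((\<zeta> i \<omega>)\<^sup>2)" using i by (subst sum.delta) auto
    finally have 2: "(\<Sum>j<n. ennreal ((\<zeta> j \<omega>)\<^sup>2) * indicator {\<sigma> j<..\<sigma> (Suc j)} s) = ennreal ((\<zeta> i \<omega>)\<^sup>2)" .
    have "s \<in> {0..T}" using i le[of 0 i] le[of "Suc i" n] r by auto
    then show ?thesis unfolding 1 2 by simp
  next
    case False
    then have out: "s \<notin> {\<sigma> j<..\<sigma> (Suc j)}" if "j < n" for j using that by blast
    have "simple_process n \<sigma> \<zeta> s \<omega> = 0"
      unfolding simple_process_def using out by (intro sum.neutral) (auto simp: indicator_def)
    moreover have "(\<Sum>j<n. ennreal ((\<zeta> j \<omega>)\<^sup>2) * indicator {\<sigma> j<..\<sigma> (Suc j)} s) = 0"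
      using out by (intro sum.neutral) (auto simp: indicator_def)
    ultimately show ?thesis by simp
  qed
  have "(\<integral>\<^sup>+s\<in>{0..T}. ennreal ((simple_process n \<sigma> \<zeta> s \<omega>)\<^sup>2) \<partial>lborel)
    = (\<Sum>i<n. \<integral>\<^sup>+s. ennreal ((\<zeta> i \<omega>)\<^sup>2) * indicator {\<sigma> i<..\<sigma> (Suc i)} s \<partial>lborel)"
    unfolding pw by (rule nn_integral_sum) simp
  also have "\<dots> = (\<Sum>i<n. ennreal ((\<zeta> i \<omega>)\<^sup>2 * (\<sigma> (Suc i) - \<sigma> i)))"
    using le by (intro sum.cong refl) (simp add: nn_integral_cmult_indicator ennreal_mult)
  also have "\<dots> = ennreal (\<Sum>i<n. (\<zeta> i \<omega>)\<^sup>2 * (\<sigma> (Suc i) - \<sigma> i))"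
    using le by (intro sum_ennreal) simp
  finally show ?thesis .
qed

text \<open>Both approximating sequences are close to H, so their difference, a simple integrand on
  a common refinement, has a small squared norm and by the tail bound a small integral. Letting n
  tend to infinity and then \<delta> to 0 gives equality almost surely at each time; continuity
  extends it from the dyadic times to all times at once.\<close>

lemma ito_integral_unique:
  assumes I: "is_ito_integral T M' G w H I" and J: "is_ito_integral T M' G w H J"
    and H: "\<And>\<omega>. \<omega> \<in> space M' \<Longrightarrow> continuous_on {0..T} (\<lambda>s. H s \<omega>)"
  shows "AE \<omega> in M'. \<forall>t\<in>{0..T}. I t \<omega> = J t \<omega>"
proof -
  obtain k \<tau> \<eta> where 1: "\<And>n. simple_integrand T G (k n) (\<tau> n) (\<eta> n)"
      "null_in_probability M' (\<lambda>n \<omega>. \<integral>\<^sup>+s\<in>{0..T}. ennreal ((simple_process (k n) (\<tau> n) (\<eta> n) s \<omega> - H s \<omega>)\<^sup>2) \<partial>lborel)"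
      "null_in_probability M' (\<lambda>n \<omega>. SUP t\<in>{0..T}. ennreal \<bar>simple_integral w (k n) (\<tau> n) (\<eta> n) t \<omega> - I t \<omega>\<bar>)"
    using I unfolding is_ito_integral_def by blast
  obtain k' \<tau>' \<eta>' where 2: "\<And>n. simple_integrand T G (k' n) (\<tau>' n) (\<eta>' n)"
      "null_in_probability M' (\<lambda>n \<omega>. \<integral>\<^sup>+s\<in>{0..T}. ennreal ((simple_process (k' n) (\<tau>' n) (\<eta>' n) s \<omega> - H s \<omega>)\<^sup>2) \<partial>lborel)"
      "null_in_probability M' (\<lambda>n \<omega>. SUP t\<in>{0..T}. ennreal \<bar>simple_integral w (k' n) (\<tau>' n) (\<eta>' n) t \<omega> - J t \<omega>\<bar>)"
    using J unfolding is_ito_integral_def by blast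
  define Q where "Q n \<omega> = (\<integral>\<^sup>+s\<in>{0..T}. ennreal ((simple_process (k n) (\<tau> n) (\<eta> n) s \<omega> - H s \<omega>)\<^sup>2) \<partial>lborel)" for n \<omega>
  define Q' where "Q' n \<omega> = (\<integral>\<^sup>+s\<in>{0..T}. ennreal ((simple_process (k' n) (\<tau>' n) (\<eta>' n) s \<omega> - H s \<omega>)\<^sup>2) \<partial>lborel)" for n \<omega>
  define R where "R n \<omega> = (SUP t\<in>{0..T}. ennreal \<bar>simple_integral w (k n) (\<tau> n) (\<eta> n) t \<omega> - I t \<omega>\<bar>)" for n \<omega>
  define R' where "R' n \<omega> = (SUP t\<in>{0..T}. ennreal \<bar>simple_integral w (k' n) (\<tau>' n) (\<eta>' n) t \<omega> - J t \<omega>\<bar>)" for n \<omega>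
  have nQ: "null_in_probability M' Q" using 1(2) unfolding Q_def[abs_def] .
  have nQ': "null_in_probability M' Q'" using 2(2) unfolding Q'_def[abs_def] .
  have nR: "null_in_probability M' R" using 1(3) unfolding R_def[abs_def] .
  have nR': "null_in_probability M' R'" using 2(3) unfolding R'_def[abs_def] .
  have Qm[measurable]: "Q n \<in> borel_measurable M'" "Q' n \<in> borel_measurable M'" "R n \<in> borel_measurable M'" "R' n \<in> borel_measurable M'" for n
    using nQ nQ' nR nR' by (auto simp: null_in_probability_def)
  have Im: "I t \<in> borel_measurable M'" "J t \<in> borel_measurable M'" if "t \<in> {0..T}" for t
    using I J that by (auto simp: is_ito_integral_def)
  \<comment> \<open>The distance 3 e splits into I against its approximation, J against its own, and
    the difference of the two. The squared norm of that difference exceeds \<delta> only if one of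
    the two errors exceeds \<delta>/4, because (u - v)^2 \<le> 2 (u - H)^2 + 2 (v - H)^2.\<close>
  have key: "prob {\<omega>\<in>space M'. 3 * e < \<bar>I t \<omega> - J t \<omega>\<bar>} \<le> \<delta> / e\<^sup>2" if t: "t \<in> {0..T}" and e: "e > 0" and \<delta>: "\<delta> > 0" for t e \<delta>
  proof -
    have bound: "prob {\<omega>\<in>space M'. 3 * e < \<bar>I t \<omega> - J t \<omega>\<bar>} \<le>
      prob {\<omega>\<in>space M'. ennreal e < R n \<omega>} + prob {\<omega>\<in>space M'. ennreal e < R' n \<omega>} +
      (prob {\<omega>\<in>space M'. ennreal (\<delta> / 4) < Q n \<omega>} + prob {\<omega>\<in>space M'. ennreal (\<delta> / 4) < Q' n \<omega>} + \<delta> / e\<^sup>2)" for n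
    proof -
      obtain m \<sigma> \<zeta> where mrg0: "simple_integrand T G m \<sigma> \<zeta>" "\<forall>i j. i < j \<longrightarrow> j \<le> m \<longrightarrow> \<sigma> i < \<sigma> j"
        "\<forall>s \<omega>. simple_process m \<sigma> \<zeta> s \<omega> = simple_process (k n) (\<tau> n) (\<eta> n) s \<omega> - simple_process (k' n) (\<tau>' n) (\<eta>' n) s \<omega>"
        "\<forall>t \<omega>. simple_integral w m \<sigma> \<zeta> t \<omega> = simple_integral w (k n) (\<tau> n) (\<eta> n) t \<omega> - simple_integral w (k' n) (\<tau>' n) (\<eta>' n) t \<omega>"
        using merge_simple[OF 1(1)[of n] 2(1)[of n]] by blast
      note mrg = mrg0(1) mrg0(2)[rule_format] mrg0(3)[rule_format] mrg0(4)[rule_format]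
      have \<sigma>: "0 \<le> \<sigma> 0" "\<sigma> m \<le> T" and \<zeta>: "\<And>j. j < m \<Longrightarrow> \<zeta> j \<in> borel_measurable (G (\<sigma> j))" using mrg(1) by (auto simp: simple_integrand_def)
      have \<sigma>in: "\<sigma> j \<in> {0..T}" if "j \<le> m" for j
        using mrg(2)[of 0 j] mrg(2)[of j m] \<sigma> that by (cases "j = 0"; cases "j = m") (auto simp: less_imp_le)
      have Sm[measurable]: "simple_integral w m \<sigma> \<zeta> t \<in> borel_measurable M'"
        using \<sigma>in by (intro simple_integral_measurable[where T = T] w_measurable t measurable_G_sub[OF \<zeta>]) auto
      have qm[measurable]: "(\<lambda>\<omega>. \<Sum>j<m. (\<zeta> j \<omega>)\<^sup>2 * (\<sigma> (Suc j) - \<sigma> j)) \<in> borel_measurable M'"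
        using \<sigma>in by (intro borel_measurable_sum borel_measurable_times borel_measurable_power measurable_G_sub[OF \<zeta>]) auto
      let ?q = "\<lambda>\<omega>. \<Sum>j<m. (\<zeta> j \<omega>)\<^sup>2 * (\<sigma> (Suc j) - \<sigma> j)"
      let ?E1 = "{\<omega>\<in>space M'. ennreal e < R n \<omega>}" and ?E2 = "{\<omega>\<in>space M'. ennreal e < R' n \<omega>}"
        and ?E3 = "{\<omega>\<in>space M'. e < \<bar>simple_integral w m \<sigma> \<zeta> t \<omega>\<bar>}"
        and ?F1 = "{\<omega>\<in>space M'. ennreal (\<delta> / 4) < Q n \<omega>}" and ?F2 = "{\<omega>\<in>space M'. ennreal (\<delta> / 4) < Q' n \<omega>}"
      have "prob {\<omega>\<in>space M'. 3 * e < \<bar>I t \<omega> - J t \<omega>\<bar>} \<le> prob (?E1 \<union> ?E2 \<union> ?E3)"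
      proof (rule finite_measure_mono)
        show "{\<omega>\<in>space M'. 3 * e < \<bar>I t \<omega> - J t \<omega>\<bar>} \<subseteq> ?E1 \<union> ?E2 \<union> ?E3"
        proof
          fix \<omega> assume "\<omega> \<in> {\<omega>\<in>space M'. 3 * e < \<bar>I t \<omega> - J t \<omega>\<bar>}"
          then have w: "\<omega> \<in> space M'" "3 * e < \<bar>I t \<omega> - J t \<omega>\<bar>" by auto
          show "\<omega> \<in> ?E1 \<union> ?E2 \<union> ?E3"
          proof (rule ccontr)
            assume "\<omega> \<notin> ?E1 \<union> ?E2 \<union> ?E3"
            then have n: "R n \<omega> \<le> ennreal e" "R' n \<omega> \<le> ennreal e" "\<bar>simple_integral w m \<sigma> \<zeta> t \<omega>\<bar> \<le> e" using w(1) by (auto simp: not_less)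
            have "ennreal \<bar>simple_integral w (k n) (\<tau> n) (\<eta> n) t \<omega> - I t \<omega>\<bar> \<le> R n \<omega>" unfolding R_def using t by (rule SUP_upper)
            from order_trans[OF this n(1)] have 1: "\<bar>simple_integral w (k n) (\<tau> n) (\<eta> n) t \<omega> - I t \<omega>\<bar> \<le> e" using e by (subst (asm) ennreal_le_iff) auto
            have "ennreal \<bar>simple_integral w (k' n) (\<tau>' n) (\<eta>' n) t \<omega> - J t \<omega>\<bar> \<le> R' n \<omega>" unfolding R'_def using t by (rule SUP_upper)
            from order_trans[OF this n(2)] have 2: "\<bar>simple_integral w (k' n) (\<tau>' n) (\<eta>' n) t \<omega> - J t \<omega>\<bar> \<le> e" using e by (subst (asm) ennreal_le_iff) auto
            show False using w(2) 1 2 n(3) unfolding mrg(4) by linarith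
          qed
        qed
      qed measurable
      also have "\<dots> \<le> prob ?E1 + prob ?E2 + prob ?E3"
      proof -
        have "prob (?E1 \<union> ?E2 \<union> ?E3) \<le> prob (?E1 \<union> ?E2) + prob ?E3" by (rule measure_Un_le) measurable
        moreover have "prob (?E1 \<union> ?E2) \<le> prob ?E1 + prob ?E2" by (rule measure_Un_le) measurable
        ultimately show ?thesis by linarith
      qed
      also have "prob ?E3 \<le> prob {\<omega>\<in>space M'. \<delta> < ?q \<omega>} + \<delta> / e\<^sup>2"
        using \<delta> by (intro simple_integral_tail mrg t e) simp
      also have "prob {\<omega>\<in>space M'. \<delta> < ?q \<omega>} \<le> prob (?F1 \<union> ?F2)"
      proof (rule finite_measure_mono)
        show "{\<omega>\<in>space M'. \<delta> < ?q \<omega>} \<subseteq> ?F1 \<union> ?F2"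
        proof
          fix \<omega> assume "\<omega> \<in> {\<omega>\<in>space M'. \<delta> < ?q \<omega>}"
          then have w: "\<omega> \<in> space M'" "\<delta> < ?q \<omega>" by auto
          show "\<omega> \<in> ?F1 \<union> ?F2"
          proof (rule ccontr)
            assume "\<omega> \<notin> ?F1 \<union> ?F2"
            then have n: "Q n \<omega> \<le> ennreal (\<delta> / 4)" "Q' n \<omega> \<le> ennreal (\<delta> / 4)" using w(1) by (auto simp: not_less)
            let ?u = "\<lambda>s. simple_process (k n) (\<tau> n) (\<eta> n) s \<omega>" and ?v = "\<lambda>s. simple_process (k' n) (\<tau>' n) (\<eta>' n) s \<omega>"
            have [measurable]: "?u \<in> borel_measurable lborel" "?v \<in> borel_measurable lborel" unfolding simple_process_def by measurable
            \<comment> \<open>Continuity of H in s enters here: the integral over s is split into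
              two, which requires measurable integrands.\<close>
            have Hm[measurable]: "(\<lambda>s. indicator {0..T} s * H s \<omega>) \<in> borel_measurable lborel"
              using borel_measurable_continuous_on_indicator[OF _ H[OF w(1)]] by simp
            have um: "(\<lambda>s. ennreal ((?u s - H s \<omega>)\<^sup>2) * indicator {0..T} s) \<in> borel_measurable lborel"
            proof -
              have "(\<lambda>s. ennreal ((?u s - indicator {0..T} s * H s \<omega>)\<^sup>2) * indicator {0..T} s) \<in> borel_measurable lborel" by measurable
              then show ?thesis by (rule measurable_cong[THEN iffD1, rotated]) (auto simp: indicator_def)
            qed
            have vm: "(\<lambda>s. ennreal ((?v s - H s \<omega>)\<^sup>2) * indicator {0..T} s) \<in> borel_measurable lborel"
            proof -
              have "(\<lambda>s. ennreal ((?v s - indicator {0..T} s * H s \<omega>)\<^sup>2) * indicator {0..T} s) \<in> borel_measurable lborel" by measurable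
              then show ?thesis by (rule measurable_cong[THEN iffD1, rotated]) (auto simp: indicator_def)
            qed
            have "ennreal (?q \<omega>) = (\<integral>\<^sup>+s\<in>{0..T}. ennreal ((?u s - ?v s)\<^sup>2) \<partial>lborel)"
              using simple_process_square_integral[OF mrg(2) \<sigma>, where \<zeta> = \<zeta> and \<omega> = \<omega>] unfolding mrg(3) by simp
            also have "\<dots> \<le> (\<integral>\<^sup>+s. 2 * (ennreal ((?u s - H s \<omega>)\<^sup>2) * indicator {0..T} s) + 2 * (ennreal ((?v s - H s \<omega>)\<^sup>2) * indicator {0..T} s) \<partial>lborel)"
            proof (rule nn_integral_mono)
              fix s
              have "(?u s - ?v s)\<^sup>2 \<le> 2 * (?u s - H s \<omega>)\<^sup>2 + 2 * (?v s - H s \<omega>)\<^sup>2"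
                using zero_le_power2[of "(?u s - H s \<omega>) + (?v s - H s \<omega>)"] by (simp add: power2_eq_square algebra_simps)
              then have "ennreal ((?u s - ?v s)\<^sup>2) \<le> ennreal (2 * (?u s - H s \<omega>)\<^sup>2 + 2 * (?v s - H s \<omega>)\<^sup>2)" by (rule ennreal_leI)
              also have "\<dots> = 2 * ennreal ((?u s - H s \<omega>)\<^sup>2) + 2 * ennreal ((?v s - H s \<omega>)\<^sup>2)" by (simp add: ennreal_mult)
              finally show "ennreal ((?u s - ?v s)\<^sup>2) * indicator {0..T} s \<le>
                2 * (ennreal ((?u s - H s \<omega>)\<^sup>2) * indicator {0..T} s) + 2 * (ennreal ((?v s - H s \<omega>)\<^sup>2) * indicator {0..T} s)"
                by (auto simp: indicator_def)
            qed
            also have "\<dots> = 2 * Q n \<omega> + 2 * Q' n \<omega>"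
              unfolding Q_def Q'_def using um vm by (subst nn_integral_add) (auto simp: nn_integral_cmult)
            also have "\<dots> \<le> 2 * ennreal (\<delta> / 4) + 2 * ennreal (\<delta> / 4)" by (intro add_mono mult_left_mono n) auto
            also have "\<dots> = ennreal \<delta>"
            proof -
              have "2 * ennreal (\<delta> / 4) = ennreal (2 * (\<delta> / 4))" using \<delta> by (subst ennreal_mult) auto
              then show ?thesis using \<delta> by (simp flip: ennreal_plus)
            qed
            finally show False using w(2) \<delta> by (subst (asm) ennreal_le_iff) auto
          qed
        qed
      qed measurable
      also have "prob (?F1 \<union> ?F2) \<le> prob ?F1 + prob ?F2" by (rule measure_Un_le) measurable
      finally show ?thesis by simp
    qed
    have "(\<lambda>n. prob {\<omega>\<in>space M'. ennreal e < R n \<omega>} + prob {\<omega>\<in>space M'. ennreal e < R' n \<omega>} +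
      (prob {\<omega>\<in>space M'. ennreal (\<delta> / 4) < Q n \<omega>} + prob {\<omega>\<in>space M'. ennreal (\<delta> / 4) < Q' n \<omega>} + \<delta> / e\<^sup>2)) \<longlonglongrightarrow> 0 + 0 + (0 + 0 + \<delta> / e\<^sup>2)"
      using nQ nQ' nR nR' e \<delta> unfolding null_in_probability_def by (intro tendsto_add tendsto_const) auto
    then show ?thesis using LIMSEQ_le_const[of _ "0 + 0 + (0 + 0 + \<delta> / e\<^sup>2)"] bound by fastforce
  qed
  have AEt: "AE \<omega> in M'. I t \<omega> = J t \<omega>" if t: "t \<in> {0..T}" for t
  proof -
    note [measurable] = Im[OF t]
    have "AE \<omega> in M'. \<forall>n. \<bar>I t \<omega> - J t \<omega>\<bar> \<le> 3 * (1 / real (Suc n))"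
      unfolding AE_all_countable
    proof
      fix n
      define e where "e = 1 / real (Suc n)"
      have e: "e > 0" by (simp add: e_def)
      \<comment> \<open>The choice \<delta> = d e^2 turns the bound into d, which is
        arbitrary.\<close>
      have "prob {\<omega>\<in>space M'. 3 * e < \<bar>I t \<omega> - J t \<omega>\<bar>} \<le> 0 + d" if "d > 0" for d
        using key[OF t e, of "d * e\<^sup>2"] that e by simp
      then have "prob {\<omega>\<in>space M'. 3 * e < \<bar>I t \<omega> - J t \<omega>\<bar>} \<le> 0" by (rule field_le_epsilon)
      then have "prob {\<omega>\<in>space M'. \<not> \<bar>I t \<omega> - J t \<omega>\<bar> \<le> 3 * e} = 0" by (simp add: not_le measure_le_0_iff)
      then show "AE \<omega> in M'. \<bar>I t \<omega> - J t \<omega>\<bar> \<le> 3 * (1 / real (Suc n))"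
        unfolding e_def[symmetric] by (subst (asm) prob_eq_0) (auto simp: AE_conj_iff)
    qed
    then show ?thesis
    proof eventually_elim
      case (elim \<omega>)
      have "\<bar>I t \<omega> - J t \<omega>\<bar> \<le> 0 + d" if "d > 0" for d
      proof -
        obtain n where "1 / real (Suc n) < d / 3" using nat_approx_posE[of "d / 3"] \<open>d > 0\<close> by auto
        then show ?thesis using elim[rule_format, of n] by linarith
      qed
      then have "\<bar>I t \<omega> - J t \<omega>\<bar> \<le> 0" by (rule field_le_epsilon)
      then show ?case by simp
    qed
  qed
  have "AE \<omega> in M'. \<forall>r. \<forall>i\<in>{..2^r}. I (grid T r i) \<omega> = J (grid T r i) \<omega>"
    unfolding AE_all_countable
    by (intro allI AE_finite_allI AEt grid_in[OF T]) auto
  then show ?thesis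
    using AE_space
  proof eventually_elim
    case (elim \<omega>)
    have c: "continuous_on {0..T} (\<lambda>t. I t \<omega> - J t \<omega>)"
      using I J elim(2) by (intro continuous_on_diff) (auto simp: is_ito_integral_def)
    show ?case
    proof
      fix t assume t: "t \<in> {0..T}"
      have "ennreal \<bar>I t \<omega> - J t \<omega>\<bar> \<le> (SUP t\<in>{0..T}. ennreal \<bar>I t \<omega> - J t \<omega>\<bar>)" by (rule SUP_upper[OF t])
      also have "\<dots> = (SUP r. SUP i\<in>{..2^r}. ennreal \<bar>I (grid T r i) \<omega> - J (grid T r i) \<omega>\<bar>)"
        by (rule SUP_continuous_grid[OF T c])
      also have "\<dots> \<le> 0" using elim(1) by (intro SUP_least) auto
      finally show "I t \<omega> = J t \<omega>" by (simp add: ennreal_eq_0_iff)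
    qed
  qed
qed

end

section \<open>Weighted sums\<close>

lemma hoelder_seminorm_bound:
  assumes fin: "hoelder_seminorm T \<alpha> h < \<infinity>" and uv: "u \<in> {0..T}" "v \<in> {0..T}"
  shows "\<bar>h u - h v\<bar> \<le> enn2real (hoelder_seminorm T \<alpha> h) * \<bar>u - v\<bar> powr \<alpha>"
proof (cases "u = v")
  case False
  have "ennreal (\<bar>h u - h v\<bar> / \<bar>u - v\<bar> powr \<alpha>) \<le> hoelder_seminorm T \<alpha> h"
    unfolding hoelder_seminorm_def using uv False by (intro SUP_upper2[of "(u, v)"]) auto
  then have "enn2real (ennreal (\<bar>h u - h v\<bar> / \<bar>u - v\<bar> powr \<alpha>)) \<le> enn2real (hoelder_seminorm T \<alpha> h)"
    using fin by (intro enn2real_mono) auto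
  then have "\<bar>h u - h v\<bar> / \<bar>u - v\<bar> powr \<alpha> \<le> enn2real (hoelder_seminorm T \<alpha> h)" by simp
  moreover have "0 < \<bar>u - v\<bar> powr \<alpha>" using False by simp
  ultimately show ?thesis by (simp add: pos_divide_le_eq)
qed simp

lemma grid_gidx_tendsto:
  assumes T: "T > 0" and t: "t \<in> {0..T}"
  shows "(\<lambda>r. grid T r (gidx T r t)) \<longlonglongrightarrow> t"
proof (rule LIM_zero_cancel, rule Lim_null_comparison)
  have "\<bar>grid T r (gidx T r t) - t\<bar> \<le> T * (1/2)^r" for r
    using gidx(2,3)[OF T t, of r] grid_Suc_diff[of T r "gidx T r t"] by (simp add: power_divide)
  then show "\<forall>\<^sub>F r in sequentially. norm (grid T r (gidx T r t) - t) \<le> T * (1/2)^r" by simp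
  have "(\<lambda>r. T * (1/2)^r) \<longlonglongrightarrow> T * 0" by (intro tendsto_intros LIMSEQ_power_zero) simp
  then show "(\<lambda>r. T * (1/2)^r) \<longlonglongrightarrow> 0" by simp
qed

text \<open>The Hoelder quotient is taken over pairs of dyadic points, a countable supremum and
  hence measurable. It is finite because the seminorm is, and continuity of the paths extends the
  bound to all pairs.\<close>

lemma hoelder_process_exists:
  assumes M: "prob_space M" and T: "T > 0" and \<alpha>: "\<alpha> > 1 / 2"
    and f: "\<And>t. t \<in> {0..T} \<Longrightarrow> f t \<in> borel_measurable M"
    and fin: "\<And>\<omega>. \<omega> \<in> space M \<Longrightarrow> hoelder_seminorm T \<alpha> (\<lambda>t. f t \<omega>) < \<infinity>"
  shows "\<exists>K. hoelder_process M T \<alpha> f K"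
proof -
  \<comment> \<open>At coinciding points the quotient is 0 / 0 = 0, so such pairs do not disturb the
    supremum.\<close>
  let ?q = "\<lambda>\<omega> u v. ennreal (\<bar>f u \<omega> - f v \<omega>\<bar> / \<bar>u - v\<bar> powr \<alpha>)"
  define \<kappa> where "\<kappa> \<omega> = (SUP r. SUP i\<in>{..2^r}. SUP r'. SUP i'\<in>{..2^r'}. ?q \<omega> (grid T r i) (grid T r' i'))" for \<omega>
  have \<kappa>m: "\<kappa> \<in> borel_measurable M"
    unfolding \<kappa>_def[abs_def]
  proof (intro borel_measurable_SUP)
    fix r r' :: nat and i i' :: nat assume "i \<in> {..2^r}" "i' \<in> {..2^r'}"
    then have [measurable]: "f (grid T r i) \<in> borel_measurable M" "f (grid T r' i') \<in> borel_measurable M"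
      by (auto intro!: f grid_in[OF T] simp del: atLeastAtMost_iff)
    show "(\<lambda>\<omega>. ?q \<omega> (grid T r i) (grid T r' i')) \<in> borel_measurable M" by measurable
  qed auto
  have \<kappa>fin: "\<kappa> \<omega> < \<infinity>" if w: "\<omega> \<in> space M" for \<omega>
  proof -
    have "\<kappa> \<omega> \<le> hoelder_seminorm T \<alpha> (\<lambda>t. f t \<omega>)"
      unfolding \<kappa>_def
    proof (intro SUP_least)
      fix r r' :: nat and i i' :: nat assume i: "i \<in> {..2^r}" "i' \<in> {..2^r'}"
      then have g: "grid T r i \<in> {0..T}" "grid T r' i' \<in> {0..T}" by (auto intro!: grid_in[OF T] simp del: atLeastAtMost_iff)
      show "?q \<omega> (grid T r i) (grid T r' i') \<le> hoelder_seminorm T \<alpha> (\<lambda>t. f t \<omega>)"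
      proof (cases "grid T r i = grid T r' i'")
        case False
        then show ?thesis unfolding hoelder_seminorm_def using g
          by (intro SUP_upper2[of "(grid T r i, grid T r' i')"]) auto
      qed simp
    qed
    also note fin[OF w]
    finally show ?thesis .
  qed
  define K0 where "K0 \<omega> = enn2real (\<kappa> \<omega>)" for \<omega>
  have K0: "0 \<le> K0 \<omega>" for \<omega> by (simp add: K0_def)
  have [measurable]: "K0 \<in> borel_measurable M" unfolding K0_def[abs_def] using \<kappa>m by measurable
  have grd: "\<bar>f (grid T r i) \<omega> - f (grid T r' i') \<omega>\<bar> \<le> K0 \<omega> * \<bar>grid T r i - grid T r' i'\<bar> powr \<alpha>"
    if w: "\<omega> \<in> space M" and i: "i \<le> 2^r" "i' \<le> 2^r'" for \<omega> r r' i i'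
  proof (cases "grid T r i = grid T r' i'")
    case False
    have "?q \<omega> (grid T r i) (grid T r' i') \<le> \<kappa> \<omega>"
      unfolding \<kappa>_def using i by (intro SUP_upper2[of r] SUP_upper2[of i] SUP_upper2[of r'] SUP_upper2[of i']) auto
    then have "enn2real (?q \<omega> (grid T r i) (grid T r' i')) \<le> K0 \<omega>"
      unfolding K0_def using \<kappa>fin[OF w] by (intro enn2real_mono) auto
    then have "\<bar>f (grid T r i) \<omega> - f (grid T r' i') \<omega>\<bar> / \<bar>grid T r i - grid T r' i'\<bar> powr \<alpha> \<le> K0 \<omega>" by simp
    moreover have "0 < \<bar>grid T r i - grid T r' i'\<bar> powr \<alpha>" using False by simp
    ultimately show ?thesis by (simp add: pos_divide_le_eq)
  qed simp
  have lim: "(\<lambda>r. f (grid T r (gidx T r t)) \<omega>) \<longlonglongrightarrow> f t \<omega>" if w: "\<omega> \<in> space M" and t: "t \<in> {0..T}" for \<omega> t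
  proof (rule LIM_zero_cancel, rule Lim_null_comparison)
    let ?c = "enn2real (hoelder_seminorm T \<alpha> (\<lambda>t. f t \<omega>))"
    show "\<forall>\<^sub>F r in sequentially. norm (f (grid T r (gidx T r t)) \<omega> - f t \<omega>) \<le> ?c * \<bar>grid T r (gidx T r t) - t\<bar> powr \<alpha>"
      using hoelder_seminorm_bound[OF fin[OF w] grid_in[OF T gidx(1)[OF T t]] t] by simp
    have "(\<lambda>r. \<bar>grid T r (gidx T r t) - t\<bar>) \<longlonglongrightarrow> \<bar>t - t\<bar>" by (intro tendsto_intros grid_gidx_tendsto[OF T t])
    then have "(\<lambda>r. \<bar>grid T r (gidx T r t) - t\<bar> powr \<alpha>) \<longlonglongrightarrow> 0"
      using \<alpha> by (intro tendsto_zero_powrI[OF _ tendsto_const]) auto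
    then have "(\<lambda>r. ?c * \<bar>grid T r (gidx T r t) - t\<bar> powr \<alpha>) \<longlonglongrightarrow> ?c * 0" by (intro tendsto_mult tendsto_const)
    then show "(\<lambda>r. ?c * \<bar>grid T r (gidx T r t) - t\<bar> powr \<alpha>) \<longlonglongrightarrow> 0" by simp
  qed
  have hol: "\<bar>f u \<omega> - f v \<omega>\<bar> \<le> K0 \<omega> * \<bar>u - v\<bar> powr \<alpha>"
    if w: "\<omega> \<in> space M" and u: "u \<in> {0..T}" and v: "v \<in> {0..T}" for \<omega> u v
  proof (rule LIMSEQ_le)
    show "(\<lambda>r. \<bar>f (grid T r (gidx T r u)) \<omega> - f (grid T r (gidx T r v)) \<omega>\<bar>) \<longlonglongrightarrow> \<bar>f u \<omega> - f v \<omega>\<bar>"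
      by (intro tendsto_intros lim w u v)
    show "(\<lambda>r. K0 \<omega> * \<bar>grid T r (gidx T r u) - grid T r (gidx T r v)\<bar> powr \<alpha>) \<longlonglongrightarrow> K0 \<omega> * \<bar>u - v\<bar> powr \<alpha>"
      using \<alpha> by (intro tendsto_mult tendsto_const tendsto_powr2 tendsto_rabs tendsto_diff grid_gidx_tendsto[OF T] u v) auto
    show "\<exists>N. \<forall>r\<ge>N. \<bar>f (grid T r (gidx T r u)) \<omega> - f (grid T r (gidx T r v)) \<omega>\<bar> \<le> K0 \<omega> * \<bar>grid T r (gidx T r u) - grid T r (gidx T r v)\<bar> powr \<alpha>"
      using grd[OF w gidx(1)[OF T u] gidx(1)[OF T v]] by blast
  qed
  \<comment> \<open>Besides dominating K0, it bounds f itself through |f u - f 0| \<le> K0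
    T^\<alpha>.\<close>
  define K where "K \<omega> = K0 \<omega> * (1 + T powr \<alpha>) + \<bar>f 0 \<omega>\<bar>" for \<omega>
  have K0K: "K0 \<omega> \<le> K \<omega>" for \<omega>
  proof -
    have "K0 \<omega> * 1 \<le> K0 \<omega> * (1 + T powr \<alpha>)" by (intro mult_left_mono K0) auto
    then show ?thesis by (simp add: K_def)
  qed
  have "hoelder_process M T \<alpha> f K"
  proof (intro hoelder_process.intro hoelder_process_axioms.intro M T \<alpha> f)
    have [measurable]: "f 0 \<in> borel_measurable M" using T by (intro f) simp
    show "K \<in> borel_measurable M" unfolding K_def[abs_def] by measurable
    show "\<bar>f u \<omega> - f v \<omega>\<bar> \<le> K \<omega> * \<bar>u - v\<bar> powr \<alpha>" if "\<omega> \<in> space M" "u \<in> {0..T}" "v \<in> {0..T}" for \<omega> u v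
      using hol[OF that] mult_right_mono[OF K0K, of "\<bar>u - v\<bar> powr \<alpha>" \<omega>] by simp
    show "\<bar>f u \<omega>\<bar> \<le> K \<omega>" if w: "\<omega> \<in> space M" and u: "u \<in> {0..T}" for \<omega> u
    proof -
      have "\<bar>f u \<omega> - f 0 \<omega>\<bar> \<le> K0 \<omega> * \<bar>u - 0\<bar> powr \<alpha>" using T by (intro hol w u) simp
      also have "\<dots> \<le> K0 \<omega> * T powr \<alpha>" using u \<alpha> by (intro mult_left_mono powr_mono2 K0) auto
      finally show ?thesis using K0[of \<omega>] unfolding K_def distrib_left by linarith
    qed
  qed
  then show ?thesis by blast
qed

lemma (in hoelder_process) simple_process_tendsto:
  assumes w: "\<omega> \<in> space N" and s: "s \<in> {0<..T}"
  shows "(\<lambda>n. simple_process (2^n) (grid T n) (\<lambda>j. f (grid T n j)) s \<omega>) \<longlonglongrightarrow> f s \<omega>"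
proof (rule LIM_zero_cancel, rule Lim_null_comparison)
  have "\<bar>simple_process (2^n) (grid T n) (\<lambda>j. f (grid T n j)) s \<omega> - f s \<omega>\<bar> \<le> K \<omega> * (T * (1/2)^n) powr \<alpha>" for n
  proof -
    obtain j where j: "j < 2^n" "grid T n j < s" "s \<le> grid T n (Suc j)" by (rule grid_interval[OF T s])
    have u: "grid T n j \<in> {0..T}" using j by (intro grid_in[OF T]) simp
    have "\<bar>f (grid T n j) \<omega> - f s \<omega>\<bar> \<le> K \<omega> * \<bar>grid T n j - s\<bar> powr \<alpha>" using s by (intro hoelder[OF w u]) auto
    also have "\<dots> \<le> K \<omega> * (T / 2^n) powr \<alpha>"
    proof -
      have "\<bar>grid T n j - s\<bar> \<le> T / 2^n" using j grid_Suc_diff[of T n j] by linarith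
      then show ?thesis using K_nonneg[OF w] \<alpha> by (intro mult_left_mono powr_mono2) auto
    qed
    finally show ?thesis unfolding simple_process_grid[OF T j] by (simp add: power_divide)
  qed
  then show "\<forall>\<^sub>F n in sequentially. norm (simple_process (2^n) (grid T n) (\<lambda>j. f (grid T n j)) s \<omega> - f s \<omega>) \<le> K \<omega> * (T * (1/2)^n) powr \<alpha>"
    by simp
  have "(\<lambda>n. T * (1/2)^n) \<longlonglongrightarrow> T * 0" by (intro tendsto_intros LIMSEQ_power_zero) simp
  then have "(\<lambda>n. (T * (1/2)^n) powr \<alpha>) \<longlonglongrightarrow> 0"
    using \<alpha> T by (intro tendsto_zero_powrI[OF _ tendsto_const]) auto
  then have "(\<lambda>n. K \<omega> * (T * (1/2)^n) powr \<alpha>) \<longlonglongrightarrow> K \<omega> * 0" by (intro tendsto_mult tendsto_const)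
  then show "(\<lambda>n. K \<omega> * (T * (1/2)^n) powr \<alpha>) \<longlonglongrightarrow> 0" by simp
qed

lemma le_nat_floor_iff:
  assumes m: "m \<ge> 1" and x: "0 \<le> x"
  shows "i \<le> nat \<lfloor>real m * x\<rfloor> \<longleftrightarrow> real i / real m \<le> x"
proof -
  have y: "0 \<le> real m * x" using x by simp
  have "i \<le> nat \<lfloor>real m * x\<rfloor> \<longleftrightarrow> real i \<le> real m * x"
    using le_nat_floor[of i "real m * x"] of_nat_floor[OF y] by (meson of_nat_mono order_trans)
  also have "\<dots> \<longleftrightarrow> real i / real m \<le> x" using m by (simp add: field_simps)
  finally show ?thesis .
qed

lemma sum_upto_nat_floor:
  fixes g :: "nat \<Rightarrow> real"
  assumes m: "m \<ge> 1" and x: "x \<in> {0..T}"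
  shows "(\<Sum>i=1..nat \<lfloor>real m * x\<rfloor>. g i) = (\<Sum>i=1..nat \<lfloor>real m * T\<rfloor>. g i * (if real i / real m \<le> x then 1 else 0))"
proof (rule sum.mono_neutral_cong_left)
  have "nat \<lfloor>real m * x\<rfloor> \<le> nat \<lfloor>real m * T\<rfloor>" using x by (intro nat_mono floor_mono mult_left_mono) auto
  then show "{1..nat \<lfloor>real m * x\<rfloor>} \<subseteq> {1..nat \<lfloor>real m * T\<rfloor>}" by auto
qed (use x m in \<open>auto simp: le_nat_floor_iff[symmetric]\<close>)

text \<open>The path \<open>g\<^sub>m\<close> is a step path with jump \<xi> i m at time i/m, so
  integrating against it evaluates the simple process at the jump times up to t. The block
  containing i/m has its left end within one mesh width, and f is continuous.\<close>

lemma (in hoelder_process) weighted_sums_limit: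
  assumes m: "m \<ge> 1" and w: "\<omega> \<in> space N" and t: "t \<in> {0..T}"
  shows "(\<lambda>n. simple_integral (partial_sums \<xi> m) (2^n) (grid T n) (\<lambda>j. f (grid T n j)) t \<omega>) \<longlonglongrightarrow> weighted_sums f \<xi> m t \<omega>"
proof -
  let ?N = "nat \<lfloor>real m * T\<rfloor>" and ?s = "\<lambda>i. real i / real m"
  let ?t = "\<lambda>i x. if ?s i \<le> x then 1 else (0 :: real)"
  have "simple_integral (partial_sums \<xi> m) (2^n) (grid T n) (\<lambda>j. f (grid T n j)) t \<omega>
    = (\<Sum>i=1..?N. \<xi> i m \<omega> * ?t i t * simple_process (2^n) (grid T n) (\<lambda>j. f (grid T n j)) (?s i) \<omega>)" for n
  proof -
    let ?u = "grid T n"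
    have ps: "partial_sums \<xi> m (min (?u j) t) \<omega> = (\<Sum>i=1..?N. \<xi> i m \<omega> * (?t i t * ?t i (?u j)))" if "j \<le> 2^n" for j
    proof -
      have "min (?u j) t \<in> {0..T}" using grid_in[OF T that] t by (auto simp: min_def)
      then have "partial_sums \<xi> m (min (?u j) t) \<omega> = (\<Sum>i=1..?N. \<xi> i m \<omega> * ?t i (min (?u j) t))"
        unfolding partial_sums_def by (rule sum_upto_nat_floor[OF m])
      also have "\<dots> = (\<Sum>i=1..?N. \<xi> i m \<omega> * (?t i t * ?t i (?u j)))" by (intro sum.cong refl) auto
      finally show ?thesis .
    qed
    have "simple_integral (partial_sums \<xi> m) (2^n) ?u (\<lambda>j. f (?u j)) t \<omega>
      = (\<Sum>j<2^n. \<Sum>i=1..?N. \<xi> i m \<omega> * ?t i t * (f (?u j) \<omega> * (?t i (?u (Suc j)) - ?t i (?u j))))"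
      unfolding simple_integral_def
    proof (intro sum.cong refl)
      fix j assume "j \<in> {..<2^n::nat}"
      then have j: "j \<le> 2^n" "Suc j \<le> 2^n" by auto
      show "f (?u j) \<omega> * (partial_sums \<xi> m (min (?u (Suc j)) t) \<omega> - partial_sums \<xi> m (min (?u j) t) \<omega>)
        = (\<Sum>i=1..?N. \<xi> i m \<omega> * ?t i t * (f (?u j) \<omega> * (?t i (?u (Suc j)) - ?t i (?u j))))"
        unfolding ps[OF j(1)] ps[OF j(2)] sum_subtractf[symmetric] sum_distrib_left
        by (intro sum.cong refl) (simp add: algebra_simps)
    qed
    also have "\<dots> = (\<Sum>i=1..?N. \<xi> i m \<omega> * ?t i t * (\<Sum>j<2^n. f (?u j) \<omega> * (?t i (?u (Suc j)) - ?t i (?u j))))"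
      by (subst sum.swap) (simp only: sum_distrib_left)
    also have "\<dots> = (\<Sum>i=1..?N. \<xi> i m \<omega> * ?t i t * simple_process (2^n) ?u (\<lambda>j. f (?u j)) (?s i) \<omega>)"
      using T by (subst simple_process_as_increments) (auto simp: grid_mono)
    finally show ?thesis .
  qed
  moreover have "(\<lambda>n. \<Sum>i=1..?N. \<xi> i m \<omega> * ?t i t * simple_process (2^n) (grid T n) (\<lambda>j. f (grid T n j)) (?s i) \<omega>)
    \<longlonglongrightarrow> (\<Sum>i=1..?N. \<xi> i m \<omega> * ?t i t * f (?s i) \<omega>)"
  proof (intro tendsto_sum tendsto_mult tendsto_const simple_process_tendsto[OF w])
    fix i assume "i \<in> {1..?N}"
    then show "?s i \<in> {0<..T}" using m T le_nat_floor_iff[OF m, of T i] by auto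
  qed
  moreover have "weighted_sums f \<xi> m t \<omega> = (\<Sum>i=1..?N. \<xi> i m \<omega> * ?t i t * f (?s i) \<omega>)"
    unfolding weighted_sums_def sum_upto_nat_floor[OF m t] by (intro sum.cong refl) simp
  ultimately show ?thesis by simp
qed

text \<open>Q is defined on all sequences, so its measurability is obtained from rounded
  coordinates, which form an integer list, and passes to the limit by the Lipschitz bound.\<close>

lemma lipschitz_coordinates_measurable:
  fixes Q :: "(nat \<Rightarrow> real) \<Rightarrow> real"
  assumes lip: "\<And>x y. \<bar>Q x - Q y\<bar> \<le> L * (\<Sum>l<k. \<bar>x l - y l\<bar>)"
    and V: "\<And>l. l < k \<Longrightarrow> V l \<in> borel_measurable N"
  shows "(\<lambda>\<omega>. Q (\<lambda>l. V l \<omega>)) \<in> borel_measurable N"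
proof (rule borel_measurable_LIMSEQ_real)
  fix r
  have "(\<lambda>\<omega>. map (\<lambda>i. \<lfloor>2^r * V i \<omega>\<rfloor>) [0..<k]) \<in> N \<rightarrow>\<^sub>M count_space UNIV"
  proof (rule measurable_int_list)
    fix i assume "i < k"
    note [measurable] = V[OF this]
    show "(\<lambda>\<omega>. \<lfloor>2^r * V i \<omega>\<rfloor>) \<in> N \<rightarrow>\<^sub>M count_space UNIV" by measurable
  qed
  then have "(\<lambda>\<omega>. Q (\<lambda>i. real_of_int (map (\<lambda>i. \<lfloor>2^r * V i \<omega>\<rfloor>) [0..<k] ! i) / 2^r)) \<in> borel_measurable N"
    by (rule measurable_compose[where g = "\<lambda>l. Q (\<lambda>i. real_of_int (l ! i) / 2^r)"]) simp
  moreover have "Q (\<lambda>i. real_of_int (map (\<lambda>i. \<lfloor>2^r * V i \<omega>\<rfloor>) [0..<k] ! i) / 2^r) = Q (\<lambda>l. dyadic r (V l \<omega>))" for \<omega>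
  proof -
    have "\<bar>Q (\<lambda>i. real_of_int (map (\<lambda>i. \<lfloor>2^r * V i \<omega>\<rfloor>) [0..<k] ! i) / 2^r) - Q (\<lambda>l. dyadic r (V l \<omega>))\<bar>
      \<le> L * (\<Sum>l<k. \<bar>real_of_int (map (\<lambda>i. \<lfloor>2^r * V i \<omega>\<rfloor>) [0..<k] ! l) / 2^r - dyadic r (V l \<omega>)\<bar>)" by (rule lip)
    also have "\<dots> = L * (\<Sum>l<k. 0)" by (intro arg_cong[where f = "\<lambda>x. L * x"] sum.cong refl) (simp add: dyadic_def)
    finally show ?thesis by simp
  qed
  ultimately show "(\<lambda>\<omega>. Q (\<lambda>l. dyadic r (V l \<omega>))) \<in> borel_measurable N" by simp
next
  have L: "\<bar>Q x - Q y\<bar> \<le> \<bar>L\<bar> * (\<Sum>l<k. \<bar>x l - y l\<bar>)" for x y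
  proof (rule order_trans[OF lip mult_right_mono])
    show "0 \<le> (\<Sum>l<k. \<bar>x l - y l\<bar>)" by (intro sum_nonneg) auto
  qed simp
  fix \<omega>
  show "(\<lambda>r. Q (\<lambda>l. dyadic r (V l \<omega>))) \<longlonglongrightarrow> Q (\<lambda>l. V l \<omega>)"
  proof (rule LIM_zero_cancel, rule Lim_null_comparison)
    have "\<bar>Q (\<lambda>l. dyadic r (V l \<omega>)) - Q (\<lambda>l. V l \<omega>)\<bar> \<le> \<bar>L\<bar> * real k * (1/2)^r" for r
    proof -
      have "\<bar>Q (\<lambda>l. dyadic r (V l \<omega>)) - Q (\<lambda>l. V l \<omega>)\<bar> \<le> \<bar>L\<bar> * (\<Sum>l<k. \<bar>dyadic r (V l \<omega>) - V l \<omega>\<bar>)" by (rule L)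
      also have "\<dots> \<le> \<bar>L\<bar> * (\<Sum>l<k. 1 / 2^r)" by (intro mult_left_mono sum_mono dyadic_error) simp
      finally show ?thesis by (simp add: power_divide)
    qed
    then show "\<forall>\<^sub>F r in sequentially. norm (Q (\<lambda>l. dyadic r (V l \<omega>)) - Q (\<lambda>l. V l \<omega>)) \<le> \<bar>L\<bar> * real k * (1/2)^r" by simp
    have "(\<lambda>r. \<bar>L\<bar> * real k * (1/2)^r) \<longlonglongrightarrow> \<bar>L\<bar> * real k * 0" by (intro tendsto_mult tendsto_const LIMSEQ_power_zero) simp
    then show "(\<lambda>r. \<bar>L\<bar> * real k * (1/2)^r) \<longlonglongrightarrow> 0" by simp
  qed
qed

text \<open>A ramp between the levels e/4 and e/2: a Lipschitz substitute for the indicator of |x| >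
  e/2, since finite dimensional convergence is tested on Lipschitz functionals. Vanishing up to e/4
  keeps its integral in the limit small by the fourth moment of the Brownian increment.\<close>

lemma ramp_bounds:
  fixes x e :: real
  assumes e: "e > 0"
  defines "\<rho> \<equiv> \<lambda>x. max 0 (min 1 (4 / e * \<bar>x\<bar> - 1))"
  shows "\<bar>\<rho> x\<bar> \<le> 1" "0 \<le> \<rho> x" "\<bar>x\<bar> > e / 2 \<Longrightarrow> \<rho> x = 1" "\<bar>x\<bar> \<le> e / 4 \<Longrightarrow> \<rho> x = 0"
    "\<bar>\<rho> x - \<rho> y\<bar> \<le> 4 / e * \<bar>x - y\<bar>"
proof -
  show "\<bar>\<rho> x\<bar> \<le> 1" "0 \<le> \<rho> x" unfolding \<rho>_def by auto
  show "\<bar>x\<bar> > e / 2 \<Longrightarrow> \<rho> x = 1" unfolding \<rho>_def using e by (simp add: field_simps)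
  show "\<bar>x\<bar> \<le> e / 4 \<Longrightarrow> \<rho> x = 0" unfolding \<rho>_def using e by (simp add: field_simps)
  have clip: "\<bar>max 0 (min 1 a) - max 0 (min 1 b)\<bar> \<le> \<bar>a - b\<bar>" for a b :: real by (auto simp: max_def min_def)
  have "\<bar>\<rho> x - \<rho> y\<bar> \<le> \<bar>(4 / e * \<bar>x\<bar> - 1) - (4 / e * \<bar>y\<bar> - 1)\<bar>" unfolding \<rho>_def by (rule clip)
  also have "(4 / e * \<bar>x\<bar> - 1) - (4 / e * \<bar>y\<bar> - 1) = 4 / e * (\<bar>x\<bar> - \<bar>y\<bar>)" by (simp add: right_diff_distrib)
  also have "\<bar>4 / e * (\<bar>x\<bar> - \<bar>y\<bar>)\<bar> = 4 / e * \<bar>\<bar>x\<bar> - \<bar>y\<bar>\<bar>" unfolding abs_mult using e by simp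
  also have "\<dots> \<le> 4 / e * \<bar>x - y\<bar>" using e by (intro mult_left_mono abs_triangle_ineq3) auto
  finally show "\<bar>\<rho> x - \<rho> y\<bar> \<le> 4 / e * \<bar>x - y\<bar>" .
qed

text \<open>The moment bound says nothing about the first summand \<open>\<xi> 1 m\<close>. It is negligible because, for
  small \<open>s\<close>, both \<open>g\<^sub>m(s)\<close> (close in law to \<open>w(s)\<close>) and \<open>g\<^sub>m(s) - \<xi> 1 m\<close> are small.\<close>

lemma first_summand_negligible:
  fixes \<xi> :: "nat \<Rightarrow> nat \<Rightarrow> 'a \<Rightarrow> real"
  assumes ext: "prob_extension M M' \<pi>" and T: "T > 0" and C: "C > 0"
    and \<xi>: "\<And>m i. m \<ge> 1 \<Longrightarrow> 1 \<le> i \<Longrightarrow> i \<le> nat \<lfloor>real m * T\<rfloor> \<Longrightarrow> \<xi> i m \<in> borel_measurable M"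
    and bm: "standard_brownian_motion T M' w"
    and fdd: "fdd_converge_stably T M (partial_sums \<xi>) M' \<pi> w"
    and moment: "\<And>m j k. m \<ge> 1 \<Longrightarrow> 1 \<le> j \<Longrightarrow> j < k \<Longrightarrow> k \<le> nat \<lfloor>real m * T\<rfloor> \<Longrightarrow>
      (\<integral>\<^sup>+\<omega>. ennreal (\<bar>\<Sum>i=j+1..k. \<xi> i m \<omega>\<bar> ^ 4) \<partial>M) \<le> ennreal (C * ((real k - real j) / real m)\<^sup>2)"
    and e: "e > 0" and d: "d > 0"
  shows "\<forall>\<^sub>F m in sequentially. measure M {\<omega>\<in>space M. e < \<bar>\<xi> 1 m \<omega>\<bar>} < d"
proof -
  interpret M: prob_space M using ext by (simp add: prob_extension_def)
  interpret M': prob_space M' using ext by (simp add: prob_extension_def)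
  \<comment> \<open>Collects the two bounds below: 4 (4/e)^4 s^2 for the partial sum at time s, and
    C (4/e)^4 s^2 for the same sum without its first summand.\<close>
  define D where "D = (4 / e)^4 * (C + 4)"
  have D: "D > 0" using e C by (simp add: D_def)
  define s where "s = min T (min 1 (d / (4 * D)))"
  have s: "0 < s" "s \<le> T" "s \<le> 1" "s \<le> d / (4 * D)" using T d D by (auto simp: s_def)
  have Ds: "D * s\<^sup>2 < d / 2"
  proof -
    have "D * s\<^sup>2 \<le> D * (s * 1)" unfolding power2_eq_square using D s by (intro mult_left_mono) auto
    also have "\<dots> \<le> D * (d / (4 * D))" using D s by (intro mult_left_mono) auto
    also have "\<dots> = d / 4" using D by simp
    finally show ?thesis using d by linarith
  qed
  define \<rho> where "\<rho> x = max 0 (min 1 (4 / e * \<bar>x\<bar> - 1))" for x :: real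
  note \<rho> = ramp_bounds[OF e, folded \<rho>_def]
  \<comment> \<open>Time 0 is a second coordinate because the normal law is given for w s - w 0, and
    w 0 vanishes only almost surely.\<close>
  let ?p = "\<lambda>l::nat. if l = 0 then s else 0"
  have conv: "(\<lambda>m. \<integral>\<omega>. indicator (space M) \<omega> * \<rho> (partial_sums \<xi> m s \<omega> - partial_sums \<xi> m 0 \<omega>) \<partial>M)
    \<longlonglongrightarrow> (\<integral>\<omega>. indicator (space M) (\<pi> \<omega>) * \<rho> (w s \<omega> - w 0 \<omega>) \<partial>M')"
  proof -
    have "(\<lambda>m. \<integral>\<omega>. indicator (space M) \<omega> * (\<lambda>y. \<rho> (y 0 - y 1)) (\<lambda>l. partial_sums \<xi> m (?p l) \<omega>) \<partial>M)
      \<longlonglongrightarrow> (\<integral>\<omega>. indicator (space M) (\<pi> \<omega>) * (\<lambda>y. \<rho> (y 0 - y 1)) (\<lambda>l. w (?p l) \<omega>) \<partial>M')"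
    proof (rule fdd_converge_lipschitz[OF fdd, where k = 2 and L = "4 / e" and b = 1])
      show "l < 2 \<Longrightarrow> ?p l \<in> {0..T}" for l using s by auto
      fix x y :: "nat \<Rightarrow> real"
      have "\<bar>\<rho> (x 0 - x 1) - \<rho> (y 0 - y 1)\<bar> \<le> 4 / e * \<bar>(x 0 - x 1) - (y 0 - y 1)\<bar>" by (rule \<rho>(5))
      also have "\<dots> \<le> 4 / e * (\<bar>x 0 - y 0\<bar> + \<bar>x 1 - y 1\<bar>)" using e by (intro mult_left_mono) auto
      also have "\<bar>x 0 - y 0\<bar> + \<bar>x 1 - y 1\<bar> = (\<Sum>l<2. \<bar>x l - y l\<bar>)" by (simp add: numeral_2_eq_2)
      finally show "\<bar>\<rho> (x 0 - x 1) - \<rho> (y 0 - y 1)\<bar> \<le> 4 / e * (\<Sum>l<2. \<bar>x l - y l\<bar>)" .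
    qed (auto intro: \<rho>)
    then show ?thesis by simp
  qed
  have wm: "w s \<in> borel_measurable M'" "w 0 \<in> borel_measurable M'"
    using bm s T by (auto simp: standard_brownian_motion_def)
  note [measurable] = wm
  have [measurable]: "\<rho> \<in> borel_measurable borel" unfolding \<rho>_def[abs_def] by measurable
  have lim_small: "(\<integral>\<omega>. indicator (space M) (\<pi> \<omega>) * \<rho> (w s \<omega> - w 0 \<omega>) \<partial>M') \<le> (4 / e)^4 * 3 * s\<^sup>2"
  proof -
    let ?B = "{\<omega>\<in>space M'. ennreal (e / 4) < ennreal \<bar>w s \<omega> - w 0 \<omega>\<bar>}"
    have "(\<integral>\<omega>. indicator (space M) (\<pi> \<omega>) * \<rho> (w s \<omega> - w 0 \<omega>) \<partial>M') \<le> (\<integral>\<omega>. indicator ?B \<omega> \<partial>M')"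
    proof (rule integral_mono')
      show "integrable M' (\<lambda>\<omega>. indicator ?B \<omega> :: real)" by (intro M'.integrable_const_bound[of _ 1]) auto
      fix \<omega> assume w: "\<omega> \<in> space M'"
      show "indicator (space M) (\<pi> \<omega>) * \<rho> (w s \<omega> - w 0 \<omega>) \<le> indicator ?B \<omega>"
      proof (cases "\<bar>w s \<omega> - w 0 \<omega>\<bar> \<le> e / 4")
        case True
        then show ?thesis using \<rho>(4) by simp
      next
        case False
        then have "\<omega> \<in> ?B" using w e by (auto simp: ennreal_less_iff)
        then show ?thesis using \<rho>(1)[of "w s \<omega> - w 0 \<omega>"] by (auto simp: indicator_def)
      qed
    qed auto
    also have "\<dots> = measure M' ?B" by simp
    also have "\<dots> \<le> (4 / e)^4 * 3 * s\<^sup>2"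
    proof (rule M'.prob_le_of_emeasure_le)
      have "emeasure M' ?B \<le> ennreal (1 / (e / 4)^4) * (\<integral>\<^sup>+\<omega>. ennreal \<bar>w s \<omega> - w 0 \<omega>\<bar> ^ 4 \<partial>M')"
        using e by (intro emeasure_gt_le_fourth_moment) auto
      also have "(\<integral>\<^sup>+\<omega>. ennreal \<bar>w s \<omega> - w 0 \<omega>\<bar> ^ 4 \<partial>M') = ennreal (3 * sqrt (s - 0)^4)"
      proof -
        have "distributed M' lborel (\<lambda>\<omega>. w s \<omega> - w 0 \<omega>) (normal_density 0 (sqrt (s - 0)))"
          using bm s unfolding standard_brownian_motion_def by blast
        from M'.normal_fourth_moment[OF this] show ?thesis using s by (simp add: ennreal_power)
      qed
      also have "sqrt (s - 0)^4 = s\<^sup>2"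
      proof -
        have "sqrt s^4 = (sqrt s^2)^2" by simp
        then show ?thesis using s by simp
      qed
      also have "ennreal (1 / (e / 4)^4) * ennreal (3 * s\<^sup>2) = ennreal ((4 / e)^4 * 3 * s\<^sup>2)"
        using e by (subst ennreal_mult'[symmetric]) (auto simp: power_divide mult.assoc)
      finally show "emeasure M' ?B \<le> ennreal ((4 / e)^4 * 3 * s\<^sup>2)" .
    qed simp
    finally show ?thesis .
  qed
  \<comment> \<open>The moment bound carries the constant 3; enlarging it to 4 gives a strict
    inequality, which the converging integrals eventually inherit.\<close>
  have "(4 / e)^4 * 3 * s\<^sup>2 < (4 / e)^4 * 4 * s\<^sup>2" using e s by simp
  with lim_small have lt: "(\<integral>\<omega>. indicator (space M) (\<pi> \<omega>) * \<rho> (w s \<omega> - w 0 \<omega>) \<partial>M') < (4 / e)^4 * 4 * s\<^sup>2" by linarith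
  have "\<forall>\<^sub>F m in sequentially. (\<integral>\<omega>. indicator (space M) \<omega> * \<rho> (partial_sums \<xi> m s \<omega> - partial_sums \<xi> m 0 \<omega>) \<partial>M) < (4 / e)^4 * 4 * s\<^sup>2"
    by (rule order_tendstoD(2)[OF conv lt])
  moreover have "\<forall>\<^sub>F m in sequentially. nat \<lceil>1 / s\<rceil> \<le> m" by (rule eventually_ge_at_top)
  ultimately show ?thesis
  proof eventually_elim
    case (elim m)
    have ms: "1 / s \<le> real m" using elim(2) by linarith
    then have ms1: "1 \<le> real m * s" using s by (simp add: field_simps)
    have m: "m \<ge> 1" using ms s by (metis One_nat_def Suc_leI divide_pos_pos gr0I less_le_not_le of_nat_0 zero_less_one)
    let ?n = "nat \<lfloor>real m * s\<rfloor>"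
    have n1: "1 \<le> ?n" using ms1 by linarith
    have nT: "?n \<le> nat \<lfloor>real m * T\<rfloor>" using s by (intro nat_mono floor_mono mult_left_mono) auto
    have \<xi>m: "\<xi> i m \<in> borel_measurable M" if "1 \<le> i" "i \<le> ?n" for i using \<xi>[OF m] that nT by simp
    have [measurable]: "\<xi> 1 m \<in> borel_measurable M" using \<xi>m n1 by simp
    define R where "R \<omega> = (\<Sum>i=1+1..?n. \<xi> i m \<omega>)" for \<omega>
    have [measurable]: "R \<in> borel_measurable M" unfolding R_def[abs_def] by (intro borel_measurable_sum \<xi>m) auto
    have g: "partial_sums \<xi> m s \<omega> = \<xi> 1 m \<omega> + R \<omega>" for \<omega>
      unfolding partial_sums_def R_def using n1 by (simp add: sum.atLeast_Suc_atMost)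
    have g0: "partial_sums \<xi> m 0 \<omega> = 0" for \<omega> by (simp add: partial_sums_def)
    have [measurable]: "partial_sums \<xi> m s \<in> borel_measurable M" unfolding g[abs_def] by measurable
    have pR: "measure M {\<omega>\<in>space M. ennreal (e / 2) < ennreal \<bar>R \<omega>\<bar>} \<le> (4 / e)^4 * C * s\<^sup>2"
    proof (rule M.prob_le_of_emeasure_le)
      have "emeasure M {\<omega>\<in>space M. ennreal (e / 2) < ennreal \<bar>R \<omega>\<bar>} \<le> ennreal (1 / (e / 2)^4) * (\<integral>\<^sup>+\<omega>. ennreal \<bar>R \<omega>\<bar> ^ 4 \<partial>M)"
        using e by (intro emeasure_gt_le_fourth_moment) auto
      also have "\<dots> \<le> ennreal ((4 / e)^4) * ennreal (C * s\<^sup>2)"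
      proof (intro mult_mono ennreal_leI)
        have "(2 / e)^4 \<le> (4 / e)^4" using e by (intro power_mono divide_right_mono) auto
        then show "1 / (e / 2)^4 \<le> (4 / e)^4" by (simp add: power_divide)
        show "(\<integral>\<^sup>+\<omega>. ennreal \<bar>R \<omega>\<bar> ^ 4 \<partial>M) \<le> ennreal (C * s\<^sup>2)"
        proof (cases "1 < ?n")
          case True
          have "(\<integral>\<^sup>+\<omega>. ennreal \<bar>R \<omega>\<bar> ^ 4 \<partial>M) \<le> ennreal (C * ((real ?n - real 1) / real m)\<^sup>2)"
            using moment[OF m _ True nT] unfolding R_def by (simp add: ennreal_power)
          also have "\<dots> \<le> ennreal (C * s\<^sup>2)"
          proof (intro ennreal_leI mult_left_mono power_mono)
            have "real ?n \<le> real m * s" using s by (intro of_nat_floor) simp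
            then show "(real ?n - real 1) / real m \<le> s" using m by (simp add: field_simps)
            show "0 \<le> (real ?n - real 1) / real m" using n1 by simp
          qed (use C in simp)
          finally show ?thesis .
        next
          \<comment> \<open>Only the first summand falls into [0,s], so the remainder is an empty
            sum.\<close>
          case False
          then have "{1+1..?n} = {}" by (intro atLeastatMost_empty) linarith
          then have "R \<omega> = 0" for \<omega> unfolding R_def by (simp only: sum.empty)
          then show ?thesis by simp
        qed
      qed auto
      also have "\<dots> = ennreal ((4 / e)^4 * C * s\<^sup>2)"
        using e C by (subst ennreal_mult'[symmetric]) (auto simp: mult.assoc)
      finally show "emeasure M {\<omega>\<in>space M. ennreal (e / 2) < ennreal \<bar>R \<omega>\<bar>} \<le> ennreal ((4 / e)^4 * C * s\<^sup>2)" .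
    qed (use C in simp)
    have pg: "measure M {\<omega>\<in>space M. e / 2 < \<bar>partial_sums \<xi> m s \<omega>\<bar>} \<le> (4 / e)^4 * 4 * s\<^sup>2"
    proof -
      have "measure M {\<omega>\<in>space M. e / 2 < \<bar>partial_sums \<xi> m s \<omega>\<bar>} = (\<integral>\<omega>. indicator {\<omega>\<in>space M. e / 2 < \<bar>partial_sums \<xi> m s \<omega>\<bar>} \<omega> \<partial>M)" by simp
      also have "\<dots> \<le> (\<integral>\<omega>. indicator (space M) \<omega> * \<rho> (partial_sums \<xi> m s \<omega> - partial_sums \<xi> m 0 \<omega>) \<partial>M)"
      proof (rule integral_mono')
        show "integrable M (\<lambda>\<omega>. indicator (space M) \<omega> * \<rho> (partial_sums \<xi> m s \<omega> - partial_sums \<xi> m 0 \<omega>))"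
          unfolding g0 using \<rho>(1) by (intro M.integrable_const_bound[of _ 1] AE_I2) (auto simp: indicator_def)
        fix \<omega> assume "\<omega> \<in> space M"
        then show "indicator {\<omega>\<in>space M. e / 2 < \<bar>partial_sums \<xi> m s \<omega>\<bar>} \<omega> \<le> indicator (space M) \<omega> * \<rho> (partial_sums \<xi> m s \<omega> - partial_sums \<xi> m 0 \<omega>)"
          unfolding g0 using \<rho>(2,3) by (auto simp: indicator_def)
        show "0 \<le> indicator (space M) \<omega> * \<rho> (partial_sums \<xi> m s \<omega> - partial_sums \<xi> m 0 \<omega>)" using \<rho>(2) by simp
      qed
      finally show ?thesis using elim(1) by linarith
    qed
    have "measure M {\<omega>\<in>space M. e < \<bar>\<xi> 1 m \<omega>\<bar>} \<le>
      measure M ({\<omega>\<in>space M. e / 2 < \<bar>partial_sums \<xi> m s \<omega>\<bar>} \<union> {\<omega>\<in>space M. ennreal (e / 2) < ennreal \<bar>R \<omega>\<bar>})"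
    proof (rule M.finite_measure_mono)
      show "{\<omega>\<in>space M. e < \<bar>\<xi> 1 m \<omega>\<bar>} \<subseteq> {\<omega>\<in>space M. e / 2 < \<bar>partial_sums \<xi> m s \<omega>\<bar>} \<union> {\<omega>\<in>space M. ennreal (e / 2) < ennreal \<bar>R \<omega>\<bar>}"
      proof
        fix \<omega> assume "\<omega> \<in> {\<omega>\<in>space M. e < \<bar>\<xi> 1 m \<omega>\<bar>}"
        then have w: "\<omega> \<in> space M" "e < \<bar>\<xi> 1 m \<omega>\<bar>" by auto
        have "e / 2 < \<bar>partial_sums \<xi> m s \<omega>\<bar> \<or> e / 2 < \<bar>R \<omega>\<bar>" unfolding g using w(2) by linarith
        then show "\<omega> \<in> {\<omega>\<in>space M. e / 2 < \<bar>partial_sums \<xi> m s \<omega>\<bar>} \<union> {\<omega>\<in>space M. ennreal (e / 2) < ennreal \<bar>R \<omega>\<bar>}"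
          using w(1) e by (auto simp: ennreal_less_iff)
      qed
    qed measurable
    also have "\<dots> \<le> measure M {\<omega>\<in>space M. e / 2 < \<bar>partial_sums \<xi> m s \<omega>\<bar>} + measure M {\<omega>\<in>space M. ennreal (e / 2) < ennreal \<bar>R \<omega>\<bar>}"
      by (rule measure_Un_le) measurable
    also have "\<dots> \<le> (4 / e)^4 * 4 * s\<^sup>2 + (4 / e)^4 * C * s\<^sup>2" by (intro add_mono pg pR)
    also have "\<dots> = D * s\<^sup>2" by (simp add: D_def algebra_simps)
    finally show ?case using Ds d by linarith
  qed
qed

section \<open>Stable convergence of the weighted sums\<close>

theorem theorem1:
  fixes M :: "'a measure" and M' :: "'b measure" and \<pi> :: "'b \<Rightarrow> 'a"
    and T \<alpha> C :: real
    and \<xi> :: "nat \<Rightarrow> nat \<Rightarrow> 'a \<Rightarrow> real"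
    and f :: "real \<Rightarrow> 'a \<Rightarrow> real"
    and w :: "real \<Rightarrow> 'b \<Rightarrow> real"
  assumes prob: "prob_space M" and complete: "complete_measure M"
    and T: "T > 0"
    and xi_rv: "\<And>m i. m \<ge> 1 \<Longrightarrow> 1 \<le> i \<Longrightarrow> i \<le> nat \<lfloor>real m * T\<rfloor> \<Longrightarrow>
                  \<xi> i m \<in> borel_measurable M"
    and ext: "prob_extension M M' \<pi>"
    and bm: "standard_brownian_motion T M' w"
    and indep: "indep_of_base T M M' \<pi> w"
    and fdd: "fdd_converge_stably T M (partial_sums \<xi>) M' \<pi> w"
    and C: "C > 0"
    and moment: "\<And>m j k. m \<ge> 1 \<Longrightarrow> 1 \<le> j \<Longrightarrow> j < k \<Longrightarrow> k \<le> nat \<lfloor>real m * T\<rfloor> \<Longrightarrow>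
                  (\<integral>\<^sup>+\<omega>. ennreal (\<bar>\<Sum>i=j+1..k. \<xi> i m \<omega>\<bar> ^ 4) \<partial>M)
                    \<le> ennreal (C * ((real k - real j) / real m)\<^sup>2)"
    and alpha: "\<alpha> > 1 / 2"
    and f_rv: "\<And>t. t \<in> {0..T} \<Longrightarrow> f t \<in> borel_measurable M"
    and f_hoelder: "\<And>\<omega>. \<omega> \<in> space M \<Longrightarrow> hoelder_seminorm T \<alpha> (\<lambda>t. f t \<omega>) < \<infinity>"
  shows "(\<exists>I. is_ito_integral T M' (enlarged_filtration M M' \<pi> w) w (\<lambda>s \<omega>'. f s (\<pi> \<omega>')) I) \<and>
    (\<forall>I. is_ito_integral T M' (enlarged_filtration M M' \<pi> w) w (\<lambda>s \<omega>'. f s (\<pi> \<omega>')) I \<longrightarrow>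
       converges_stably (D_space T) M (\<lambda>m. path_of T (weighted_sums f \<xi> m)) M' \<pi> (path_of T I))"
proof -
  interpret bb: base_brownian M M' \<pi> T w using ext T bm indep by unfold_locales
  interpret M: prob_space M by fact
  have \<pi>: "\<pi> \<in> M' \<rightarrow>\<^sub>M M" by (rule bb.\<pi>_measurable)
  obtain K where hp: "hoelder_process M T \<alpha> f K"
    using hoelder_process_exists[OF prob T alpha f_rv f_hoelder] by blast
  interpret P: hoelder_process M T \<alpha> f K by fact
  interpret P': hoelder_process M' T \<alpha> "\<lambda>t \<omega>. f t (\<pi> \<omega>)" "\<lambda>\<omega>. K (\<pi> \<omega>)"
    by (rule hoelder_process_lift[OF ext hp])
  have wdom: "dominated_increments M' T w (\<lambda>t. t) 375" by (rule brownian_motion_dominated[OF T bm])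
  have wc: "continuous_on {0..T} (\<lambda>t. w t \<omega>)" if "\<omega> \<in> space M'" for \<omega>
    using bm that by (auto simp: standard_brownian_motion_def)
  obtain I0 where I0: "is_ito_integral T M' bb.G w (\<lambda>s \<omega>'. f s (\<pi> \<omega>')) I0"
    "AE \<omega> in M'. \<forall>t\<in>{0..T}. (\<lambda>n. simple_integral w (2^n) (grid T n) (\<lambda>j \<omega>. f (grid T n j) (\<pi> \<omega>)) t \<omega>) \<longlonglongrightarrow> I0 t \<omega>"
    using ito_integral_exists[OF ext hp wdom wc] by blast
  \<comment> \<open>With the first summand removed the moment bound holds for j = 0 as well, and the
    maximal inequality applies from time 0 on.\<close>
  define \<xi>' where "\<xi>' i m = (if i = 1 then (\<lambda>_. 0) else \<xi> i m)" for i m :: nat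
  have \<xi>'m: "\<xi>' i m \<in> borel_measurable M" if "m \<ge> 1" "1 \<le> i" "i \<le> nat \<lfloor>real m * T\<rfloor>" for i m
    using xi_rv[OF that] by (simp add: \<xi>'_def)
  \<comment> \<open>The weight 1 gives the partial sums, the values of f give the weighted
    sums.\<close>
  have shift: "(\<Sum>i=1..k. \<xi>' i m \<omega> * c i) = (\<Sum>i=1..k. \<xi> i m \<omega> * c i) - (if 1 \<le> k then \<xi> 1 m \<omega> * c 1 else 0)"
    for k m \<omega> and c :: "nat \<Rightarrow> real"
  proof (cases "1 \<le> k")
    case True
    have "(\<Sum>i=Suc 1..k. \<xi>' i m \<omega> * c i) = (\<Sum>i=Suc 1..k. \<xi> i m \<omega> * c i)"
      by (intro sum.cong refl) (simp add: \<xi>'_def)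
    then show ?thesis using True by (simp add: sum.atLeast_Suc_atMost \<xi>'_def)
  qed simp
  have moment': "(\<integral>\<^sup>+\<omega>. ennreal (\<bar>\<Sum>i=j+1..k. \<xi>' i m \<omega>\<bar> ^ 4) \<partial>M) \<le> ennreal (C * ((real k - real j) / real m)\<^sup>2)"
    if m: "m \<ge> 1" and jk: "j < k" "k \<le> nat \<lfloor>real m * T\<rfloor>" for m j k
  proof (cases "max 1 j < k")
    case True
    \<comment> \<open>For j = 0 the sum effectively starts at 2, where the given moment bound
      begins.\<close>
    have "(\<Sum>i=j+1..k. \<xi>' i m \<omega>) = (\<Sum>i=max 1 j+1..k. \<xi> i m \<omega>)" for \<omega>
      by (rule sum.mono_neutral_cong_right) (auto simp: \<xi>'_def)
    then have "(\<integral>\<^sup>+\<omega>. ennreal (\<bar>\<Sum>i=j+1..k. \<xi>' i m \<omega>\<bar> ^ 4) \<partial>M) \<le> ennreal (C * ((real k - real (max 1 j)) / real m)\<^sup>2)"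
      using moment[OF m _ True jk(2)] by simp
    also have "\<dots> \<le> ennreal (C * ((real k - real j) / real m)\<^sup>2)"
      using C True by (intro ennreal_leI mult_left_mono power_mono divide_right_mono divide_nonneg_nonneg) auto
    finally show ?thesis .
  next
    \<comment> \<open>This leaves j = 0 and k = 1, where the only summand is the removed
      one.\<close>
    case False
    then have "\<xi>' i m \<omega> = 0" if "i \<in> {j+1..k}" for i \<omega> using that jk by (auto simp: \<xi>'_def max_def split: if_splits)
    then have "(\<Sum>i=j+1..k. \<xi>' i m \<omega>) = 0" for \<omega> by (intro sum.neutral) auto
    then show ?thesis by simp
  qed
  let ?H = "partial_sums \<xi>'" and ?\<mu> = "\<lambda>m t. real (nat \<lfloor>real m * t\<rfloor>) / real m"
  have dom: "dominated_increments M T (?H m) (?\<mu> m) (500 * C)" if "m \<ge> 1" for m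
    using C that by (intro partial_sums_dominated[OF T] \<xi>'m moment') auto
  have le_T: "nat \<lfloor>real m * t\<rfloor> \<le> nat \<lfloor>real m * T\<rfloor>" if "t \<in> {0..T}" for m t
    using that by (intro nat_mono floor_mono mult_left_mono) auto
  have psm: "(\<lambda>\<omega>. \<Sum>i=1..k. \<eta> i m \<omega>) \<in> borel_measurable M"
    if "k \<le> nat \<lfloor>real m * T\<rfloor>" "\<And>m i. m \<ge> 1 \<Longrightarrow> 1 \<le> i \<Longrightarrow> i \<le> nat \<lfloor>real m * T\<rfloor> \<Longrightarrow> \<eta> i m \<in> borel_measurable M" for k m and \<eta> :: "nat \<Rightarrow> nat \<Rightarrow> 'a \<Rightarrow> real"
  proof (cases "m = 0")
    case False
    then show ?thesis using that by (intro borel_measurable_sum that(2)) auto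
  qed (use that in simp)
  have Hm: "?H m t \<in> borel_measurable M" and gm: "partial_sums \<xi> m t \<in> borel_measurable M" if "t \<in> {0..T}" for m t
    unfolding partial_sums_def[abs_def] using psm[OF le_T[OF that], of \<xi>'] psm[OF le_T[OF that], of \<xi>] \<xi>'m xi_rv by auto
  \<comment> \<open>A block of level n has mass at most T / 2^n + 1/m, the second term coming from
    the integer part. So \<delta> fixes n, and m is large afterwards.\<close>
  have mesh: "\<exists>n1. \<forall>n\<ge>n1. \<forall>\<^sub>F m in sequentially. \<forall>j<2^n. ?\<mu> m (grid T n (Suc j)) - ?\<mu> m (grid T n j) \<le> \<delta>"
    if \<delta>: "\<delta> > 0" for \<delta> :: real
  proof -
    obtain n1 where n1: "\<And>n. n \<ge> n1 \<Longrightarrow> T / 2^n \<le> \<delta> / 2"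
      using pow_half_eventually_le[OF half_gt_zero[OF \<delta>], of T] unfolding eventually_sequentially by blast
    have "\<forall>\<^sub>F m in sequentially. \<forall>j<2^n. ?\<mu> m (grid T n (Suc j)) - ?\<mu> m (grid T n j) \<le> \<delta>" if n: "n \<ge> n1" for n
    proof -
      have "\<forall>\<^sub>F m in sequentially. nat \<lceil>2 / \<delta>\<rceil> + 1 \<le> m" by (rule eventually_ge_at_top)
      then show ?thesis
      proof eventually_elim
        case (elim m)
        then have m: "real m > 0" "2 / \<delta> \<le> real m" by linarith+
        show ?case
        proof (intro allI impI)
          fix j assume "j < (2::nat)^n"
          have "0 \<le> grid T n j" "0 \<le> grid T n (Suc j)" using T by (simp_all add: grid_def)
          then have "real (nat \<lfloor>real m * grid T n (Suc j)\<rfloor>) \<le> real m * grid T n (Suc j)"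
            "real m * grid T n j - 1 \<le> real (nat \<lfloor>real m * grid T n j\<rfloor>)"
            by (intro of_nat_floor) (simp, linarith)
          then have "real (nat \<lfloor>real m * grid T n (Suc j)\<rfloor>) - real (nat \<lfloor>real m * grid T n j\<rfloor>) \<le> real m * (T / 2^n) + 1"
            using arg_cong[OF grid_Suc_diff[of T n j], of "\<lambda>x. real m * x"] unfolding right_diff_distrib by linarith
          then have "(real (nat \<lfloor>real m * grid T n (Suc j)\<rfloor>) - real (nat \<lfloor>real m * grid T n j\<rfloor>)) / real m \<le> (real m * (T / 2^n) + 1) / real m"
            by (intro divide_right_mono) auto
          also have "\<dots> = T / 2^n + 1 / real m" using m by (simp add: field_simps)
          also have "\<dots> \<le> \<delta> / 2 + \<delta> / 2" using m \<delta> by (intro add_mono n1 n) (simp add: field_simps)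
          finally show "?\<mu> m (grid T n (Suc j)) - ?\<mu> m (grid T n j) \<le> \<delta>" by (simp add: diff_divide_distrib)
        qed
      qed
    qed
    then show ?thesis by blast
  qed
  have small: "\<forall>\<^sub>F m in sequentially. measure M {\<omega>\<in>space M. e < \<bar>\<xi> 1 m \<omega>\<bar>} < d" if "e > 0" "d > 0" for e d
    by (rule first_summand_negligible[OF ext T C xi_rv bm fdd moment that])
  have ev1: "\<forall>\<^sub>F m in sequentially. m \<ge> 1 \<and> 1 \<le> nat \<lfloor>real m * T\<rfloor>"
  proof -
    have "\<forall>\<^sub>F m in sequentially. nat \<lceil>1 / T\<rceil> + 1 \<le> m" by (rule eventually_ge_at_top)
    then show ?thesis
    proof eventually_elim
      case (elim m)
      then have "1 / T \<le> real m" by linarith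
      then have "1 \<le> real m * T" using T by (simp add: field_simps)
      then show ?case using elim by linarith
    qed
  qed
  \<comment> \<open>Off the event |\<xi> 1 m| > \<epsilon> the removal moves every partial sum by at
    most \<epsilon>, and that event becomes negligible; Lipschitz test functionals therefore have
    the same limits.\<close>
  have fdd': "fdd_lipschitz_convergence T M ?H M' \<pi> w"
    unfolding fdd_lipschitz_convergence_def
  proof (intro allI impI ballI)
    fix k s A and Q :: "(nat \<Rightarrow> real) \<Rightarrow> real" and L b
    assume k: "1 \<le> k" and s: "\<forall>l<k. s l \<in> {0..T}" and A: "A \<in> sets M"
      and Q: "(\<forall>x y. \<bar>Q x - Q y\<bar> \<le> L * (\<Sum>l<k. \<bar>x l - y l\<bar>)) \<and> (\<forall>x. \<bar>Q x\<bar> \<le> b)"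
    have lip: "\<bar>Q x - Q y\<bar> \<le> L * (\<Sum>l<k. \<bar>x l - y l\<bar>)" and bd: "\<bar>Q x\<bar> \<le> b" for x y using Q by auto
    have b0: "0 \<le> b" using bd[of undefined] by linarith
    show "(\<lambda>m. \<integral>\<omega>. indicator A \<omega> * Q (\<lambda>l. ?H m (s l) \<omega>) \<partial>M) \<longlonglongrightarrow> (\<integral>\<omega>. indicator A (\<pi> \<omega>) * Q (\<lambda>l. w (s l) \<omega>) \<partial>M')"
    proof (rule tendsto_by_approximation)
      fix e :: real assume e: "e > 0"
      have half: "x * (y / (2 * x)) = y / 2" if "x > 0" for x y :: real using that by simp
      define \<epsilon> where "\<epsilon> = e / (2 * (\<bar>L\<bar> * real k + 1))"
      have q: "\<bar>L\<bar> * real k + 1 > 0" by (intro add_nonneg_pos mult_nonneg_nonneg) auto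
      have \<epsilon>: "\<epsilon> > 0" using e q by (simp add: \<epsilon>_def)
      define d where "d = e / (2 * (2 * b + 1))"
      have q2: "2 * b + 1 > 0" using b0 by simp
      have d: "d > 0" using e q2 by (simp add: d_def)
      have "\<forall>\<^sub>F m in sequentially. \<bar>(\<integral>\<omega>. indicator A \<omega> * Q (\<lambda>l. ?H m (s l) \<omega>) \<partial>M) -
          (\<integral>\<omega>. indicator A \<omega> * Q (\<lambda>l. partial_sums \<xi> m (s l) \<omega>) \<partial>M)\<bar> \<le> e"
        using small[OF \<epsilon> d] ev1
      proof eventually_elim
        case (elim m)
        have [measurable]: "\<xi> 1 m \<in> borel_measurable M" using elim by (intro xi_rv) auto
        note [measurable] = A
        have [measurable]: "(\<lambda>\<omega>. Q (\<lambda>l. ?H m (s l) \<omega>)) \<in> borel_measurable M" "(\<lambda>\<omega>. Q (\<lambda>l. partial_sums \<xi> m (s l) \<omega>)) \<in> borel_measurable M"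
          using s by (auto intro!: lipschitz_coordinates_measurable[OF lip] Hm gm)
        let ?B = "{\<omega>\<in>space M. \<epsilon> < \<bar>\<xi> 1 m \<omega>\<bar>}"
        have "?B \<in> sets M" by measurable
        have "\<bar>(\<integral>\<omega>. indicator A \<omega> * Q (\<lambda>l. ?H m (s l) \<omega>) \<partial>M) - (\<integral>\<omega>. indicator A \<omega> * Q (\<lambda>l. partial_sums \<xi> m (s l) \<omega>) \<partial>M)\<bar>
          \<le> \<bar>L\<bar> * real k * \<epsilon> + 2 * b * measure M ?B"
        proof (rule bounded_integral_diff_le[OF prob])
          fix \<omega> assume w: "\<omega> \<in> space M - ?B"
          have diff: "\<bar>?H m t \<omega> - partial_sums \<xi> m t \<omega>\<bar> \<le> \<epsilon>" for t
            unfolding partial_sums_def using shift[of m \<omega> "\<lambda>_. 1" "nat \<lfloor>real m * t\<rfloor>"] w \<epsilon> by auto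
          have "\<bar>Q (\<lambda>l. ?H m (s l) \<omega>) - Q (\<lambda>l. partial_sums \<xi> m (s l) \<omega>)\<bar> \<le> L * (\<Sum>l<k. \<bar>?H m (s l) \<omega> - partial_sums \<xi> m (s l) \<omega>\<bar>)" by (rule lip)
          also have "\<dots> \<le> \<bar>L\<bar> * (\<Sum>l<k. \<bar>?H m (s l) \<omega> - partial_sums \<xi> m (s l) \<omega>\<bar>)" by (intro mult_right_mono sum_nonneg) auto
          also have "\<dots> \<le> \<bar>L\<bar> * (\<Sum>l<k. \<epsilon>)" by (intro mult_left_mono sum_mono diff) simp
          finally have "\<bar>Q (\<lambda>l. ?H m (s l) \<omega>) - Q (\<lambda>l. partial_sums \<xi> m (s l) \<omega>)\<bar> \<le> \<bar>L\<bar> * real k * \<epsilon>" by simp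
          then show "\<bar>indicator A \<omega> * Q (\<lambda>l. ?H m (s l) \<omega>) - indicator A \<omega> * Q (\<lambda>l. partial_sums \<xi> m (s l) \<omega>)\<bar> \<le> \<bar>L\<bar> * real k * \<epsilon>"
            using \<epsilon> by (auto simp: indicator_def)
        qed (use \<open>?B \<in> sets M\<close> bd b0 \<epsilon> in \<open>auto simp: indicator_def\<close>)
        also have "\<dots> \<le> (\<bar>L\<bar> * real k + 1) * \<epsilon> + (2 * b + 1) * d"
          using elim(1) b0 \<epsilon> by (intro add_mono mult_right_mono mult_mono) auto
        also have "\<dots> = e" using half[OF q, of e] half[OF q2, of e] unfolding \<epsilon>_def d_def by linarith
        finally show ?case .
      qed
      moreover have "(\<lambda>m. \<integral>\<omega>. indicator A \<omega> * Q (\<lambda>l. partial_sums \<xi> m (s l) \<omega>) \<partial>M) \<longlonglongrightarrow> (\<integral>\<omega>. indicator A (\<pi> \<omega>) * Q (\<lambda>l. w (s l) \<omega>) \<partial>M')"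
        using s by (intro fdd_converge_lipschitz[OF fdd k _ A lip bd]) auto
      ultimately show "\<exists>b b'. (\<forall>\<^sub>F m in sequentially. \<bar>(\<integral>\<omega>. indicator A \<omega> * Q (\<lambda>l. ?H m (s l) \<omega>) \<partial>M) - b m\<bar> \<le> e) \<and>
        \<bar>(\<integral>\<omega>. indicator A (\<pi> \<omega>) * Q (\<lambda>l. w (s l) \<omega>) \<partial>M') - b'\<bar> \<le> e \<and> b \<longlonglongrightarrow> b'"
        using e by (intro exI[of _ "\<lambda>m. \<integral>\<omega>. indicator A \<omega> * Q (\<lambda>l. partial_sums \<xi> m (s l) \<omega>) \<partial>M"]
            exI[of _ "\<integral>\<omega>. indicator A (\<pi> \<omega>) * Q (\<lambda>l. w (s l) \<omega>) \<partial>M'"] conjI) auto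
    qed
  qed
  have pX: "(\<lambda>\<omega>. (path_of T (weighted_sums f \<eta> m) \<omega>, Z \<omega>)) \<in> M \<rightarrow>\<^sub>M borel_of (prod_topology (D_space T) euclideanreal)"
    if Z: "Z \<in> borel_measurable M" and \<eta>: "\<And>m i. m \<ge> 1 \<Longrightarrow> 1 \<le> i \<Longrightarrow> i \<le> nat \<lfloor>real m * T\<rfloor> \<Longrightarrow> \<eta> i m \<in> borel_measurable M"
    for m Z and \<eta> :: "nat \<Rightarrow> nat \<Rightarrow> 'a \<Rightarrow> real"
    unfolding path_of_def weighted_sums_def
  proof (rule step_path_pair_measurable[where X = "\<lambda>k \<omega>. \<Sum>i=1..k. f (real i / real m) \<omega> * \<eta> i m \<omega>"])
    fix k assume k: "k \<le> nat \<lfloor>real m * T\<rfloor>"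
    show "(\<lambda>\<omega>. \<Sum>i=1..k. f (real i / real m) \<omega> * \<eta> i m \<omega>) \<in> borel_measurable M"
    proof (rule borel_measurable_sum)
      fix i assume i: "i \<in> {1..k}"
      then have m: "m \<ge> 1" using k by (cases m) auto
      have "real i / real m \<in> {0..T}" using le_nat_floor_iff[OF m, of T i] i k T by auto
      then show "(\<lambda>\<omega>. f (real i / real m) \<omega> * \<eta> i m \<omega>) \<in> borel_measurable M"
        using i k m by (intro borel_measurable_times f_rv \<eta>) auto
    qed
  qed (use T Z in auto)
  show ?thesis
  proof (intro conjI allI impI)
    show "\<exists>I. is_ito_integral T M' bb.G w (\<lambda>s \<omega>'. f s (\<pi> \<omega>')) I" using I0(1) by blast
    fix I assume I: "is_ito_integral T M' bb.G w (\<lambda>s \<omega>'. f s (\<pi> \<omega>')) I"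
    \<comment> \<open>The claim concerns every version of the integral. Uniqueness identifies it
      with the constructed one, to which the Riemann sums converge.\<close>
    have eq: "AE \<omega> in M'. \<forall>t\<in>{0..T}. I t \<omega> = I0 t \<omega>"
      by (rule bb.ito_integral_unique[OF I I0(1) P'.f_continuous])
    have Ilim: "AE \<omega> in M'. \<forall>t\<in>{0..T}. (\<lambda>n. simple_integral w (2^n) (grid T n) (\<lambda>j \<omega>. f (grid T n j) (\<pi> \<omega>)) t \<omega>) \<longlonglongrightarrow> I t \<omega>"
      using eq I0(2) by eventually_elim simp
    have pI: "(\<lambda>\<omega>. (path_of T I \<omega>, Z \<omega>)) \<in> M' \<rightarrow>\<^sub>M borel_of (prod_topology (D_space T) euclideanreal)"
      if "Z \<in> borel_measurable M'" for Z
      using I by (intro continuous_path_pair_measurable[OF T that]) (auto simp: is_ito_integral_def)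
    show "converges_stably (D_space T) M (\<lambda>m. path_of T (weighted_sums f \<xi> m)) M' \<pi> (path_of T I)"
    proof (rule converges_stably_D_criterion[OF ext less_imp_le[OF T] pX[OF _ xi_rv] pI])
      fix A h L b assume A: "A \<in> sets M" and L: "0 \<le> L"
        and lip: "\<And>x y r. x \<in> mspace (D_metric T) \<Longrightarrow> y \<in> mspace (D_metric T) \<Longrightarrow>
          (\<forall>t\<in>{0..T}. \<bar>x t - y t\<bar> \<le> r) \<Longrightarrow> \<bar>h x - h y\<bar> \<le> L * r"
        and bd: "\<And>x. x \<in> mspace (D_metric T) \<Longrightarrow> \<bar>h x\<bar> \<le> b"
      have h: "D_lipschitz T L b h" unfolding D_lipschitz_def using L lip bd by blast
      have b0: "0 \<le> b" using bd[OF grid_path_in_D[OF T, of 0 "\<lambda>_. 0" "\<lambda>_. 0"]] by linarith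
      let ?X = "\<lambda>m. path_of T (weighted_sums f \<xi> m)" and ?X' = "\<lambda>m. path_of T (weighted_sums f \<xi>' m)"
      \<comment> \<open>Path convergence is first obtained for the array without its first summand,
        then transferred.\<close>
      have conv: "(\<lambda>m. \<integral>\<omega>. indicator A \<omega> * h (?X' m \<omega>) \<partial>M) \<longlonglongrightarrow> (\<integral>\<omega>. indicator A (\<pi> \<omega>) * h (path_of T I \<omega>) \<partial>M')"
        using C by (intro stable_convergence_core[OF ext hp _ _ dom Hm mesh wdom fdd' P.weighted_sums_limit pX[OF _ \<xi>'m] Ilim pI h A]) auto
      show "(\<lambda>m. \<integral>\<omega>. indicator A \<omega> * h (?X m \<omega>) \<partial>M) \<longlonglongrightarrow> (\<integral>\<omega>. indicator A (\<pi> \<omega>) * h (path_of T I \<omega>) \<partial>M')"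
      proof (rule tendsto_by_approximation)
        fix e :: real assume e: "e > 0"
        \<comment> \<open>Collects L d from the Lipschitz bound and 2 b times the probabilities of
          two exceptional events, each below d.\<close>
        define q where "q = 4 * b + L + 1"
        have q: "q > 0" using b0 L by (simp add: q_def)
        define d where "d = e / q"
        have d: "d > 0" using e q by (simp add: d_def)
        obtain R :: nat where R: "R \<ge> 1" "M.prob {\<omega>\<in>space M. real R < \<bar>K \<omega>\<bar>} < d"
          using M.tail_prob_lt[OF P.K_measurable d, of 1] by metis
        have dR: "d / real R > 0" using d R by simp
        have "\<forall>\<^sub>F m in sequentially. \<bar>(\<integral>\<omega>. indicator A \<omega> * h (?X m \<omega>) \<partial>M) - (\<integral>\<omega>. indicator A \<omega> * h (?X' m \<omega>) \<partial>M)\<bar> \<le> e"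
          using small[OF dR d] ev1
        proof eventually_elim
          case (elim m)
          have [measurable]: "\<xi> 1 m \<in> borel_measurable M" using elim by (intro xi_rv) auto
          note [measurable] = A
          have Xm: "(\<lambda>\<omega>. (?X m \<omega>, 0 :: real)) \<in> M \<rightarrow>\<^sub>M borel_of (prod_topology (D_space T) euclideanreal)"
            and Xm': "(\<lambda>\<omega>. (?X' m \<omega>, 0 :: real)) \<in> M \<rightarrow>\<^sub>M borel_of (prod_topology (D_space T) euclideanreal)"
            using pX[OF _ xi_rv] pX[OF _ \<xi>'m] by auto
          have [measurable]: "(\<lambda>\<omega>. h (?X m \<omega>)) \<in> borel_measurable M" "(\<lambda>\<omega>. h (?X' m \<omega>)) \<in> borel_measurable M"
            using D_lipschitz_measurable[OF h less_imp_le[OF T] Xm] D_lipschitz_measurable[OF h less_imp_le[OF T] Xm'] by auto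
          have XD: "?X m \<omega> \<in> mspace (D_metric T)" "?X' m \<omega> \<in> mspace (D_metric T)" if "\<omega> \<in> space M" for \<omega>
            using measurable_space[OF Xm that] measurable_space[OF Xm' that] by (simp_all add: D_space_eq)
          \<comment> \<open>The two paths differ by at most the single term f(1/m) \<xi> 1 m. Off
            both events its factors are at most R and d / R.\<close>
          let ?B1 = "{\<omega>\<in>space M. d / real R < \<bar>\<xi> 1 m \<omega>\<bar>}" and ?B2 = "{\<omega>\<in>space M. real R < \<bar>K \<omega>\<bar>}"
          note [measurable] = P.K_measurable
          have B: "?B1 \<in> sets M" "?B2 \<in> sets M" by measurable
          have "\<bar>(\<integral>\<omega>. indicator A \<omega> * h (?X m \<omega>) \<partial>M) - (\<integral>\<omega>. indicator A \<omega> * h (?X' m \<omega>) \<partial>M)\<bar>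
            \<le> L * d + 2 * b * measure M (?B1 \<union> ?B2)"
          proof (rule bounded_integral_diff_le[OF prob])
            fix \<omega> assume w: "\<omega> \<in> space M - (?B1 \<union> ?B2)"
            then have ws: "\<omega> \<in> space M" and x1: "\<bar>\<xi> 1 m \<omega>\<bar> \<le> d / real R" and Kw: "K \<omega> \<le> real R" by auto
            have "real 1 / real m \<in> {0..T}" using le_nat_floor_iff[of m T 1] elim T by auto
            then have "\<bar>f (real 1 / real m) \<omega>\<bar> \<le> real R" using P.f_bound[OF ws] Kw by fastforce
            then have "\<bar>f (real 1 / real m) \<omega>\<bar> * \<bar>\<xi> 1 m \<omega>\<bar> \<le> real R * (d / real R)" using x1 by (intro mult_mono) auto
            then have fx: "\<bar>\<xi> 1 m \<omega> * f (real 1 / real m) \<omega>\<bar> \<le> d" using R(1) by (simp add: abs_mult mult.commute)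
            have "\<bar>?X m \<omega> t - ?X' m \<omega> t\<bar> \<le> d" if "t \<in> {0..T}" for t
            proof -
              have "?X m \<omega> t - ?X' m \<omega> t = (\<Sum>i=1..nat \<lfloor>real m * t\<rfloor>. \<xi> i m \<omega> * f (real i / real m) \<omega>) - (\<Sum>i=1..nat \<lfloor>real m * t\<rfloor>. \<xi>' i m \<omega> * f (real i / real m) \<omega>)"
                using that by (simp add: path_of_def weighted_sums_def mult.commute)
              then show ?thesis unfolding shift using fx d by (auto split: if_splits)
            qed
            then have "\<bar>h (?X m \<omega>) - h (?X' m \<omega>)\<bar> \<le> L * d" by (intro lip XD ws) blast
            then show "\<bar>indicator A \<omega> * h (?X m \<omega>) - indicator A \<omega> * h (?X' m \<omega>)\<bar> \<le> L * d"
              using L d by (auto simp: indicator_def)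
          qed (use sets.Un[OF B] XD bd b0 L d in \<open>auto simp: indicator_def\<close>)
          also have "measure M (?B1 \<union> ?B2) \<le> measure M ?B1 + measure M ?B2" by (intro measure_Un_le B)
          also have "L * d + 2 * b * (measure M ?B1 + measure M ?B2) \<le> L * d + 2 * b * (d + d)"
            using elim(1) R(2) b0 by (intro add_left_mono mult_left_mono) auto
          also have "\<dots> \<le> q * d" using d by (simp add: q_def algebra_simps)
          also have "\<dots> = e" using q by (simp add: d_def)
          finally show ?case using b0 by (simp add: mult_left_mono)
        qed
        then show "\<exists>b b'. (\<forall>\<^sub>F m in sequentially. \<bar>(\<integral>\<omega>. indicator A \<omega> * h (?X m \<omega>) \<partial>M) - b m\<bar> \<le> e) \<and>
          \<bar>(\<integral>\<omega>. indicator A (\<pi> \<omega>) * h (path_of T I \<omega>) \<partial>M') - b'\<bar> \<le> e \<and> b \<longlonglongrightarrow> b'"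
          using conv e by (intro exI[of _ "\<lambda>m. \<integral>\<omega>. indicator A \<omega> * h (?X' m \<omega>) \<partial>M"]
              exI[of _ "\<integral>\<omega>. indicator A (\<pi> \<omega>) * h (path_of T I \<omega>) \<partial>M'"] conjI) auto
      qed
    qed
  qed
qed

end
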